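(* Let $f:[0,\infty)\to[0,1]$ be nonincreasing with $0<\sup\{a: f(a)>0\}<\infty$, and let $\lambda>\lambda_f$. Let $\mathcal{C}$ be the (almost surely unique) infinite connected component of $RCM(\lambda,f)$. Then the critical probabilities for site and bond percolation on $\mathcal{C}$ satisfy $p_c^{\rm site}>p_c^{\rm bond}$.
   Context: For $\lambda>0$, $\mathscr{P}_\lambda$ is a homogeneous Poisson point process of intensity $\lambda$ in $\mathbb{R}^2$. Given a connection function $f:[0,\infty)\to[0,1]$, the random connection model $RCM(\lambda,f)$ is the random graph with vertex set $\mathscr{P}_\lambda$ in which each pair of vertices $x,y$ is joined by an edge with probability $f(|x-y|)$, independently of all other pairs. When $0<\int_0^\infty r f(r)\,dr<\infty$ there is a critical intensity $\lambda_f\in(0,\infty)$ such that for $\lambda>\lambda_f$ the graph $RCM(\lambda,f)$ a.s. has a unique infinite connected component $\mathcal{C}$, and for $\lambda<\lambda_f$ a.s. it has no infinite component. Site percolation on $\mathcal{C}$ with parameter $p$: each vertex of $\mathcal{C}$ is independently open with probability $p$; $p_c^{\rm site}$ is the critical value of $p$ above which the open-vertex induced subgraph a.s. has an infinite component and below which a.s. it does not. Bond percolation: each edge of $\mathcal{C}$ is independently open with probability $p$, and $p_c^{\rm bond}$ is the analogous critical value for the open-edge subgraph. *)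

theory Defs
  imports "HOL-Probability.Probability"
begin

definition has_inf_cluster :: "('a \<Rightarrow> 'a \<Rightarrow> bool) \<Rightarrow> bool" where
  "has_inf_cluster adj \<longleftrightarrow> (\<exists>v. infinite {w. adj\<^sup>*\<^sup>* v w})"

definition site_meas :: "'a set \<Rightarrow> real \<Rightarrow> ('a \<Rightarrow> bool) measure" where
  "site_meas S p = PiM S (\<lambda>_. measure_pmf (bernoulli_pmf p))"

definition site_open_adj :: "'a set \<Rightarrow> ('a \<Rightarrow> 'a \<Rightarrow> bool) \<Rightarrow> ('a \<Rightarrow> bool) \<Rightarrow> 'a \<Rightarrow> 'a \<Rightarrow> bool" where
  "site_open_adj S adj \<eta> v w \<longleftrightarrow> v \<in> S \<and> w \<in> S \<and> adj v w \<and> \<eta> v \<and> \<eta> w"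

definition pc_site :: "'a set \<Rightarrow> ('a \<Rightarrow> 'a \<Rightarrow> bool) \<Rightarrow> real" where
  "pc_site S adj = Sup {p \<in> {0..1}.
      AE \<eta> in site_meas S p. \<not> has_inf_cluster (site_open_adj S adj \<eta>)}"

definition edges_of :: "'a set \<Rightarrow> ('a \<Rightarrow> 'a \<Rightarrow> bool) \<Rightarrow> 'a set set" where
  "edges_of S adj = {{v, w} | v w. v \<in> S \<and> w \<in> S \<and> adj v w}"

definition bond_meas :: "'a set \<Rightarrow> ('a \<Rightarrow> 'a \<Rightarrow> bool) \<Rightarrow> real \<Rightarrow> ('a set \<Rightarrow> bool) measure" where
  "bond_meas S adj p = PiM (edges_of S adj) (\<lambda>_. measure_pmf (bernoulli_pmf p))"

definition bond_open_adj :: "'a set \<Rightarrow> ('a \<Rightarrow> 'a \<Rightarrow> bool) \<Rightarrow> ('a set \<Rightarrow> bool) \<Rightarrow> 'a \<Rightarrow> 'a \<Rightarrow> bool" where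
  "bond_open_adj S adj \<eta> v w \<longleftrightarrow> v \<in> S \<and> w \<in> S \<and> adj v w \<and> \<eta> {v, w}"

definition pc_bond :: "'a set \<Rightarrow> ('a \<Rightarrow> 'a \<Rightarrow> bool) \<Rightarrow> real" where
  "pc_bond S adj = Sup {p \<in> {0..1}.
      AE \<eta> in bond_meas S adj p. \<not> has_inf_cluster (bond_open_adj S adj \<eta>)}"

text \<open>Vertices are labels ((z1,z2), i): the i-th Poisson point in the unit square
  [z1,z1+1) x [z2,z2+1).  A sample consists of: the Poisson counts N z (rate \<lambda>),
  i.i.d. uniform positions X v in the square of v, and i.i.d. uniform [0,1] variables U
  indexed by unordered pairs {v,w} of labels.\<close>

type_synonym lbl = "(int \<times> int) \<times> nat"
type_synonym rcm_sample = "((int \<times> int \<Rightarrow> nat) \<times> (lbl \<Rightarrow> real \<times> real)) \<times> (lbl set \<Rightarrow> real)"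

definition cube :: "int \<times> int \<Rightarrow> (real \<times> real) set" where
  "cube z = {real_of_int (fst z)..<real_of_int (fst z) + 1} \<times> {real_of_int (snd z)..<real_of_int (snd z) + 1}"

definition RCM_space :: "real \<Rightarrow> rcm_sample measure" where
  "RCM_space lam =
     (PiM UNIV (\<lambda>z. measure_pmf (poisson_pmf lam))
       \<Otimes>\<^sub>M PiM UNIV (\<lambda>v::lbl. uniform_measure lborel (cube (fst v))))
     \<Otimes>\<^sub>M PiM UNIV (\<lambda>e::lbl set. uniform_measure lborel {0..1::real})"

definition rcm_vertices :: "rcm_sample \<Rightarrow> lbl set" where
  "rcm_vertices \<omega> = {v. snd v < fst (fst \<omega>) (fst v)}"

definition rcm_pos :: "rcm_sample \<Rightarrow> lbl \<Rightarrow> real \<times> real" where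
  "rcm_pos \<omega> = snd (fst \<omega>)"

definition rcm_adj :: "(real \<Rightarrow> real) \<Rightarrow> rcm_sample \<Rightarrow> lbl \<Rightarrow> lbl \<Rightarrow> bool" where
  "rcm_adj f \<omega> v w \<longleftrightarrow> v \<in> rcm_vertices \<omega> \<and> w \<in> rcm_vertices \<omega> \<and> v \<noteq> w \<and>
     snd \<omega> {v, w} < f (dist (rcm_pos \<omega> v) (rcm_pos \<omega> w))"

definition lambda_crit :: "(real \<Rightarrow> real) \<Rightarrow> real" where
  "lambda_crit f = Sup {lam. 0 < lam \<and> (AE \<omega> in RCM_space lam. \<not> has_inf_cluster (rcm_adj f \<omega>))}"

text \<open>Vertices lying in an infinite component (a.s. this is the unique infinite component).\<close>
definition inf_comp :: "(real \<Rightarrow> real) \<Rightarrow> rcm_sample \<Rightarrow> lbl set" where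
  "inf_comp f \<omega> = {v. infinite {w. (rcm_adj f \<omega>)\<^sup>*\<^sup>* v w}}"

definition inf_comp_adj :: "(real \<Rightarrow> real) \<Rightarrow> rcm_sample \<Rightarrow> lbl \<Rightarrow> lbl \<Rightarrow> bool" where
  "inf_comp_adj f \<omega> v w \<longleftrightarrow> rcm_adj f \<omega> v w \<and> v \<in> inf_comp f \<omega> \<and> w \<in> inf_comp f \<omega>"

end

theory Submission
  imports Defs
begin

text \<open>
  Keeping each vertex of RCM(\<lambda>, f) with probability p gives RCM(p \<lambda>, f), and keeping each edge with probability p gives
  RCM(\<lambda>, p f). Hence the site threshold is at least p* = \<lambda>_f / \<lambda>, and it suffices to find q < p* for which
  RCM(\<lambda>, q f) percolates.

  In a finite box, approximate the Poisson points by many independent vertices and apply Russo's formula to the event that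
  a unit square is connected to distance n. A pivotal edge has pivotal ends, so there are at least as many pivotal vertices
  as pivotal edges, and local modifications improve this in expectation to a factor 1 + c as long as edge probabilities stay
  bounded away from 1. Therefore the connection probability does not decrease along the curve
  t \<mapsto> (\<lambda> exp((1 - c) t), p exp(-t)). Starting just above \<lambda>_f with edge probability f, the weak comparison (c = 0)
  leads to q' f for some q' in (p*, 1), and the strict one then reaches (\<lambda>, q f) with q < p*. A zero-one law turns
  connection probabilities bounded below into almost sure percolation.

  That \<lambda>_f is positive follows by counting paths of occupied unit squares, that it is finite by a hierarchical
  renormalisation.
\<close>

section \<open>Finite products of Bernoulli variables\<close>

text \<open>The constant c must be uniform in the box and in the number M of potential vertices per
  unit square, since both grow afterwards. A single potential vertex has probability \<lambda>/M, so
  a detour through one prescribed vertex gains nothing in the limit; the sum over about M absent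
  vertices does, and uniqueness of the detour vertex (\<open>witn_unique\<close>) prevents
  overcounting. Cutting the inserted vertex off from everything else costs (1 - q)^m when m vertices
  are present nearby. This is bounded only in sparse surroundings, whence the separate treatment of
  crowded ones. A second obstacle: the inserted vertex may lie in the start or target region and
  thereby create a connection of its own. So end points must carry a mark, present with probability
  1/2, and the inserted vertex is left unmarked. Marks lower connection probabilities at most by the
  factor 1/4. Finally, the detour exists only for favourable positions of the new vertex, so the
  pivotal sites are compared only after averaging over positions, whereas Russo's formula is applied
  for fixed ones.\<close>

definition bexp :: "'i set \<Rightarrow> ('i \<Rightarrow> real) \<Rightarrow> ('i set \<Rightarrow> real) \<Rightarrow> real" where
  "bexp I r h = (\<Sum>S\<in>Pow I. (\<Prod>i\<in>S. r i) * (\<Prod>i\<in>I - S. 1 - r i) * h S)"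

lemma bexp_empty [simp]: "bexp {} r h = h {}"
  by (simp add: bexp_def)

text \<open>Conditioning on one site. Most later rules are inductions over this recursion; as an
  identity of polynomials in r it involves no bound on the rates.\<close>

lemma bexp_insert:
  assumes "finite I" "i \<notin> I"
  shows "bexp (insert i I) r h = r i * bexp I r (\<lambda>S. h (insert i S)) + (1 - r i) * bexp I r h"
proof -
  have disj: "Pow I \<inter> insert i ` Pow I = {}" using assms by auto
  have inj: "inj_on (insert i) (Pow I)" using assms by (auto simp: inj_on_def)
  have fin: "finite S" if "S \<in> Pow I" for S using that assms finite_subset by blast
  have "bexp (insert i I) r h =
     (\<Sum>S\<in>Pow I. (\<Prod>i\<in>S. r i) * (\<Prod>i\<in>insert i I - S. 1 - r i) * h S) +
     (\<Sum>S\<in>insert i ` Pow I. (\<Prod>i\<in>S. r i) * (\<Prod>i\<in>insert i I - S. 1 - r i) * h S)"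
    unfolding bexp_def Pow_insert using assms disj by (intro sum.union_disjoint) auto
  also have "(\<Sum>S\<in>Pow I. (\<Prod>i\<in>S. r i) * (\<Prod>i\<in>insert i I - S. 1 - r i) * h S) = (1 - r i) * bexp I r h"
    unfolding bexp_def sum_distrib_left
  proof (intro sum.cong refl)
    fix S assume S: "S \<in> Pow I"
    then have "insert i I - S = insert i (I - S)" using assms by auto
    then show "(\<Prod>i\<in>S. r i) * (\<Prod>i\<in>insert i I - S. 1 - r i) * h S
        = (1 - r i) * ((\<Prod>i\<in>S. r i) * (\<Prod>i\<in>I - S. 1 - r i) * h S)"
      using assms by simp
  qed
  also have "(\<Sum>S\<in>insert i ` Pow I. (\<Prod>i\<in>S. r i) * (\<Prod>i\<in>insert i I - S. 1 - r i) * h S)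
     = r i * bexp I r (\<lambda>S. h (insert i S))"
    unfolding bexp_def sum_distrib_left sum.reindex[OF inj] o_def
  proof (intro sum.cong refl)
    fix S assume S: "S \<in> Pow I"
    then have "insert i I - insert i S = I - S" "i \<notin> S" using assms by auto
    then show "(\<Prod>i\<in>insert i S. r i) * (\<Prod>i\<in>insert i I - insert i S. 1 - r i) * h (insert i S)
        = r i * ((\<Prod>i\<in>S. r i) * (\<Prod>i\<in>I - S. 1 - r i) * h (insert i S))"
      using fin[OF S] by simp
  qed
  finally show ?thesis by simp
qed

lemma bexp_split:
  assumes "finite I" "i \<in> I"
  shows "bexp I r h = r i * bexp (I - {i}) r (\<lambda>S. h (insert i S)) + (1 - r i) * bexp (I - {i}) r h"
  using bexp_insert[of "I - {i}" i r h] assms by (simp add: insert_absorb)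

lemma bexp_cong:
  assumes "\<And>i. i \<in> I \<Longrightarrow> r i = r' i" "\<And>S. S \<subseteq> I \<Longrightarrow> h S = h' S"
  shows "bexp I r h = bexp I r' h'"
  unfolding bexp_def
proof (intro sum.cong refl)
  fix S assume S: "S \<in> Pow I"
  have 1: "(\<Prod>i\<in>S. r i) = (\<Prod>i\<in>S. r' i)" using S assms(1) by (intro prod.cong) auto
  have 2: "(\<Prod>i\<in>I-S. 1 - r i) = (\<Prod>i\<in>I-S. 1 - r' i)" using assms(1) by (intro prod.cong) auto
  show "(\<Prod>i\<in>S. r i) * (\<Prod>i\<in>I - S. 1 - r i) * h S = (\<Prod>i\<in>S. r' i) * (\<Prod>i\<in>I - S. 1 - r' i) * h' S"
    using 1 2 assms(2) S by simp
qed

text \<open>Configurations that contain a site of rate 0 have weight 0, so the pointwise comparison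
  is asked for only where all present sites have positive rate. This later discards edges that are
  too long to exist.\<close>

lemma bexp_mono:
  assumes "finite I" "\<And>i. i \<in> I \<Longrightarrow> 0 \<le> r i \<and> r i \<le> 1"
    and "\<And>S. S \<subseteq> I \<Longrightarrow> (\<And>i. i \<in> S \<Longrightarrow> 0 < r i) \<Longrightarrow> h S \<le> h' S"
  shows "bexp I r h \<le> bexp I r h'"
  unfolding bexp_def
proof (intro sum_mono)
  fix S assume S: "S \<in> Pow I"
  show "(\<Prod>i\<in>S. r i) * (\<Prod>i\<in>I - S. 1 - r i) * h S \<le> (\<Prod>i\<in>S. r i) * (\<Prod>i\<in>I - S. 1 - r i) * h' S"
  proof (cases "\<forall>i\<in>S. 0 < r i")
    case True
    then have "h S \<le> h' S" using assms(3) S by auto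
    moreover have "0 \<le> (\<Prod>i\<in>S. r i) * (\<Prod>i\<in>I - S. 1 - r i)"
      using assms(2) S by (intro mult_nonneg_nonneg prod_nonneg) auto
    ultimately show ?thesis by (intro mult_left_mono)
  next
    case False
    then obtain i where "i \<in> S" "\<not> 0 < r i" by auto
    then have "r i = 0" using assms(2)[of i] S by auto
    then have "(\<Prod>i\<in>S. r i) = 0" using \<open>i \<in> S\<close> S assms(1) by (meson Pow_iff finite_subset prod_zero)
    then show ?thesis by simp
  qed
qed

lemma bexp_add: "bexp I r (\<lambda>S. h S + g S) = bexp I r h + bexp I r g"
  by (simp add: bexp_def sum.distrib distrib_left)

lemma bexp_diff: "bexp I r (\<lambda>S. h S - g S) = bexp I r h - bexp I r g"
  by (simp add: bexp_def sum_subtractf right_diff_distrib)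

lemma bexp_cmult: "bexp I r (\<lambda>S. c * h S) = c * bexp I r h"
  by (simp add: bexp_def sum_distrib_left mult_ac)

lemma bexp_sum: "bexp I r (\<lambda>S. \<Sum>x\<in>A. h x S) = (\<Sum>x\<in>A. bexp I r (h x))"
  unfolding bexp_def by (simp add: sum_distrib_left) (rule sum.swap)

lemma bexp_zero [simp]: "bexp I r (\<lambda>S. 0) = 0"
  by (simp add: bexp_def)

lemma bexp_const: "finite I \<Longrightarrow> bexp I r (\<lambda>S. c) = c"
  by (induction I rule: finite_induct) (auto simp: bexp_insert algebra_simps)

lemma bexp_nonneg:
  assumes "finite I" "\<And>i. i \<in> I \<Longrightarrow> 0 \<le> r i \<and> r i \<le> 1" "\<And>S. S \<subseteq> I \<Longrightarrow> 0 \<le> h S"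
  shows "0 \<le> bexp I r h"
  using bexp_mono[of I r "\<lambda>_. 0" h] assms by simp

text \<open>Toggling i changes the weight of a configuration by the ratio of r i to 1 - r i. This is
  the price of a local modification at a single site.\<close>

lemma bexp_flip:
  assumes "finite I" "i \<in> I"
  shows "(1 - r i) * bexp I r (\<lambda>S. if i \<in> S then h (S - {i}) else 0)
     = r i * bexp I r (\<lambda>S. if i \<notin> S then h S else 0)"
proof -
  have 1: "bexp (I - {i}) r (\<lambda>S. if i \<in> insert i S then h (insert i S - {i}) else 0) = bexp (I - {i}) r h"
    by (intro bexp_cong) (auto simp: subset_Diff_insert)
  have 2: "bexp (I - {i}) r (\<lambda>S. if i \<in> S then h (S - {i}) else 0) = bexp (I - {i}) r (\<lambda>_. 0)"
    by (intro bexp_cong) auto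
  have 3: "bexp (I - {i}) r (\<lambda>S. if i \<notin> S then h S else 0) = bexp (I - {i}) r h"
    by (intro bexp_cong) auto
  have 4: "bexp (I - {i}) r (\<lambda>S. if i \<notin> insert i S then h (insert i S) else 0) = bexp (I - {i}) r (\<lambda>_. 0)"
    by (intro bexp_cong) auto
  show ?thesis
    unfolding bexp_split[OF assms, of r "\<lambda>S. if i \<in> S then h (S - {i}) else 0"]
      bexp_split[OF assms, of r "\<lambda>S. if i \<notin> S then h S else 0"] 1 2 3 4 by simp
qed

text \<open>\<open>bexp\<close> is affine in each rate separately, with slope the mean effect of
  adding the site. For the indicator of an increasing event this is Russo's formula.\<close>

lemma bexp_has_real_derivative:
  assumes "finite I" "\<And>i. i \<in> I \<Longrightarrow> ((\<lambda>t. r t i) has_real_derivative r' i) (at t within T)"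
  shows "((\<lambda>t. bexp I (r t) h) has_real_derivative
     (\<Sum>i\<in>I. r' i * bexp I (r t) (\<lambda>S. h (insert i S) - h (S - {i})))) (at t within T)"
  using assms
proof (induction I arbitrary: h rule: finite_induct)
  case empty
  then show ?case by simp
next
  case (insert j I)
  let ?D = "\<lambda>h. \<Sum>i\<in>I. r' i * bexp I (r t) (\<lambda>S. h (insert i S) - h (S - {i}))"
  have IH: "((\<lambda>t. bexp I (r t) h) has_real_derivative ?D h) (at t within T)" for h
    using insert by auto
  have j: "((\<lambda>t. r t j) has_real_derivative r' j) (at t within T)" using insert by auto
  have "((\<lambda>t. r t j * bexp I (r t) (\<lambda>S. h (insert j S)) + (1 - r t j) * bexp I (r t) h)
     has_real_derivative (r' j * bexp I (r t) (\<lambda>S. h (insert j S)) + ?D (\<lambda>S. h (insert j S)) * r t j)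
      + (- r' j * bexp I (r t) h + ?D h * (1 - r t j))) (at t within T)"
    by (auto intro!: derivative_eq_intros IH j)
  also have "(\<lambda>t. r t j * bexp I (r t) (\<lambda>S. h (insert j S)) + (1 - r t j) * bexp I (r t) h)
     = (\<lambda>t. bexp (insert j I) (r t) h)"
    using insert by (simp add: bexp_insert)
  also have "(r' j * bexp I (r t) (\<lambda>S. h (insert j S)) + ?D (\<lambda>S. h (insert j S)) * r t j)
      + (- r' j * bexp I (r t) h + ?D h * (1 - r t j)) =
     (\<Sum>i\<in>insert j I. r' i * bexp (insert j I) (r t) (\<lambda>S. h (insert i S) - h (S - {i})))"
  proof -
    have jj: "bexp (insert j I) (r t) (\<lambda>S. h (insert j S) - h (S - {j}))
       = bexp I (r t) (\<lambda>S. h (insert j S)) - bexp I (r t) h"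
    proof -
      have "bexp I (r t) (\<lambda>S. h (insert j (insert j S)) - h (insert j S - {j}))
           = bexp I (r t) (\<lambda>S. h (insert j S) - h S)"
        using insert.hyps by (intro bexp_cong) (auto simp: insert_Diff_if Diff_idemp subset_iff
            intro!: arg_cong[of _ _ h])
      moreover have "bexp I (r t) (\<lambda>S. h (insert j S) - h (S - {j}))
           = bexp I (r t) (\<lambda>S. h (insert j S) - h S)"
        using insert.hyps by (intro bexp_cong) (auto intro!: arg_cong[of _ _ h])
      ultimately show ?thesis using insert.hyps
        by (simp add: bexp_insert bexp_diff algebra_simps)
    qed
    have ii: "bexp (insert j I) (r t) (\<lambda>S. h (insert i S) - h (S - {i}))
       = r t j * bexp I (r t) (\<lambda>S. h (insert j (insert i S)) - h (insert j (S - {i})))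
        + (1 - r t j) * bexp I (r t) (\<lambda>S. h (insert i S) - h (S - {i}))" if "i \<in> I" for i
    proof -
      have "i \<noteq> j" using that insert by auto
      then have "\<And>S. insert j S - {i} = insert j (S - {i})" by auto
      then show ?thesis using insert.hyps by (simp add: bexp_insert insert_commute)
    qed
    have "(\<Sum>i\<in>I. r' i * bexp (insert j I) (r t) (\<lambda>S. h (insert i S) - h (S - {i})))
       = ?D (\<lambda>S. h (insert j S)) * r t j + ?D h * (1 - r t j)"
      unfolding sum_distrib_right sum.distrib[symmetric]
      by (intro sum.cong refl) (simp add: ii algebra_simps)
    then show ?thesis using insert.hyps by (simp add: jj algebra_simps)
  qed
  finally show ?case .
qed

text \<open>The left side is a term of Russo's formula when rates move proportionally to themselves;
  on the right the pivotal site is required to be present.\<close>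

lemma bexp_pivot:
  assumes "finite I" "i \<in> I"
  shows "r i * bexp I r (\<lambda>S. h (insert i S) - h (S - {i})) = bexp I r (\<lambda>S. if i \<in> S then h S - h (S - {i}) else 0)"
proof -
  have 1: "bexp (I - {i}) r (\<lambda>S. h (insert i (insert i S)) - h (insert i S - {i}))
      = bexp (I - {i}) r (\<lambda>S. h (insert i S) - h S)"
    by (intro bexp_cong) (auto simp: subset_Diff_insert intro!: arg_cong[of _ _ h])
  have 2: "bexp (I - {i}) r (\<lambda>S. h (insert i S) - h (S - {i}))
      = bexp (I - {i}) r (\<lambda>S. h (insert i S) - h S)"
    by (intro bexp_cong) (auto simp: subset_Diff_insert)
  have 3: "bexp (I - {i}) r (\<lambda>S. if i \<in> insert i S then h (insert i S) - h (insert i S - {i}) else 0)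
      = bexp (I - {i}) r (\<lambda>S. h (insert i S) - h S)"
    by (intro bexp_cong) (auto simp: subset_Diff_insert intro!: arg_cong[of _ _ h])
  have 4: "bexp (I - {i}) r (\<lambda>S. if i \<in> S then h S - h (S - {i}) else 0) = bexp (I - {i}) r (\<lambda>S. 0)"
    by (intro bexp_cong) auto
  show ?thesis
    unfolding bexp_split[OF assms, of r "\<lambda>S. h (insert i S) - h (S - {i})"]
      bexp_split[OF assms, of r "\<lambda>S. if i \<in> S then h S - h (S - {i}) else 0"] 1 2 3 4
    by (simp add: algebra_simps)
qed

lemma bexp_Un:
  assumes "finite I" "finite J" "I \<inter> J = {}"
  shows "bexp (I \<union> J) r h = bexp I r (\<lambda>S. bexp J r (\<lambda>T. h (S \<union> T)))"
  using assms(1,3)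
proof (induction I arbitrary: h rule: finite_induct)
  case empty
  then show ?case by simp
next
  case (insert i I)
  then show ?case using assms(2) by (simp add: bexp_insert)
qed

lemma bexp_reindex:
  assumes "finite I" "inj_on g I"
  shows "bexp (g ` I) r h = bexp I (\<lambda>i. r (g i)) (\<lambda>S. h (g ` S))"
  using assms
proof (induction I arbitrary: h rule: finite_induct)
  case empty
  then show ?case by simp
next
  case (insert i I)
  then have "g i \<notin> g ` I" by auto
  then show ?case using insert by (simp add: bexp_insert)
qed

lemma bexp_subset:
  assumes "finite I" "J \<subseteq> I" "\<And>S. S \<subseteq> I \<Longrightarrow> h S = h (S \<inter> J)"
  shows "bexp I r h = bexp J r h"
proof -
  have fJ: "finite J" using assms finite_subset by blast
  have "bexp I r h = bexp (J \<union> (I - J)) r h" using assms by (simp add: Un_absorb1)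
  also have "\<dots> = bexp J r (\<lambda>S. bexp (I - J) r (\<lambda>T. h (S \<union> T)))"
    using assms fJ by (intro bexp_Un) auto
  also have "\<dots> = bexp J r (\<lambda>S. bexp (I - J) r (\<lambda>T. h S))"
  proof (intro bexp_cong refl)
    fix S T assume "S \<subseteq> J" "T \<subseteq> I - J"
    then have "(S \<union> T) \<inter> J = S" "S \<union> T \<subseteq> I" using assms(2) by auto
    then show "h (S \<union> T) = h S" using assms(3)[of "S \<union> T"] by simp
  qed
  also have "\<dots> = bexp J r h" using assms by (simp add: bexp_const)
  finally show ?thesis .
qed

text \<open>Two independent coins per site must both succeed. Later one set consists of the edges of
  the graph and the other comes from bond percolation.\<close>

lemma bexp_Int:
  assumes "finite I"
  shows "bexp I r (\<lambda>S. bexp I q (\<lambda>T. h (S \<inter> T))) = bexp I (\<lambda>i. r i * q i) h"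
  using assms
proof (induction I arbitrary: h rule: finite_induct)
  case empty
  then show ?case by simp
next
  case (insert i I)
  let ?K = "\<lambda>h S. bexp I q (\<lambda>T. h (S \<inter> T))"
  have a: "bexp I r (\<lambda>S. bexp (insert i I) q (\<lambda>T. h (S \<inter> T))) = bexp I r (?K h)"
  proof (intro bexp_cong refl)
    fix S assume "S \<subseteq> I"
    then have "\<And>T. S \<inter> insert i T = S \<inter> T" using insert.hyps by auto
    then show "bexp (insert i I) q (\<lambda>T. h (S \<inter> T)) = ?K h S"
      using insert.hyps by (simp add: bexp_insert algebra_simps)
  qed
  have b: "bexp I r (\<lambda>S. bexp (insert i I) q (\<lambda>T. h (insert i S \<inter> T)))
      = bexp I r (\<lambda>S. q i * ?K (\<lambda>S. h (insert i S)) S + (1 - q i) * ?K h S)"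
  proof (intro bexp_cong refl)
    fix S assume "S \<subseteq> I"
    have "bexp I q (\<lambda>T. h (insert i S \<inter> T)) = ?K h S"
      using insert.hyps by (intro bexp_cong refl arg_cong[of _ _ h]) auto
    moreover have "\<And>T. insert i S \<inter> insert i T = insert i (S \<inter> T)" by auto
    ultimately show "bexp (insert i I) q (\<lambda>T. h (insert i S \<inter> T))
        = q i * ?K (\<lambda>S. h (insert i S)) S + (1 - q i) * ?K h S"
      using insert.hyps by (simp add: bexp_insert)
  qed
  show ?case
    unfolding bexp_insert[OF insert.hyps, of r] a b bexp_add bexp_cmult insert.IH insert.IH[of "\<lambda>S. h (insert i S)"]
      bexp_insert[OF insert.hyps, of "\<lambda>i. r i * q i"]
    by (simp add: algebra_simps)
qed

lemma bexp_cylinder: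
  assumes "finite I" "A \<subseteq> I" "B \<subseteq> I" "A \<inter> B = {}"
  shows "bexp I r (\<lambda>S. of_bool (A \<subseteq> S \<and> S \<inter> B = {})) = (\<Prod>i\<in>A. r i) * (\<Prod>i\<in>B. 1 - r i)"
proof -
  have fA: "finite A" "finite B" using assms finite_subset by blast+
  \<comment> \<open>A single product over I, with a case distinction in each factor, is the form
    that survives the removal of one site from I.\<close>
  have gen: "bexp I r (\<lambda>S. of_bool (A \<subseteq> S \<and> S \<inter> B = {})) = (\<Prod>i\<in>I. if i \<in> A then r i else if i \<in> B then 1 - r i else 1)"
    if "finite I" "A \<subseteq> I" "B \<subseteq> I" "A \<inter> B = {}" for A B I
    using that
  proof (induction I arbitrary: A B rule: finite_induct)
    case empty
    then show ?case by simp
  next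
    case (insert i I)
    let ?P = "\<lambda>A B. \<Prod>i\<in>I. if i \<in> A then r i else if i \<in> B then 1 - r i else 1"
    have c: "?P (A - {i}) (B - {i}) = ?P A B" using insert.hyps by (intro prod.cong) auto
    have IH: "bexp I r (\<lambda>S. of_bool (A - {i} \<subseteq> S \<and> S \<inter> (B - {i}) = {})) = ?P A B"
      using insert.IH[of "A - {i}" "B - {i}"] insert.prems insert.hyps c by fastforce
    have e1: "bexp I r (\<lambda>S. of_bool (A \<subseteq> insert i S \<and> insert i S \<inter> B = {}))
        = (if i \<in> B then 0 else ?P A B)"
    proof (cases "i \<in> B")
      case True
      then show ?thesis by simp
    next
      case False
      then show ?thesis unfolding IH[symmetric]
        by (auto intro!: bexp_cong arg_cong[of _ _ of_bool])
    qed
    have e2: "bexp I r (\<lambda>S. of_bool (A \<subseteq> S \<and> S \<inter> B = {})) = (if i \<in> A then 0 else ?P A B)"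
    proof (cases "i \<in> A")
      case True
      then have "bexp I r (\<lambda>S. of_bool (A \<subseteq> S \<and> S \<inter> B = {})) = bexp I r (\<lambda>S. 0)"
        using insert.hyps by (intro bexp_cong) auto
      then show ?thesis using True by simp
    next
      case False
      then show ?thesis unfolding IH[symmetric] using insert.hyps
        by (auto intro!: bexp_cong arg_cong[of _ _ of_bool])
    qed
    show ?case using insert.hyps insert.prems unfolding bexp_insert[OF insert.hyps] e1 e2
      by (auto simp: algebra_simps)
  qed
  have "(\<Prod>i\<in>I. if i \<in> A then r i else if i \<in> B then 1 - r i else 1)
     = (\<Prod>i\<in>A \<union> B. if i \<in> A then r i else if i \<in> B then 1 - r i else 1)"
    using assms by (intro prod.mono_neutral_right) auto
  also have "\<dots> = (\<Prod>i\<in>A. if i \<in> A then r i else if i \<in> B then 1 - r i else 1) * (\<Prod>i\<in>B. if i \<in> A then r i else if i \<in> B then 1 - r i else 1)"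
    using fA assms by (intro prod.union_disjoint) auto
  also have "\<dots> = (\<Prod>i\<in>A. r i) * (\<Prod>i\<in>B. 1 - r i)"
    using assms by (intro arg_cong2[of _ _ _ _ "(*)"] prod.cong) auto
  finally show ?thesis using gen[OF assms] by simp
qed

section \<open>Pivotal vertices and edges\<close>

text \<open>A configuration is a set of present sites: \<^term>\<open>Inl v\<close> is the vertex v, \<^term>\<open>Inr {x, y}\<close> the open
  edge xy, and \<^term>\<open>Inr {v}\<close> a mark that allows v to be an end point of a connection. Marks serve to insert a
  vertex that is certainly not an end point.\<close>

definition cadj :: "('a + 'a set) set \<Rightarrow> 'a \<Rightarrow> 'a \<Rightarrow> bool" where
  "cadj S x y \<longleftrightarrow> x \<noteq> y \<and> Inl x \<in> S \<and> Inl y \<in> S \<and> Inr {x, y} \<in> S"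

definition con :: "'a set \<Rightarrow> 'a set \<Rightarrow> ('a + 'a set) set \<Rightarrow> bool" where
  "con A B S \<longleftrightarrow> (\<exists>x\<in>A. \<exists>y\<in>B. Inl x \<in> S \<and> Inr {x} \<in> S \<and> Inl y \<in> S \<and> Inr {y} \<in> S \<and> (cadj S)\<^sup>*\<^sup>* x y)"

text \<open>Only present sites count as pivotal, in accordance with the right side of
  \<open>bexp_pivot\<close>.\<close>

definition piv :: "'a set \<Rightarrow> 'a set \<Rightarrow> ('a + 'a set) set \<Rightarrow> 'a + 'a set \<Rightarrow> bool" where
  "piv A B S i \<longleftrightarrow> i \<in> S \<and> con A B S \<and> \<not> con A B (S - {i})"

definition pivV :: "'a set \<Rightarrow> 'a set \<Rightarrow> ('a + 'a set) set \<Rightarrow> 'a set" where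
  "pivV A B S = {v. piv A B S (Inl v)}"

definition pivE :: "'a set \<Rightarrow> 'a set \<Rightarrow> ('a + 'a set) set \<Rightarrow> 'a set set" where
  "pivE A B S = {e. card e = 2 \<and> piv A B S (Inr e)}"

text \<open>The edges of \<open>sgE\<close> account for the surplus of pivotal vertices over pivotal edges.\<close>

definition sgE :: "'a set \<Rightarrow> 'a set \<Rightarrow> ('a + 'a set) set \<Rightarrow> 'a set set" where
  "sgE A B S = {e. card e = 2 \<and> Inr e \<in> S \<and> \<not> piv A B S (Inr e) \<and> e \<subseteq> pivV A B S}"

lemma cadj_sym: "cadj S x y \<Longrightarrow> cadj S y x"
  by (auto simp: cadj_def insert_commute)

text \<open>An embedding principle: edges of S may be replaced by walks of T as long as marked end
  points survive. Deletions, detours and plain monotonicity are instances.\<close>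

lemma con_mono_gen:
  assumes "con A B S" "\<And>x. Inl x \<in> S \<Longrightarrow> Inr {x} \<in> S \<Longrightarrow> x \<in> A \<union> B \<Longrightarrow> Inl x \<in> T \<and> Inr {x} \<in> T"
    and "\<And>x y. cadj S x y \<Longrightarrow> (cadj T)\<^sup>*\<^sup>* x y"
  shows "con A B T"
proof -
  obtain x y where xy: "x \<in> A" "y \<in> B" "Inl x \<in> S" "Inr {x} \<in> S" "Inl y \<in> S" "Inr {y} \<in> S" "(cadj S)\<^sup>*\<^sup>* x y"
    using assms(1) by (auto simp: con_def)
  have "(cadj T)\<^sup>*\<^sup>* x y" using xy(7)
    by (induction rule: rtranclp_induct) (use assms(3) in \<open>auto intro: rtranclp_trans\<close>)
  then show ?thesis using xy assms(2)[of x] assms(2)[of y] unfolding con_def by blast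
qed

lemma con_mono: "con A B S \<Longrightarrow> S \<subseteq> T \<Longrightarrow> con A B T"
  by (erule con_mono_gen) (auto simp: cadj_def intro!: r_into_rtranclp)

lemma rtranclp_imp_successively:
  "R\<^sup>*\<^sup>* x y \<Longrightarrow> \<exists>xs. xs \<noteq> [] \<and> hd xs = x \<and> last xs = y \<and> successively R xs"
proof (induction rule: rtranclp_induct)
  case base
  show ?case by (rule exI[of _ "[x]"]) auto
next
  case (step y z)
  then obtain xs where "xs \<noteq> []" "hd xs = x" "last xs = y" "successively R xs" by auto
  then show ?case using step by (intro exI[of _ "xs @ [z]"]) (auto simp: successively_append_iff)
qed

lemma successively_imp_rtranclp:
  "successively R xs \<Longrightarrow> xs \<noteq> [] \<Longrightarrow> R\<^sup>*\<^sup>* (hd xs) (last xs)"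
proof (induction xs)
  case (Cons a xs)
  then show ?case by (cases xs) (auto intro: converse_rtranclp_into_rtranclp)
qed simp

definition cwalk :: "'a set \<Rightarrow> 'a set \<Rightarrow> ('a + 'a set) set \<Rightarrow> 'a list \<Rightarrow> bool" where
  "cwalk A B S xs \<longleftrightarrow> xs \<noteq> [] \<and> hd xs \<in> A \<and> last xs \<in> B \<and> Inl (hd xs) \<in> S \<and> Inr {hd xs} \<in> S
     \<and> Inl (last xs) \<in> S \<and> Inr {last xs} \<in> S \<and> successively (cadj S) xs"

lemma con_iff_cwalk: "con A B S \<longleftrightarrow> (\<exists>xs. cwalk A B S xs)"
proof
  assume "con A B S"
  then obtain x y where xy: "x \<in> A" "y \<in> B" "Inl x \<in> S" "Inr {x} \<in> S" "Inl y \<in> S" "Inr {y} \<in> S" "(cadj S)\<^sup>*\<^sup>* x y"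
    by (auto simp: con_def)
  then show "\<exists>xs. cwalk A B S xs"
    using rtranclp_imp_successively[OF xy(7)] unfolding cwalk_def by blast
next
  assume "\<exists>xs. cwalk A B S xs"
  then show "con A B S" unfolding cwalk_def con_def using successively_imp_rtranclp by blast
qed

lemma pivV_in_cwalk:
  assumes "cwalk A B S xs" "v \<in> pivV A B S"
  shows "v \<in> set xs"
proof (rule ccontr)
  assume v: "v \<notin> set xs"
  have "cwalk A B (S - {Inl v}) xs"
    using assms(1) v unfolding cwalk_def
    by (auto intro: successively_mono[of "cadj S"] simp: cadj_def)
  then show False using assms(2) con_iff_cwalk unfolding pivV_def piv_def by blast
qed

text \<open>Pivotal vertices lie on every connecting walk, and on a shortest one an open edge
  between two of its vertices joins neighbours, as it would be a short cut otherwise. With g the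
  successor on the walk, u \<mapsto> {u, g u} covers all such edges. This bounds their number by
  that of the vertices, also within any set of pivotal vertices.\<close>

lemma open_edges_between_pivots:
  assumes "con A B S"
  shows "\<exists>g. \<forall>e. card e = 2 \<and> Inr e \<in> S \<and> e \<subseteq> pivV A B S \<longrightarrow> (\<exists>u\<in>e. e = {u, g u})"
proof -
  obtain xs where xs: "cwalk A B S xs" and min: "\<And>ys. cwalk A B S ys \<Longrightarrow> length xs \<le> length ys"
  proof -
    obtain zs where "cwalk A B S zs" using assms con_iff_cwalk by blast
    from ex_has_least_nat[of "cwalk A B S", OF this, of length] that show ?thesis by blast
  qed
  \<comment> \<open>Taking the first index gives each vertex a definite position before repetitions
    are excluded.\<close>
  define ix where "ix u = (LEAST i. i < length xs \<and> xs ! i = u)" for u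
  have ix: "ix u < length xs \<and> xs ! ix u = u" if "u \<in> set xs" for u
  proof -
    obtain i where "i < length xs \<and> xs ! i = u" using \<open>u \<in> set xs\<close> by (auto simp: in_set_conv_nth)
    then show ?thesis unfolding ix_def by (rule LeastI)
  qed
  have key: "ix w = Suc (ix u)" if uw: "u \<in> set xs" "w \<in> set xs" "ix u < ix w" "cadj S u w" for u w
  proof (rule ccontr)
    assume ne: "ix w \<noteq> Suc (ix u)"
    let ?i = "ix u" and ?j = "ix w"
    \<comment> \<open>The stretch between u and w is cut out and replaced by the edge uw.\<close>
    define ys where "ys = take (Suc ?i) xs @ drop ?j xs"
    have s: "successively (cadj S) xs" and x0: "xs \<noteq> []" using xs by (auto simp: cwalk_def)
    have "take (Suc ?i) xs = take ?i xs @ [u]" using ix[OF uw(1)] by (simp add: take_Suc_conv_app_nth)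
    then have l: "last (take (Suc ?i) xs) = u" by simp
    have h: "hd (drop ?j xs) = w" using ix[OF uw(2)] by (simp add: hd_drop_conv_nth)
    have s1: "successively (cadj S) (take (Suc ?i) xs)" 
      using s append_take_drop_id[of "Suc ?i" xs] by (metis successively_append_iff)
    have s2: "successively (cadj S) (drop ?j xs)" 
      using s append_take_drop_id[of "?j" xs] by (metis successively_append_iff)
    have sy: "successively (cadj S) ys" unfolding ys_def successively_append_iff using s1 s2 l h uw(4) by auto
    have hy: "hd ys = hd xs" using x0 by (simp add: ys_def)
    have ly: "last ys = last xs" using ix[OF uw(2)] by (simp add: ys_def)
    have "cwalk A B S ys" using xs sy hy ly x0 unfolding cwalk_def by (auto simp: ys_def)
    then have "length xs \<le> length ys" by (rule min)
    moreover have "length ys < length xs" using ne uw(3) ix[OF uw(2)] by (simp add: ys_def) linarith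
    ultimately show False by simp
  qed
  show ?thesis
  proof (intro exI[of _ "\<lambda>u. xs ! Suc (ix u)"] allI impI)
    fix e assume e: "card e = 2 \<and> Inr e \<in> S \<and> e \<subseteq> pivV A B S"
    then obtain u w where uw: "e = {u, w}" "u \<noteq> w" by (auto simp: card_2_iff)
    have mem: "u \<in> set xs" "w \<in> set xs" using e uw pivV_in_cwalk[OF xs] by auto
    have "Inl u \<in> S" "Inl w \<in> S" using e uw by (auto simp: pivV_def piv_def)
    then have c: "cadj S u w" "cadj S w u" using e uw by (auto simp: cadj_def insert_commute)
    have "ix u \<noteq> ix w" using ix mem uw(2) by metis
    then consider "ix u < ix w" | "ix w < ix u" by linarith
    then show "\<exists>u\<in>e. e = {u, xs ! Suc (ix u)}"
    proof cases
      case 1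
      then show ?thesis using key[OF mem 1 c(1)] ix[OF mem(2)] uw by (intro bexI[of _ u]) auto
    next
      case 2
      then show ?thesis using key[OF mem(2,1) 2 c(2)] ix[OF mem(1)] uw by (intro bexI[of _ w]) auto
    qed
  qed
qed

text \<open>Without a vertex the edges at it are lost as well, so removing an end of e is at least
  as destructive as removing e.\<close>

lemma pivE_subset_pivV:
  assumes "e \<in> pivE A B S" shows "e \<subseteq> pivV A B S"
proof
  fix a assume a: "a \<in> e"
  have e: "card e = 2" "Inr e \<in> S" "con A B S" "\<not> con A B (S - {Inr e})" using assms by (auto simp: pivE_def piv_def)
  have n: "\<not> con A B (S - {Inl a})"
  proof
    assume "con A B (S - {Inl a})"
    then have "con A B (S - {Inr e})"
    proof (rule con_mono_gen)
      show "Inl x \<in> S - {Inr e} \<and> Inr {x} \<in> S - {Inr e}" if "Inl x \<in> S - {Inl a}" "Inr {x} \<in> S - {Inl a}" for x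
        using that e by auto
      show "(cadj (S - {Inr e}))\<^sup>*\<^sup>* x y" if "cadj (S - {Inl a}) x y" for x y
        using that a by (intro r_into_rtranclp) (auto simp: cadj_def)
    qed
    then show False using e by simp
  qed
  then have "Inl a \<in> S" using e by (metis Diff_insert0 Diff_empty)
  then show "a \<in> pivV A B S" using e n by (auto simp: pivV_def piv_def)
qed

text \<open>All pivotal vertices lie on one shortest connecting path, in a fixed order, and an open edge between two of them
  has to join consecutive ones.\<close>

lemma card_pivE_sgE:
  assumes "finite (pivV A B S)"
  shows "card (pivE A B S) + card (sgE A B S) \<le> card (pivV A B S)"
proof (cases "con A B S")
  case True
  obtain g where g: "\<And>e. card e = 2 \<Longrightarrow> Inr e \<in> S \<Longrightarrow> e \<subseteq> pivV A B S \<Longrightarrow> \<exists>u\<in>e. e = {u, g u}"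
    using open_edges_between_pivots[OF True] by blast
  have sub: "pivE A B S \<union> sgE A B S \<subseteq> (\<lambda>u. {u, g u}) ` pivV A B S"
  proof
    fix e assume "e \<in> pivE A B S \<union> sgE A B S"
    then have "card e = 2" "Inr e \<in> S" "e \<subseteq> pivV A B S" using pivE_subset_pivV[of e A B S]
      by (auto simp: pivE_def sgE_def piv_def)
    then show "e \<in> (\<lambda>u. {u, g u}) ` pivV A B S" using g by blast
  qed
  have "pivE A B S \<inter> sgE A B S = {}" by (auto simp: pivE_def sgE_def)
  moreover have "finite (pivE A B S \<union> sgE A B S)" using sub assms finite_subset by blast
  ultimately have "card (pivE A B S) + card (sgE A B S) = card (pivE A B S \<union> sgE A B S)"
    by (simp add: card_Un_disjoint)
  also have "\<dots> \<le> card ((\<lambda>u. {u, g u}) ` pivV A B S)" using sub assms by (intro card_mono) auto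
  also have "\<dots> \<le> card (pivV A B S)" using assms by (rule card_image_le)
  finally show ?thesis .
next
  case False
  then show ?thesis by (auto simp: pivE_def sgE_def pivV_def piv_def subset_iff card_2_iff)
qed

text \<open>The connection exists before e is added, so e is not pivotal; a walk through e visits
  both ends, so adding e makes neither of them avoidable.\<close>

lemma sgE_insert_edge:
  assumes "card e = 2" "Inr e \<notin> S" "e \<subseteq> pivV A B S"
  shows "e \<in> sgE A B (insert (Inr e) S)"
proof -
  let ?T = "insert (Inr e) S"
  have conS: "con A B S" using assms by (auto simp: pivV_def piv_def card_2_iff)
  have conT: "con A B ?T" using conS con_mono by blast
  have np: "\<not> piv A B ?T (Inr e)" using conS assms(2) by (auto simp: piv_def)
  have "a \<in> pivV A B ?T" if a: "a \<in> e" for a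
  proof -
    have "\<not> con A B (?T - {Inl a})"
    proof
      assume "con A B (?T - {Inl a})"
      then have "con A B (S - {Inl a})"
      proof (rule con_mono_gen)
        show "Inl x \<in> S - {Inl a} \<and> Inr {x} \<in> S - {Inl a}" if "Inl x \<in> ?T - {Inl a}" "Inr {x} \<in> ?T - {Inl a}" for x
          using that assms(1) by auto
        show "(cadj (S - {Inl a}))\<^sup>*\<^sup>* x y" if "cadj (?T - {Inl a}) x y" for x y
          using that a by (intro r_into_rtranclp) (auto simp: cadj_def)
      qed
      then show False using assms(3) a by (auto simp: pivV_def piv_def)
    qed
    moreover have "Inl a \<in> ?T" using assms(3) a by (auto simp: pivV_def piv_def)
    ultimately show ?thesis using conT by (auto simp: pivV_def piv_def)
  qed
  then show ?thesis using np assms(1) by (auto simp: sgE_def)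
qed

text \<open>Removing w keeps the connection because w is not pivotal, and it cannot create one that
  avoids e.\<close>

lemma pivE_delete_vertex:
  assumes "e \<in> pivE A B S" "Inl w \<in> S" "w \<notin> pivV A B S"
  shows "e \<in> pivE A B (S - {Inl w})"
proof -
  have e: "card e = 2" "Inr e \<in> S" "con A B S" "\<not> con A B (S - {Inr e})" using assms by (auto simp: pivE_def piv_def)
  have 1: "con A B (S - {Inl w})" using assms e by (auto simp: pivV_def piv_def)
  have 2: "\<not> con A B (S - {Inl w} - {Inr e})" using e(4) con_mono[of A B "S - {Inl w} - {Inr e}" "S - {Inr e}"] by blast
  show ?thesis using 1 2 e by (auto simp: pivE_def piv_def)
qed

text \<open>All sites that involve l: the vertex, its mark and its edges. Under the product measure
  they can be integrated separately from the rest.\<close>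

definition star :: "'a \<Rightarrow> ('a + 'a set) set" where
  "star l = insert (Inl l) (Inr ` {f. l \<in> f})"

lemma con_minus_star: "Inl l \<notin> S \<Longrightarrow> con A B (S - star l) = con A B S"
proof
  assume "Inl l \<notin> S" "con A B S"
  then show "con A B (S - star l)"
    by (elim con_mono_gen) (auto simp: cadj_def star_def intro!: r_into_rtranclp)
qed (auto intro: con_mono)

lemma pivE_minus_star:
  assumes "Inl l \<notin> S" "l \<notin> e"
  shows "e \<in> pivE A B (S - star l) \<longleftrightarrow> e \<in> pivE A B S"
proof -
  have "S - star l - {Inr e} = (S - {Inr e}) - star l" by auto
  then have "con A B (S - star l - {Inr e}) = con A B (S - {Inr e})"
    using con_minus_star[of l "S - {Inr e}" A B] assms by simp
  then show ?thesis using con_minus_star[of l S A B] assms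
    by (auto simp: pivE_def piv_def star_def)
qed

text \<open>Each use of the edge ab is replaced by the two steps through l.\<close>

lemma con_detour:
  assumes "con A B S" "cadj S a l" "cadj S l b" "l \<noteq> a" "l \<noteq> b" "a \<noteq> b"
  shows "con A B (S - {Inr {a, b}})"
  using assms(1)
proof (rule con_mono_gen)
  let ?T = "S - {Inr {a, b}}"
  have al: "cadj ?T a l" "cadj ?T l b" using assms by (auto simp: cadj_def doubleton_eq_iff)
  then have la: "cadj ?T l a" "cadj ?T b l" by (auto intro: cadj_sym)
  show "Inl x \<in> ?T \<and> Inr {x} \<in> ?T" if "Inl x \<in> S" "Inr {x} \<in> S" for x
    using that \<open>a \<noteq> b\<close> by (auto simp: doubleton_eq_iff)
  show "(cadj ?T)\<^sup>*\<^sup>* x y" if xy: "cadj S x y" for x y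
  proof (cases "{x, y} = {a, b}")
    case True
    then have "x = a \<and> y = b \<or> x = b \<and> y = a" by (auto simp: doubleton_eq_iff)
    then show ?thesis using al la by (meson converse_rtranclp_into_rtranclp r_into_rtranclp)
  next
    case False
    then show ?thesis using xy by (intro r_into_rtranclp) (auto simp: cadj_def)
  qed
qed

text \<open>Folding l onto b maps every walk to one that avoids l. The mark matters here: an
  unmarked l is no end point, so the fold leaves the end points of the walk fixed.\<close>

lemma con_leaf:
  assumes "con A B T" "Inr {l} \<notin> T" "\<And>w. cadj T l w \<Longrightarrow> w = b" "b \<noteq> l"
  shows "con A B (T - star l)"
proof -
  obtain x y where xy: "x \<in> A" "y \<in> B" "Inl x \<in> T" "Inr {x} \<in> T" "Inl y \<in> T" "Inr {y} \<in> T" "(cadj T)\<^sup>*\<^sup>* x y"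
    using assms(1) by (auto simp: con_def)
  define p where "p z = (if z = l then b else z)" for z
  have ne: "x \<noteq> l" "y \<noteq> l" using xy assms(2) by auto
  have step: "(cadj (T - star l))\<^sup>*\<^sup>* (p u) (p v)" if uv: "cadj T u v" for u v
  proof (cases "u = l \<or> v = l")
    case True
    then have "p u = p v" using assms(3)[of v] assms(3)[of u] uv cadj_sym[OF uv] by (auto simp: p_def)
    then show ?thesis by simp
  next
    case False
    then have "cadj (T - star l) u v" using uv by (auto simp: cadj_def star_def)
    then show ?thesis using False by (auto simp: p_def)
  qed
  have "(cadj (T - star l))\<^sup>*\<^sup>* (p x) (p y)" using xy(7)
    by (induction rule: rtranclp_induct) (use step in \<open>auto intro: rtranclp_trans\<close>)
  then have "(cadj (T - star l))\<^sup>*\<^sup>* x y" using ne by (simp add: p_def)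
  then show ?thesis using xy ne unfolding con_def
    by (intro bexI[of _ x] bexI[of _ y]) (auto simp: star_def)
qed

text \<open>The vertex l is a detour around e: without l the edge e is pivotal, with l only its ends are.\<close>

definition witn :: "'a set \<Rightarrow> 'a set \<Rightarrow> ('a + 'a set) set \<Rightarrow> 'a set \<Rightarrow> 'a \<Rightarrow> bool" where
  "witn A B T e l \<longleftrightarrow> l \<notin> e \<and> Inl l \<in> T \<and> (\<forall>x\<in>e. Inr {l, x} \<in> T) \<and> e \<in> sgE A B T \<and> e \<in> pivE A B (T - {Inl l})"

text \<open>Joined to a and b only, l provides a detour, so e is no longer pivotal. Its ends still
  are: once a is removed, l is an unmarked leaf at b, and \<open>con_leaf\<close> leads back to the
  configuration without l, where a was pivotal.\<close>

lemma witn_insert_vertex: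
  assumes e: "e = {a, b}" "a \<noteq> b" "l \<notin> e" and piv: "e \<in> pivE A B S0" "S0 \<inter> star l = {}" 
    and T: "T - star l = S0" "Inl l \<in> T" "Inr {l} \<notin> T" "Inr {l, a} \<in> T" "Inr {l, b} \<in> T"
    and only: "\<And>w. Inl w \<in> S0 \<Longrightarrow> w \<notin> e \<Longrightarrow> Inr {l, w} \<notin> T"
  shows "witn A B T e l"
proof -
  have ab: "a \<in> pivV A B S0" "b \<in> pivV A B S0" using pivE_subset_pivV[OF piv(1)] e by auto
  then have inS: "Inl a \<in> S0" "Inl b \<in> S0" by (auto simp: pivV_def piv_def)
  have eS: "Inr e \<in> S0" "con A B S0" using piv(1) by (auto simp: pivE_def piv_def)
  have S0T: "S0 \<subseteq> T" using T by auto
  have conT: "con A B T" using eS S0T con_mono by blast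
  have mem: "Inl w \<in> S0" if "Inl w \<in> T" "w \<noteq> l" for w using that T(1) by (auto simp: star_def)
  have nb: "w \<in> e" if "cadj T l w" for w using that only[of w] mem[of w] unfolding cadj_def by auto
  have adj: "cadj T a l" "cadj T l b" using inS S0T T e by (auto simp: cadj_def insert_commute)
  have np: "\<not> piv A B T (Inr e)"
    using con_detour[OF conT adj] e by (auto simp: piv_def)
  have pv: "c \<in> pivV A B T" if c: "c \<in> e" for c
  proof -
    obtain d where d: "e = {c, d}" "d \<noteq> l" using c e by auto
    have "\<not> con A B (T - {Inl c})"
    proof
      assume "con A B (T - {Inl c})"
      then have "con A B (T - {Inl c} - star l)"
      proof (rule con_leaf)
        show "Inr {l} \<notin> T - {Inl c}" using T by auto
        show "w = d" if "cadj (T - {Inl c}) l w" for w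
          using nb[of w] that d by (auto simp: cadj_def)
        show "d \<noteq> l" by fact
      qed
      moreover have "T - {Inl c} - star l = S0 - {Inl c}" using T by auto
      ultimately show False using pivE_subset_pivV[OF piv(1)] c by (auto simp: pivV_def piv_def)
    qed
    then show ?thesis using conT c e inS S0T by (auto simp: pivV_def piv_def)
  qed
  have sg: "e \<in> sgE A B T" using np pv eS S0T e by (auto simp: sgE_def)
  have "T - {Inl l} - star l = S0" using T by (auto simp: star_def)
  then have "e \<in> pivE A B (T - {Inl l})" using pivE_minus_star[of l "T - {Inl l}" e A B] piv(1) e(3) by simp
  then show ?thesis using e T sg unfolding witn_def by auto
qed

text \<open>A second detour vertex would bypass e even after the first is deleted, where e is
  pivotal. So a sum over all candidate vertices counts each edge at most once.\<close>

lemma witn_unique: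
  assumes "witn A B T e l" "witn A B T e l'"
  shows "l = l'"
proof (rule ccontr)
  assume ne: "l \<noteq> l'"
  have "card e = 2" using assms by (auto simp: witn_def sgE_def)
  then obtain a b where e: "e = {a, b}" "a \<noteq> b" by (auto simp: card_2_iff)
  let ?S = "T - {Inl l}"
  have p: "con A B ?S" "\<not> con A B (?S - {Inr e})" using assms by (auto simp: witn_def pivE_def piv_def)
  have "Inl a \<in> T" "Inl b \<in> T" using assms e by (auto simp: witn_def sgE_def pivV_def piv_def)
  then have "cadj ?S a l'" "cadj ?S l' b" using assms e ne by (auto simp: witn_def cadj_def insert_commute)
  then have "con A B (?S - {Inr {a, b}})" using con_detour[OF p(1), of a l' b] assms e by (auto simp: witn_def)
  then show False using p e by simp
qed

section \<open>Local modifications of finite configurations\<close>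

definition cidx :: "'a set \<Rightarrow> ('a + 'a set) set" where
  "cidx W = Inl ` W \<union> Inr ` {e. e \<subseteq> W \<and> (card e = 1 \<or> card e = 2)}"

definition pairs :: "'a set \<Rightarrow> 'a set set" where
  "pairs W = {e. e \<subseteq> W \<and> card e = 2}"

lemma finite_cidx [simp]: "finite W \<Longrightarrow> finite (cidx W)"
  by (auto simp: cidx_def)

lemma finite_pairs [simp]: "finite W \<Longrightarrow> finite (pairs W)"
  by (auto simp: pairs_def)

lemma pivV_subset: "S \<subseteq> cidx W \<Longrightarrow> pivV A B S \<subseteq> W"
  by (auto simp: pivV_def piv_def cidx_def)

lemma pivE_subset_pairs: "S \<subseteq> cidx W \<Longrightarrow> pivE A B S \<subseteq> pairs W"
  by (auto simp: pivE_def piv_def cidx_def pairs_def)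

lemma sgE_subset_pairs: "S \<subseteq> cidx W \<Longrightarrow> sgE A B S \<subseteq> pairs W"
  by (auto simp: sgE_def cidx_def pairs_def)

lemma real_card_eq_sum:
  "finite U \<Longrightarrow> X \<subseteq> U \<Longrightarrow> real (card X) = (\<Sum>x\<in>U. of_bool (x \<in> X))"
  by (simp add: of_bool_def sum.If_cases Int_absorb1 Int_commute)

text \<open>s is the probability of a potential vertex and tends to 0 in the limit of many vertices;
  the bound 1/2 makes 1 / (1 - s) at most 2.\<close>

locale config_model =
  fixes W :: "'a set" and A B :: "'a set" and r :: "'a + 'a set \<Rightarrow> real" and s :: real
  assumes finW: "finite W"
    and r01: "\<And>i. i \<in> cidx W \<Longrightarrow> 0 \<le> r i \<and> r i \<le> 1"
    and rV: "\<And>v. v \<in> W \<Longrightarrow> r (Inl v) = s"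
    and s_half: "0 \<le> s" "s \<le> 1/2"
begin

abbreviation ex where "ex h \<equiv> bexp (cidx W) r h"

lemma ex_mono: 
  "(\<And>S. S \<subseteq> cidx W \<Longrightarrow> (\<And>i. i \<in> S \<Longrightarrow> 0 < r i) \<Longrightarrow> h S \<le> h' S) \<Longrightarrow> ex h \<le> ex h'"
  using finW r01 by (intro bexp_mono) auto

text \<open>Opening a closed edge between two pivotal vertices produces an element of
  \<open>sgE\<close>, and the price of opening it is at least \<rho>.\<close>

lemma open_edge_estimate:
  assumes e: "e \<in> pairs W" and rho: "0 < \<rho>" "\<rho> \<le> r (Inr e)"
  shows "\<rho> * ex (\<lambda>S. of_bool (Inr e \<notin> S \<and> e \<subseteq> pivV A B S)) \<le> ex (\<lambda>S. of_bool (e \<in> sgE A B S))"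
proof -
  have i: "Inr e \<in> cidx W" using e by (auto simp: cidx_def pairs_def)
  have nn: "0 \<le> ex (\<lambda>S. of_bool (Inr e \<notin> S \<and> e \<subseteq> pivV A B S))"
    using finW r01 by (intro bexp_nonneg) auto
  have eq: "ex (\<lambda>S. of_bool (Inr e \<notin> S \<and> e \<subseteq> pivV A B S))
      = ex (\<lambda>S. if Inr e \<notin> S then of_bool (e \<subseteq> pivV A B S) else 0)"
    by (intro bexp_cong) auto
  have "\<rho> * ex (\<lambda>S. of_bool (Inr e \<notin> S \<and> e \<subseteq> pivV A B S))
      \<le> r (Inr e) * ex (\<lambda>S. of_bool (Inr e \<notin> S \<and> e \<subseteq> pivV A B S))"
    using rho nn by (intro mult_right_mono) auto
  also have "\<dots> = (1 - r (Inr e)) * ex (\<lambda>S. if Inr e \<in> S then of_bool (e \<subseteq> pivV A B (S - {Inr e})) else 0)"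
    using bexp_flip[of "cidx W" "Inr e" r "\<lambda>S. of_bool (e \<subseteq> pivV A B S)"] finW i unfolding eq by simp
  also have "\<dots> \<le> 1 * ex (\<lambda>S. if Inr e \<in> S then of_bool (e \<subseteq> pivV A B (S - {Inr e})) else 0)"
    using r01[OF i] finW r01 by (intro mult_right_mono bexp_nonneg) auto
  also have "\<dots> \<le> ex (\<lambda>S. of_bool (e \<in> sgE A B S))"
    unfolding mult_1
  proof (intro ex_mono)
    fix S assume S: "S \<subseteq> cidx W"
    show "(if Inr e \<in> S then of_bool (e \<subseteq> pivV A B (S - {Inr e})) else 0) \<le> (of_bool (e \<in> sgE A B S) :: real)"
      using sgE_insert_edge[of e "S - {Inr e}" A B] e by (auto simp: pairs_def insert_absorb)
  qed
  finally show ?thesis .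
qed

text \<open>Deletion keeps e pivotal and yields the factor s / (1 - s) \<le> 2 * s. So on average
  there are not many non-pivotal vertices around a pivotal edge.\<close>

lemma delete_vertex_estimate:
  assumes e: "e \<in> pairs W" and w: "w \<in> W"
  shows "ex (\<lambda>S. of_bool (e \<in> pivE A B S \<and> Inl w \<in> S \<and> w \<notin> pivV A B S)) \<le> 2 * s * ex (\<lambda>S. of_bool (e \<in> pivE A B S))"
proof -
  have i: "Inl w \<in> cidx W" using w by (auto simp: cidx_def)
  let ?h = "\<lambda>S. of_bool (e \<in> pivE A B S) :: real"
  have nn: "0 \<le> ex (\<lambda>S. if Inl w \<in> S then ?h (S - {Inl w}) else 0)"
    using finW r01 by (intro bexp_nonneg) auto
  have "ex (\<lambda>S. of_bool (e \<in> pivE A B S \<and> Inl w \<in> S \<and> w \<notin> pivV A B S)) \<le>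
     ex (\<lambda>S. if Inl w \<in> S then ?h (S - {Inl w}) else 0)"
    by (intro ex_mono) (auto simp: pivE_delete_vertex)
  also have "\<dots> \<le> 2 * ((1 - r (Inl w)) * ex (\<lambda>S. if Inl w \<in> S then ?h (S - {Inl w}) else 0))"
    using nn s_half rV[OF w] mult_right_mono[of "1" "2 * (1 - s)" "ex (\<lambda>S. if Inl w \<in> S then ?h (S - {Inl w}) else 0)"]
    by (simp add: algebra_simps)
  also have "(1 - r (Inl w)) * ex (\<lambda>S. if Inl w \<in> S then ?h (S - {Inl w}) else 0)
      = s * ex (\<lambda>S. if Inl w \<notin> S then ?h S else 0)"
    using bexp_flip[of "cidx W" "Inl w" r ?h] finW i rV[OF w] by simp
  also have "2 * \<dots> \<le> 2 * (s * ex ?h)"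
    using s_half by (intro mult_left_mono ex_mono) auto
  finally show ?thesis by simp
qed

end

text \<open>At most |V| pairs are open by \<open>open_edges_between_pivots\<close>, while there are
  at least 2 * |V| pairs in all. The latter holds from |V| = 5 on, where there are 10.\<close>

lemma pairs_in_cell:
  assumes fin: "finite V" and V: "V \<subseteq> W" "V \<subseteq> pivV A B S" "5 \<le> card V"
  shows "card V \<le> card {e \<in> pairs V. Inr e \<notin> S}"
proof -
  have "V \<noteq> {}" using V(3) by auto
  then have "con A B S" using V(2) by (auto simp: pivV_def piv_def)
  then obtain g where g: "\<And>e. card e = 2 \<Longrightarrow> Inr e \<in> S \<Longrightarrow> e \<subseteq> pivV A B S \<Longrightarrow> \<exists>u\<in>e. e = {u, g u}"
    using open_edges_between_pivots[of A B S] by blast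
  have "{e \<in> pairs V. Inr e \<in> S} \<subseteq> (\<lambda>u. {u, g u}) ` V"
    using g V unfolding pairs_def by blast
  then have 1: "card {e \<in> pairs V. Inr e \<in> S} \<le> card V"
    using fin by (meson card_image_le card_mono finite_imageI le_trans)
  have "card (pairs V) = card V choose 2" using n_subsets[OF fin, of 2] by (simp add: pairs_def)
  moreover have "pairs V = {e \<in> pairs V. Inr e \<in> S} \<union> {e \<in> pairs V. Inr e \<notin> S}" by auto
  then have "card (pairs V) = card {e \<in> pairs V. Inr e \<in> S} + card {e \<in> pairs V. Inr e \<notin> S}"
    using fin by (subst card_Un_disjoint[symmetric]) auto
  moreover have "2 * card V \<le> card V choose 2"
  proof -
    obtain k where k: "card V = Suc k" "4 \<le> k" using V(3) by (cases "card V") auto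
    have "4 * Suc k \<le> k * Suc k" using k by (intro mult_right_mono) auto
    then show ?thesis unfolding k(1) choose_two by (simp add: mult.commute)
  qed
  ultimately show ?thesis using 1 by linarith
qed

section \<open>Crowded surroundings of a pivotal edge\<close>

locale cell_model = config_model W A B r s for W A B r s +
  fixes \<kappa> :: "'a \<Rightarrow> 'c" and nb :: "'a set \<Rightarrow> 'c set" and NN :: "'c \<Rightarrow> 'c set" and K :: nat and \<rho> :: real
  assumes rho: "0 < \<rho>"
    and cell_close: "\<And>e. e \<in> pairs W \<Longrightarrow> (\<And>x y. x \<in> e \<Longrightarrow> y \<in> e \<Longrightarrow> \<kappa> x = \<kappa> y) \<Longrightarrow> \<rho> \<le> r (Inr e)"
    and nb_NN: "\<And>e u. e \<in> pairs W \<Longrightarrow> 0 < r (Inr e) \<Longrightarrow> u \<in> e \<Longrightarrow> nb e \<subseteq> NN (\<kappa> u)"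
    and NN_sym: "\<And>c c'. c \<in> NN c' \<Longrightarrow> c' \<in> NN c"
    and NN_fin: "\<And>c. finite (NN c)"
    and NN_card: "\<And>c. card (NN c) \<le> K"
begin

definition vc where "vc S c = {x \<in> pivV A B S. \<kappa> x = c}"
definition big where "big S = {c. 5 \<le> card (vc S c)}"
text \<open>Each such pair becomes an element of \<open>sgE\<close> when it is opened, at a price
  bounded by \<rho>.\<close>

definition NA where "NA S = {e \<in> pairs W. (\<forall>x\<in>e. \<forall>y\<in>e. \<kappa> x = \<kappa> y) \<and> Inr e \<notin> S \<and> e \<subseteq> pivV A B S}"
definition L where "L e = {w \<in> W. \<kappa> w \<in> nb e}"
definition cnt where "cnt e S = card {w \<in> L e. Inl w \<in> S}"

lemma fin_vc: "S \<subseteq> cidx W \<Longrightarrow> finite (vc S c)" "S \<subseteq> cidx W \<Longrightarrow> vc S c \<subseteq> W"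
  using pivV_subset[of S W A B] finW finite_subset[of "vc S c" W] by (auto simp: vc_def)

lemma fin_big: "S \<subseteq> cidx W \<Longrightarrow> finite (big S)"
proof -
  assume S: "S \<subseteq> cidx W"
  have "big S \<subseteq> \<kappa> ` W"
  proof
    fix c assume "c \<in> big S"
    then have "vc S c \<noteq> {}" by (auto simp: big_def)
    then show "c \<in> \<kappa> ` W" using fin_vc(2)[OF S] by (auto simp: vc_def)
  qed
  then show ?thesis using finW finite_subset by blast
qed

text \<open>Different cells share no pairs, so the counts of \<open>pairs_in_cell\<close> add
  up.\<close>

lemma big_le_NA:
  assumes S: "S \<subseteq> cidx W"
  shows "(\<Sum>c\<in>big S. card (vc S c)) \<le> card (NA S)"
proof -
  let ?N = "\<lambda>c. {e \<in> pairs (vc S c). Inr e \<notin> S}"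
  have "(\<Sum>c\<in>big S. card (vc S c)) \<le> (\<Sum>c\<in>big S. card (?N c))"
    using S fin_vc[OF S] by (intro sum_mono pairs_in_cell) (auto simp: big_def vc_def)
  also have "\<dots> = card (\<Union>c\<in>big S. ?N c)"
  proof (rule card_UN_disjoint[symmetric])
    show "\<forall>i\<in>big S. \<forall>j\<in>big S. i \<noteq> j \<longrightarrow> ?N i \<inter> ?N j = {}"
    proof (intro ballI impI)
      fix i j :: 'c assume ij: "i \<noteq> j"
      show "?N i \<inter> ?N j = {}"
      proof (rule ccontr)
        assume "?N i \<inter> ?N j \<noteq> {}"
        then obtain e where e: "e \<in> pairs (vc S i)" "e \<in> pairs (vc S j)" by auto
        then obtain x where "x \<in> e" by (auto simp: pairs_def card_2_iff)
        then show False using e ij by (auto simp: pairs_def vc_def)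
      qed
    qed
  qed (use fin_big[OF S] fin_vc[OF S] in auto)
  also have "\<dots> \<le> card (NA S)"
  proof (rule card_mono)
    show "finite (NA S)" using finW by (auto simp: NA_def)
    show "(\<Union>c\<in>big S. ?N c) \<subseteq> NA S"
      using fin_vc(2)[OF S] by (auto simp: NA_def pairs_def vc_def subset_iff)
  qed
  finally show ?thesis .
qed

text \<open>Each pivotal edge is charged to its end u in {u, g u}. This end lies in a crowded cell,
  or in one of at most K uncrowded cells close to a crowded cell c; each of these holds at most 4
  pivotal vertices, while c holds at least 5.\<close>

lemma bad_edges_le:
  assumes S: "S \<subseteq> cidx W" and pos: "\<And>i. i \<in> S \<Longrightarrow> 0 < r i"
  shows "card {e \<in> pivE A B S. nb e \<inter> big S \<noteq> {}} \<le> (1 + K) * card (NA S)"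
proof (cases "con A B S")
  case False
  then show ?thesis by (simp add: pivE_def piv_def)
next
  case True
  then obtain g where g: "\<And>e. card e = 2 \<Longrightarrow> Inr e \<in> S \<Longrightarrow> e \<subseteq> pivV A B S \<Longrightarrow> \<exists>u\<in>e. e = {u, g u}"
    using open_edges_between_pivots[of A B S] by blast
  define BV1 where "BV1 = (\<Union>c\<in>big S. vc S c)"
  define BV2 where "BV2 = (\<Union>c\<in>big S. \<Union>c'\<in>NN c - big S. vc S c')"
  have "{e \<in> pivE A B S. nb e \<inter> big S \<noteq> {}} \<subseteq> (\<lambda>u. {u, g u}) ` (BV1 \<union> BV2)"
  proof
    fix e assume e: "e \<in> {e \<in> pivE A B S. nb e \<inter> big S \<noteq> {}}"
    then have e1: "card e = 2" "Inr e \<in> S" "e \<subseteq> pivV A B S" using pivE_subset_pivV[of e A B S]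
      by (auto simp: pivE_def piv_def)
    then obtain u where u: "u \<in> e" "e = {u, g u}" using g by blast
    obtain c where c: "c \<in> nb e" "c \<in> big S" using e by auto
    have eW: "e \<in> pairs W" using e pivE_subset_pairs[OF S] by blast
    have "c \<in> NN (\<kappa> u)" using nb_NN[OF eW pos[OF e1(2)] u(1)] c by auto
    then have "\<kappa> u \<in> NN c" by (rule NN_sym)
    moreover have "u \<in> vc S (\<kappa> u)" using u e1 by (auto simp: vc_def)
    ultimately have "u \<in> BV1 \<union> BV2" using c(2) by (auto simp: BV1_def BV2_def)
    then show "e \<in> (\<lambda>u. {u, g u}) ` (BV1 \<union> BV2)" using u by blast
  qed
  moreover have fin: "finite (BV1 \<union> BV2)"
    using fin_vc(2)[OF S] finW by (intro finite_subset[of "BV1 \<union> BV2" W]) (auto simp: BV1_def BV2_def)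
  ultimately have "card {e \<in> pivE A B S. nb e \<inter> big S \<noteq> {}} \<le> card (BV1 \<union> BV2)"
    by (meson card_image_le card_mono finite_imageI le_trans)
  also have "\<dots> \<le> card BV1 + card BV2" by (rule card_Un_le)
  also have "card BV1 \<le> (\<Sum>c\<in>big S. card (vc S c))" unfolding BV1_def
    using fin_big[OF S] by (rule card_UN_le)
  also have "card BV2 \<le> (\<Sum>c\<in>big S. card (\<Union>c'\<in>NN c - big S. vc S c'))" unfolding BV2_def
    using fin_big[OF S] by (rule card_UN_le)
  also have "\<dots> \<le> (\<Sum>c\<in>big S. K * card (vc S c))"
  proof (intro sum_mono)
    fix c assume c: "c \<in> big S"
    have "card (\<Union>c'\<in>NN c - big S. vc S c') \<le> (\<Sum>c'\<in>NN c - big S. card (vc S c'))"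
      using NN_fin by (intro card_UN_le) auto
    also have "\<dots> \<le> (\<Sum>c'\<in>NN c - big S. 4)" by (intro sum_mono) (auto simp: big_def)
    also have "\<dots> \<le> K * 4" using card_mono[of "NN c" "NN c - big S"] NN_fin[of c] NN_card[of c] by auto
    also have "\<dots> \<le> K * card (vc S c)" using c by (intro mult_left_mono) (auto simp: big_def)
    finally show "card (\<Union>c'\<in>NN c - big S. vc S c') \<le> K * card (vc S c)" .
  qed
  finally have "card {e \<in> pivE A B S. nb e \<inter> big S \<noteq> {}} \<le> (1 + K) * (\<Sum>c\<in>big S. card (vc S c))"
    by (simp add: sum_distrib_left sum.distrib)
  also have "\<dots> \<le> (1 + K) * card (NA S)" using big_le_NA[OF S] by (intro mult_left_mono) auto
  finally show ?thesis .
qed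

text \<open>A pivotal edge has few vertices nearby, or a nearby vertex that is not pivotal (deleting it keeps e pivotal), or
  it lies near a cell with many pivotal vertices, hence with many closed edges between pivotal vertices.\<close>

lemma crowd_pointwise:
  assumes S: "S \<subseteq> cidx W" and pos: "\<And>i. i \<in> S \<Longrightarrow> 0 < r i" and T: "0 < T"
  shows "real (card (pivE A B S)) \<le> (1 + K) * real (card (NA S))
     + (\<Sum>e\<in>pairs W. \<Sum>w\<in>L e. of_bool (e \<in> pivE A B S \<and> Inl w \<in> S \<and> w \<notin> pivV A B S)) / real T
     + real (card {e \<in> pivE A B S. cnt e S < 4 * K + T})"
proof -
  let ?E = "pivE A B S"
  have finE: "finite ?E" using finite_subset[OF pivE_subset_pairs[OF S]] finW by simp
  let ?E1 = "{e \<in> ?E. nb e \<inter> big S \<noteq> {}}" and ?E3 = "{e \<in> ?E. cnt e S < 4 * K + T}"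
  let ?E2 = "{e \<in> ?E. nb e \<inter> big S = {} \<and> 4 * K + T \<le> cnt e S}"
  have "?E = ?E1 \<union> ?E2 \<union> ?E3" by auto
  then have "card ?E \<le> card ?E1 + card ?E2 + card ?E3" 
    using card_Un_le[of "?E1 \<union> ?E2" ?E3] card_Un_le[of ?E1 ?E2] by simp
  moreover have "card ?E1 \<le> (1 + K) * card (NA S)" using bad_edges_le[OF S pos] .
  then have "real (card ?E1) \<le> (1 + K) * real (card (NA S))"
    using of_nat_mono[of "card ?E1" "(1 + K) * card (NA S)", where 'a = real] by (simp add: algebra_simps)
  \<comment> \<open>For e in \<open>?E2\<close> the at most K cells near e hold at most 4 pivotal
    vertices each, so at least T of the 4 * K + T or more present vertices nearby are not
    pivotal.\<close>
  moreover have "real T * card ?E2 \<le> (\<Sum>e\<in>pairs W. \<Sum>w\<in>L e. of_bool (e \<in> ?E \<and> Inl w \<in> S \<and> w \<notin> pivV A B S))"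
  proof -
    have "real T \<le> (\<Sum>w\<in>L e. of_bool (e \<in> ?E \<and> Inl w \<in> S \<and> w \<notin> pivV A B S))" if e: "e \<in> ?E2" for e
    proof -
      have e': "e \<in> ?E" "nb e \<inter> big S = {}" "4 * K + T \<le> cnt e S" using e by auto
      have eW: "e \<in> pairs W" using e'(1) pivE_subset_pairs[OF S] by blast
      have "Inr e \<in> S" using e'(1) by (auto simp: pivE_def piv_def)
      obtain u where u: "u \<in> e" using eW by (auto simp: pairs_def card_2_iff)
      have sub: "nb e \<subseteq> NN (\<kappa> u)" using nb_NN[OF eW pos[OF \<open>Inr e \<in> S\<close>] u] .
      then have nbf: "finite (nb e)" "card (nb e) \<le> K"
        using finite_subset[OF sub NN_fin] NN_card[of "\<kappa> u"] card_mono[OF NN_fin sub] by auto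
      have fL: "finite (L e)" using finW by (auto simp: L_def)
      have "L e \<inter> pivV A B S \<subseteq> (\<Union>c\<in>nb e. vc S c)" by (auto simp: L_def vc_def)
      then have "card (L e \<inter> pivV A B S) \<le> card (\<Union>c\<in>nb e. vc S c)"
        using nbf fin_vc(1)[OF S] by (intro card_mono) auto
      also have "\<dots> \<le> (\<Sum>c\<in>nb e. card (vc S c))" using nbf by (intro card_UN_le)
      also have "\<dots> \<le> (\<Sum>c\<in>nb e. 4)"
      proof (intro sum_mono)
        fix c assume "c \<in> nb e"
        then have "c \<notin> big S" using e'(2) by auto
        then show "card (vc S c) \<le> 4" by (simp add: big_def)
      qed
      also have "\<dots> \<le> 4 * K" using nbf by simp
      finally have p: "card (L e \<inter> pivV A B S) \<le> 4 * K" .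
      have "cnt e S \<le> card ({w \<in> L e. Inl w \<in> S \<and> w \<notin> pivV A B S} \<union> (L e \<inter> pivV A B S))"
        unfolding cnt_def using fL by (intro card_mono) auto
      also have "\<dots> \<le> card {w \<in> L e. Inl w \<in> S \<and> w \<notin> pivV A B S} + card (L e \<inter> pivV A B S)"
        by (rule card_Un_le)
      finally have "T \<le> card {w \<in> L e. Inl w \<in> S \<and> w \<notin> pivV A B S}" using p e'(3) by linarith
      also have "real \<dots> = (\<Sum>w\<in>L e. of_bool (w \<in> {w \<in> L e. Inl w \<in> S \<and> w \<notin> pivV A B S}))"
        using fL by (intro real_card_eq_sum) auto
      also have "\<dots> = (\<Sum>w\<in>L e. of_bool (e \<in> ?E \<and> Inl w \<in> S \<and> w \<notin> pivV A B S))"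
        using e'(1) by (intro sum.cong) auto
      finally show ?thesis by simp
    qed
    then have "(\<Sum>e\<in>?E2. real T) \<le> (\<Sum>e\<in>?E2. \<Sum>w\<in>L e. of_bool (e \<in> ?E \<and> Inl w \<in> S \<and> w \<notin> pivV A B S))"
      by (intro sum_mono)
    also have "\<dots> \<le> (\<Sum>e\<in>pairs W. \<Sum>w\<in>L e. of_bool (e \<in> ?E \<and> Inl w \<in> S \<and> w \<notin> pivV A B S))"
      using finW pivE_subset_pairs[OF S] by (intro sum_mono2) (auto intro!: sum_nonneg)
    finally show ?thesis by (simp add: mult.commute)
  qed
  then have "real (card ?E2) \<le> (\<Sum>e\<in>pairs W. \<Sum>w\<in>L e. of_bool (e \<in> ?E \<and> Inl w \<in> S \<and> w \<notin> pivV A B S)) / real T"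
    using T by (simp add: field_simps)
  ultimately show ?thesis by linarith
qed

lemma ex_card: 
  assumes "\<And>S. S \<subseteq> cidx W \<Longrightarrow> X S \<subseteq> pairs W"
  shows "ex (\<lambda>S. real (card (X S))) = (\<Sum>e\<in>pairs W. ex (\<lambda>S. of_bool (e \<in> X S)))"
  unfolding bexp_sum[symmetric] using assms finW by (intro bexp_cong refl real_card_eq_sum) auto

text \<open>The condition on T makes the deletion term of \<open>crowd_pointwise\<close> at most
  half of its left side, where it is absorbed. The closed pairs within cells are paid for by
  \<open>open_edge_estimate\<close>.\<close>

lemma crowd_estimate:
  assumes T: "0 < T" and KL: "\<And>e. e \<in> pairs W \<Longrightarrow> 4 * s * real (card (L e)) \<le> T"
  shows "ex (\<lambda>S. real (card (pivE A B S))) / 2 \<le> (1 + K) / \<rho> * ex (\<lambda>S. real (card (sgE A B S)))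
     + ex (\<lambda>S. real (card {e \<in> pivE A B S. cnt e S < 4 * K + T}))"
proof -
  let ?EP = "ex (\<lambda>S. real (card (pivE A B S)))"
  have 1: "?EP \<le> ex (\<lambda>S. ((1 + K) * real (card (NA S))
     + (1 / real T) * (\<Sum>e\<in>pairs W. \<Sum>w\<in>L e. of_bool (e \<in> pivE A B S \<and> Inl w \<in> S \<and> w \<notin> pivV A B S)))
     + real (card {e \<in> pivE A B S. cnt e S < 4 * K + T}))"
    using crowd_pointwise[OF _ _ T] by (intro ex_mono) simp
  have 2: "ex (\<lambda>S. real (card (NA S))) \<le> ex (\<lambda>S. real (card (sgE A B S))) / \<rho>"
  proof -
    have "ex (\<lambda>S. real (card (NA S))) = (\<Sum>e\<in>pairs W. ex (\<lambda>S. of_bool (e \<in> NA S)))"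
      by (rule ex_card) (auto simp: NA_def)
    also have "\<dots> \<le> (\<Sum>e\<in>pairs W. ex (\<lambda>S. of_bool (e \<in> sgE A B S)) / \<rho>)"
    proof (intro sum_mono)
      fix e assume e: "e \<in> pairs W"
      show "ex (\<lambda>S. of_bool (e \<in> NA S)) \<le> ex (\<lambda>S. of_bool (e \<in> sgE A B S)) / \<rho>"
      proof (cases "\<forall>x\<in>e. \<forall>y\<in>e. \<kappa> x = \<kappa> y")
        case True
        then have "\<rho> \<le> r (Inr e)" using cell_close[OF e] by blast
        from open_edge_estimate[OF e rho this] 
        have "ex (\<lambda>S. of_bool (Inr e \<notin> S \<and> e \<subseteq> pivV A B S)) \<le> ex (\<lambda>S. of_bool (e \<in> sgE A B S)) / \<rho>"
          using rho by (simp add: field_simps)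
        moreover have "ex (\<lambda>S. of_bool (e \<in> NA S)) = ex (\<lambda>S. of_bool (Inr e \<notin> S \<and> e \<subseteq> pivV A B S))"
        proof -
          have "\<And>S. e \<in> NA S \<longleftrightarrow> Inr e \<notin> S \<and> e \<subseteq> pivV A B S" using True e unfolding NA_def by blast
          then show ?thesis by simp
        qed
        ultimately show ?thesis by simp
      next
        case False
        then have "\<And>S. e \<notin> NA S" unfolding NA_def by blast
        then have "ex (\<lambda>S. of_bool (e \<in> NA S)) = 0" by simp
        moreover have "0 \<le> ex (\<lambda>S. of_bool (e \<in> sgE A B S)) / \<rho>"
          using rho finW r01 by (intro divide_nonneg_nonneg bexp_nonneg) auto
        ultimately show ?thesis by simp
      qed
    qed
    also have "\<dots> = ex (\<lambda>S. real (card (sgE A B S))) / \<rho>"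
      using ex_card[of "sgE A B", OF sgE_subset_pairs] by (simp add: sum_divide_distrib)
    finally show ?thesis .
  qed
  have 3: "ex (\<lambda>S. \<Sum>e\<in>pairs W. \<Sum>w\<in>L e. of_bool (e \<in> pivE A B S \<and> Inl w \<in> S \<and> w \<notin> pivV A B S)) \<le> T / 2 * ?EP"
  proof -
    have "ex (\<lambda>S. \<Sum>e\<in>pairs W. \<Sum>w\<in>L e. of_bool (e \<in> pivE A B S \<and> Inl w \<in> S \<and> w \<notin> pivV A B S))
       = (\<Sum>e\<in>pairs W. \<Sum>w\<in>L e. ex (\<lambda>S. of_bool (e \<in> pivE A B S \<and> Inl w \<in> S \<and> w \<notin> pivV A B S)))"
      by (simp add: bexp_sum)
    also have "\<dots> \<le> (\<Sum>e\<in>pairs W. \<Sum>w\<in>L e. 2 * s * ex (\<lambda>S. of_bool (e \<in> pivE A B S)))"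
      by (intro sum_mono delete_vertex_estimate) (auto simp: L_def)
    also have "\<dots> \<le> (\<Sum>e\<in>pairs W. T / 2 * ex (\<lambda>S. of_bool (e \<in> pivE A B S)))"
    proof (intro sum_mono)
      fix e assume e: "e \<in> pairs W"
      have "0 \<le> ex (\<lambda>S. of_bool (e \<in> pivE A B S))" using finW r01 by (intro bexp_nonneg) auto
      then have "4 * s * real (card (L e)) * ex (\<lambda>S. of_bool (e \<in> pivE A B S)) \<le> T * ex (\<lambda>S. of_bool (e \<in> pivE A B S))"
        using KL[OF e] by (intro mult_right_mono) auto
      then show "(\<Sum>w\<in>L e. 2 * s * ex (\<lambda>S. of_bool (e \<in> pivE A B S))) \<le> T / 2 * ex (\<lambda>S. of_bool (e \<in> pivE A B S))"
        by (simp add: algebra_simps)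
    qed
    also have "\<dots> = T / 2 * ?EP"
      using ex_card[of "pivE A B", OF pivE_subset_pairs] by (simp add: sum_distrib_left)
    finally show ?thesis .
  qed
  have "(1 + real K) * ex (\<lambda>S. real (card (NA S))) \<le> (1 + real K) * (ex (\<lambda>S. real (card (sgE A B S))) / \<rho>)"
    using 2 by (intro mult_left_mono) auto
  moreover have "(1 / real T) * ex (\<lambda>S. \<Sum>e\<in>pairs W. \<Sum>w\<in>L e. of_bool (e \<in> pivE A B S \<and> Inl w \<in> S \<and> w \<notin> pivV A B S)) \<le> ?EP / 2"
    using 3 T by (simp add: field_simps)
  moreover have "?EP \<le> (1 + real K) * ex (\<lambda>S. real (card (NA S)))
      + (1 / real T) * ex (\<lambda>S. \<Sum>e\<in>pairs W. \<Sum>w\<in>L e. of_bool (e \<in> pivE A B S \<and> Inl w \<in> S \<and> w \<notin> pivV A B S))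
      + ex (\<lambda>S. real (card {e \<in> pivE A B S. cnt e S < 4 * K + T}))"
    using 1 unfolding bexp_add bexp_cmult by simp
  ultimately have "?EP / 2 \<le> (1 + real K) * (ex (\<lambda>S. real (card (sgE A B S))) / \<rho>)
      + ex (\<lambda>S. real (card {e \<in> pivE A B S. cnt e S < 4 * K + T}))" by linarith
  then show ?thesis by simp
qed

end

section \<open>Sparse surroundings: inserting a detour vertex\<close>

context config_model
begin

text \<open>The factors are the prices of the vertex l, of its edges to a and b, of its missing
  mark, and of having no edge to another present vertex. Only present vertices must be avoided, at
  most m of which are within reach of l; so the price does not depend on the size of W.\<close>

lemma insert_vertex_estimate:
  assumes e: "e = {a, b}" "a \<noteq> b" "e \<subseteq> W" and l: "l \<in> W" "l \<notin> e"
    and mark: "r (Inr {l}) \<le> \<gamma>" "\<gamma> \<le> 1"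
    and rho: "0 \<le> \<rho>" "\<rho> \<le> r (Inr {l, a})" "\<rho> \<le> r (Inr {l, b})"
    and q: "q \<le> 1" "\<And>w. w \<in> W \<Longrightarrow> w \<noteq> l \<Longrightarrow> r (Inr {l, w}) \<le> q"
    and far: "\<And>w. w \<in> W \<Longrightarrow> w \<notin> Le \<Longrightarrow> w \<noteq> l \<Longrightarrow> w \<notin> e \<Longrightarrow> r (Inr {l, w}) = 0"
  shows "s * (\<rho>\<^sup>2 * ((1 - \<gamma>) * (1 - q) ^ m)) * 
      bexp (cidx W - star l) r (\<lambda>S. of_bool (e \<in> pivE A B S \<and> card {w \<in> Le \<inter> W. Inl w \<in> S} \<le> m))
    \<le> ex (\<lambda>S. of_bool (witn A B S e l))"
proof -
  define I0 where "I0 = cidx W - star l"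
  define J where "J = cidx W \<inter> star l"
  have fin: "finite I0" "finite J" using finW by (auto simp: I0_def J_def)
  have I: "cidx W = I0 \<union> J" "I0 \<inter> J = {}" by (auto simp: I0_def J_def)
  have q0: "0 \<le> 1 - q" using q by simp
  let ?c = "s * (\<rho>\<^sup>2 * ((1 - \<gamma>) * (1 - q) ^ m))"
  let ?H = "\<lambda>S. e \<in> pivE A B S \<and> card {w \<in> Le \<inter> W. Inl w \<in> S} \<le> m"
  have "?c * bexp I0 r (\<lambda>S. of_bool (?H S)) = bexp I0 r (\<lambda>S. ?c * of_bool (?H S))"
    by (simp only: bexp_cmult)
  also have "\<dots> \<le> bexp I0 r (\<lambda>S. bexp J r (\<lambda>T. of_bool (witn A B (S \<union> T) e l)))"
  proof (rule bexp_mono[OF fin(1)])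
    show "0 \<le> r i \<and> r i \<le> 1" if "i \<in> I0" for i using that r01 by (auto simp: I0_def)
    fix S assume S: "S \<subseteq> I0"
    have nn: "0 \<le> bexp J r (\<lambda>T. of_bool (witn A B (S \<union> T) e l))"
      using fin r01 by (intro bexp_nonneg) (auto simp: J_def)
    show "?c * of_bool (?H S) \<le> bexp J r (\<lambda>T. of_bool (witn A B (S \<union> T) e l))"
    proof (cases "?H S")
      case False
      then have z: "of_bool (?H S) = (0::real)" by (simp only: of_bool_eq)
      show ?thesis unfolding z using nn by simp
    next
      case True
      \<comment> \<open>The other present vertices; their edges to l are to be closed.\<close>
      define Q where "Q = {w \<in> W. w \<notin> e \<and> w \<noteq> l \<and> Inl w \<in> S}"
      define A0 where "A0 = {Inl l, Inr {l, a}, Inr {l, b}}"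
      define B0 :: "('a + 'a set) set" where "B0 = insert (Inr {l}) ((\<lambda>w. Inr {l, w}) ` Q)"
      have lab: "l \<noteq> a" "l \<noteq> b" using l e by auto
      have abW: "a \<in> W" "b \<in> W" using e by auto
      have A0: "A0 \<subseteq> J" using l(1) abW lab by (auto simp: A0_def J_def cidx_def star_def)
      have B0: "B0 \<subseteq> J" using l(1) by (auto simp: B0_def Q_def J_def cidx_def star_def)
      have AB: "A0 \<inter> B0 = {}" using lab unfolding e(1) A0_def B0_def Q_def by (auto simp: doubleton_eq_iff)
      have "(\<Prod>i\<in>A0. r i) * (\<Prod>i\<in>B0. 1 - r i) = bexp J r (\<lambda>T. of_bool (A0 \<subseteq> T \<and> T \<inter> B0 = {}))"
        using bexp_cylinder[OF fin(2) A0 B0 AB] by simp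
      also have "\<dots> \<le> bexp J r (\<lambda>T. of_bool (witn A B (S \<union> T) e l))"
      proof (rule bexp_mono[OF fin(2)])
        show "0 \<le> r i \<and> r i \<le> 1" if "i \<in> J" for i using that r01 by (auto simp: J_def)
        fix T assume T: "T \<subseteq> J"
        show "of_bool (A0 \<subseteq> T \<and> T \<inter> B0 = {}) \<le> (of_bool (witn A B (S \<union> T) e l) :: real)"
        proof (cases "A0 \<subseteq> T \<and> T \<inter> B0 = {}")
          case ok: True
          have Sst: "S \<inter> star l = {}" using S by (auto simp: I0_def)
          have "witn A B (S \<union> T) e l"
          proof (rule witn_insert_vertex[OF e(1,2) l(2) _ Sst])
            show "e \<in> pivE A B S" using True by simp
            show "S \<union> T - star l = S" using Sst T by (auto simp: J_def)
            show "Inl l \<in> S \<union> T" "Inr {l, a} \<in> S \<union> T" "Inr {l, b} \<in> S \<union> T" using ok by (auto simp: A0_def)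
            show "Inr {l} \<notin> S \<union> T" using ok Sst by (auto simp: B0_def star_def)
            fix w assume w: "Inl w \<in> S" "w \<notin> e"
            then have "w \<in> W" "w \<noteq> l" using S by (auto simp: I0_def cidx_def star_def)
            then have "w \<in> Q" using w by (auto simp: Q_def)
            then have "Inr {l, w} \<notin> T" using ok by (auto simp: B0_def)
            moreover have "Inr {l, w} \<notin> S" using Sst by (auto simp: star_def)
            ultimately show "Inr {l, w} \<notin> S \<union> T" by auto
          qed
          then show ?thesis by simp
        qed auto
      qed
      finally have 1: "(\<Prod>i\<in>A0. r i) * (\<Prod>i\<in>B0. 1 - r i) \<le> bexp J r (\<lambda>T. of_bool (witn A B (S \<union> T) e l))" .
      have "{l, a} \<noteq> {l, b}" using e(2) by (auto simp: doubleton_eq_iff)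
      then have pA: "(\<Prod>i\<in>A0. r i) = s * (r (Inr {l, a}) * r (Inr {l, b}))"
        using rV[OF l(1)] by (simp add: A0_def)
      have pA': "s * \<rho>\<^sup>2 \<le> (\<Prod>i\<in>A0. r i)"
        unfolding pA power2_eq_square using rho s_half by (intro mult_mono) auto
      have finQ: "finite Q" using finW by (auto simp: Q_def)
      have inj: "inj_on (\<lambda>w. Inr {l, w} :: 'a + 'a set) Q" by (auto simp: inj_on_def doubleton_eq_iff)
      have nm: "Inr {l} \<notin> (\<lambda>w. Inr {l, w} :: 'a + 'a set) ` Q" by (auto simp: Q_def)
      have pB: "(\<Prod>i\<in>B0. 1 - r i) = (1 - r (Inr {l})) * (\<Prod>w\<in>Q. 1 - r (Inr {l, w}))"
        unfolding B0_def using finQ nm by (simp add: prod.reindex[OF inj])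
      have rQ: "0 \<le> r (Inr {l, w}) \<and> r (Inr {l, w}) \<le> 1" if "w \<in> Q" for w
        using that l by (intro r01) (auto simp: Q_def cidx_def)
      have "(1 - q) ^ m \<le> (1 - q) ^ card (Q \<inter> Le)"
      proof (rule power_decreasing)
        have "card (Q \<inter> Le) \<le> card {w \<in> Le \<inter> W. Inl w \<in> S}"
          using finW by (intro card_mono) (auto simp: Q_def)
        then show "card (Q \<inter> Le) \<le> m" using True by simp
        have "a \<in> W" "a \<noteq> l" "r (Inr {l, a}) \<le> q" using q(2)[of a] e l by auto
        then show "1 - q \<le> 1" using rho by linarith
      qed (use q0 in auto)
      also have "\<dots> = (\<Prod>w\<in>Q \<inter> Le. 1 - q)" by simp
      also have "\<dots> \<le> (\<Prod>w\<in>Q \<inter> Le. 1 - r (Inr {l, w}))"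
        using q0 q(2) by (intro prod_mono) (auto simp: Q_def)
      \<comment> \<open>Vertices outside \<open>Le\<close> have rate 0 and contribute factors
        1.\<close>
      also have "\<dots> = (\<Prod>w\<in>Q. 1 - r (Inr {l, w}))"
        using finQ far by (intro prod.mono_neutral_left) (auto simp: Q_def)
      finally have "(1 - \<gamma>) * (1 - q) ^ m \<le> (\<Prod>i\<in>B0. 1 - r i)"
        unfolding pB using mark q0 by (intro mult_mono) auto
      then have "(s * \<rho>\<^sup>2) * ((1 - \<gamma>) * (1 - q) ^ m) \<le> (\<Prod>i\<in>A0. r i) * (\<Prod>i\<in>B0. 1 - r i)"
        using pA' mark q0 s_half rho A0 B0 r01 by (intro mult_mono prod_nonneg) (auto simp: J_def)
      then show ?thesis using 1 True by (simp add: mult.assoc)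
    qed
  qed
  also have "\<dots> = ex (\<lambda>S. of_bool (witn A B S e l))"
    unfolding I(1) using bexp_Un[OF fin I(2)] by simp
  finally show ?thesis unfolding I0_def .
qed

text \<open>When l is absent, its mark and edges affect neither the pivotality of e nor the count,
  so its star integrates out.\<close>

lemma absent_vertex_expectation:
  assumes l: "l \<in> W" "l \<notin> e"
  shows "ex (\<lambda>S. of_bool (Inl l \<notin> S \<and> e \<in> pivE A B S \<and> card {w \<in> L. Inl w \<in> S} \<le> m))
     \<le> bexp (cidx W - star l) r (\<lambda>S. of_bool (e \<in> pivE A B S \<and> card {w \<in> L. Inl w \<in> S} \<le> m))"
proof -
  define I0 where "I0 = cidx W - star l"
  define J where "J = cidx W \<inter> star l"
  have fin: "finite I0" "finite J" using finW by (auto simp: I0_def J_def)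
  have I: "cidx W = I0 \<union> J" "I0 \<inter> J = {}" by (auto simp: I0_def J_def)
  let ?H = "\<lambda>S. e \<in> pivE A B S \<and> card {w \<in> L. Inl w \<in> S} \<le> m"
  have "ex (\<lambda>S. of_bool (Inl l \<notin> S \<and> ?H S)) = bexp I0 r (\<lambda>S. bexp J r (\<lambda>T. of_bool (Inl l \<notin> S \<union> T \<and> ?H (S \<union> T))))"
    unfolding I(1) using bexp_Un[OF fin I(2)] by simp
  also have "\<dots> \<le> bexp I0 r (\<lambda>S. bexp J r (\<lambda>T. of_bool (?H S)))"
  proof (rule bexp_mono[OF fin(1)])
    show "0 \<le> r i \<and> r i \<le> 1" if "i \<in> I0" for i using that r01 by (auto simp: I0_def)
    fix S assume S: "S \<subseteq> I0"
    show "bexp J r (\<lambda>T. of_bool (Inl l \<notin> S \<union> T \<and> ?H (S \<union> T))) \<le> bexp J r (\<lambda>T. of_bool (?H S))"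
    proof (rule bexp_mono[OF fin(2)])
      show "0 \<le> r i \<and> r i \<le> 1" if "i \<in> J" for i using that r01 by (auto simp: J_def)
      fix T assume T: "T \<subseteq> J"
      have "?H S" if h: "Inl l \<notin> S \<union> T" "?H (S \<union> T)"
      proof -
        have "S \<union> T - star l = S" using S T by (auto simp: I0_def J_def)
        then have 1: "e \<in> pivE A B S" using pivE_minus_star[OF h(1) l(2), of A B] h by simp
        have "{w \<in> L. Inl w \<in> S} = {w \<in> L. Inl w \<in> S \<union> T}"
          using T h(1) by (auto simp: J_def star_def)
        then show ?thesis using 1 h by simp
      qed
      then show "of_bool (Inl l \<notin> S \<union> T \<and> ?H (S \<union> T)) \<le> (of_bool (?H S) :: real)" by auto
    qed
  qed
  also have "\<dots> = bexp I0 r (\<lambda>S. of_bool (?H S))" using fin by (simp add: bexp_const)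
  finally show ?thesis unfolding I0_def .
qed

text \<open>At most one summand is nonzero by \<open>witn_unique\<close>, and then e is in
  \<open>sgE\<close>.\<close>

lemma sum_witn_le:
  "(\<Sum>l\<in>W. ex (\<lambda>S. of_bool (witn A B S e l))) \<le> ex (\<lambda>S. of_bool (e \<in> sgE A B S))"
  unfolding bexp_sum[symmetric]
proof (intro ex_mono)
  fix S assume "S \<subseteq> cidx W"
  show "(\<Sum>l\<in>W. of_bool (witn A B S e l)) \<le> (of_bool (e \<in> sgE A B S) :: real)"
  proof (cases "\<exists>l\<in>W. witn A B S e l")
    case True
    then obtain l where l: "l \<in> W" "witn A B S e l" by auto
    have "witn A B S e x \<longleftrightarrow> x = l" for x using l(2) witn_unique[of A B S e l x] by blast
    then have "(\<Sum>x\<in>W. of_bool (witn A B S e x)) = (\<Sum>x\<in>W. if x = l then 1 else (0::real))"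
      by (intro sum.cong) auto
    also have "\<dots> = 1" using l finW by simp
    finally show ?thesis using l by (simp add: witn_def)
  next
    case False
    then show ?thesis by simp
  qed
qed

end

section \<open>Infinite product measures\<close>

lemma measure_pair_measure_alt:
  assumes "prob_space M1" "prob_space M2" and S: "S \<in> sets (M1 \<Otimes>\<^sub>M M2)"
  shows "measure (M1 \<Otimes>\<^sub>M M2) S = (\<integral>x. measure M2 (Pair x -` S) \<partial>M1)"
    and "(\<lambda>x. measure M2 (Pair x -` S)) \<in> borel_measurable M1"
proof -
  interpret M1: prob_space M1 by fact
  interpret M2: prob_space M2 by fact
  have m[measurable]: "(\<lambda>x. emeasure M2 (Pair x -` S)) \<in> borel_measurable M1"
    using S by (rule M2.measurable_emeasure_Pair)
  show m': "(\<lambda>x. measure M2 (Pair x -` S)) \<in> borel_measurable M1"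
    unfolding measure_def by simp
  have "emeasure (M1 \<Otimes>\<^sub>M M2) S = (\<integral>\<^sup>+x. emeasure M2 (Pair x -` S) \<partial>M1)"
    using S by (rule M2.emeasure_pair_measure_alt)
  also have "\<dots> = (\<integral>\<^sup>+x. ennreal (measure M2 (Pair x -` S)) \<partial>M1)"
    by (simp add: M2.emeasure_eq_measure)
  also have "\<dots> = ennreal (\<integral>x. measure M2 (Pair x -` S) \<partial>M1)"
    using m' by (intro nn_integral_eq_integral M1.integrable_const_bound[where B=1]) auto
  finally show "measure (M1 \<Otimes>\<^sub>M M2) S = (\<integral>x. measure M2 (Pair x -` S) \<partial>M1)"
    unfolding measure_def by (simp add: integral_nonneg_AE)
qed

text \<open>Replacing one coordinate by an independent copy preserves the product measure. Both the
  reduction to \<open>bexp\<close> and the zero-one law integrate coordinates one at a time through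
  this.\<close>

lemma PiM_resample_integral:
  fixes M :: "'i \<Rightarrow> 'a measure" and h :: "('i \<Rightarrow> 'a) \<Rightarrow> real"
  assumes M: "\<And>i. prob_space (M i)" and h[measurable]: "h \<in> borel_measurable (PiM UNIV M)"
    and bd: "\<And>x. x \<in> space (PiM UNIV M) \<Longrightarrow> \<bar>h x\<bar> \<le> B"
  shows "(\<integral>x. h x \<partial>PiM UNIV M) = (\<integral>x. (\<integral>y. h (x(i := y)) \<partial>M i) \<partial>PiM UNIV M)"
    and "(\<lambda>x. \<integral>y. h (x(i := y)) \<partial>M i) \<in> borel_measurable (PiM UNIV M)"
proof -
  let ?P = "PiM UNIV M"
  interpret P: prob_space ?P using M by (intro prob_space_PiM)
  interpret Mi: prob_space "M i" by (rule M)
  interpret PM: pair_sigma_finite "M i" ?P ..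
  interpret PP: prob_space "M i \<Otimes>\<^sub>M ?P" by (intro prob_space_pair) unfold_locales
  have upd[measurable]: "(\<lambda>z. (snd z)(i := fst z)) \<in> M i \<Otimes>\<^sub>M ?P \<rightarrow>\<^sub>M ?P"
    using measurable_fun_upd[of UNIV UNIV i snd "M i \<Otimes>\<^sub>M ?P" M fst] by simp
  have "(\<integral>x. h x \<partial>?P) = (\<integral>x. h x \<partial>distr (M i \<Otimes>\<^sub>M ?P) ?P (\<lambda>(y, x). x(i := y)))"
    using distr_pair_PiM_eq_PiM[of UNIV M i] M by simp
  also have "\<dots> = (\<integral>z. h ((snd z)(i := fst z)) \<partial>(M i \<Otimes>\<^sub>M ?P))"
    by (subst integral_distr) (auto simp: case_prod_beta')
  also have "\<dots> = (\<integral>x. (\<integral>y. h (x(i := y)) \<partial>M i) \<partial>?P)"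
  proof -
    have "integrable (M i \<Otimes>\<^sub>M ?P) (\<lambda>z. h ((snd z)(i := fst z)))"
      using bd measurable_space[OF upd] by (intro PP.integrable_const_bound[where B=B]) auto
    then have int: "integrable (M i \<Otimes>\<^sub>M ?P) (\<lambda>(y, x). h (x(i := y)))" by (simp add: case_prod_beta')
    show ?thesis using PM.integral_snd[OF int] by (simp add: case_prod_beta')
  qed
  finally show "(\<integral>x. h x \<partial>PiM UNIV M) = (\<integral>x. (\<integral>y. h (x(i := y)) \<partial>M i) \<partial>PiM UNIV M)" .
  have "(\<lambda>z. h ((fst z)(i := snd z))) \<in> borel_measurable (?P \<Otimes>\<^sub>M M i)"
    using measurable_fun_upd[of UNIV UNIV i fst "?P \<Otimes>\<^sub>M M i" M snd] by simp
  then show "(\<lambda>x. \<integral>y. h (x(i := y)) \<partial>M i) \<in> borel_measurable (PiM UNIV M)"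
    by (intro Mi.borel_measurable_lebesgue_integral) (simp add: case_prod_beta')
qed

lemma PiM_coin_measurable [measurable]:
  assumes "finite J" "\<And>e. e \<in> J \<Longrightarrow> Measurable.pred N (\<lambda>x. Q e x)"
  shows "(\<lambda>x. h {e \<in> J. Q e x} :: real) \<in> borel_measurable N"
  using assms
proof (induction J arbitrary: h rule: finite_induct)
  case empty
  then show ?case by simp
next
  case (insert j J)
  have "(\<lambda>x. if Q j x then h (insert j {e \<in> J. Q e x}) else h {e \<in> J. Q e x}) \<in> borel_measurable N"
    using insert by (intro measurable_If insert.IH[of h] insert.IH[of "\<lambda>S. h (insert j S)"]) auto
  also have "(\<lambda>x. if Q j x then h (insert j {e \<in> J. Q e x}) else h {e \<in> J. Q e x}) = (\<lambda>x. h {e \<in> insert j J. Q e x})"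
    by (auto intro!: arg_cong[of _ _ h])
  finally show ?case .
qed

text \<open>The bridge from infinite product spaces to \<open>bexp\<close>: each coordinate in J
  enters only through a coin.\<close>

lemma PiM_coin_integral:
  fixes M :: "'i \<Rightarrow> 'a measure"
  assumes M: "\<And>i. prob_space (M i)" and fin: "finite J" 
    and B[measurable]: "\<And>e. e \<in> J \<Longrightarrow> {y \<in> space (M e). Q e y} \<in> sets (M e)"
  shows "(\<integral>x. h {e \<in> J. Q e (x e)} \<partial>PiM UNIV M) = bexp J (\<lambda>e. measure (M e) {y \<in> space (M e). Q e y}) h"
  using fin B
proof (induction J arbitrary: h rule: finite_induct)
  case empty
  interpret P: prob_space "PiM UNIV M" using M by (intro prob_space_PiM)
  show ?case by (simp add: P.prob_space)
next
  case (insert j J)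
  interpret P: prob_space "PiM UNIV M" using M by (intro prob_space_PiM)
  interpret Mi: prob_space "M j" by (rule M)
  have pr: "Measurable.pred (PiM UNIV M) (\<lambda>x. Q e (x e))" if "e \<in> insert j J" for e
  proof -
    have "(\<lambda>x. x e) -` {y \<in> space (M e). Q e y} \<inter> space (PiM UNIV M) \<in> sets (PiM UNIV M)"
      using insert.prems[OF that] by measurable
    also have "(\<lambda>x. x e) -` {y \<in> space (M e). Q e y} \<inter> space (PiM UNIV M) = {x \<in> space (PiM UNIV M). Q e (x e)}"
      by (auto simp: space_PiM)
    finally show ?thesis by (simp add: pred_def)
  qed
  let ?h = "\<lambda>x. h {e \<in> insert j J. Q e (x e)}"
  have meas: "?h \<in> borel_measurable (PiM UNIV M)"
    using insert.hyps pr by (intro PiM_coin_measurable) auto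
  have bd: "\<bar>?h x\<bar> \<le> Max ((\<lambda>S. \<bar>h S\<bar>) ` Pow (insert j J))" for x
    using insert.hyps by (intro Max_ge) auto
  have "(\<integral>x. ?h x \<partial>PiM UNIV M) = (\<integral>x. (\<integral>y. ?h (x(j := y)) \<partial>M j) \<partial>PiM UNIV M)"
    by (rule PiM_resample_integral(1)[OF M meas bd])
  also have "\<dots> = (\<integral>x. (let F = {e \<in> J. Q e (x e)}; m = measure (M j) {y \<in> space (M j). Q j y} in
       m * h (insert j F) + (1 - m) * h F) \<partial>PiM UNIV M)"
  proof (intro Bochner_Integration.integral_cong refl)
    fix x assume "x \<in> space (PiM UNIV M)"
    let ?F = "{e \<in> J. Q e (x e)}" and ?m = "measure (M j) {y \<in> space (M j). Q j y}" and ?B = "{y \<in> space (M j). Q j y}"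
    have Bm: "?B \<in> sets (M j)" using insert.prems by simp
    have "(\<integral>y. ?h (x(j := y)) \<partial>M j) = (\<integral>y. h (insert j ?F) * indicator ?B y + h ?F * (1 - indicator ?B y) \<partial>M j)"
    proof (intro Bochner_Integration.integral_cong refl)
      fix y assume y: "y \<in> space (M j)"
      have "{e \<in> insert j J. Q e ((x(j := y)) e)} = (if y \<in> ?B then insert j ?F else ?F)"
        using insert.hyps y by auto
      then show "?h (x(j := y)) = h (insert j ?F) * indicator ?B y + h ?F * (1 - indicator ?B y)"
        by (cases "y \<in> ?B") auto
    qed
    also have "\<dots> = h (insert j ?F) * ?m + h ?F * (1 - ?m)"
      using Bm Mi.emeasure_eq_measure[of ?B] by (simp add: Mi.prob_space Mi.emeasure_finite less_top)
    finally show "(\<integral>y. ?h (x(j := y)) \<partial>M j) = (let F = ?F; m = ?m in m * h (insert j F) + (1 - m) * h F)"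
      by (simp add: Let_def mult.commute)
  qed
  also have "\<dots> = measure (M j) {y \<in> space (M j). Q j y} * (\<integral>x. h (insert j {e \<in> J. Q e (x e)}) \<partial>PiM UNIV M)
      + (1 - measure (M j) {y \<in> space (M j). Q j y}) * (\<integral>x. h {e \<in> J. Q e (x e)} \<partial>PiM UNIV M)"
  proof -
    have i: "integrable (PiM UNIV M) (\<lambda>x. g {e \<in> J. Q e (x e)})" for g :: "_ \<Rightarrow> real"
    proof (rule P.integrable_const_bound[where B = "Max ((\<lambda>S. \<bar>g S\<bar>) ` Pow J)"])
      show "AE x in PiM UNIV M. norm (g {e \<in> J. Q e (x e)}) \<le> Max ((\<lambda>S. \<bar>g S\<bar>) ` Pow J)"
        using insert.hyps by (auto intro!: Max_ge)
      show "(\<lambda>x. g {e \<in> J. Q e (x e)}) \<in> borel_measurable (PiM UNIV M)"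
        using insert.hyps pr by (intro PiM_coin_measurable) auto
    qed
    show ?thesis using i[of h] i[of "\<lambda>S. h (insert j S)"] by (simp add: Let_def)
  qed
  also have "\<dots> = bexp (insert j J) (\<lambda>e. measure (M e) {y \<in> space (M e). Q e y}) h"
    using insert.IH[of h] insert.IH[of "\<lambda>S. h (insert j S)"] insert.prems bexp_insert[OF insert.hyps] by simp
  finally show ?case .
qed

text \<open>Resampling the coordinates of a cylinder one at a time shows that T is independent of
  every cylinder, hence of itself. Invariance is required at every point of the space, not almost
  everywhere; \<open>nearE\<close> will be introduced for that reason.\<close>

lemma PiM_zero_one:
  fixes M :: "'i \<Rightarrow> 'a measure"
  assumes M: "\<And>i. prob_space (M i)" and T[measurable]: "T \<in> sets (PiM UNIV M)"
    and inv: "\<And>x i y. x \<in> space (PiM UNIV M) \<Longrightarrow> y \<in> space (M i) \<Longrightarrow> x(i := y) \<in> T \<longleftrightarrow> x \<in> T"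
  shows "measure (PiM UNIV M) T = 0 \<or> measure (PiM UNIV M) T = 1"
proof -
  let ?P = "PiM UNIV M"
  interpret P: prob_space ?P using M by (intro prob_space_PiM)
  have Tsp: "T \<subseteq> space ?P" using T by (rule sets.sets_into_space)
  have cyl: "measure ?P {x \<in> T. \<forall>j\<in>J. x j \<in> A j} = measure ?P T * (\<Prod>j\<in>J. measure (M j) (A j))"
    if "finite J" "\<And>j. j \<in> J \<Longrightarrow> A j \<in> sets (M j)" for J A
    using that
  proof (induction J rule: finite_induct)
    case empty
    then show ?case by simp
  next
    case (insert j J)
    interpret Mi: prob_space "M j" by (rule M)
    let ?U = "\<lambda>J. {x \<in> T. \<forall>j\<in>J. x j \<in> A j}"
    have m: "?U J' \<in> sets ?P" if J': "J' \<subseteq> insert j J" for J'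
    proof -
      have fJ: "finite J'" using J' insert.hyps finite_subset by blast
      have "?U J' = T \<inter> {x \<in> space ?P. \<forall>j\<in>J'. x j \<in> A j}" using Tsp by auto
      also have "\<dots> \<in> sets ?P"
      proof (intro sets.Int T sets.sets_Collect_finite_All fJ)
        fix i assume "i \<in> J'"
        then have "(\<lambda>x. x i) -` A i \<inter> space ?P \<in> sets ?P" using insert.prems[of i] J' by (intro measurable_sets[of _ _ "M i"]) auto
        moreover have "(\<lambda>x. x i) -` A i \<inter> space ?P = {x \<in> space ?P. x i \<in> A i}" by auto
        ultimately show "{x \<in> space ?P. x i \<in> A i} \<in> sets ?P" by simp
      qed
      finally show ?thesis .
    qed
    have Aj: "A j \<in> sets (M j)" using insert.prems by simp
    have im: "(indicator (?U (insert j J)) :: _ \<Rightarrow> real) \<in> borel_measurable ?P"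
      using m[of "insert j J"] by (intro borel_measurable_indicator) auto
    have "measure ?P (?U (insert j J)) = (\<integral>x. indicator (?U (insert j J)) x \<partial>?P)"
      using m[of "insert j J"] by simp
    also have "\<dots> = (\<integral>x. (\<integral>y. indicator (?U (insert j J)) (x(j := y)) \<partial>M j) \<partial>?P)"
      by (rule PiM_resample_integral(1)[OF M im, where B = 1]) (simp add: indicator_def)
    also have "\<dots> = (\<integral>x. measure (M j) (A j) * indicator (?U J) x \<partial>?P)"
    proof (intro Bochner_Integration.integral_cong refl)
      fix x assume x: "x \<in> space ?P"
      have "(\<integral>y. (indicator (?U (insert j J)) (x(j := y)) :: real) \<partial>M j) = (\<integral>y. indicator (?U J) x * indicator (A j) y \<partial>M j)"
      proof (intro Bochner_Integration.integral_cong refl)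
        fix y assume y: "y \<in> space (M j)"
        have "(\<forall>i\<in>J. (x(j := y)) i \<in> A i) \<longleftrightarrow> (\<forall>i\<in>J. x i \<in> A i)" using insert.hyps by auto
        then show "indicator (?U (insert j J)) (x(j := y)) = (indicator (?U J) x * indicator (A j) y :: real)"
          using inv[OF x y] by (auto simp: indicator_def)
      qed
      also have "\<dots> = measure (M j) (A j) * indicator (?U J) x"
        using Aj by (simp add: mult.commute)
      finally show "(\<integral>y. indicator (?U (insert j J)) (x(j := y)) \<partial>M j) = measure (M j) (A j) * indicator (?U J) x" .
    qed
    also have "\<dots> = measure (M j) (A j) * measure ?P (?U J)" using sets.sets_into_space[OF m[of J]] by (simp add: subset_insertI Int_absorb2)
    also have "\<dots> = measure ?P T * (\<Prod>j\<in>insert j J. measure (M j) (A j))"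
      using insert by simp
    finally show ?case .
  qed
  \<comment> \<open>Independence of cylinders says that restriction to T and multiplication by the
    mass of T agree on a generator. Evaluating both at T gives P(T) = P(T)^2.\<close>
  define Q where "Q = density ?P (indicator T)"
  define Q' where "Q' = scale_measure (emeasure ?P T) ?P"
  have "Q = Q'"
  proof (rule measure_eqI_PiM_infinite)
    show "sets Q = sets ?P" "sets Q' = sets ?P" by (simp_all add: Q_def Q'_def)
    show "finite_measure Q" 
      by (rule finite_measureI) (simp add: Q_def emeasure_density nn_integral_indicator cong: nn_integral_cong)
    fix A J assume J: "finite J" "J \<subseteq> UNIV" and A: "\<And>i. i \<in> J \<Longrightarrow> A i \<in> sets (M i)"
    let ?X = "prod_emb UNIV M J (Pi\<^sub>E J A)"
    have X: "?X \<in> sets ?P" using J A by (intro sets_PiM_I) auto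
    have TX: "T \<inter> ?X = {x \<in> T. \<forall>j\<in>J. x j \<in> A j}" using Tsp by (auto simp: prod_emb_def space_PiM PiE_iff restrict_def)
    have "emeasure Q ?X = emeasure ?P (T \<inter> ?X)"
      using X unfolding Q_def by (subst emeasure_density) (simp_all add: indicator_inter_arith[symmetric] nn_integral_indicator)
    also have "\<dots> = ennreal (measure ?P T * (\<Prod>j\<in>J. measure (M j) (A j)))"
      unfolding TX P.emeasure_eq_measure using cyl[OF J(1) A] by simp
    also have "(\<Prod>j\<in>J. measure (M j) (A j)) = measure ?P ?X"
    proof -
      have "emeasure ?P ?X = (\<Prod>i\<in>J. emeasure (M i) (A i))"
        using M J A by (intro emeasure_PiM_emb) auto
      also have "\<dots> = ennreal (\<Prod>i\<in>J. measure (M i) (A i))"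
        using finite_measure.emeasure_eq_measure[OF prob_space.finite_measure[OF M]] by (simp add: prod_ennreal)
      finally show ?thesis by (simp add: P.emeasure_eq_measure prod_nonneg)
    qed
    also have "ennreal (measure ?P T * measure ?P ?X) = emeasure Q' ?X"
      by (simp add: Q'_def emeasure_scale_measure P.emeasure_eq_measure ennreal_mult)
    finally show "emeasure Q ?X = emeasure Q' ?X" .
  qed
  then have "emeasure Q T = emeasure Q' T" by simp
  moreover have "emeasure Q T = emeasure ?P T"
    unfolding Q_def by (subst emeasure_density) (simp_all add: indicator_inter_arith[symmetric] nn_integral_indicator)
  moreover have "emeasure Q' T = emeasure ?P T * emeasure ?P T"
    by (simp add: Q'_def emeasure_scale_measure)
  ultimately have "ennreal (measure ?P T) = ennreal (measure ?P T * measure ?P T)"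
    by (simp add: P.emeasure_eq_measure ennreal_mult)
  then have "measure ?P T = measure ?P T * measure ?P T" by simp
  then show ?thesis by (metis mult_cancel_left2 mult_eq_0_iff)
qed

section \<open>Unit squares and uniform positions\<close>

definition zd :: "int \<times> int \<Rightarrow> int \<times> int \<Rightarrow> int" where
  "zd z z' = max \<bar>fst z - fst z'\<bar> \<bar>snd z - snd z'\<bar>"

definition zbox :: "int \<times> int \<Rightarrow> nat \<Rightarrow> (int \<times> int) set" where
  "zbox z n = {z'. zd z z' \<le> int n}"

lemma zd_commute: "zd z z' = zd z' z"
  by (auto simp: zd_def)

lemma zd_triangle: "zd x z \<le> zd x y + zd y z"
  by (auto simp: zd_def)

lemma zd_same [simp]: "zd z z = 0"
  by (simp add: zd_def)

lemma zbox_eq: "zbox z n = {fst z - int n..fst z + int n} \<times> {snd z - int n..snd z + int n}"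
  by (auto simp: zbox_def zd_def)

lemma finite_zbox [simp]: "finite (zbox z n)"
  by (simp add: zbox_eq)

lemma card_zbox: "card (zbox z n) = (2 * n + 1)\<^sup>2"
  by (simp add: zbox_eq card_cartesian_product power2_eq_square nat_add_distrib nat_mult_distrib)

lemma mem_cube: "x \<in> cube z \<longleftrightarrow> real_of_int (fst z) \<le> fst x \<and> fst x < real_of_int (fst z) + 1
     \<and> real_of_int (snd z) \<le> snd x \<and> snd x < real_of_int (snd z) + 1"
  by (cases x) (auto simp: cube_def)

lemma abs_fst_le_dist: "\<bar>fst x - fst y\<bar> \<le> dist x (y::real\<times>real)"
  using dist_fst_le[of x y] by (simp add: dist_real_def)

lemma abs_snd_le_dist: "\<bar>snd x - snd y\<bar> \<le> dist x (y::real\<times>real)"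
  using dist_snd_le[of x y] by (simp add: dist_real_def)

lemma dist_pair_le: "dist x (y::real\<times>real) \<le> \<bar>fst x - fst y\<bar> + \<bar>snd x - snd y\<bar>"
  unfolding dist_prod_def dist_real_def
  using sqrt_sum_squares_le_sum_abs[of "fst x - fst y" "snd x - snd y"] by simp

text \<open>Points at distance at most R lie in squares whose corners differ by less than R + 1 in
  each coordinate; \<open>rng R\<close> bounds that integer difference.\<close>

definition rng :: "real \<Rightarrow> nat" where "rng R = nat \<lceil>R\<rceil> + 1"

lemma zd_le_rng:
  assumes "x \<in> cube z" "y \<in> cube z'" "dist x y \<le> R"
  shows "zd z z' \<le> int (rng R)"
proof -
  have R0: "0 \<le> R" using assms(3) zero_le_dist[of x y] by linarith
  have 1: "\<bar>real_of_int (fst z) - real_of_int (fst z')\<bar> < R + 1"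
    using abs_fst_le_dist[of x y] assms unfolding mem_cube by linarith
  have 2: "\<bar>real_of_int (snd z) - real_of_int (snd z')\<bar> < R + 1"
    using abs_snd_le_dist[of x y] assms unfolding mem_cube by linarith
  have c: "R \<le> real_of_int \<lceil>R\<rceil>" by simp
  have "real_of_int \<bar>fst z - fst z'\<bar> < real_of_int (\<lceil>R\<rceil> + 1)"
       "real_of_int \<bar>snd z - snd z'\<bar> < real_of_int (\<lceil>R\<rceil> + 1)"
    using 1 2 c by linarith+
  then show ?thesis using R0 unfolding zd_def rng_def of_int_less_iff by auto
qed

lemma emeasure_lborel_rect:
  assumes "0 \<le> a" "0 \<le> b"
  shows "emeasure lborel ({u..<u + a} \<times> {v..<v + b} :: (real\<times>real) set) = ennreal (a * b)"
proof -
  have "emeasure lborel ({u..<u + a} \<times> {v..<v + b} :: (real\<times>real) set)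
     = emeasure (lborel \<Otimes>\<^sub>M lborel) ({u..<u + a} \<times> {v..<v + b})"
    by (simp add: lborel_prod)
  also have "\<dots> = emeasure lborel {u..<u + a} * emeasure lborel {v..<v + b}"
    by (intro lborel.emeasure_pair_measure_Times) auto
  finally show ?thesis using assms by (simp add: ennreal_mult)
qed

lemma emeasure_cube: "emeasure lborel (cube z) = 1"
  using emeasure_lborel_rect[of 1 1] by (simp add: cube_def)

lemma sets_cube [measurable]: "cube z \<in> sets borel"
  unfolding cube_def by (intro borel_Times) auto

lemma prob_space_unif: "prob_space (uniform_measure lborel (cube z))"
  by (intro prob_space_uniform_measure) (simp_all add: emeasure_cube)

definition PX :: "(lbl \<Rightarrow> real \<times> real) measure" where
  "PX = PiM UNIV (\<lambda>v::lbl. uniform_measure lborel (cube (fst v)))"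

lemma prob_space_PX: "prob_space PX"
  unfolding PX_def by (intro prob_space_PiM prob_space_unif)

lemma PX_component [measurable]: "(\<lambda>X. X v) \<in> borel_measurable PX"
proof -
  have "(\<lambda>X. X v) \<in> PX \<rightarrow>\<^sub>M uniform_measure lborel (cube (fst v))"
    unfolding PX_def by (rule measurable_component_singleton) simp
  then show ?thesis by (simp cong: measurable_cong_sets)
qed

lemma AE_PX_cube: "AE X in PX. \<forall>v. X v \<in> cube (fst v)"
proof -
  have "AE X in PX. X v \<in> cube (fst v)" for v
    unfolding PX_def
    by (intro AE_PiM_component prob_space_unif AE_uniform_measureI) auto
  then show ?thesis unfolding AE_all_countable by blast
qed

text \<open>Edges are unordered, so their length has to be a function of a set; for a pair the
  maximum is the distance of its two points.\<close>

definition pdist :: "('a \<Rightarrow> real \<times> real) \<Rightarrow> 'a set \<Rightarrow> real" where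
  "pdist X e = Max ((\<lambda>(a, b). dist (X a) (X b)) ` (e \<times> e))"

lemma pdist_pair: "pdist X {a, b} = dist (X a) (X b)"
proof -
  have "(\<lambda>(a, b). dist (X a) (X b)) ` ({a, b} \<times> {a, b}) = {0, dist (X a) (X b)}"
    by (auto simp: dist_commute image_iff)
  then show ?thesis by (simp add: pdist_def)
qed

lemma pdist_nonneg: "finite e \<Longrightarrow> e \<noteq> {} \<Longrightarrow> 0 \<le> pdist X e"
proof -
  assume e: "finite e" "e \<noteq> {}"
  then obtain a where "a \<in> e" by auto
  then have "dist (X a) (X a) \<in> (\<lambda>(a, b). dist (X a) (X b)) ` (e \<times> e)" by (auto intro!: image_eqI[of _ _ "(a, a)"])
  then show ?thesis unfolding pdist_def using e by (metis Max_ge dist_self finite_SigmaI finite_imageI)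
qed

definition rt :: "real \<Rightarrow> real \<Rightarrow> (real \<Rightarrow> real) \<Rightarrow> ('a \<Rightarrow> real \<times> real) \<Rightarrow> 'a + 'a set \<Rightarrow> real" where
  "rt s \<gamma> g X i = (case i of Inl v \<Rightarrow> s | Inr e \<Rightarrow> if card e = 1 then \<gamma> else g (pdist X e))"

text \<open>R is the range. The value at R itself is left open, as it may be positive or
  zero.\<close>

locale conn_fun =
  fixes f :: "real \<Rightarrow> real" and R :: real
  assumes f01: "\<And>r. 0 \<le> r \<Longrightarrow> 0 \<le> f r \<and> f r \<le> 1"
    and f_anti: "\<And>r t. 0 \<le> r \<Longrightarrow> r \<le> t \<Longrightarrow> f t \<le> f r"
    and R_pos: "0 < R"
    and f_pos: "\<And>r. 0 \<le> r \<Longrightarrow> r < R \<Longrightarrow> 0 < f r"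
    and f_zero: "\<And>r. R < r \<Longrightarrow> f r = 0"
begin

text \<open>Monotonicity is known for nonnegative arguments only; composition with max 0 gives a
  function that is monotone on the whole line, hence Borel.\<close>

lemma f_max_measurable: "(\<lambda>r. f (max 0 r)) \<in> borel_measurable borel"
proof -
  have "mono (\<lambda>r. - f (max 0 r))"
    by (rule monoI) (use f_anti in auto)
  then have "(\<lambda>r. - f (max 0 r)) \<in> borel_measurable borel" by (rule borel_measurable_mono)
  then have "(\<lambda>r. - (- f (max 0 r))) \<in> borel_measurable borel" by measurable
  then show ?thesis by simp
qed

lemma f_dist_measurable [measurable]:
  assumes [measurable]: "a \<in> borel_measurable N" "b \<in> borel_measurable N"
  shows "(\<lambda>x. f (dist (a x) (b x :: real \<times> real))) \<in> borel_measurable N"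
proof -
  have "(\<lambda>x. f (max 0 (dist (a x) (b x)))) \<in> borel_measurable N"
    using f_max_measurable by measurable
  then show ?thesis by simp
qed

lemma f_pdist_measurable:
  assumes "card e = 2" shows "(\<lambda>X. f (pdist X e)) \<in> borel_measurable PX"
proof -
  obtain a b where "e = {a, b}" using assms unfolding card_2_iff by blast
  then show ?thesis unfolding pdist_pair[abs_def] \<open>e = {a, b}\<close> pdist_pair by measurable
qed

lemma rt_01:
  assumes "0 \<le> s" "s \<le> 1" "0 \<le> \<gamma>" "\<gamma> \<le> 1" "0 \<le> p" "p \<le> 1" "i \<in> cidx W"
  shows "0 \<le> rt s \<gamma> (\<lambda>r. p * f r) X i \<and> rt s \<gamma> (\<lambda>r. p * f r) X i \<le> 1"
proof (cases i)
  case (Inl v)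
  then show ?thesis using assms by (simp add: rt_def)
next
  case (Inr e)
  then have e: "card e = 1 \<or> card e = 2" using assms(7) by (auto simp: cidx_def)
  then have "finite e" "e \<noteq> {}" by (auto intro: card_ge_0_finite)
  then have "0 \<le> f (pdist X e)" "f (pdist X e) \<le> 1" using f01[OF pdist_nonneg] by auto
  then show ?thesis using Inr assms by (auto simp: rt_def mult_le_one)
qed

lemma rt_measurable:
  assumes "i \<in> cidx W"
  shows "(\<lambda>X. rt s \<gamma> (\<lambda>r. p * f r) X i) \<in> borel_measurable PX"
proof (cases i)
  case (Inl v)
  then show ?thesis by (simp add: rt_def)
next
  case (Inr e)
  then have e: "card e = 1 \<or> card e = 2" using assms by (auto simp: cidx_def)
  then show ?thesis using Inr f_pdist_measurable[of e] by (auto simp: rt_def)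
qed

text \<open>The midpoint is within R / 2 of both points, and a square of side \<delta> \<le> R / 8
  at the midpoint stays within 3 * R / 4 of them. By convexity the midpoint lies in the box, and
  \<delta> \<le> 1 / 2 lets the small square fit into the unit square that contains the
  midpoint.\<close>

lemma midpoint_ball:
  assumes x: "x \<in> cube z" "z \<in> zbox z0 N" and y: "y \<in> cube z'" "z' \<in> zbox z0 N" and d: "dist x y \<le> R"
  shows "\<exists>zm\<in>zbox z0 N. zd zm z \<le> int (rng R) \<and>
    (min (R / 8) (1 / 2))\<^sup>2 \<le> measure (uniform_measure lborel (cube zm)) {w. dist w x \<le> 3 * R / 4 \<and> dist w y \<le> 3 * R / 4}"
proof -
  define mid where "mid = ((fst x + fst y) / 2, (snd x + snd y) / 2)"
  define zm where "zm = (\<lfloor>fst mid\<rfloor>, \<lfloor>snd mid\<rfloor>)"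
  define \<delta> where "\<delta> = min (R / 8) (1 / 2)"
  have \<delta>: "0 < \<delta>" "\<delta> \<le> R / 8" "\<delta> \<le> 1 / 2" using R_pos by (auto simp: \<delta>_def)
  have mc: "mid \<in> cube zm" unfolding mem_cube zm_def by (auto simp: floor_correct)
  have dmx: "dist mid x = dist x y / 2" "dist mid y = dist x y / 2"
  proof -
    have m: "mid = (1/2) *\<^sub>R (x + y)" by (simp add: mid_def prod_eq_iff)
    have "mid - x = (1/2) *\<^sub>R (y - x)" "mid - y = (1/2) *\<^sub>R (x - y)" unfolding m
      by (simp_all add: prod_eq_iff field_simps)
    then show "dist mid x = dist x y / 2" "dist mid y = dist x y / 2"
      by (simp_all add: dist_norm norm_minus_commute)
  qed
  have zmbox: "zm \<in> zbox z0 N"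
  proof -
    have b: "fst z0 - int N \<le> fst z" "fst z \<le> fst z0 + int N" "fst z0 - int N \<le> fst z'" "fst z' \<le> fst z0 + int N"
      "snd z0 - int N \<le> snd z" "snd z \<le> snd z0 + int N" "snd z0 - int N \<le> snd z'" "snd z' \<le> snd z0 + int N"
      using x(2) y(2) by (auto simp: zbox_eq mem_Times_iff)
    have b': "real_of_int (fst z0 - int N) \<le> fst mid" "fst mid < real_of_int (fst z0 + int N + 1)"
      "real_of_int (snd z0 - int N) \<le> snd mid" "snd mid < real_of_int (snd z0 + int N + 1)"
      using b[THEN of_int_le_iff[where 'a = real, THEN iffD2]] x(1) y(1) unfolding mem_cube mid_def by auto
    then have "fst z0 - int N \<le> \<lfloor>fst mid\<rfloor>" "\<lfloor>fst mid\<rfloor> < fst z0 + int N + 1"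
      "snd z0 - int N \<le> \<lfloor>snd mid\<rfloor>" "\<lfloor>snd mid\<rfloor> < snd z0 + int N + 1"
      by (simp_all only: le_floor_iff floor_less_iff)
    then show ?thesis by (auto simp: zbox_eq zm_def mem_Times_iff)
  qed
  have near: "zd zm z \<le> int (rng R)"
    using zd_le_rng[OF mc x(1), of R] dmx d R_pos zero_le_dist[of x y] by linarith
  \<comment> \<open>The small interval is placed on that side of u which points into the unit
    interval of u.\<close>
  define lo where "lo u = (if u - \<lfloor>u\<rfloor> \<le> 1 / 2 then u else u - \<delta>)" for u :: real
  have lo: "\<lfloor>u\<rfloor> \<le> lo u" "lo u + \<delta> \<le> \<lfloor>u\<rfloor> + 1" "\<And>t. lo u \<le> t \<Longrightarrow> t < lo u + \<delta> \<Longrightarrow> \<bar>t - u\<bar> \<le> \<delta>" for u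
    using \<delta> floor_correct[of u] unfolding lo_def by (auto split: if_splits)
  define Q where "Q = {lo (fst mid)..<lo (fst mid) + \<delta>} \<times> {lo (snd mid)..<lo (snd mid) + \<delta>}"
  have Qc: "Q \<subseteq> cube zm"
    using lo(1,2)[of "fst mid"] lo(1,2)[of "snd mid"] by (auto simp: Q_def zm_def cube_def)
  have Qb: "Q \<subseteq> {w. dist w x \<le> 3 * R / 4 \<and> dist w y \<le> 3 * R / 4}"
  proof
    fix w assume w: "w \<in> Q"
    then have "\<bar>fst w - fst mid\<bar> \<le> \<delta>" "\<bar>snd w - snd mid\<bar> \<le> \<delta>"
      using lo(3)[of "fst mid" "fst w"] lo(3)[of "snd mid" "snd w"] by (auto simp: Q_def)
    then have "dist w mid \<le> R / 4" using dist_pair_le[of w mid] \<delta> by linarith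
    then show "w \<in> {w. dist w x \<le> 3 * R / 4 \<and> dist w y \<le> 3 * R / 4}"
      using dist_triangle[of w x mid] dist_triangle[of w y mid] dmx d by auto
  qed
  interpret U: prob_space "uniform_measure lborel (cube zm)" by (rule prob_space_unif)
  have Qs: "Q \<in> sets borel" unfolding Q_def by (intro borel_Times) auto
  have "emeasure (uniform_measure lborel (cube zm)) Q = emeasure lborel (cube zm \<inter> Q) / emeasure lborel (cube zm)"
    using Qs by (intro emeasure_uniform_measure) auto
  also have "\<dots> = ennreal (\<delta> * \<delta>)"
  proof -
    have "emeasure lborel (cube zm \<inter> Q) = ennreal (\<delta> * \<delta>)"
      using Qc \<delta> emeasure_lborel_rect[of \<delta> \<delta>] by (simp add: Int_absorb1 Q_def)
    then show ?thesis using \<delta> divide_ennreal[of "\<delta> * \<delta>" 1] by (simp add: emeasure_cube)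
  qed
  finally have "measure (uniform_measure lborel (cube zm)) Q = \<delta>\<^sup>2"
    using \<delta> by (simp add: measure_def power2_eq_square)
  moreover have "measure (uniform_measure lborel (cube zm)) Q \<le>
      measure (uniform_measure lborel (cube zm)) {w. dist w x \<le> 3 * R / 4 \<and> dist w y \<le> 3 * R / 4}"
    using Qb by (intro U.finite_measure_mono) auto
  ultimately show ?thesis using zmbox near unfolding \<delta>_def by auto
qed

end

lemma bexp_measurable:
  assumes "finite I" "\<And>i. i \<in> I \<Longrightarrow> (\<lambda>X. r X i) \<in> borel_measurable N"
  shows "(\<lambda>X. bexp I (r X) h) \<in> borel_measurable N"
  unfolding bexp_def using assms
  by (intro borel_measurable_sum borel_measurable_times borel_measurable_prod borel_measurable_diff) (auto dest: subsetD)

lemma bexp_abs_le: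
  assumes "finite I" "\<And>i. i \<in> I \<Longrightarrow> 0 \<le> r i \<and> r i \<le> 1" "\<And>S. S \<subseteq> I \<Longrightarrow> \<bar>h S\<bar> \<le> B"
  shows "\<bar>bexp I r h\<bar> \<le> B"
proof -
  have "bexp I r h \<le> bexp I r (\<lambda>_. B)"
    using assms(3) by (intro bexp_mono assms(1,2)) (auto simp: abs_le_iff)
  moreover have "bexp I r (\<lambda>_. - B) \<le> bexp I r h"
  proof (intro bexp_mono assms(1,2))
    show "- B \<le> h S" if "S \<subseteq> I" for S using assms(3)[OF that] by linarith
  qed
  ultimately have "bexp I r h \<le> bexp I r (\<lambda>_. B)" "bexp I r (\<lambda>_. - B) \<le> bexp I r h" by auto
  then show ?thesis using assms(1) by (simp add: bexp_const)
qed

text \<open>Twice the range, because a detour vertex for e is within one range of its ends and its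
  own edges reach one range further.\<close>

definition Lb :: "real \<Rightarrow> lbl set \<Rightarrow> lbl set \<Rightarrow> lbl set" where
  "Lb R W e = {w \<in> W. \<exists>x\<in>e. zd (fst w) (fst x) \<le> 2 * int (rng R)}"

definition lbls :: "(int \<times> int) set \<Rightarrow> nat \<Rightarrow> lbl set" where
  "lbls Z M = Z \<times> {..<M}"

lemma finite_lbls [simp]: "finite Z \<Longrightarrow> finite (lbls Z M)"
  by (simp add: lbls_def)

text \<open>With cells of side at most R / 4, two points of a cell are at distance at most R / 2, so
  their edge has probability bounded below.\<close>

definition subs :: "real \<Rightarrow> nat" where "subs R = nat \<lceil>4 / R\<rceil> + 1"

definition cell :: "real \<Rightarrow> (lbl \<Rightarrow> real \<times> real) \<Rightarrow> lbl \<Rightarrow> (int \<times> int) \<times> (int \<times> int)" where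
  "cell R X v = (fst v, (\<lfloor>real (subs R) * (fst (X v) - fst (fst v))\<rfloor>, \<lfloor>real (subs R) * (snd (X v) - snd (fst v))\<rfloor>))"

definition subset_idx :: "real \<Rightarrow> (int \<times> int) set" where
  "subset_idx R = {0..<int (subs R)} \<times> {0..<int (subs R)}"

text \<open>The number of cells in the squares within three ranges of a given one: two ranges for
  the surroundings of an edge and one for the edge itself.\<close>

definition crowdK :: "real \<Rightarrow> nat" where
  "crowdK R = (6 * rng R + 1)\<^sup>2 * (subs R)\<^sup>2"

lemma subs_pos: "0 < subs R" by (simp add: subs_def)

lemma floor_mult_mem:
  assumes "0 \<le> u" "u < 1" "0 < m" shows "\<lfloor>real m * u\<rfloor> \<in> {0..<int m}"
proof -
  have "real m * u < real m * 1" using assms by (intro mult_strict_left_mono) auto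
  then show ?thesis using assms by (simp add: floor_less_iff)
qed

lemma cell_sub: "X v \<in> cube (fst v) \<Longrightarrow> snd (cell R X v) \<in> subset_idx R"
  unfolding cell_def subset_idx_def mem_cube
  using floor_mult_mem[OF _ _ subs_pos[of R], of "fst (X v) - fst (fst v)"]
    floor_mult_mem[OF _ _ subs_pos[of R], of "snd (X v) - snd (fst v)"] by auto

lemma floor_eq_close:
  assumes "\<lfloor>m * u\<rfloor> = \<lfloor>m * v\<rfloor>" "0 < (m::real)" shows "\<bar>u - v\<bar> \<le> 1 / m"
proof -
  have "\<bar>m * u - m * v\<bar> \<le> 1" using floor_correct[of "m * u"] floor_correct[of "m * v"] assms by linarith
  also have "m * u - m * v = m * (u - v)" by (simp add: algebra_simps)
  finally have "m * \<bar>u - v\<bar> \<le> 1" using assms(2) by (simp add: abs_mult)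
  then show ?thesis using assms(2) by (simp add: field_simps)
qed

lemma same_cell_dist:
  assumes "cell R X v = cell R X w" "0 < R"
  shows "dist (X v) (X w) \<le> 3 * R / 4"
proof -
  let ?m = "real (subs R)"
  have m0: "0 < ?m" using subs_pos[of R] by simp
  have "fst v = fst w" using assms by (simp add: cell_def)
  then have e: "\<lfloor>?m * (fst (X v) - fst (fst v))\<rfloor> = \<lfloor>?m * (fst (X w) - fst (fst v))\<rfloor>"
    "\<lfloor>?m * (snd (X v) - snd (fst v))\<rfloor> = \<lfloor>?m * (snd (X w) - snd (fst v))\<rfloor>"
    using assms by (simp_all add: cell_def)
  have "\<bar>fst (X v) - fst (X w)\<bar> \<le> 1 / ?m" "\<bar>snd (X v) - snd (X w)\<bar> \<le> 1 / ?m"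
    using floor_eq_close[OF e(1) m0] floor_eq_close[OF e(2) m0] by auto
  then have "dist (X v) (X w) \<le> 2 / ?m" using dist_pair_le[of "X v" "X w"] by linarith
  also have "\<dots> \<le> 3 * R / 4"
  proof -
    have "4 / R \<le> ?m" unfolding subs_def by (simp add: real_nat_ceiling_ge le_add_same_cancel1 add.commute add_increasing)
    then have "4 \<le> ?m * R" using assms(2) by (simp add: field_simps)
    then show ?thesis using m0 by (simp add: field_simps)
  qed
  finally show ?thesis .
qed

section \<open>The two estimates with random positions\<close>

context conn_fun
begin

text \<open>Marks have probability 1/2, so that neither a mark nor its absence is expensive.\<close>

abbreviation rX where "rX M lam p \<equiv> rt (lam / real M) (1/2) (\<lambda>r. p * f r)"

lemma rX_config_model:
  fixes lam :: real
  assumes "0 < M" "0 \<le> lam" "2 * lam \<le> M" "0 \<le> p" "p \<le> 1"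
  shows "config_model (lbls (zbox z0 N) M) (rX M lam p X) (lam / real M)"
proof
  show "finite (lbls (zbox z0 N) M)" by simp
  show "0 \<le> lam / real M" "lam / real M \<le> 1 / 2" using assms by (auto simp: field_simps)
  then show "0 \<le> rX M lam p X i \<and> rX M lam p X i \<le> 1" if "i \<in> cidx (lbls (zbox z0 N) M)" for i
    using assms that by (intro rt_01) auto
qed (simp add: rt_def)

lemma crowd_X:
  fixes z0 :: "int \<times> int" and N :: nat and lam :: real
  assumes cub: "\<And>v. X v \<in> cube (fst v)" and M: "0 < M" "0 \<le> lam" "2 * lam \<le> M"
    and p: "0 < pmin" "pmin \<le> p" "p \<le> 1" and T: "0 < T" "8 * lam * real ((4 * rng R + 1)\<^sup>2) \<le> T"
  defines "W \<equiv> lbls (zbox z0 N) M"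
  shows "bexp (cidx W) (rX M lam p X) (\<lambda>S. real (card (pivE A B S))) / 2 \<le>
     (1 + real (crowdK R)) / (pmin * f (3 * R / 4)) * bexp (cidx W) (rX M lam p X) (\<lambda>S. real (card (sgE A B S)))
   + bexp (cidx W) (rX M lam p X) (\<lambda>S. real (card {e \<in> pivE A B S. card {w \<in> Lb R W e. Inl w \<in> S} < 4 * crowdK R + T}))"
proof -
  let ?D = "int (rng R)"
  have csub: "snd (cell R X v) \<in> subset_idx R" for v using cell_sub[of X v R] cub[of v] by blast
  define nb where "nb e = {c. (\<exists>x\<in>e. zd (fst c) (fst x) \<le> 2 * ?D) \<and> snd c \<in> subset_idx R}" for e :: "lbl set"
  \<comment> \<open>Empty at indices that are not cells, because symmetry and the bound on the size
    are required at every argument.\<close>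
  define NN where "NN c = (if snd c \<in> subset_idx R then {c'. zd (fst c) (fst c') \<le> 3 * ?D \<and> snd c' \<in> subset_idx R} else {})"
    for c :: "(int \<times> int) \<times> (int \<times> int)"
  have NNsub: "NN c \<subseteq> zbox (fst c) (3 * rng R) \<times> subset_idx R" for c
    by (auto simp: NN_def zbox_def)
  have finT: "finite (zbox (fst c) (3 * rng R) \<times> subset_idx R)" for c :: "(int \<times> int) \<times> (int \<times> int)"
    by (simp add: subset_idx_def)
  have c0: "0 < f (3 * R / 4)" using R_pos by (intro f_pos) auto
  interpret config_model W A B "rX M lam p X" "lam / real M"
    unfolding W_def using M p by (intro rX_config_model) auto
  interpret cell_model W A B "rX M lam p X" "lam / real M" "cell R X" nb NN "crowdK R" "pmin * f (3 * R / 4)"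
  proof
    show "0 < pmin * f (3 * R / 4)" using p c0 by simp
    show "pmin * f (3 * R / 4) \<le> rX M lam p X (Inr e)"
      if e: "e \<in> pairs W" "\<And>x y. x \<in> e \<Longrightarrow> y \<in> e \<Longrightarrow> cell R X x = cell R X y" for e
    proof -
      obtain a b where ab: "e = {a, b}" "a \<noteq> b" using e(1) unfolding pairs_def card_2_iff by blast
      have "dist (X a) (X b) \<le> 3 * R / 4" using same_cell_dist[OF _ R_pos] e(2)[of a b] ab(1) by blast
      then have "f (3 * R / 4) \<le> f (dist (X a) (X b))" by (intro f_anti) auto
      then have "pmin * f (3 * R / 4) \<le> p * f (dist (X a) (X b))" using p c0 by (intro mult_mono) auto
      then show ?thesis using ab by (simp add: rt_def pdist_pair)
    qed
    show "nb e \<subseteq> NN (cell R X u)" if e: "e \<in> pairs W" "0 < rX M lam p X (Inr e)" "u \<in> e" for e u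
    proof
      fix c assume c: "c \<in> nb e"
      obtain a b where ab: "e = {a, b}" "a \<noteq> b" using e(1) unfolding pairs_def card_2_iff by blast
      have "0 < p * f (dist (X a) (X b))" using e(2) ab by (simp add: rt_def pdist_pair)
      then have "dist (X a) (X b) \<le> R" using f_zero[of "dist (X a) (X b)"] by fastforce
      then have "zd (fst a) (fst b) \<le> ?D" using zd_le_rng[OF cub cub] by blast
      then have abD: "zd (fst x) (fst y) \<le> ?D" if "x \<in> e" "y \<in> e" for x y
        using that ab zd_commute[of "fst a" "fst b"] by auto
      obtain x where x: "x \<in> e" "zd (fst c) (fst x) \<le> 2 * ?D" using c by (auto simp: nb_def)
      have "zd (fst u) (fst c) \<le> 3 * ?D"
        using zd_triangle[of "fst u" "fst c" "fst x"] abD[OF e(3) x(1)] x(2) zd_commute[of "fst x" "fst c"] by linarith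
      then show "c \<in> NN (cell R X u)" using c csub[of u] by (auto simp: NN_def nb_def cell_def)
    qed
    show "c' \<in> NN c" if "c \<in> NN c'" for c c'
      using that by (auto simp: NN_def zd_commute split: if_splits)
    show "finite (NN c)" for c using finT NNsub by (rule finite_subset[rotated])
    show "card (NN c) \<le> crowdK R" for c
    proof -
      have "card (NN c) \<le> card (zbox (fst c) (3 * rng R) \<times> subset_idx R)" using finT NNsub by (rule card_mono)
      also have "\<dots> = crowdK R"
        by (simp add: card_cartesian_product card_zbox subset_idx_def crowdK_def power2_eq_square)
      finally show ?thesis .
    qed
  qed
  have Leq: "L e = Lb R W e" for e
    unfolding L_def Lb_def nb_def using csub by (auto simp: cell_def)
  \<comment> \<open>Each of the two ends accounts for a box of squares with M labels each; M cancels
    against the vertex probability lam / M.\<close>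
  have "4 * (lam / real M) * real (card (L e)) \<le> T" if e: "e \<in> pairs W" for e
  proof -
    obtain a b where ab: "e = {a, b}" "a \<noteq> b" using e(1) unfolding pairs_def card_2_iff by blast
    have "L e \<subseteq> (\<Union>x\<in>e. zbox (fst x) (2 * rng R) \<times> {..<M})"
      unfolding Leq by (auto simp: Lb_def W_def lbls_def zbox_def zd_commute)
    moreover have "finite (\<Union>x\<in>e. zbox (fst x) (2 * rng R) \<times> {..<M})" using ab by auto
    ultimately have "card (L e) \<le> card (\<Union>x\<in>e. zbox (fst x) (2 * rng R) \<times> {..<M})" by (rule card_mono[rotated])
    also have "\<dots> \<le> (\<Sum>x\<in>e. card (zbox (fst x) (2 * rng R) \<times> {..<M}))" using ab by (intro card_UN_le) auto
    also have "\<dots> = 2 * ((4 * rng R + 1)\<^sup>2 * M)" using ab by (simp add: card_cartesian_product card_zbox)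
    finally have "real (card (L e)) \<le> 2 * (real ((4 * rng R + 1)\<^sup>2) * real M)"
      by (metis of_nat_le_iff of_nat_mult of_nat_numeral)
    then have "4 * (lam / real M) * real (card (L e)) \<le> 4 * (lam / real M) * (2 * (real ((4 * rng R + 1)\<^sup>2) * real M))"
      using M by (intro mult_left_mono) auto
    also have "\<dots> = 8 * lam * real ((4 * rng R + 1)\<^sup>2)" using M by simp
    finally show ?thesis using T by linarith
  qed
  from crowd_estimate[OF T(1) this] show ?thesis unfolding cnt_def Leq by simp
qed

lemma rX_bexp_integrable:
  fixes lam :: real
  assumes "0 < M" "0 \<le> lam" "2 * lam \<le> M" "0 \<le> p" "p \<le> 1" and I: "I \<subseteq> cidx (lbls (zbox z0 N) M)"
  shows "integrable PX (\<lambda>X. bexp I (rX M lam p X) h)"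
proof -
  interpret P: prob_space PX by (rule prob_space_PX)
  have fin: "finite I" using I finite_cidx finite_subset finite_lbls finite_zbox by metis
  show ?thesis
  proof (rule P.integrable_const_bound[where B = "Max ((\<lambda>S. \<bar>h S\<bar>) ` Pow I)"])
    show "(\<lambda>X. bexp I (rX M lam p X) h) \<in> borel_measurable PX"
      using I by (intro bexp_measurable fin rt_measurable[of _ "lbls (zbox z0 N) M"]) auto
    have "\<bar>bexp I (rX M lam p X) h\<bar> \<le> Max ((\<lambda>S. \<bar>h S\<bar>) ` Pow I)" for X
    proof (rule bexp_abs_le[OF fin])
      interpret config_model "lbls (zbox z0 N) M" "A" "B" "rX M lam p X" "lam / real M" for A B
        using assms by (intro rX_config_model)
      show "0 \<le> rX M lam p X i \<and> rX M lam p X i \<le> 1" if "i \<in> I" for i using that I r01 by blast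
      show "\<bar>h S\<bar> \<le> Max ((\<lambda>S. \<bar>h S\<bar>) ` Pow I)" if "S \<subseteq> I" for S using that fin by (intro Max_ge) auto
    qed
    then show "AE X in PX. norm (bexp I (rX M lam p X) h) \<le> Max ((\<lambda>S. \<bar>h S\<bar>) ` Pow I)" by simp
  qed
qed

text \<open>The position of l is integrated first: for labels of a suitable square it falls near the
  midpoint of e with probability bounded below. At least M - m labels of that square are absent, and
  this number compensates for the price lam / M of a single vertex.\<close>

lemma insertion_X:
  fixes z0 :: "int \<times> int" and N :: nat and lam :: real and A B :: "lbl set"
  assumes M: "0 < M" "0 \<le> lam" "2 * lam \<le> M"
    and p: "0 < pmin" "pmin \<le> p" "p \<le> q" "q < 1" and m: "m \<le> M"
  defines "W \<equiv> lbls (zbox z0 N) M"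
  assumes e: "e \<in> pairs W"
  defines "H \<equiv> \<lambda>S. e \<in> pivE A B S \<and> card {w \<in> Lb R W e. Inl w \<in> S} \<le> m"
  shows "(lam / real M) * ((pmin * f (3 * R / 4))\<^sup>2 * ((1 - 1/2) * (1 - q) ^ m)) * ((min (R / 8) (1 / 2))\<^sup>2 * (real M - real m))
     * (\<integral>X. bexp (cidx W) (rX M lam p X) (\<lambda>S. of_bool (H S)) \<partial>PX)
     \<le> (\<integral>X. bexp (cidx W) (rX M lam p X) (\<lambda>S. of_bool (e \<in> sgE A B S)) \<partial>PX)"
proof -
  interpret P: prob_space PX by (rule prob_space_PX)
  let ?D = "int (rng R)"
  let ?I = "cidx W" and ?r = "rX M lam p"
  obtain a b where ab: "e = {a, b}" "a \<noteq> b" using e(1) unfolding pairs_def card_2_iff by blast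
  have abW: "a \<in> W" "b \<in> W" using e ab by (auto simp: pairs_def)
  have finW: "finite W" by (simp add: W_def)
  define C where "C = (lam / real M) * ((pmin * f (3 * R / 4))\<^sup>2 * ((1 - 1/2) * (1 - q) ^ m))"
  define k1 where "k1 = (min (R / 8) (1 / 2))\<^sup>2"
  define G where "G l X = bexp (?I - star l) (?r X) (\<lambda>S. of_bool (H S))" for l X
  define ball where "ball X = {y. dist y (X a) \<le> 3 * R / 4 \<and> dist y (X b) \<le> 3 * R / 4}" for X :: "lbl \<Rightarrow> real \<times> real"
  define \<mu> where "\<mu> l = uniform_measure lborel (cube (fst l))" for l :: lbl
  have c0: "0 < f (3 * R / 4)" using R_pos by (intro f_pos) auto
  have C0: "0 \<le> C" unfolding C_def using M p by (intro mult_nonneg_nonneg) auto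
  have p1: "0 \<le> p" "p \<le> 1" using p by auto
  have cm: "config_model W (?r X) (lam / real M)" for X
    unfolding W_def using M p1 by (intro rX_config_model) auto
  have intg: "integrable PX (\<lambda>X. bexp I (?r X) h)" if "I \<subseteq> ?I" for I h
    using M p1 that unfolding W_def by (intro rX_bexp_integrable) auto
  have Gb: "0 \<le> G l X" "G l X \<le> 1" for l X
  proof -
    have fin: "finite (?I - star l)" using finW by simp
    have r01: "0 \<le> ?r X i \<and> ?r X i \<le> 1" if "i \<in> ?I - star l" for i using config_model.r01[OF cm] that by blast
    show "0 \<le> G l X" unfolding G_def by (intro bexp_nonneg fin r01) auto
    have "\<bar>G l X\<bar> \<le> 1" unfolding G_def by (intro bexp_abs_le fin r01) auto
    then show "G l X \<le> 1" by simp
  qed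
  have LbW: "Lb R W e \<inter> W = Lb R W e" by (auto simp: Lb_def)
  have s1: "AE X in PX. C * (indicator (ball X) (X l) * G l X) \<le> bexp ?I (?r X) (\<lambda>S. of_bool (witn A B S e l))"
    if l: "l \<in> W" "l \<notin> e" for l
    using AE_PX_cube
  proof eventually_elim
    case (elim X)
    interpret config_model W A B "?r X" "lam / real M" by (rule cm)
    show ?case
    proof (cases "X l \<in> ball X")
      case False
      then show ?thesis using finW r01 by (auto intro!: bexp_nonneg)
    next
      case True
      have lab: "l \<noteq> a" "l \<noteq> b" using l ab by auto
      have rl: "?r X (Inr {l, w}) = p * f (dist (X l) (X w))" if "w \<noteq> l" for w
        using that by (simp add: rt_def pdist_pair)
      have rho: "pmin * f (3 * R / 4) \<le> ?r X (Inr {l, w})" if w: "w \<in> e" for w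
      proof -
        have "dist (X l) (X w) \<le> 3 * R / 4" using True w ab by (auto simp: ball_def)
        then have "f (3 * R / 4) \<le> f (dist (X l) (X w))" by (intro f_anti) auto
        then have "pmin * f (3 * R / 4) \<le> p * f (dist (X l) (X w))" using p c0 by (intro mult_mono) auto
        moreover have "w \<noteq> l" using w l by auto
        ultimately show ?thesis by (simp add: rl)
      qed
      have q: "?r X (Inr {l, w}) \<le> q" if w: "w \<noteq> l" for w
      proof -
        have "f (dist (X l) (X w)) \<le> 1" "0 \<le> f (dist (X l) (X w))" using f01[of "dist (X l) (X w)"] by auto
        then have "p * f (dist (X l) (X w)) \<le> q * 1" using p by (intro mult_mono) auto
        then show ?thesis using w by (simp add: rl)
      qed
      have far: "?r X (Inr {l, w}) = 0" if w: "w \<in> W" "w \<notin> Lb R W e" "w \<noteq> l" for w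
      proof (rule ccontr)
        assume "?r X (Inr {l, w}) \<noteq> 0"
        then have "f (dist (X l) (X w)) \<noteq> 0" using w by (auto simp: rl)
        then have "dist (X l) (X w) \<le> R" by (metis f_zero not_le)
        then have 1: "zd (fst l) (fst w) \<le> ?D" using zd_le_rng elim by blast
        have "dist (X l) (X a) \<le> R" using True R_pos by (auto simp: ball_def)
        then have "zd (fst l) (fst a) \<le> ?D" using zd_le_rng elim by blast
        then have "zd (fst w) (fst a) \<le> 2 * ?D"
          using 1 zd_triangle[of "fst w" "fst a" "fst l"] zd_commute[of "fst l" "fst w"] by linarith
        then show False using w ab by (auto simp: Lb_def)
      qed
      have mk: "?r X (Inr {l}) \<le> 1/2" by (simp add: rt_def)
      have "(lam / real M) * ((pmin * f (3 * R / 4))\<^sup>2 * ((1 - 1/2) * (1 - q) ^ m)) *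
         bexp (?I - star l) (?r X) (\<lambda>S. of_bool (e \<in> pivE A B S \<and> card {w \<in> Lb R W e \<inter> W. Inl w \<in> S} \<le> m))
          \<le> ex (\<lambda>S. of_bool (witn A B S e l))"
        using ab abW l mk rho[of a] rho[of b] p c0 q far
        by (intro insert_vertex_estimate[where a = a and b = b]) auto
      then show ?thesis using True unfolding LbW by (simp add: C_def G_def H_def)
    qed
  qed
  have Gupd: "G l (X(l := y)) = G l X" for l X y
    unfolding G_def
  proof (intro bexp_cong refl)
    fix i assume i: "i \<in> ?I - star l"
    show "?r (X(l := y)) i = ?r X i"
    proof (cases i)
      case (Inr e')
      then have "l \<notin> e'" using i by (auto simp: star_def)
      then have "pdist (X(l := y)) e' = pdist X e'" unfolding pdist_def by (intro arg_cong[of _ _ Max] image_cong) auto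
      then show ?thesis using Inr by (simp add: rt_def)
    qed (simp add: rt_def)
  qed
  have Gm: "G l \<in> borel_measurable PX" for l
    unfolding G_def[abs_def] using intg[of "?I - star l"] by auto
  have Bm: "(\<lambda>X. indicator (ball X) (X l) :: real) \<in> borel_measurable PX" for l
  proof -
    have "(\<lambda>X. if dist (X l) (X a) \<le> 3 * R / 4 \<and> dist (X l) (X b) \<le> 3 * R / 4 then 1 else 0 :: real) \<in> borel_measurable PX"
      by measurable
    then show ?thesis by (simp add: ball_def indicator_def of_bool_def)
  qed
  \<comment> \<open>Neither the rates outside the star of l nor the ball depend on the position of
    l, so that position integrates out.\<close>
  have s2: "(\<integral>X. indicator (ball X) (X l) * G l X \<partial>PX) = (\<integral>X. measure (\<mu> l) (ball X) * G l X \<partial>PX)"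
    and s2m: "integrable PX (\<lambda>X. measure (\<mu> l) (ball X) * G l X)"
    if l: "l \<notin> e" for l
  proof -
    interpret U: prob_space "\<mu> l" unfolding \<mu>_def by (rule prob_space_unif)
    let ?h = "\<lambda>X. indicator (ball X) (X l) * G l X"
    have hm: "?h \<in> borel_measurable (PiM UNIV (\<lambda>v::lbl. uniform_measure lborel (cube (fst v))))"
      using Gm Bm unfolding PX_def[symmetric] by (intro borel_measurable_times)
    have bd: "\<bar>?h X\<bar> \<le> 1" for X using Gb[of l X] by (auto simp: indicator_def)
    have inner: "(\<integral>y. ?h (X(l := y)) \<partial>\<mu> l) = measure (\<mu> l) (ball X) * G l X" for X
    proof -
      have "ball (X(l := y)) = ball X" for y using l ab by (auto simp: ball_def)
      then have "(\<integral>y. ?h (X(l := y)) \<partial>\<mu> l) = (\<integral>y. indicator (ball X) y * G l X \<partial>\<mu> l)"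
        by (simp add: Gupd)
      also have "\<dots> = measure (\<mu> l) (ball X) * G l X"
        by (simp add: \<mu>_def ball_def)
      finally show ?thesis .
    qed
    note rs = PiM_resample_integral[OF prob_space_unif hm bd, of l, folded PX_def \<mu>_def, unfolded inner]
    show "(\<integral>X. ?h X \<partial>PX) = (\<integral>X. measure (\<mu> l) (ball X) * G l X \<partial>PX)" by (rule rs(1))
    show "integrable PX (\<lambda>X. measure (\<mu> l) (ball X) * G l X)"
    proof (rule P.integrable_const_bound[where B = 1])
      show "AE X in PX. norm (measure (\<mu> l) (ball X) * G l X) \<le> 1"
        using Gb[of l] U.prob_le_1 by (auto intro!: AE_I2 mult_le_one simp: abs_mult)
    qed (rule rs(2))
  qed
  have s3: "AE X in PX. k1 * (real M - real m) * bexp ?I (?r X) (\<lambda>S. of_bool (H S)) \<le> (\<Sum>l\<in>W - e. measure (\<mu> l) (ball X) * G l X)"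
    using AE_PX_cube
  proof eventually_elim
    case (elim X)
    interpret config_model W A B "?r X" "lam / real M" by (rule cm)
    show ?case
    proof (cases "dist (X a) (X b) \<le> R")
      case False
      have "ex (\<lambda>S. of_bool (H S)) \<le> ex (\<lambda>S. 0)"
      proof (rule ex_mono)
        fix S assume S: "\<And>i. i \<in> S \<Longrightarrow> 0 < ?r X i"
        have "?r X (Inr e) = 0" using False f_zero ab by (simp add: rt_def pdist_pair)
        then have "Inr e \<notin> S" using S[of "Inr e"] by auto
        then show "of_bool (H S) \<le> (0::real)" by (auto simp: H_def pivE_def piv_def)
      qed
      then have "k1 * (real M - real m) * ex (\<lambda>S. of_bool (H S)) \<le> 0"
        using m by (intro mult_nonneg_nonpos) (auto simp: k1_def)
      also have "0 \<le> (\<Sum>l\<in>W - e. measure (\<mu> l) (ball X) * G l X)"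
        using Gb by (intro sum_nonneg mult_nonneg_nonneg) auto
      finally show ?thesis .
    next
      case True
      obtain zm where zm: "zm \<in> zbox z0 N" "zd zm (fst a) \<le> ?D"
        "k1 \<le> measure (uniform_measure lborel (cube zm)) (ball X)"
        using midpoint_ball[OF elim[rule_format, of a] _ elim[rule_format, of b] _ True, of z0 N] abW
        unfolding k1_def ball_def W_def lbls_def by auto
      define V where "V = {l \<in> W - e. fst l = zm}"
      have Vf: "finite V" "V \<subseteq> W - e" using finW by (auto simp: V_def)
      \<comment> \<open>Both ends of a pivotal edge are present, so the absent labels of the square
        differ from them.\<close>
      have pt: "(real M - real m) * of_bool (H S) \<le> (\<Sum>l\<in>V. of_bool (Inl l \<notin> S \<and> H S))" for S
      proof (cases "H S")
        case HS: True
        have "e \<subseteq> pivV A B S" using HS pivE_subset_pivV unfolding H_def by blast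
        then have pres: "Inl x \<in> S" if "x \<in> e" for x using that by (auto simp: pivV_def piv_def)
        let ?Q = "{zm} \<times> {..<M}"
        have QW: "?Q \<subseteq> W" using zm by (auto simp: W_def lbls_def)
        have "card {l \<in> ?Q. Inl l \<in> S} \<le> card {w \<in> Lb R W e. Inl w \<in> S}"
        proof (rule card_mono)
          show "finite {w \<in> Lb R W e. Inl w \<in> S}" using finW by (auto simp: Lb_def)
          show "{l \<in> ?Q. Inl l \<in> S} \<subseteq> {w \<in> Lb R W e. Inl w \<in> S}"
            using QW zm(2) ab by (auto simp: Lb_def)
        qed
        also have "\<dots> \<le> m" using HS by (simp add: H_def)
        finally have 1: "card {l \<in> ?Q. Inl l \<in> S} \<le> m" .
        have "card ?Q = card {l \<in> ?Q. Inl l \<in> S} + card {l \<in> ?Q. Inl l \<notin> S}"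
        proof -
          have qe: "{l \<in> ?Q. Inl l \<in> S} \<union> {l \<in> ?Q. Inl l \<notin> S} = ?Q" by auto
          have "card ({l \<in> ?Q. Inl l \<in> S} \<union> {l \<in> ?Q. Inl l \<notin> S}) = card {l \<in> ?Q. Inl l \<in> S} + card {l \<in> ?Q. Inl l \<notin> S}"
            by (intro card_Un_disjoint) auto
          then show ?thesis unfolding qe .
        qed
        then have "real M - real m \<le> real (card {l \<in> ?Q. Inl l \<notin> S})" using 1 by (simp add: card_cartesian_product)
        also have "\<dots> \<le> real (card {l \<in> V. Inl l \<notin> S})"
        proof (intro of_nat_mono card_mono)
          show "finite {l \<in> V. Inl l \<notin> S}" using Vf(1) by simp
          show "{l \<in> ?Q. Inl l \<notin> S} \<subseteq> {l \<in> V. Inl l \<notin> S}" using QW pres by (auto simp: V_def)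
        qed
        also have "\<dots> = (\<Sum>l\<in>V. of_bool (l \<in> {l \<in> V. Inl l \<notin> S}))" using Vf by (intro real_card_eq_sum) auto
        also have "\<dots> = (\<Sum>l\<in>V. of_bool (Inl l \<notin> S \<and> H S))" using HS by (intro sum.cong) auto
        finally show ?thesis using HS by simp
      qed simp
      have "k1 * (real M - real m) * ex (\<lambda>S. of_bool (H S)) = k1 * ex (\<lambda>S. (real M - real m) * of_bool (H S))"
        by (simp add: bexp_cmult)
      also have "\<dots> \<le> k1 * ex (\<lambda>S. \<Sum>l\<in>V. of_bool (Inl l \<notin> S \<and> H S))"
        using pt by (intro mult_left_mono ex_mono) (auto simp: k1_def)
      also have "\<dots> = (\<Sum>l\<in>V. k1 * ex (\<lambda>S. of_bool (Inl l \<notin> S \<and> H S)))"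
        by (simp add: bexp_sum sum_distrib_left)
      also have "\<dots> \<le> (\<Sum>l\<in>V. measure (\<mu> l) (ball X) * G l X)"
      proof (intro sum_mono mult_mono)
        fix l assume l: "l \<in> V"
        show "k1 \<le> measure (\<mu> l) (ball X)" using zm(3) l by (simp add: V_def \<mu>_def)
        show "ex (\<lambda>S. of_bool (Inl l \<notin> S \<and> H S)) \<le> G l X"
          unfolding G_def H_def using absent_vertex_expectation[of l e "Lb R W e" m] l by (auto simp: V_def)
        show "0 \<le> ex (\<lambda>S. of_bool (Inl l \<notin> S \<and> H S))" using finW r01 by (intro bexp_nonneg) auto
      qed auto
      also have "\<dots> \<le> (\<Sum>l\<in>W - e. measure (\<mu> l) (ball X) * G l X)"
        using finW Vf Gb by (intro sum_mono2) auto
      finally show ?thesis .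
    qed
  qed
  have "C * (k1 * (real M - real m)) * (\<integral>X. bexp ?I (?r X) (\<lambda>S. of_bool (H S)) \<partial>PX)
     = C * (\<integral>X. k1 * (real M - real m) * bexp ?I (?r X) (\<lambda>S. of_bool (H S)) \<partial>PX)" by simp
  also have "\<dots> \<le> C * (\<integral>X. (\<Sum>l\<in>W - e. measure (\<mu> l) (ball X) * G l X) \<partial>PX)"
    using s3 C0 s2m intg[of ?I] by (intro mult_left_mono integral_mono_AE) auto
  also have "\<dots> = (\<Sum>l\<in>W - e. C * (\<integral>X. measure (\<mu> l) (ball X) * G l X \<partial>PX))"
    using s2m by (subst Bochner_Integration.integral_sum) (auto simp: sum_distrib_left)
  also have "\<dots> = (\<Sum>l\<in>W - e. (\<integral>X. C * (indicator (ball X) (X l) * G l X) \<partial>PX))"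
    using s2 by (intro sum.cong) auto
  also have "\<dots> \<le> (\<Sum>l\<in>W - e. (\<integral>X. bexp ?I (?r X) (\<lambda>S. of_bool (witn A B S e l)) \<partial>PX))"
  proof (intro sum_mono integral_mono_AE)
    fix l assume l: "l \<in> W - e"
    have "integrable PX (\<lambda>X. indicator (ball X) (X l) * G l X)"
      using Gb Bm Gm by (intro P.integrable_const_bound[where B = 1]) (auto simp: indicator_def)
    then show "integrable PX (\<lambda>X. C * (indicator (ball X) (X l) * G l X))" by simp
    show "AE X in PX. C * (indicator (ball X) (X l) * G l X) \<le> bexp ?I (?r X) (\<lambda>S. of_bool (witn A B S e l))"
      using s1[of l] l by auto
  qed (use intg in auto)
  also have "\<dots> = (\<integral>X. (\<Sum>l\<in>W - e. bexp ?I (?r X) (\<lambda>S. of_bool (witn A B S e l))) \<partial>PX)"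
    using intg by (subst Bochner_Integration.integral_sum) auto
  also have "\<dots> \<le> (\<integral>X. bexp ?I (?r X) (\<lambda>S. of_bool (e \<in> sgE A B S)) \<partial>PX)"
  proof (intro integral_mono)
    fix X
    interpret config_model W A B "?r X" "lam / real M" by (rule cm)
    have "(\<Sum>l\<in>W - e. ex (\<lambda>S. of_bool (witn A B S e l))) \<le> (\<Sum>l\<in>W. ex (\<lambda>S. of_bool (witn A B S e l)))"
      using finW r01 by (intro sum_mono2 bexp_nonneg) auto
    then show "(\<Sum>l\<in>W - e. ex (\<lambda>S. of_bool (witn A B S e l))) \<le> ex (\<lambda>S. of_bool (e \<in> sgE A B S))"
      using sum_witn_le[of e] by linarith
  qed (use intg in \<open>auto intro!: Bochner_Integration.integrable_sum\<close>)
  finally show ?thesis unfolding C_def k1_def .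
qed

end

section \<open>Russo's formula and the comparison of parameters\<close>

context conn_fun
begin

text \<open>This is where strictness comes from, and where q < 1 is needed: a positive fraction of the pivotal edges becomes
  non-pivotal, with both ends still pivotal, after a local change of bounded cost. In sparse surroundings the change inserts a
  detour vertex near the midpoint; in crowded ones it opens an edge inside a cell.\<close>

lemma pivot_inequality:
  assumes pmin: "0 < pmin" and q: "pmin \<le> q" "q < 1" and l0: "0 < l0" "l0 \<le> l1"
  shows "\<exists>c>0. \<exists>M0>0. \<forall>M\<ge>M0. \<forall>lam p z0 N A B. l0 \<le> lam \<and> lam \<le> l1 \<and> pmin \<le> p \<and> p \<le> q \<longrightarrow>
     2 * lam \<le> real M \<and>
     (1 + c) * (\<integral>X. bexp (cidx (lbls (zbox z0 N) M)) (rX M lam p X) (\<lambda>S. real (card (pivE A B S))) \<partial>PX)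
      \<le> (\<integral>X. bexp (cidx (lbls (zbox z0 N) M)) (rX M lam p X) (\<lambda>S. real (card (pivV A B S))) \<partial>PX)"
proof -
  define c0 where "c0 = f (3 * R / 4)"
  have c0: "0 < c0" unfolding c0_def using R_pos by (intro f_pos) auto
  \<comment> \<open>Large enough for \<open>crowd_X\<close> at every intensity up to l1.\<close>
  define T where "T = nat \<lceil>8 * l1 * real ((4 * rng R + 1)\<^sup>2)\<rceil> + 1"
  have T: "0 < T" "8 * l1 * real ((4 * rng R + 1)\<^sup>2) \<le> real T"
    using real_nat_ceiling_ge[of "8 * l1 * real ((4 * rng R + 1)\<^sup>2)"] unfolding T_def by linarith+
  \<comment> \<open>The largest count strictly below the bound 4 * crowdK R + T of the crowded
    case.\<close>
  define m where "m = 4 * crowdK R + T - 1"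
  define k1 where "k1 = (min (R / 8) (1 / 2))\<^sup>2"
  have k1: "0 < k1" using R_pos by (auto simp: k1_def)
  define C4 where "C4 = l0 / 2 * ((pmin * c0)\<^sup>2 * ((1 - 1/2) * (1 - q) ^ m)) * k1"
  have C4: "0 < C4" using pmin q l0 c0 k1 by (auto simp: C4_def)
  define a where "a = (1 + real (crowdK R)) / (pmin * c0)"
  have a: "0 < a" using pmin c0 by (auto simp: a_def)
  \<comment> \<open>Solves EP / 2 \<le> a * ES + EH together with EH \<le> ES / C4 for ES, where EP,
    ES and EH are the expected numbers of pivotal edges, of edges in \<open>sgE\<close>, and of
    pivotal edges in sparse surroundings.\<close>
  define c where "c = 1 / (2 * (a + 1 / C4))"
  have c: "0 < c" using a C4 by (simp add: c_def add_pos_pos)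
  \<comment> \<open>M \<ge> 2 * m gives M - m \<ge> M / 2, whence the l0 / 2 in C4; M \<ge> 2 * l1
    keeps vertex probabilities at most 1 / 2.\<close>
  define M0 where "M0 = nat \<lceil>2 * l1\<rceil> + 2 * m + 1"
  have main: "2 * lam \<le> real M \<and>
     (1 + c) * (\<integral>X. bexp (cidx (lbls (zbox z0 N) M)) (rX M lam p X) (\<lambda>S. real (card (pivE A B S))) \<partial>PX)
      \<le> (\<integral>X. bexp (cidx (lbls (zbox z0 N) M)) (rX M lam p X) (\<lambda>S. real (card (pivV A B S))) \<partial>PX)"
    if M: "M0 \<le> M" and lam: "l0 \<le> lam" "lam \<le> l1" and p: "pmin \<le> p" "p \<le> q" for M lam p z0 N A B
  proof -
    interpret P: prob_space PX by (rule prob_space_PX)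
    define W where "W = lbls (zbox z0 N) M"
    let ?I = "cidx W" and ?r = "rX M lam p"
    have finW: "finite W" by (simp add: W_def)
    have "nat \<lceil>2 * l1\<rceil> \<le> M" using M by (simp only: M0_def)
    then have "real (nat \<lceil>2 * l1\<rceil>) \<le> real M" by (rule of_nat_mono)
    then have M2: "2 * lam \<le> real M" using lam real_nat_ceiling_ge[of "2 * l1"] by linarith
    have M1: "0 < M" "2 * m \<le> M" "m \<le> M" using M by (auto simp: M0_def)
    have lam0: "0 < lam" using lam l0 by linarith
    have p01: "0 \<le> p" "p \<le> 1" "0 < p" using p pmin q by auto
    have intg: "integrable PX (\<lambda>X. bexp ?I (?r X) h)" for h
      using M1 M2 lam0 p01 unfolding W_def by (intro rX_bexp_integrable) auto
    have cm: "config_model W (?r X) (lam / real M)" for X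
      unfolding W_def using M1 M2 lam0 p01 by (intro rX_config_model) auto
    let ?EP = "\<integral>X. bexp ?I (?r X) (\<lambda>S. real (card (pivE A B S))) \<partial>PX"
    let ?ES = "\<integral>X. bexp ?I (?r X) (\<lambda>S. real (card (sgE A B S))) \<partial>PX"
    let ?EV = "\<integral>X. bexp ?I (?r X) (\<lambda>S. real (card (pivV A B S))) \<partial>PX"
    define H where "H e S = (e \<in> pivE A B S \<and> card {w \<in> Lb R W e. Inl w \<in> S} \<le> m)" for e S
    let ?EH = "\<integral>X. bexp ?I (?r X) (\<lambda>S. real (card {e. H e S})) \<partial>PX"
    have mH: "{e \<in> pivE A B S. card {w \<in> Lb R W e. Inl w \<in> S} < 4 * crowdK R + T} = {e. H e S}" for S
      using T(1) by (auto simp: H_def m_def)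
    have 1: "?EP / 2 \<le> a * ?ES + ?EH"
    proof -
      have "(\<integral>X. bexp ?I (?r X) (\<lambda>S. real (card (pivE A B S))) / 2 \<partial>PX) \<le>
         (\<integral>X. a * bexp ?I (?r X) (\<lambda>S. real (card (sgE A B S))) + bexp ?I (?r X) (\<lambda>S. real (card {e. H e S})) \<partial>PX)"
      proof (rule integral_mono_AE)
        have Tl: "8 * lam * real ((4 * rng R + 1)\<^sup>2) \<le> real T"
          using T(2) mult_right_mono[of "8 * lam" "8 * l1" "real ((4 * rng R + 1)\<^sup>2)"] lam by linarith
        show "AE X in PX. bexp ?I (?r X) (\<lambda>S. real (card (pivE A B S))) / 2 \<le>
            a * bexp ?I (?r X) (\<lambda>S. real (card (sgE A B S))) + bexp ?I (?r X) (\<lambda>S. real (card {e. H e S}))"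
          using AE_PX_cube
        proof eventually_elim
          case (elim X)
          show ?case
            using crowd_X[of X M lam pmin p T z0 N A B] elim M1 M2 lam0 pmin p p01 T(1) Tl
            unfolding W_def[symmetric] mH a_def c0_def by auto
        qed
      qed (use intg in auto)
      then show ?thesis using intg by simp
    qed
    have 2: "C4 * ?EH \<le> ?ES"
    proof -
      have EH: "?EH = (\<Sum>e\<in>pairs W. \<integral>X. bexp ?I (?r X) (\<lambda>S. of_bool (H e S)) \<partial>PX)"
      proof -
        have "bexp ?I (?r X) (\<lambda>S. real (card {e. H e S})) = (\<Sum>e\<in>pairs W. bexp ?I (?r X) (\<lambda>S. of_bool (H e S)))" for X
          unfolding bexp_sum[symmetric]
        proof (intro bexp_cong refl)
          fix S assume S: "S \<subseteq> ?I"
          have "{e. H e S} \<subseteq> pairs W" using pivE_subset_pairs[OF S] by (auto simp: H_def)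
          then show "real (card {e. H e S}) = (\<Sum>e\<in>pairs W. of_bool (H e S))"
            using real_card_eq_sum[of "pairs W" "{e. H e S}"] finW by simp
        qed
        then show ?thesis using intg by (simp add: Bochner_Integration.integral_sum)
      qed
      have ES: "?ES = (\<Sum>e\<in>pairs W. \<integral>X. bexp ?I (?r X) (\<lambda>S. of_bool (e \<in> sgE A B S)) \<partial>PX)"
      proof -
        have "bexp ?I (?r X) (\<lambda>S. real (card (sgE A B S))) = (\<Sum>e\<in>pairs W. bexp ?I (?r X) (\<lambda>S. of_bool (e \<in> sgE A B S)))" for X
          unfolding bexp_sum[symmetric] using finW
          by (intro bexp_cong refl real_card_eq_sum sgE_subset_pairs) auto
        then show ?thesis using intg by (simp add: Bochner_Integration.integral_sum)
      qed
      show ?thesis unfolding EH ES sum_distrib_left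
      proof (intro sum_mono)
        fix e assume e: "e \<in> pairs W"
        let ?EHe = "\<integral>X. bexp ?I (?r X) (\<lambda>S. of_bool (H e S)) \<partial>PX"
        have nn: "0 \<le> ?EHe"
        proof (intro integral_nonneg_AE AE_I2)
          fix X
          show "0 \<le> bexp ?I (?r X) (\<lambda>S. of_bool (H e S))"
            using finW config_model.r01[OF cm] by (intro bexp_nonneg) auto
        qed
        have "l0 / 2 \<le> lam / real M * (real M - real m)"
        proof -
          have "real M / 2 \<le> real M - real m" using M1 by linarith
          then have "lam / real M * (real M / 2) \<le> lam / real M * (real M - real m)"
            using lam0 by (intro mult_left_mono) auto
          then show ?thesis using lam M1 by simp
        qed
        then have "l0 / 2 * (((pmin * c0)\<^sup>2 * ((1 - 1/2) * (1 - q) ^ m)) * k1)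
           \<le> (lam / real M * (real M - real m)) * (((pmin * c0)\<^sup>2 * ((1 - 1/2) * (1 - q) ^ m)) * k1)"
          using k1 q by (intro mult_right_mono) auto
        then have "C4 \<le> (lam / real M) * ((pmin * c0)\<^sup>2 * ((1 - 1/2) * (1 - q) ^ m)) * (k1 * (real M - real m))"
          unfolding C4_def by (simp only: mult.assoc mult.commute mult.left_commute)
        then have "C4 * ?EHe \<le> (lam / real M) * ((pmin * c0)\<^sup>2 * ((1 - 1/2) * (1 - q) ^ m)) * (k1 * (real M - real m)) * ?EHe"
          using nn by (intro mult_right_mono)
        also have "\<dots> \<le> (\<integral>X. bexp ?I (?r X) (\<lambda>S. of_bool (e \<in> sgE A B S)) \<partial>PX)"
          using insertion_X[of M lam pmin p q m e z0 N A B] M1 M2 lam0 pmin p q e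
          unfolding W_def[symmetric] c0_def k1_def H_def by auto
        finally show "C4 * ?EHe \<le> (\<integral>X. bexp ?I (?r X) (\<lambda>S. of_bool (e \<in> sgE A B S)) \<partial>PX)" .
      qed
    qed
    have 3: "?EP + ?ES \<le> ?EV"
    proof -
      have "(\<integral>X. bexp ?I (?r X) (\<lambda>S. real (card (pivE A B S))) + bexp ?I (?r X) (\<lambda>S. real (card (sgE A B S))) \<partial>PX) \<le> ?EV"
      proof (intro integral_mono)
        fix X
        have "real (card (pivE A B S)) + real (card (sgE A B S)) \<le> real (card (pivV A B S))" if "S \<subseteq> ?I" for S
          using card_pivE_sgE[of A B S] finite_subset[OF pivV_subset[OF that, of A B] finW] by linarith
        then show "bexp ?I (?r X) (\<lambda>S. real (card (pivE A B S))) + bexp ?I (?r X) (\<lambda>S. real (card (sgE A B S)))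
          \<le> bexp ?I (?r X) (\<lambda>S. real (card (pivV A B S)))"
          unfolding bexp_add[symmetric] using finW config_model.r01[OF cm] by (intro bexp_mono) auto
      qed (use intg in auto)
      then show ?thesis using intg by simp
    qed
    have "?EH \<le> ?ES / C4" using 2 C4 by (simp add: field_simps)
    then have "?EP / 2 \<le> (a + 1 / C4) * ?ES" using 1 by (simp add: algebra_simps)
    then have "c * ?EP \<le> ?ES" unfolding c_def using a C4 by (simp add: field_simps add_pos_pos)
    then show ?thesis using M2 3 unfolding W_def by (simp add: algebra_simps)
  qed
  show ?thesis using c main by (intro exI[of _ c] conjI exI[of _ M0]) (auto simp: M0_def)
qed

lemma pivot_inequality_weak:
  fixes lam :: real
  assumes M: "0 < M" "0 \<le> lam" "2 * lam \<le> real M" and p: "0 \<le> p" "p \<le> 1"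
  shows "(\<integral>X. bexp (cidx (lbls (zbox z0 N) M)) (rX M lam p X) (\<lambda>S. real (card (pivE A B S))) \<partial>PX)
      \<le> (\<integral>X. bexp (cidx (lbls (zbox z0 N) M)) (rX M lam p X) (\<lambda>S. real (card (pivV A B S))) \<partial>PX)"
proof (intro integral_mono)
  let ?I = "cidx (lbls (zbox z0 N) M)"
  fix X
  have "real (card (pivE A B S)) \<le> real (card (pivV A B S))" if "S \<subseteq> ?I" for S
    using card_pivE_sgE[of A B S] finite_subset[OF pivV_subset[OF that, of A B]] by simp
  then show "bexp ?I (rX M lam p X) (\<lambda>S. real (card (pivE A B S))) \<le> bexp ?I (rX M lam p X) (\<lambda>S. real (card (pivV A B S)))"
    using config_model.r01[OF rX_config_model[OF assms]] by (intro bexp_mono) auto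
qed (use assms in \<open>auto intro!: rX_bexp_integrable\<close>)

text \<open>Along the curve the logarithmic derivatives of the rates are 1 - c for vertices, -1 for
  edges and 0 for marks. With \<open>bexp_pivot\<close> Russo's formula becomes a difference of
  expected numbers of pivotal sites.\<close>

lemma bexp_con_derivative:
  fixes z0 :: "int \<times> int" and N :: nat and lam c p0 :: real and X :: "lbl \<Rightarrow> real \<times> real"
  assumes M: "0 < M"
  defines "W \<equiv> lbls (zbox z0 N) M"
  defines "rr \<equiv> \<lambda>t. rX M (lam * exp ((1 - c) * t)) (p0 * exp (- t)) X"
  shows "((\<lambda>t. bexp (cidx W) (rr t) (\<lambda>S. of_bool (con A B S))) has_real_derivative
     ((1 - c) * bexp (cidx W) (rr t) (\<lambda>S. real (card (pivV A B S))) - bexp (cidx W) (rr t) (\<lambda>S. real (card (pivE A B S))))) (at t)"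
proof -
  let ?I = "cidx W" and ?h = "\<lambda>S. of_bool (con A B S) :: real"
  have finW: "finite W" by (simp add: W_def)
  define r' where "r' i = (case i of Inl v \<Rightarrow> (1 - c) * rr t i | Inr e \<Rightarrow> if card e = 1 then 0 else - rr t i)" for i
  have der: "((\<lambda>t. rr t i) has_real_derivative r' i) (at t)" if "i \<in> ?I" for i
    using M by (cases i) (auto simp: rr_def r'_def rt_def intro!: derivative_eq_intros)
  have pv: "rr t i * bexp ?I (rr t) (\<lambda>S. ?h (insert i S) - ?h (S - {i})) = bexp ?I (rr t) (\<lambda>S. of_bool (piv A B S i))"
    if "i \<in> ?I" for i
  proof -
    have "rr t i * bexp ?I (rr t) (\<lambda>S. ?h (insert i S) - ?h (S - {i})) = bexp ?I (rr t) (\<lambda>S. if i \<in> S then ?h S - ?h (S - {i}) else 0)"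
      using finW that by (intro bexp_pivot) auto
    also have "\<dots> = bexp ?I (rr t) (\<lambda>S. of_bool (piv A B S i))"
      using con_mono[of A B "_ - {i}"] by (intro bexp_cong refl) (auto simp: piv_def)
    finally show ?thesis .
  qed
  have I: "?I = Inl ` W \<union> (Inr ` {e. e \<subseteq> W \<and> card e = 1} \<union> Inr ` pairs W)"
    by (auto simp: cidx_def pairs_def)
  have fin1: "finite {e. e \<subseteq> W \<and> card e = 1}" using finW by simp
  have "(\<Sum>i\<in>?I. r' i * bexp ?I (rr t) (\<lambda>S. ?h (insert i S) - ?h (S - {i})))
     = (\<Sum>i\<in>Inl ` W. r' i * bexp ?I (rr t) (\<lambda>S. ?h (insert i S) - ?h (S - {i})))
      + ((\<Sum>i\<in>Inr ` {e. e \<subseteq> W \<and> card e = 1}. r' i * bexp ?I (rr t) (\<lambda>S. ?h (insert i S) - ?h (S - {i})))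
      + (\<Sum>i\<in>Inr ` pairs W. r' i * bexp ?I (rr t) (\<lambda>S. ?h (insert i S) - ?h (S - {i}))))"
  proof -
    let ?g = "\<lambda>i. r' i * bexp ?I (rr t) (\<lambda>S. ?h (insert i S) - ?h (S - {i}))"
    have "sum ?g ?I = sum ?g (Inl ` W \<union> (Inr ` {e. e \<subseteq> W \<and> card e = 1} \<union> Inr ` pairs W))" using I by simp
    also have "\<dots> = sum ?g (Inl ` W) + sum ?g (Inr ` {e. e \<subseteq> W \<and> card e = 1} \<union> Inr ` pairs W)"
      using finW by (intro sum.union_disjoint) auto
    also have "sum ?g (Inr ` {e. e \<subseteq> W \<and> card e = 1} \<union> Inr ` pairs W)
        = sum ?g (Inr ` {e. e \<subseteq> W \<and> card e = 1}) + sum ?g (Inr ` pairs W)"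
      using finW by (intro sum.union_disjoint) (auto simp: pairs_def)
    finally show ?thesis .
  qed
  also have "(\<Sum>i\<in>Inl ` W. r' i * bexp ?I (rr t) (\<lambda>S. ?h (insert i S) - ?h (S - {i})))
     = (1 - c) * bexp ?I (rr t) (\<lambda>S. real (card (pivV A B S)))"
  proof -
    have "(\<Sum>i\<in>Inl ` W. r' i * bexp ?I (rr t) (\<lambda>S. ?h (insert i S) - ?h (S - {i})))
       = (\<Sum>v\<in>W. (1 - c) * bexp ?I (rr t) (\<lambda>S. of_bool (piv A B S (Inl v))))"
    proof (subst sum.reindex, simp, intro sum.cong refl, unfold o_def)
      fix v assume v: "v \<in> W"
      then have "Inl v \<in> ?I" by (auto simp: cidx_def)
      from pv[OF this] show "r' (Inl v) * bexp ?I (rr t) (\<lambda>S. ?h (insert (Inl v) S) - ?h (S - {Inl v}))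
          = (1 - c) * bexp ?I (rr t) (\<lambda>S. of_bool (piv A B S (Inl v)))"
        by (simp add: r'_def mult.assoc)
    qed
    also have "\<dots> = (1 - c) * bexp ?I (rr t) (\<lambda>S. \<Sum>v\<in>W. of_bool (v \<in> pivV A B S))"
      by (simp add: bexp_sum sum_distrib_left pivV_def)
    also have "bexp ?I (rr t) (\<lambda>S. \<Sum>v\<in>W. of_bool (v \<in> pivV A B S)) = bexp ?I (rr t) (\<lambda>S. real (card (pivV A B S)))"
      using pivV_subset[of _ W A B] finW by (intro bexp_cong refl real_card_eq_sum[symmetric]) auto
    finally show ?thesis .
  qed
  also have "(\<Sum>i\<in>Inr ` {e. e \<subseteq> W \<and> card e = 1}. r' i * bexp ?I (rr t) (\<lambda>S. ?h (insert i S) - ?h (S - {i}))) = 0"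
    by (intro sum.neutral) (auto simp: r'_def)
  also have "(\<Sum>i\<in>Inr ` pairs W. r' i * bexp ?I (rr t) (\<lambda>S. ?h (insert i S) - ?h (S - {i})))
     = - bexp ?I (rr t) (\<lambda>S. real (card (pivE A B S)))"
  proof -
    have "(\<Sum>i\<in>Inr ` pairs W. r' i * bexp ?I (rr t) (\<lambda>S. ?h (insert i S) - ?h (S - {i})))
       = (\<Sum>e\<in>pairs W. - bexp ?I (rr t) (\<lambda>S. of_bool (piv A B S (Inr e))))"
    proof (subst sum.reindex, simp, intro sum.cong refl, unfold o_def)
      fix e assume e: "e \<in> pairs W"
      then have "Inr e \<in> ?I" "card e = 2" by (auto simp: cidx_def pairs_def)
      then show "r' (Inr e) * bexp ?I (rr t) (\<lambda>S. ?h (insert (Inr e) S) - ?h (S - {Inr e}))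
          = - bexp ?I (rr t) (\<lambda>S. of_bool (piv A B S (Inr e)))"
        using pv[of "Inr e"] by (simp add: r'_def)
    qed
    also have "\<dots> = - bexp ?I (rr t) (\<lambda>S. \<Sum>e\<in>pairs W. of_bool (e \<in> pivE A B S))"
      by (simp add: bexp_sum sum_negf pivE_def pairs_def)
    also have "bexp ?I (rr t) (\<lambda>S. \<Sum>e\<in>pairs W. of_bool (e \<in> pivE A B S)) = bexp ?I (rr t) (\<lambda>S. real (card (pivE A B S)))"
      using pivE_subset_pairs[of _ W A B] finW by (intro bexp_cong refl real_card_eq_sum[symmetric]) auto
    finally show ?thesis .
  qed
  finally show ?thesis
    using bexp_has_real_derivative[of ?I rr r' t UNIV ?h] der finW by simp
qed

text \<open>For fixed positions the sign of the derivative is not known; the hypothesis controls its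
  average over positions. So the fundamental theorem of calculus is applied for each X, and Fubini
  exchanges the average with the time integral.\<close>

lemma flow_le:
  fixes z0 :: "int \<times> int" and N :: nat and lam c p0 \<tau> :: real
  assumes M: "0 < M" and lam: "0 \<le> lam" "2 * lam * exp ((1 - c) * \<tau>) \<le> real M" and c: "0 \<le> c" "c \<le> 1"
    and p0: "0 \<le> p0" "p0 \<le> 1" and \<tau>: "0 \<le> \<tau>"
  defines "W \<equiv> lbls (zbox z0 N) M"
  defines "rr \<equiv> \<lambda>t. rX M (lam * exp ((1 - c) * t)) (p0 * exp (- t))"
  assumes ineq: "\<And>t. 0 \<le> t \<Longrightarrow> t \<le> \<tau> \<Longrightarrow>
     (\<integral>X. bexp (cidx W) (rr t X) (\<lambda>S. real (card (pivE A B S))) \<partial>PX)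
      \<le> (1 - c) * (\<integral>X. bexp (cidx W) (rr t X) (\<lambda>S. real (card (pivV A B S))) \<partial>PX)"
  shows "(\<integral>X. bexp (cidx W) (rr 0 X) (\<lambda>S. of_bool (con A B S)) \<partial>PX)
     \<le> (\<integral>X. bexp (cidx W) (rr \<tau> X) (\<lambda>S. of_bool (con A B S)) \<partial>PX)"
proof -
  interpret P: prob_space PX by (rule prob_space_PX)
  let ?I = "cidx W"
  have finW: "finite W" by (simp add: W_def)
  have par: "0 \<le> lam * exp ((1 - c) * t)" "2 * (lam * exp ((1 - c) * t)) \<le> real M" "0 \<le> p0 * exp (- t)" "p0 * exp (- t) \<le> 1"
    if t: "0 \<le> t" "t \<le> \<tau>" for t
  proof -
    have "exp ((1 - c) * t) \<le> exp ((1 - c) * \<tau>)" using t c by (simp add: mult_left_mono)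
    then have "2 * lam * exp ((1 - c) * t) \<le> 2 * lam * exp ((1 - c) * \<tau>)" using lam by (intro mult_left_mono) auto
    then show "2 * (lam * exp ((1 - c) * t)) \<le> real M" using lam by linarith
    have "p0 * exp (- t) \<le> 1 * 1" using p0 t by (intro mult_mono) auto
    then show "p0 * exp (- t) \<le> 1" by simp
  qed (use lam p0 in auto)
  have intg: "integrable PX (\<lambda>X. bexp ?I (rr t X) h)" if "0 \<le> t" "t \<le> \<tau>" for t h
    unfolding rr_def W_def using par[OF that] M by (intro rX_bexp_integrable) auto
  have r01: "0 \<le> rr t X i \<and> rr t X i \<le> 1" if "0 \<le> t" "t \<le> \<tau>" "i \<in> ?I" for t X i
    using config_model.r01[OF rX_config_model[OF M par[OF that(1,2)]], of i z0 N X] that(3)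
    unfolding rr_def W_def by auto
  define D where "D X t = (1 - c) * bexp ?I (rr t X) (\<lambda>S. real (card (pivV A B S))) - bexp ?I (rr t X) (\<lambda>S. real (card (pivE A B S)))" for X t
  have der: "((\<lambda>t. bexp ?I (rr t X) (\<lambda>S. of_bool (con A B S))) has_real_derivative D X t) (at t)" for X t
    using bexp_con_derivative[OF M, where X = X] unfolding D_def rr_def W_def .
  have cont: "isCont (D X) t" for X t
  proof -
    have r: "isCont (\<lambda>t. rr t X i) t" for i
    proof (cases i)
      case (Inl v)
      then show ?thesis using M by (auto simp: rr_def rt_def intro!: continuous_intros)
    next
      case (Inr e)
      then show ?thesis by (cases "card e = 1") (auto simp: rr_def rt_def intro!: continuous_intros)
    qed
    have "isCont (\<lambda>t. bexp ?I (rr t X) h) t" for h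
      unfolding bexp_def by (intro continuous_intros r)
    then show ?thesis unfolding D_def[abs_def] by (intro continuous_intros)
  qed
  \<comment> \<open>Lebesgue measure on the time interval, as a finite measure so that bounded
    functions are integrable on the product.\<close>
  define Q where "Q = density lborel (indicator {0..\<tau>} :: real \<Rightarrow> ennreal)"
  have emQ: "emeasure Q (space Q) = ennreal \<tau>" unfolding Q_def using \<tau> by (subst emeasure_density) auto
  interpret Q: finite_measure Q by (rule finite_measureI) (simp add: emQ)
  interpret PQ: pair_sigma_finite PX Q ..
  interpret PQf: finite_measure "PX \<Otimes>\<^sub>M Q" by (intro finite_measure_pair_measure) unfold_locales
  have Qint: "(\<integral>t. g t \<partial>Q) = (\<integral>t. g t * indicator {0..\<tau>} t \<partial>lborel)" if "g \<in> borel_measurable borel" for g :: "real \<Rightarrow> real"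
  proof -
    have e: "Q = density lborel (\<lambda>x. ennreal (indicator {0..\<tau>} x))" unfolding Q_def
      by (intro arg_cong[of _ _ "density lborel"] ext) (auto simp: indicator_def)
    show ?thesis unfolding e using that by (subst integral_density) (auto simp: mult.commute)
  qed
  have AEQ: "AE t in Q. 0 \<le> t \<and> t \<le> \<tau>" unfolding Q_def by (subst AE_density) (auto simp: indicator_def)
  have Dt: "D X \<in> borel_measurable borel" for X
    using cont by (intro borel_measurable_continuous_onI continuous_at_imp_continuous_on) auto
  have FTC: "(\<integral>t. D X t \<partial>Q) = bexp ?I (rr \<tau> X) (\<lambda>S. of_bool (con A B S)) - bexp ?I (rr 0 X) (\<lambda>S. of_bool (con A B S))" for X
    unfolding Qint[OF Dt] using \<tau> der cont by (intro integral_FTC_Icc_real) auto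
  define Bd where "Bd = 2 * (real (card W) + real (card (pairs W)))"
  have bd: "\<bar>D X t\<bar> \<le> Bd" if t: "0 \<le> t" "t \<le> \<tau>" for X t
  proof -
    have 1: "\<bar>bexp ?I (rr t X) (\<lambda>S. real (card (pivV A B S)))\<bar> \<le> real (card W)"
      using finW r01[OF t] pivV_subset[of _ W A B] by (intro bexp_abs_le) (auto intro!: card_mono)
    have 2: "\<bar>bexp ?I (rr t X) (\<lambda>S. real (card (pivE A B S)))\<bar> \<le> real (card (pairs W))"
      using finW r01[OF t] pivE_subset_pairs[of _ W A B] by (intro bexp_abs_le) (auto intro!: card_mono)
    have "\<bar>D X t\<bar> \<le> \<bar>(1 - c) * bexp ?I (rr t X) (\<lambda>S. real (card (pivV A B S)))\<bar> + \<bar>bexp ?I (rr t X) (\<lambda>S. real (card (pivE A B S)))\<bar>"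
      unfolding D_def by (rule abs_triangle_ineq4)
    also have "\<dots> \<le> 1 * real (card W) + real (card (pairs W))"
      unfolding abs_mult using 1 2 c by (intro add_mono mult_mono) auto
    finally show ?thesis unfolding Bd_def by simp
  qed
  have meas: "(\<lambda>z. D (fst z) (snd z)) \<in> borel_measurable (PX \<Otimes>\<^sub>M Q)"
  proof -
    have sq: "(\<lambda>z. snd z) \<in> borel_measurable (PX \<Otimes>\<^sub>M Q)"
    proof -
      have "snd \<in> PX \<Otimes>\<^sub>M Q \<rightarrow>\<^sub>M Q" by simp
      then show ?thesis by (simp add: Q_def cong: measurable_cong_sets)
    qed
    have r: "(\<lambda>z. rr (snd z) (fst z) i) \<in> borel_measurable (PX \<Otimes>\<^sub>M Q)" if i: "i \<in> ?I" for i
    proof (cases i)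
      case (Inl v)
      then show ?thesis using sq by (simp add: rr_def rt_def)
    next
      case (Inr e)
      then have "card e = 1 \<or> card e = 2" using i by (auto simp: cidx_def)
      moreover have "(\<lambda>z. f (pdist (fst z) e)) \<in> borel_measurable (PX \<Otimes>\<^sub>M Q)" if "card e = 2"
        using measurable_compose[OF measurable_fst f_pdist_measurable[OF that], of Q] .
      ultimately show ?thesis using sq Inr by (auto simp: rr_def rt_def)
    qed
    show ?thesis unfolding D_def using finW r by (intro borel_measurable_diff borel_measurable_times bexp_measurable) auto
  qed
  have intD: "integrable (PX \<Otimes>\<^sub>M Q) (\<lambda>z. D (fst z) (snd z))"
  proof (rule PQf.integrable_const_bound[where B = Bd])
    have "AE t in Q. norm (D (fst (X, t)) (snd (X, t))) \<le> Bd" for X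
      using AEQ by eventually_elim (use bd in auto)
    then have "AE X in PX. AE t in Q. norm (D (fst (X, t)) (snd (X, t))) \<le> Bd" by (rule AE_I2)
    then show "AE z in PX \<Otimes>\<^sub>M Q. norm (D (fst z) (snd z)) \<le> Bd"
      using meas by (intro PQ.AE_pair_measure) (auto simp: case_prod_beta')
  qed (rule meas)
  have "0 \<le> (\<integral>t. (\<integral>X. D X t \<partial>PX) \<partial>Q)"
  proof (rule integral_nonneg_AE)
    show "AE t in Q. 0 \<le> (\<integral>X. D X t \<partial>PX)" using AEQ
    proof eventually_elim
      case (elim t)
      then show ?case unfolding D_def using ineq[of t] intg[of t] by simp
    qed
  qed
  also have "\<dots> = (\<integral>X. (\<integral>t. D X t \<partial>Q) \<partial>PX)"
    using PQ.Fubini_integral[of "\<lambda>X t. D X t"] intD by (simp add: case_prod_beta')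
  also have "\<dots> = (\<integral>X. bexp ?I (rr \<tau> X) (\<lambda>S. of_bool (con A B S)) \<partial>PX) - (\<integral>X. bexp ?I (rr 0 X) (\<lambda>S. of_bool (con A B S)) \<partial>PX)"
    unfolding FTC using intg \<tau> by simp
  finally show ?thesis by simp
qed

end

section \<open>Exchangeability within unit squares\<close>

definition eidx :: "'a set \<Rightarrow> 'a set set" where
  "eidx A = {e. e \<subseteq> A \<and> (card e = 1 \<or> card e = 2)}"

definition rr :: "real \<Rightarrow> (real \<Rightarrow> real) \<Rightarrow> ('a \<Rightarrow> real \<times> real) \<Rightarrow> 'a set \<Rightarrow> real" where
  "rr \<gamma> g X e = (if card e = 1 then \<gamma> else g (pdist X e))"

definition cub :: "(int \<times> int) set \<Rightarrow> lbl set" where "cub Z = {v. fst v \<in> Z}"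

definition conf :: "'a set \<Rightarrow> 'a set set \<Rightarrow> ('a + 'a set) set" where
  "conf A F = Inl ` A \<union> Inr ` F"

text \<open>The connection probability for a given set A of present vertices, averaged over
  positions, edges and marks. It depends on A only through the number of vertices in each
  square.\<close>

definition qf :: "real \<Rightarrow> (real \<Rightarrow> real) \<Rightarrow> (int \<times> int) set \<Rightarrow> (int \<times> int) set \<Rightarrow> lbl set \<Rightarrow> real" where
  "qf \<gamma> g Sa Sb A = (\<integral>X. bexp (eidx A) (rr \<gamma> g X) (\<lambda>F. of_bool (con (cub Sa) (cub Sb) (conf A F))) \<partial>PX)"

text \<open>A representative of the label sets with given counts; the vertices of the random
  connection model in Z form such a set.\<close>

definition std :: "(int \<times> int) set \<Rightarrow> (int \<times> int \<Rightarrow> nat) \<Rightarrow> lbl set" where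
  "std Z k = {v. fst v \<in> Z \<and> snd v < k (fst v)}"

definition cntv :: "lbl set \<Rightarrow> int \<times> int \<Rightarrow> nat" where
  "cntv A z = card {i. (z, i) \<in> A}"

lemma finite_eidx [simp]: "finite A \<Longrightarrow> finite (eidx A)"
  by (auto simp: eidx_def)

lemma eidx_mono: "A \<subseteq> A' \<Longrightarrow> eidx A \<subseteq> eidx A'"
  by (auto simp: eidx_def)

lemma std_eq: "std Z k = (SIGMA z:Z. {..<k z})"
  by (auto simp: std_def)

lemma finite_std [simp]: "finite Z \<Longrightarrow> finite (std Z k)"
  by (simp add: std_eq)

lemma cidx_eq: "cidx W = Inl ` W \<union> Inr ` eidx W"
  by (auto simp: cidx_def eidx_def)

lemma cadj_conf: "cadj (conf A F) x y \<longleftrightarrow> x \<noteq> y \<and> x \<in> A \<and> y \<in> A \<and> {x, y} \<in> F"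
  by (auto simp: cadj_def conf_def)

lemma con_conf: "con P Q (conf A F) \<longleftrightarrow> (\<exists>x\<in>P. \<exists>y\<in>Q. x \<in> A \<and> {x} \<in> F \<and> y \<in> A \<and> {y} \<in> F \<and> (cadj (conf A F))\<^sup>*\<^sup>* x y)"
  by (auto simp: con_def conf_def)

lemma con_conf_Int: "con P Q (conf A (F \<inter> eidx A)) = con P Q (conf A F)"
proof
  assume "con P Q (conf A F)"
  then show "con P Q (conf A (F \<inter> eidx A))"
    by (rule con_mono_gen) (auto simp: conf_def cadj_def eidx_def card_insert_if intro!: r_into_rtranclp)
qed (auto elim!: con_mono simp: conf_def)

text \<open>The dependence on one rate is affine, and its slope, the mean gain of adding the site,
  is nonnegative for increasing h.\<close>

lemma bexp_mono_rate:
  assumes "finite I" "\<And>i. i \<in> I \<Longrightarrow> 0 \<le> r i \<and> r i \<le> r' i \<and> r' i \<le> 1"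
    and "\<And>S T. S \<subseteq> T \<Longrightarrow> T \<subseteq> I \<Longrightarrow> h S \<le> h T"
  shows "bexp I r h \<le> bexp I r' h"
  using assms
proof (induction I arbitrary: h rule: finite_induct)
  case empty
  then show ?case by simp
next
  case (insert i I)
  let ?a = "bexp I r (\<lambda>S. h (insert i S))" and ?b = "bexp I r h"
  let ?a' = "bexp I r' (\<lambda>S. h (insert i S))" and ?b' = "bexp I r' h"
  have 1: "?a \<le> ?a'" using insert.prems insert.hyps by (intro insert.IH) (auto intro!: insert.prems(2))
  have 2: "?b \<le> ?b'" using insert.prems insert.hyps by (intro insert.IH) (auto intro!: insert.prems(2))
  have 3: "?b \<le> ?a" using insert.prems insert.hyps
    by (intro bexp_mono) (auto intro!: insert.prems(2) intro: order_trans)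
  have ri: "0 \<le> r i" "r i \<le> r' i" "r' i \<le> 1" using insert.prems(1)[of i] by auto
  have "r i * ?a + (1 - r i) * ?b = ?b + r i * (?a - ?b)" by (simp add: algebra_simps)
  also have "\<dots> \<le> ?b + r' i * (?a - ?b)" using ri 3 by (intro add_left_mono mult_right_mono) auto
  also have "\<dots> = r' i * ?a + (1 - r' i) * ?b" by (simp add: algebra_simps)
  also have "\<dots> \<le> r' i * ?a' + (1 - r' i) * ?b'" using 1 2 ri by (intro add_mono mult_left_mono) auto
  finally show ?case using insert.hyps by (simp add: bexp_insert)
qed

lemma bexp_one: "finite I \<Longrightarrow> (\<And>i. i \<in> I \<Longrightarrow> r i = 1) \<Longrightarrow> bexp I r h = h I"
  by (induction I arbitrary: h rule: finite_induct) (auto simp: bexp_insert)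

lemma bexp_integral:
  assumes "finite I" "\<And>S. S \<subseteq> I \<Longrightarrow> integrable N (\<Psi> S)"
  shows "(\<integral>x. bexp I r (\<lambda>S. \<Psi> S x) \<partial>N) = bexp I r (\<lambda>S. \<integral>x. \<Psi> S x \<partial>N)"
    and "integrable N (\<lambda>x. bexp I r (\<lambda>S. \<Psi> S x))"
proof -
  show "integrable N (\<lambda>x. bexp I r (\<lambda>S. \<Psi> S x))"
    unfolding bexp_def using assms(2) by (intro Bochner_Integration.integrable_sum integrable_mult_right) auto
  show "(\<integral>x. bexp I r (\<lambda>S. \<Psi> S x) \<partial>N) = bexp I r (\<lambda>S. \<integral>x. \<Psi> S x \<partial>N)"
    unfolding bexp_def using assms(2) by (subst Bochner_Integration.integral_sum) auto
qed

lemma con_relabel: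
  assumes inj: "inj_on \<pi> A" and fst: "\<And>v. v \<in> A \<Longrightarrow> fst (\<pi> v) = fst v" and F: "F \<subseteq> eidx A"
  shows "con (cub Sa) (cub Sb) (conf (\<pi> ` A) (image \<pi> ` F)) \<longleftrightarrow> con (cub Sa) (cub Sb) (conf A F)"
proof -
  have inF: "\<pi> ` e \<in> image \<pi> ` F \<longleftrightarrow> e \<in> F" if "e \<subseteq> A" for e
  proof
    assume "\<pi> ` e \<in> image \<pi> ` F"
    then obtain e' where e': "e' \<in> F" "\<pi> ` e = \<pi> ` e'" by auto
    then have "e' \<subseteq> A" using F by (auto simp: eidx_def)
    then have "e = e'" using e'(2) inj that by (simp add: inj_on_image_eq_iff)
    then show "e \<in> F" using e' by simp
  qed auto
  have adj: "cadj (conf (\<pi> ` A) (image \<pi> ` F)) (\<pi> x) (\<pi> y) \<longleftrightarrow> cadj (conf A F) x y" if "x \<in> A" "y \<in> A" for x y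
    using that inF[of "{x, y}"] inj by (auto simp: cadj_conf inj_on_eq_iff)
  have adjA: "x \<in> A \<and> y \<in> A" if "cadj (conf A F) x y" for x y using that by (simp add: cadj_conf)
  have to: "(cadj (conf (\<pi> ` A) (image \<pi> ` F)))\<^sup>*\<^sup>* (\<pi> x) (\<pi> y)" if "(cadj (conf A F))\<^sup>*\<^sup>* x y" for x y
    using that
  proof (induction rule: rtranclp_induct)
    case (step y z)
    then show ?case using adj[of y z] adjA[of y z] by (meson rtranclp.rtrancl_into_rtrancl)
  qed simp
  have bwd: "\<exists>y. y \<in> A \<and> \<pi> y = v \<and> (cadj (conf A F))\<^sup>*\<^sup>* x y"
    if "(cadj (conf (\<pi> ` A) (image \<pi> ` F)))\<^sup>*\<^sup>* u v" "u = \<pi> x" "x \<in> A" for u v x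
    using that
  proof (induction rule: rtranclp_induct)
    case base
    then show ?case by (intro exI[of _ x]) simp
  next
    case (step v w)
    then obtain y where y: "y \<in> A" "\<pi> y = v" "(cadj (conf A F))\<^sup>*\<^sup>* x y" by auto
    obtain t where t: "t \<in> A" "w = \<pi> t" using step.hyps(2) by (auto simp: cadj_conf)
    then have "cadj (conf A F) y t" using step.hyps(2) adj[of y t] y by simp
    then show ?case using y t by (intro exI[of _ t]) auto
  qed
  show ?thesis
  proof
    assume "con (cub Sa) (cub Sb) (conf A F)"
    then obtain x y where xy: "x \<in> cub Sa" "y \<in> cub Sb" "x \<in> A" "{x} \<in> F" "y \<in> A" "{y} \<in> F" "(cadj (conf A F))\<^sup>*\<^sup>* x y"
      unfolding con_conf by blast
    have "\<pi> x \<in> cub Sa" "\<pi> y \<in> cub Sb" using xy fst by (auto simp: cub_def)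
    moreover have "{\<pi> x} \<in> image \<pi> ` F" "{\<pi> y} \<in> image \<pi> ` F" using inF[of "{x}"] inF[of "{y}"] xy by auto
    ultimately show "con (cub Sa) (cub Sb) (conf (\<pi> ` A) (image \<pi> ` F))"
      using to[OF xy(7)] xy unfolding con_conf by blast
  next
    assume "con (cub Sa) (cub Sb) (conf (\<pi> ` A) (image \<pi> ` F))"
    then obtain u v where uv: "u \<in> cub Sa" "v \<in> cub Sb" "u \<in> \<pi> ` A" "{u} \<in> image \<pi> ` F" "v \<in> \<pi> ` A"
      "{v} \<in> image \<pi> ` F" "(cadj (conf (\<pi> ` A) (image \<pi> ` F)))\<^sup>*\<^sup>* u v"
      unfolding con_conf by blast
    obtain x where x: "x \<in> A" "u = \<pi> x" using uv by auto
    obtain y where y: "y \<in> A" "\<pi> y = v" "(cadj (conf A F))\<^sup>*\<^sup>* x y" using bwd[OF uv(7) x(2,1)] by auto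
    have "fst x = fst u" "fst y = fst v" using fst[OF x(1)] fst[OF y(1)] x(2) y(2) by simp_all
    then have "x \<in> cub Sa" "y \<in> cub Sb" using uv(1,2) by (simp_all add: cub_def)
    moreover have "{x} \<in> F" "{y} \<in> F" using inF[of "{x}"] inF[of "{y}"] uv(4,6) x y by simp_all
    ultimately show "con (cub Sa) (cub Sb) (conf A F)" using x y unfolding con_conf by blast
  qed
qed

lemma same_counts_bij:
  assumes "finite A" "finite A'" "\<And>z. cntv A z = cntv A' z"
  shows "\<exists>\<pi>. inj_on \<pi> A \<and> \<pi> ` A = A' \<and> (\<forall>v\<in>A. fst (\<pi> v) = fst v)"
proof -
  have fin: "finite {i. (z, i) \<in> A}" if "finite A" for A :: "lbl set" and z
  proof -
    have "{i. (z, i) \<in> A} \<subseteq> snd ` A" by force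
    then show ?thesis using that finite_subset by blast
  qed
  have "\<exists>h. bij_betw h {i. (z, i) \<in> A} {i. (z, i) \<in> A'}" for z
    using finite_same_card_bij[OF fin[OF assms(1)] fin[OF assms(2)]] assms(3)[of z] by (auto simp: cntv_def)
  then obtain h where h: "\<And>z. bij_betw (h z) {i. (z, i) \<in> A} {i. (z, i) \<in> A'}" by metis
  define \<pi> where "\<pi> v = (fst v, h (fst v) (snd v))" for v :: lbl
  have "inj_on \<pi> A"
  proof (rule inj_onI)
    fix v w assume vw: "v \<in> A" "w \<in> A" "\<pi> v = \<pi> w"
    then have "fst v = fst w" "h (fst v) (snd v) = h (fst v) (snd w)" by (auto simp: \<pi>_def)
    moreover have "(fst v, snd v) \<in> A" "(fst v, snd w) \<in> A" using vw \<open>fst v = fst w\<close> by (metis prod.collapse)+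
    ultimately have "snd v = snd w" using bij_betw_imp_inj_on[OF h[of "fst v"]] by (auto simp: inj_on_def)
    then show "v = w" using \<open>fst v = fst w\<close> by (simp add: prod_eq_iff)
  qed
  moreover have "\<pi> ` A = A'"
  proof
    show "\<pi> ` A \<subseteq> A'"
    proof
      fix w assume "w \<in> \<pi> ` A"
      then obtain v where v: "v \<in> A" "w = \<pi> v" by auto
      then have "snd v \<in> {i. (fst v, i) \<in> A}" by simp
      then have "h (fst v) (snd v) \<in> {i. (fst v, i) \<in> A'}" using bij_betw_apply[OF h] by blast
      then show "w \<in> A'" using v by (simp add: \<pi>_def)
    qed
    show "A' \<subseteq> \<pi> ` A"
    proof
      fix w assume w: "w \<in> A'"
      then have "snd w \<in> {i. (fst w, i) \<in> A'}" by simp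
      then obtain j where j: "(fst w, j) \<in> A" "snd w = h (fst w) j" using bij_betw_imp_surj_on[OF h[of "fst w"]] by blast
      then have "w = \<pi> (fst w, j)" by (simp add: \<pi>_def prod_eq_iff)
      then show "w \<in> \<pi> ` A" using j by blast
    qed
  qed
  ultimately show ?thesis by (intro exI[of _ \<pi>]) (auto simp: \<pi>_def)
qed

text \<open>The map \<pi> only exchanges identically distributed coordinates, as it preserves
  squares. It is injective on A alone, so the argument passes through the product over A.\<close>

lemma PX_relabel:
  fixes G :: "(lbl \<Rightarrow> real \<times> real) \<Rightarrow> real"
  assumes inj: "inj_on \<pi> A" and fst: "\<And>v. v \<in> A \<Longrightarrow> fst (\<pi> v) = fst v"
    and G: "G \<in> borel_measurable PX" and dep: "\<And>X Y. (\<And>v. v \<in> A \<Longrightarrow> X v = Y v) \<Longrightarrow> G X = G Y"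
  shows "(\<integral>X. G (\<lambda>v. X (\<pi> v)) \<partial>PX) = (\<integral>X. G X \<partial>PX)"
proof -
  let ?M = "\<lambda>v::lbl. uniform_measure lborel (cube (fst v))"
  let ?PA = "PiM A ?M"
  \<comment> \<open>An arbitrary value outside A, where G does not look.\<close>
  define ext where "ext Y = (\<lambda>v. if v \<in> A then Y v else (0, 0))" for Y :: "lbl \<Rightarrow> real \<times> real"
  have sp: "space (?M v) = UNIV" for v by simp
  have extm: "ext \<in> ?PA \<rightarrow>\<^sub>M PX" unfolding PX_def
  proof (rule measurable_PiM_single')
    show "(\<lambda>Y. ext Y i) \<in> ?PA \<rightarrow>\<^sub>M ?M i" for i
      by (cases "i \<in> A") (auto simp: ext_def)
  qed (auto simp: PiE_iff extensional_def)
  have GA: "(\<lambda>Y. G (ext Y)) \<in> borel_measurable ?PA" using extm G by (rule measurable_compose)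
  have Meq: "(\<Pi>\<^sub>M i\<in>A. ?M (\<pi> i)) = ?PA" using fst by (intro PiM_cong) auto
  have 1: "distr PX ?PA (\<lambda>X. \<lambda>n\<in>A. X (\<pi> n)) = ?PA"
    using distr_PiM_reindex[of UNIV ?M \<pi> A] inj prob_space_unif unfolding Meq PX_def by auto
  have 2: "distr PX ?PA (\<lambda>X. \<lambda>n\<in>A. X n) = ?PA"
    using distr_PiM_reindex[of UNIV ?M "\<lambda>x. x" A] prob_space_unif unfolding PX_def by auto
  have m1: "(\<lambda>X. \<lambda>n\<in>A. X (\<pi> n)) \<in> PX \<rightarrow>\<^sub>M ?PA"
  proof (rule measurable_restrict)
    fix n assume n: "n \<in> A"
    have "(\<lambda>X. X (\<pi> n)) \<in> PX \<rightarrow>\<^sub>M ?M (\<pi> n)" unfolding PX_def by simp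
    then show "(\<lambda>X. X (\<pi> n)) \<in> PX \<rightarrow>\<^sub>M ?M n" using fst[OF n] by simp
  qed
  have m2: "(\<lambda>X. \<lambda>n\<in>A. X n) \<in> PX \<rightarrow>\<^sub>M ?PA" unfolding PX_def by (rule measurable_restrict) simp
  have "(\<integral>X. G (\<lambda>v. X (\<pi> v)) \<partial>PX) = (\<integral>X. G (ext (\<lambda>n\<in>A. X (\<pi> n))) \<partial>PX)"
    by (intro Bochner_Integration.integral_cong refl dep) (auto simp: ext_def)
  also have "\<dots> = (\<integral>Y. G (ext Y) \<partial>distr PX ?PA (\<lambda>X. \<lambda>n\<in>A. X (\<pi> n)))"
    using m1 GA by (subst integral_distr) auto
  also have "\<dots> = (\<integral>Y. G (ext Y) \<partial>distr PX ?PA (\<lambda>X. \<lambda>n\<in>A. X n))" unfolding 1 2 ..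
  also have "\<dots> = (\<integral>X. G (ext (\<lambda>n\<in>A. X n)) \<partial>PX)"
    using m2 GA by (subst integral_distr) auto
  also have "\<dots> = (\<integral>X. G X \<partial>PX)"
    by (intro Bochner_Integration.integral_cong refl dep) (auto simp: ext_def)
  finally show ?thesis .
qed

lemma pdist_image: "pdist X (\<pi> ` e) = pdist (\<lambda>v. X (\<pi> v)) e"
proof -
  have "(\<lambda>(a, b). dist (X a) (X b)) ` (\<pi> ` e \<times> \<pi> ` e) = (\<lambda>(a, b). dist (X (\<pi> a)) (X (\<pi> b))) ` (e \<times> e)"
    by (auto simp: image_iff)
  then show ?thesis by (simp add: pdist_def)
qed

lemma pdist_cong: "(\<And>v. v \<in> e \<Longrightarrow> X v = Y v) \<Longrightarrow> pdist X e = pdist Y e"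
  unfolding pdist_def by (intro arg_cong[of _ _ Max] image_cong) auto

text \<open>What remains of a connection function under multiplication by an edge probability,
  without reference to its range.\<close>

locale conn_meas =
  fixes g :: "real \<Rightarrow> real"
  assumes g01: "\<And>r. 0 \<le> r \<Longrightarrow> 0 \<le> g r \<and> g r \<le> 1"
    and g_anti: "\<And>r t. 0 \<le> r \<Longrightarrow> r \<le> t \<Longrightarrow> g t \<le> g r"
begin

lemma g_max_measurable: "(\<lambda>r. g (max 0 r)) \<in> borel_measurable borel"
proof -
  have "mono (\<lambda>r. - g (max 0 r))"
    by (rule monoI) (use g_anti in auto)
  then have "(\<lambda>r. - g (max 0 r)) \<in> borel_measurable borel" by (rule borel_measurable_mono)
  then have "(\<lambda>r. - (- g (max 0 r))) \<in> borel_measurable borel" by measurable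
  then show ?thesis by simp
qed

lemma g_pdist_measurable:
  assumes "card e = 2" shows "(\<lambda>X. g (pdist X e)) \<in> borel_measurable PX"
proof -
  obtain a b where e: "e = {a, b}" using assms unfolding card_2_iff by blast
  have "(\<lambda>X. g (max 0 (dist (X a) (X b)))) \<in> borel_measurable PX"
    using g_max_measurable by measurable
  then show ?thesis unfolding e pdist_pair by simp
qed

lemma rr01: "0 \<le> \<gamma> \<Longrightarrow> \<gamma> \<le> 1 \<Longrightarrow> e \<in> eidx A \<Longrightarrow> 0 \<le> rr \<gamma> g X e \<and> rr \<gamma> g X e \<le> 1"
proof -
  assume *: "0 \<le> \<gamma>" "\<gamma> \<le> 1" "e \<in> eidx A"
  then have "finite e" "e \<noteq> {}" by (auto simp: eidx_def intro: card_ge_0_finite)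
  then show ?thesis using g01[OF pdist_nonneg] * by (auto simp: rr_def)
qed

lemma rr_measurable: "e \<in> eidx A \<Longrightarrow> (\<lambda>X. rr \<gamma> g X e) \<in> borel_measurable PX"
  using g_pdist_measurable[of e] by (auto simp: rr_def eidx_def)

lemma bexp_rr_integrable:
  assumes "finite A" "0 \<le> \<gamma>" "\<gamma> \<le> 1" "I \<subseteq> eidx A" "\<And>S. S \<subseteq> I \<Longrightarrow> \<bar>h S\<bar> \<le> 1"
  shows "integrable PX (\<lambda>X. bexp I (rr \<gamma> g X) h)"
proof -
  interpret P: prob_space PX by (rule prob_space_PX)
  have fin: "finite I" using assms finite_subset finite_eidx by metis
  show ?thesis
  proof (rule P.integrable_const_bound[where B = 1])
    have "0 \<le> rr \<gamma> g X i \<and> rr \<gamma> g X i \<le> 1" if "i \<in> I" for X i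
      using rr01[OF assms(2,3), of i A X] that assms(4) by blast
    then have "\<bar>bexp I (rr \<gamma> g X) h\<bar> \<le> 1" for X using assms(5) by (intro bexp_abs_le[OF fin]) auto
    then show "AE X in PX. norm (bexp I (rr \<gamma> g X) h) \<le> 1" by simp
    show "(\<lambda>X. bexp I (rr \<gamma> g X) h) \<in> borel_measurable PX"
      using assms by (intro bexp_measurable[OF fin] rr_measurable[of _ A]) auto
  qed
qed

text \<open>Equal counts give a bijection that moves labels within squares only; it preserves the
  law of the positions and carries connections to connections.\<close>

lemma qf_exchange:
  assumes fin: "finite A" "finite A'" and \<gamma>: "0 \<le> \<gamma>" "\<gamma> \<le> 1" and cnt: "\<And>z. cntv A z = cntv A' z"
  shows "qf \<gamma> g Sa Sb A = qf \<gamma> g Sa Sb A'"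
proof -
  obtain \<pi> where \<pi>: "inj_on \<pi> A" "\<pi> ` A = A'" "\<And>v. v \<in> A \<Longrightarrow> fst (\<pi> v) = fst v"
    using same_counts_bij[OF fin cnt] by blast
  have inj2: "inj_on (image \<pi>) (eidx A)"
    by (rule inj_onI) (use \<pi>(1) in \<open>auto simp: eidx_def inj_on_image_eq_iff\<close>)
  have card\<pi>: "card (\<pi> ` e) = card e" if "e \<subseteq> A" for e
    using \<pi>(1) that by (intro card_image) (auto intro: inj_on_subset)
  have E: "eidx A' = image \<pi> ` eidx A"
  proof
    show "image \<pi> ` eidx A \<subseteq> eidx A'" using card\<pi> \<pi>(2) by (auto simp: eidx_def)
    show "eidx A' \<subseteq> image \<pi> ` eidx A"
    proof
      fix e' assume e': "e' \<in> eidx A'"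
      then obtain e where "e \<subseteq> A" "e' = \<pi> ` e" using \<pi>(2) by (auto simp: eidx_def subset_image_iff)
      then show "e' \<in> image \<pi> ` eidx A" using e' card\<pi>[of e] by (auto simp: eidx_def)
    qed
  qed
  have "bexp (eidx A') (rr \<gamma> g X) (\<lambda>F. of_bool (con (cub Sa) (cub Sb) (conf A' F)))
     = bexp (eidx A) (rr \<gamma> g (\<lambda>v. X (\<pi> v))) (\<lambda>F. of_bool (con (cub Sa) (cub Sb) (conf A F)))" for X
    unfolding E bexp_reindex[OF finite_eidx[OF fin(1)] inj2]
  proof (intro bexp_cong)
    show "rr \<gamma> g X (\<pi> ` e) = rr \<gamma> g (\<lambda>v. X (\<pi> v)) e" if "e \<in> eidx A" for e
      using that card\<pi>[of e] by (auto simp: rr_def pdist_image eidx_def)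
    show "of_bool (con (cub Sa) (cub Sb) (conf A' (image \<pi> ` F))) = (of_bool (con (cub Sa) (cub Sb) (conf A F)) :: real)"
      if "F \<subseteq> eidx A" for F
      using con_relabel[OF \<pi>(1,3) that] \<pi>(2) by simp
  qed
  then have "qf \<gamma> g Sa Sb A' = (\<integral>X. bexp (eidx A) (rr \<gamma> g (\<lambda>v. X (\<pi> v))) (\<lambda>F. of_bool (con (cub Sa) (cub Sb) (conf A F))) \<partial>PX)"
    by (simp add: qf_def)
  also have "\<dots> = qf \<gamma> g Sa Sb A" unfolding qf_def
  proof (rule PX_relabel[OF \<pi>(1,3)])
    show "(\<lambda>X. bexp (eidx A) (rr \<gamma> g X) (\<lambda>F. of_bool (con (cub Sa) (cub Sb) (conf A F)))) \<in> borel_measurable PX"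
      using fin by (intro bexp_measurable rr_measurable) auto
    fix X Y :: "lbl \<Rightarrow> real \<times> real" assume "\<And>v. v \<in> A \<Longrightarrow> X v = Y v"
    then have "rr \<gamma> g X e = rr \<gamma> g Y e" if "e \<in> eidx A" for e
      using that by (auto simp: rr_def eidx_def intro!: arg_cong[of _ _ g] pdist_cong)
    then show "bexp (eidx A) (rr \<gamma> g X) (\<lambda>F. of_bool (con (cub Sa) (cub Sb) (conf A F)))
        = bexp (eidx A) (rr \<gamma> g Y) (\<lambda>F. of_bool (con (cub Sa) (cub Sb) (conf A F)))"
      by (intro bexp_cong) auto
  qed
  finally show ?thesis by simp
qed

lemma qf_bounds:
  assumes "finite A" "0 \<le> \<gamma>" "\<gamma> \<le> 1"
  shows "0 \<le> qf \<gamma> g Sa Sb A" "qf \<gamma> g Sa Sb A \<le> 1"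
proof -
  interpret P: prob_space PX by (rule prob_space_PX)
  let ?b = "\<lambda>X. bexp (eidx A) (rr \<gamma> g X) (\<lambda>F. of_bool (con (cub Sa) (cub Sb) (conf A F)))"
  have b: "0 \<le> ?b X" "\<bar>?b X\<bar> \<le> 1" for X
    using assms rr01[of \<gamma>] by (auto intro!: bexp_nonneg bexp_abs_le)
  show "0 \<le> qf \<gamma> g Sa Sb A" unfolding qf_def using b by (intro integral_nonneg_AE) auto
  have "qf \<gamma> g Sa Sb A \<le> (\<integral>X. 1 \<partial>PX)" unfolding qf_def
    using b(2) assms by (intro integral_mono bexp_rr_integrable) (auto simp: abs_le_iff)
  then show "qf \<gamma> g Sa Sb A \<le> 1" by (simp add: P.prob_space)
qed

lemma qf_mono:
  assumes "A \<subseteq> A'" "finite A'" "0 \<le> \<gamma>" "\<gamma> \<le> 1"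
  shows "qf \<gamma> g Sa Sb A \<le> qf \<gamma> g Sa Sb A'"
  unfolding qf_def
proof (intro integral_mono bexp_rr_integrable)
  fix X
  have sub: "eidx A \<subseteq> eidx A'" using assms(1) by (auto simp: eidx_def)
  have "bexp (eidx A) (rr \<gamma> g X) (\<lambda>F. of_bool (con (cub Sa) (cub Sb) (conf A F)))
     = bexp (eidx A') (rr \<gamma> g X) (\<lambda>F. of_bool (con (cub Sa) (cub Sb) (conf A F)))"
    using assms(2) sub by (intro bexp_subset[symmetric]) (auto simp: con_conf_Int)
  also have "\<dots> \<le> bexp (eidx A') (rr \<gamma> g X) (\<lambda>F. of_bool (con (cub Sa) (cub Sb) (conf A' F)))"
  proof (intro bexp_mono)
    show "of_bool (con (cub Sa) (cub Sb) (conf A F)) \<le> (of_bool (con (cub Sa) (cub Sb) (conf A' F)) :: real)" for F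
      using con_mono[of "cub Sa" "cub Sb" "conf A F" "conf A' F"] assms(1) by (auto simp: conf_def)
  qed (use assms rr01[of \<gamma> _ A'] in auto)
  finally show "bexp (eidx A) (rr \<gamma> g X) (\<lambda>F. of_bool (con (cub Sa) (cub Sb) (conf A F)))
     \<le> bexp (eidx A') (rr \<gamma> g X) (\<lambda>F. of_bool (con (cub Sa) (cub Sb) (conf A' F)))" .
qed (use assms in \<open>auto dest: subsetD[OF eidx_mono[OF assms(1)]] intro: finite_subset\<close>)

end

section \<open>Poisson counts and thinning\<close>

lemma pmf_integrable_01: 
  fixes h :: "'a \<Rightarrow> real" 
  assumes "\<And>y. 0 \<le> h y \<and> h y \<le> 1" shows "integrable (measure_pmf p) h"
  using assms by (intro measure_pmf.integrable_const_bound[where B = 1]) auto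

lemma pmf_expectation_01:
  fixes h :: "'a \<Rightarrow> real" 
  assumes "\<And>y. 0 \<le> h y \<and> h y \<le> 1"
  shows "0 \<le> measure_pmf.expectation p h \<and> measure_pmf.expectation p h \<le> 1"
proof -
  have "measure_pmf.expectation p h \<le> measure_pmf.expectation p (\<lambda>_. 1)"
    using assms pmf_integrable_01[OF assms] by (intro integral_mono) auto
  then show ?thesis using assms by (auto intro!: integral_nonneg_AE)
qed

lemma pmf_expectation_bind_01:
  fixes h :: "'b \<Rightarrow> real" 
  assumes h: "\<And>y. 0 \<le> h y \<and> h y \<le> 1"
  shows "measure_pmf.expectation (bind_pmf p f) h = measure_pmf.expectation p (\<lambda>x. measure_pmf.expectation (f x) h)"
proof -
  have nn': "(\<integral>\<^sup>+x. ennreal (k x) \<partial>measure_pmf q) = ennreal (measure_pmf.expectation q k)"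
    if "\<And>y. 0 \<le> k y \<and> k y \<le> 1" for q :: "'b pmf" and k
    using that pmf_integrable_01[OF that] by (intro nn_integral_eq_integral) auto
  have nn'': "(\<integral>\<^sup>+x. ennreal (k x) \<partial>measure_pmf q) = ennreal (measure_pmf.expectation q k)"
    if "\<And>y. 0 \<le> k y \<and> k y \<le> 1" for q :: "'a pmf" and k
    using that pmf_integrable_01[OF that] by (intro nn_integral_eq_integral) auto
  have "ennreal (measure_pmf.expectation (bind_pmf p f) h) = (\<integral>\<^sup>+x. ennreal (h x) \<partial>bind_pmf p f)"
    by (rule nn'[of h, OF h, symmetric])
  also have "\<dots> = (\<integral>\<^sup>+x. \<integral>\<^sup>+y. ennreal (h y) \<partial>f x \<partial>p)" by (rule nn_integral_bind_pmf)
  also have "\<dots> = (\<integral>\<^sup>+x. ennreal (measure_pmf.expectation (f x) h) \<partial>p)"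
    by (intro nn_integral_cong nn' h)
  also have "\<dots> = ennreal (measure_pmf.expectation p (\<lambda>x. measure_pmf.expectation (f x) h))"
    using pmf_expectation_01[of h, OF h] by (intro nn'') auto
  finally show ?thesis
    using pmf_expectation_01[of h, OF h] pmf_expectation_01[of "\<lambda>x. measure_pmf.expectation (f x) h" p]
    by (subst (asm) ennreal_inj) auto
qed

lemma bexp_binomial:
  fixes g :: "nat \<Rightarrow> real"
  assumes "finite V" and s: "0 \<le> s" "s \<le> 1" and g: "\<And>n. 0 \<le> g n \<and> g n \<le> 1"
  shows "bexp V (\<lambda>_. s) (\<lambda>A. g (card A)) = measure_pmf.expectation (binomial_pmf (card V) s) g"
  using assms(1) g
proof (induction V arbitrary: g rule: finite_induct)
  case empty
  then show ?case using s by (simp add: binomial_pmf_0)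
next
  case (insert v V)
  have "bexp V (\<lambda>_. s) (\<lambda>A. g (card (insert v A))) = bexp V (\<lambda>_. s) (\<lambda>A. g (Suc (card A)))"
    using insert.hyps by (intro bexp_cong refl) (auto simp: card_insert_if finite_subset subset_iff)
  then have "bexp (insert v V) (\<lambda>_. s) (\<lambda>A. g (card A))
     = s * measure_pmf.expectation (binomial_pmf (card V) s) (\<lambda>n. g (Suc n)) + (1 - s) * measure_pmf.expectation (binomial_pmf (card V) s) g"
    using insert.hyps insert.IH[of "\<lambda>n. g (Suc n)"] insert.IH[of g] insert.prems by (simp add: bexp_insert)
  also have "\<dots> = measure_pmf.expectation (binomial_pmf (Suc (card V)) s) g"
    using s insert.prems by (subst binomial_pmf_Suc) (auto simp: pmf_expectation_bind_01)
  finally show ?case using insert.hyps by simp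
qed

lemma cntv_std: "cntv (std Z k) z = (if z \<in> Z then k z else 0)"
  by (auto simp: cntv_def std_def)

lemma bexp_counts:
  fixes h :: "(int \<times> int \<Rightarrow> nat) \<Rightarrow> real"
  assumes "finite Z" and s: "0 \<le> s" "s \<le> 1" and h: "\<And>k. 0 \<le> h k \<and> h k \<le> 1"
  shows "bexp (std Z n) (\<lambda>_. s) (\<lambda>A. h (cntv A)) = measure_pmf.expectation (Pi_pmf Z 0 (\<lambda>z. binomial_pmf (n z) s)) h"
  using assms(1) h
proof (induction Z arbitrary: h rule: finite_induct)
  case empty
  then show ?case by (simp add: std_def cntv_def)
next
  case (insert z Z)
  let ?V = "{z} \<times> {..<n z}"
  have eq: "std (insert z Z) n = ?V \<union> std Z n" by (auto simp: std_def)
  have disj: "?V \<inter> std Z n = {}" using insert.hyps by (auto simp: std_def)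
  have "bexp (std (insert z Z) n) (\<lambda>_. s) (\<lambda>A. h (cntv A))
      = bexp ?V (\<lambda>_. s) (\<lambda>A1. bexp (std Z n) (\<lambda>_. s) (\<lambda>A2. h (cntv (A1 \<union> A2))))"
    unfolding eq using insert.hyps disj by (intro bexp_Un) auto
  also have "\<dots> = bexp ?V (\<lambda>_. s) (\<lambda>A1. bexp (std Z n) (\<lambda>_. s) (\<lambda>A2. h ((cntv A2)(z := card A1))))"
  proof (intro bexp_cong refl arg_cong[of _ _ h] ext)
    fix A1 A2 z' assume A: "A1 \<subseteq> ?V" "A2 \<subseteq> std Z n"
    show "cntv (A1 \<union> A2) z' = ((cntv A2)(z := card A1)) z'"
    proof (cases "z' = z")
      case True
      then have "{i. (z', i) \<in> A1 \<union> A2} = {i. (z, i) \<in> A1}" using A insert.hyps by (auto simp: std_def)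
      moreover have "card {i. (z, i) \<in> A1} = card A1"
      proof -
        have "A1 = Pair z ` {i. (z, i) \<in> A1}" using A by auto
        moreover have "card (Pair z ` {i. (z, i) \<in> A1}) = card {i. (z, i) \<in> A1}"
          by (rule card_image) (auto simp: inj_on_def)
        ultimately show ?thesis by simp
      qed
      ultimately show ?thesis using True by (simp add: cntv_def)
    next
      case False
      then have "{i. (z', i) \<in> A1 \<union> A2} = {i. (z', i) \<in> A2}" using A by auto
      then show ?thesis using False by (simp add: cntv_def)
    qed
  qed
  also have "\<dots> = bexp ?V (\<lambda>_. s) (\<lambda>A1. measure_pmf.expectation (Pi_pmf Z 0 (\<lambda>z. binomial_pmf (n z) s)) (\<lambda>k. h (k(z := card A1))))"
    using insert.prems by (intro bexp_cong refl insert.IH) auto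
  also have "\<dots> = measure_pmf.expectation (binomial_pmf (n z) s) (\<lambda>y. measure_pmf.expectation (Pi_pmf Z 0 (\<lambda>z. binomial_pmf (n z) s)) (\<lambda>k. h (k(z := y))))"
    using bexp_binomial[of ?V s "\<lambda>y. measure_pmf.expectation (Pi_pmf Z 0 (\<lambda>z. binomial_pmf (n z) s)) (\<lambda>k. h (k(z := y)))"]
      s insert.prems pmf_expectation_01[of "\<lambda>k. h (k(z := _))"] by (simp add: card_cartesian_product)
  also have "\<dots> = measure_pmf.expectation (Pi_pmf (insert z Z) 0 (\<lambda>z. binomial_pmf (n z) s)) h"
    using insert.hyps insert.prems by (subst Pi_pmf_insert') (auto simp: pmf_expectation_bind_01)
  finally show ?case .
qed

text \<open>Terms with n < k vanish, and the shifted series is the exponential series of (1 - p) *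
  lam.\<close>

lemma poisson_thinning:
  assumes lam: "0 < lam" and p: "0 < p" "p \<le> 1"
  shows "bind_pmf (poisson_pmf lam) (\<lambda>n. binomial_pmf n p) = poisson_pmf (p * lam)"
proof (rule pmf_eqI)
  fix k
  let ?t = "\<lambda>n. lam ^ n / fact n * exp (- lam) * (real (n choose k) * p ^ k * (1 - p) ^ (n - k))"
  have t: "pmf (poisson_pmf lam) n * pmf (binomial_pmf n p) k = ?t n" for n
    using lam p by (simp add: pmf_poisson)
  have "(\<lambda>m. ?t (m + k)) sums (exp (- lam) * (p * lam) ^ k / fact k * exp ((1 - p) * lam))"
  proof -
    have "(\<lambda>m. exp (- lam) * (p * lam) ^ k / fact k * (((1 - p) * lam) ^ m /\<^sub>R fact m))
        sums (exp (- lam) * (p * lam) ^ k / fact k * exp ((1 - p) * lam))"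
      by (intro sums_mult exp_converges)
    also have "(\<lambda>m. exp (- lam) * (p * lam) ^ k / fact k * (((1 - p) * lam) ^ m /\<^sub>R fact m)) = (\<lambda>m. ?t (m + k))"
    proof
      fix m
      define q where "q = 1 - p"
      have "real ((m + k) choose k) = fact (m + k) / (fact k * fact m)"
        by (subst binomial_fact) auto
      then show "exp (- lam) * (p * lam) ^ k / fact k * (((1 - p) * lam) ^ m /\<^sub>R fact m) = ?t (m + k)"
        unfolding q_def[symmetric] by (simp add: field_simps power_mult_distrib power_add)
    qed
    finally show ?thesis .
  qed
  also have "exp (- lam) * (p * lam) ^ k / fact k * exp ((1 - p) * lam) = (p * lam) ^ k / fact k * exp (- (p * lam))"
  proof -
    have "exp (- lam) * exp ((1 - p) * lam) = exp (- (p * lam))" by (simp add: exp_add[symmetric] algebra_simps)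
    then show ?thesis by (simp add: mult.commute mult.left_commute)
  qed
  finally have "?t sums ((p * lam) ^ k / fact k * exp (- (p * lam)))"
    by (subst (asm) sums_iff_shift) (simp add: binomial_eq_0)
  then have su: "(\<lambda>n. pmf (poisson_pmf lam) n * pmf (binomial_pmf n p) k) sums pmf (poisson_pmf (p * lam)) k"
    using lam p by (simp add: t pmf_poisson)
  have "ennreal (pmf (bind_pmf (poisson_pmf lam) (\<lambda>n. binomial_pmf n p)) k)
      = (\<Sum>n. ennreal (pmf (poisson_pmf lam) n * pmf (binomial_pmf n p) k))"
    by (simp add: ennreal_pmf_bind nn_integral_measure_pmf nn_integral_count_space_nat ennreal_mult pmf_nonneg)
  also have "\<dots> = ennreal (pmf (poisson_pmf (p * lam)) k)"
    using su by (intro suminf_ennreal_eq) (auto simp: pmf_nonneg)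
  finally show "pmf (bind_pmf (poisson_pmf lam) (\<lambda>n. binomial_pmf n p)) k = pmf (poisson_pmf (p * lam)) k"
    by (simp add: pmf_nonneg)
qed

lemma binomial_poisson_limit:
  assumes lam: "0 < lam"
  shows "(\<lambda>M. pmf (binomial_pmf M (lam / real M)) k) \<longlonglongrightarrow> pmf (poisson_pmf lam) k"
proof -
  let ?a = "\<lambda>M::nat. (\<Prod>i=0..<k. 1 - real i / real M) / fact k * lam ^ k * (1 + (- lam) / real M) ^ M / (1 - lam / real M) ^ k"
  have z: "(\<lambda>M::nat. c / real M) \<longlonglongrightarrow> 0" for c :: real by (rule lim_const_over_n)
  have "?a \<longlonglongrightarrow> (\<Prod>i=0..<k. 1 - 0) / fact k * lam ^ k * exp (- lam) / (1 - 0) ^ k"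
    by (intro tendsto_intros z tendsto_exp_limit_sequentially) auto
  moreover have "eventually (\<lambda>M. ?a M = pmf (binomial_pmf M (lam / real M)) k) sequentially"
    using eventually_ge_at_top[of "max (Suc k) (nat \<lceil>lam\<rceil> + 1)"]
  proof eventually_elim
    case (elim M)
    have M: "0 < real M" "k \<le> M" using elim by auto
    have "lam \<le> real (nat \<lceil>lam\<rceil>)" by (rule real_nat_ceiling_ge)
    then have lM: "lam < real M" using elim by linarith
    have ne: "1 - lam / real M \<noteq> 0" using lM M by (simp add: field_simps)
    have "real (M choose k) = (\<Prod>i=0..<k. real M - real i) / fact k"
      by (simp add: binomial_gbinomial gbinomial_prod_rev)
    also have "(\<Prod>i=0..<k. real M - real i) = (\<Prod>i=0..<k. real M * (1 - real i / real M))"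
      using M by (intro prod.cong) (auto simp: field_simps)
    also have "\<dots> = real M ^ k * (\<Prod>i=0..<k. 1 - real i / real M)" by (simp add: prod.distrib)
    finally have c: "real (M choose k) = real M ^ k * (\<Prod>i=0..<k. 1 - real i / real M) / fact k" .
    have pw: "(1 - lam / real M) ^ (M - k) = (1 - lam / real M) ^ M / (1 - lam / real M) ^ k"
      using ne M by (simp add: power_diff)
    have "pmf (binomial_pmf M (lam / real M)) k = real (M choose k) * (lam / real M) ^ k * (1 - lam / real M) ^ (M - k)"
      using lam lM M by (subst pmf_binomial) (auto simp: field_simps)
    also have "\<dots> = ?a M" unfolding c pw using M by (simp add: power_divide)
    finally show ?case by simp
  qed
  ultimately show ?thesis using lam by (simp add: pmf_poisson Lim_transform_eventually)
qed

text \<open>The limit has total mass 1, so a finite set carries almost all of it; pointwise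
  convergence on that set bounds the expectations from below. The same bound for 1 - h works from
  above.\<close>

lemma pmf_tendsto_expectation:
  fixes h :: "'a \<Rightarrow> real"
  assumes lim: "\<And>x. (\<lambda>n. pmf (P n) x) \<longlonglongrightarrow> pmf p x" and h: "\<And>y. 0 \<le> h y \<and> h y \<le> 1"
  shows "(\<lambda>n. measure_pmf.expectation (P n) h) \<longlonglongrightarrow> measure_pmf.expectation p h"
proof -
  have lower: "eventually (\<lambda>n. measure_pmf.expectation p h - \<epsilon> < measure_pmf.expectation (P n) h) sequentially"
    if eps: "0 < \<epsilon>" and h: "\<And>y. 0 \<le> h y \<and> h y \<le> 1" for \<epsilon> and h :: "'a \<Rightarrow> real"
  proof -
    define T where "T K = from_nat_into (set_pmf p) ` {..K::nat}" for K
    have "incseq T" by (auto simp: T_def incseq_def)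
    then have "(\<lambda>K. measure_pmf.prob p (T K)) \<longlonglongrightarrow> measure_pmf.prob p (\<Union>K. T K)"
      by (intro measure_pmf.finite_Lim_measure_incseq) auto
    moreover have "(\<Union>K. T K) = set_pmf p"
    proof -
      have "(\<Union>K. T K) = range (from_nat_into (set_pmf p))" by (auto simp: T_def)
      then show ?thesis by (simp add: range_from_nat_into set_pmf_not_empty)
    qed
    moreover have "measure_pmf.prob p (set_pmf p) = 1" by (simp add: measure_pmf.prob_eq_1 AE_measure_pmf)
    ultimately have "eventually (\<lambda>K. 1 - \<epsilon> / 2 < measure_pmf.prob p (T K)) sequentially"
      using eps by (auto intro!: order_tendstoD(1))
    then obtain K where K: "1 - \<epsilon> / 2 < measure_pmf.prob p (T K)" by (auto simp: eventually_sequentially)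
    have finT: "finite (T K)" by (simp add: T_def)
    have sumT: "measure_pmf.expectation q (\<lambda>x. h x * indicator (T K) x) = (\<Sum>x\<in>T K. h x * pmf q x)" for q
      using finT by (subst integral_measure_pmf_real[of "T K"]) (auto simp: indicator_def intro!: sum.cong)
    have h1: "0 \<le> h x * indicator (T K) x \<and> h x * indicator (T K) x \<le> 1" for x using h[of x] by (auto simp: indicator_def)
    have "measure_pmf.expectation p h \<le> measure_pmf.expectation p (\<lambda>x. h x * indicator (T K) x + (1 - indicator (T K) x))"
      using h by (intro integral_mono Bochner_Integration.integrable_add pmf_integrable_01 h1) (auto simp: indicator_def)
    also have "\<dots> = measure_pmf.expectation p (\<lambda>x. h x * indicator (T K) x) + measure_pmf.expectation p (\<lambda>x. 1 - indicator (T K) x)"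
      by (intro Bochner_Integration.integral_add pmf_integrable_01 h1) (auto simp: indicator_def)
    also have "measure_pmf.expectation p (\<lambda>x. 1 - indicator (T K) x :: real) = 1 - measure_pmf.prob p (T K)"
      by (subst Bochner_Integration.integral_diff) (auto simp: pmf_integrable_01 indicator_def intro!: pmf_integrable_01)
    finally have 1: "measure_pmf.expectation p h - \<epsilon> / 2 < (\<Sum>x\<in>T K. h x * pmf p x)"
      using K sumT[of p] by linarith
    have "(\<lambda>n. \<Sum>x\<in>T K. h x * pmf (P n) x) \<longlonglongrightarrow> (\<Sum>x\<in>T K. h x * pmf p x)"
      by (intro tendsto_intros lim)
    then have "eventually (\<lambda>n. measure_pmf.expectation p h - \<epsilon> < (\<Sum>x\<in>T K. h x * pmf (P n) x)) sequentially"
      using 1 eps by (intro order_tendstoD(1)) auto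
    then show ?thesis
    proof eventually_elim
      case (elim n)
      have "(\<Sum>x\<in>T K. h x * pmf (P n) x) \<le> measure_pmf.expectation (P n) h"
        unfolding sumT[symmetric] using h by (intro integral_mono pmf_integrable_01 h1) (auto simp: indicator_def)
      then show ?case using elim by linarith
    qed
  qed
  show ?thesis
  proof (rule order_tendstoI)
    fix a assume "a < measure_pmf.expectation p h"
    then show "eventually (\<lambda>n. a < measure_pmf.expectation (P n) h) sequentially"
      using lower[of "measure_pmf.expectation p h - a" h] h by simp
  next
    fix a assume a: "measure_pmf.expectation p h < a"
    have neg: "measure_pmf.expectation q (\<lambda>x. 1 - h x) = 1 - measure_pmf.expectation q h" for q
      using pmf_integrable_01[of h, OF h] by simp
    have "0 \<le> 1 - h y \<and> 1 - h y \<le> 1" for y using h[of y] by auto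
    with a lower[of "a - measure_pmf.expectation p h" "\<lambda>x. 1 - h x"]
    have "eventually (\<lambda>n. measure_pmf.expectation p (\<lambda>x. 1 - h x) - (a - measure_pmf.expectation p h) < measure_pmf.expectation (P n) (\<lambda>x. 1 - h x)) sequentially"
      by simp
    then show "eventually (\<lambda>n. measure_pmf.expectation (P n) h < a) sequentially"
      unfolding neg by (auto elim!: eventually_mono)
  qed
qed

text \<open>The probability that Sa and Sb are connected within Z in the random connection model
  with intensity lam and connection function g, where each vertex qualifies as an end point with
  probability \<gamma>. The model itself has \<gamma> = 1.\<close>

definition theta :: "real \<Rightarrow> (real \<Rightarrow> real) \<Rightarrow> (int \<times> int) set \<Rightarrow> (int \<times> int) set \<Rightarrow> (int \<times> int) set \<Rightarrow> real \<Rightarrow> real" where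
  "theta \<gamma> g Sa Sb Z lam = measure_pmf.expectation (Pi_pmf Z 0 (\<lambda>_. poisson_pmf lam)) (\<lambda>k. qf \<gamma> g Sa Sb (std Z k))"

context conn_meas
begin

lemma qf01: "finite Z \<Longrightarrow> 0 \<le> \<gamma> \<Longrightarrow> \<gamma> \<le> 1 \<Longrightarrow> 0 \<le> qf \<gamma> g Sa Sb (std Z k) \<and> qf \<gamma> g Sa Sb (std Z k) \<le> 1"
  using qf_bounds[of "std Z k"] by auto

lemma qf_std_cntv:
  assumes "finite Z" "A \<subseteq> std Z n" "0 \<le> \<gamma>" "\<gamma> \<le> 1"
  shows "qf \<gamma> g Sa Sb A = qf \<gamma> g Sa Sb (std Z (cntv A))"
proof (rule qf_exchange)
  show "finite A" using assms finite_std finite_subset by blast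
  show "cntv A z = cntv (std Z (cntv A)) z" for z
  proof (cases "z \<in> Z")
    case False
    then have "{i. (z, i) \<in> A} = {}" using assms(2) by (auto simp: std_def)
    then have "cntv A z = 0" by (simp add: cntv_def)
    then show ?thesis using False by (simp add: cntv_std)
  qed (simp add: cntv_std)
qed (use assms in auto)

lemma bexp_qf:
  assumes "finite Z" "0 \<le> s" "s \<le> 1" "0 \<le> \<gamma>" "\<gamma> \<le> 1"
  shows "bexp (std Z n) (\<lambda>_. s) (qf \<gamma> g Sa Sb) = measure_pmf.expectation (Pi_pmf Z 0 (\<lambda>z. binomial_pmf (n z) s)) (\<lambda>k. qf \<gamma> g Sa Sb (std Z k))"
proof -
  have "bexp (std Z n) (\<lambda>_. s) (qf \<gamma> g Sa Sb) = bexp (std Z n) (\<lambda>_. s) (\<lambda>A. qf \<gamma> g Sa Sb (std Z (cntv A)))"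
    using assms by (intro bexp_cong refl qf_std_cntv) auto
  then show ?thesis using bexp_counts[of Z s "\<lambda>k. qf \<gamma> g Sa Sb (std Z k)" n] assms qf01 by simp
qed

text \<open>Independent coins at the vertices turn the counts into binomial ones, and a binomially
  thinned Poisson count is Poisson with mean p * lam.\<close>

lemma theta_thinning:
  assumes Z: "finite Z" and lam: "0 < lam" and p: "0 < p" "p \<le> 1" and \<gamma>: "0 \<le> \<gamma>" "\<gamma> \<le> 1"
  shows "measure_pmf.expectation (Pi_pmf Z 0 (\<lambda>_. poisson_pmf lam)) (\<lambda>n. bexp (std Z n) (\<lambda>_. p) (qf \<gamma> g Sa Sb)) = theta \<gamma> g Sa Sb Z (p * lam)"
proof -
  have "theta \<gamma> g Sa Sb Z (p * lam) = measure_pmf.expectation (Pi_pmf Z 0 (\<lambda>_. bind_pmf (poisson_pmf lam) (\<lambda>n. binomial_pmf n p))) (\<lambda>k. qf \<gamma> g Sa Sb (std Z k))"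
    unfolding theta_def poisson_thinning[OF lam p] ..
  also have "\<dots> = measure_pmf.expectation (Pi_pmf Z 0 (\<lambda>_. poisson_pmf lam)) (\<lambda>n. bexp (std Z n) (\<lambda>_. p) (qf \<gamma> g Sa Sb))"
    using Z p \<gamma> qf01 by (subst Pi_pmf_bind[of _ _ _ _ 0]) (auto simp: pmf_expectation_bind_01 bexp_qf)
  finally show ?thesis by simp
qed

text \<open>The smaller intensity is a thinning of the larger one, and more vertices only help to
  connect.\<close>

lemma theta_mono_lam:
  assumes Z: "finite Z" and lam: "0 < lam" "lam \<le> lam'" and \<gamma>: "0 \<le> \<gamma>" "\<gamma> \<le> 1"
  shows "theta \<gamma> g Sa Sb Z lam \<le> theta \<gamma> g Sa Sb Z lam'"
proof -
  have p: "0 < lam / lam'" "lam / lam' \<le> 1" "0 < lam'" using lam by auto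
  have le: "bexp (std Z n) (\<lambda>_. lam / lam') (qf \<gamma> g Sa Sb) \<le> qf \<gamma> g Sa Sb (std Z n)" for n
  proof -
    have "bexp (std Z n) (\<lambda>_. lam / lam') (qf \<gamma> g Sa Sb) \<le> bexp (std Z n) (\<lambda>_. lam / lam') (\<lambda>_. qf \<gamma> g Sa Sb (std Z n))"
      using Z p \<gamma> by (intro bexp_mono qf_mono) auto
    then show ?thesis using Z by (simp add: bexp_const)
  qed
  have b01: "0 \<le> bexp (std Z n) (\<lambda>_. lam / lam') (qf \<gamma> g Sa Sb) \<and> bexp (std Z n) (\<lambda>_. lam / lam') (qf \<gamma> g Sa Sb) \<le> 1" for n
  proof
    show "0 \<le> bexp (std Z n) (\<lambda>_. lam / lam') (qf \<gamma> g Sa Sb)"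
      using Z p \<gamma> by (intro bexp_nonneg qf_bounds) (auto intro: finite_subset)
    show "bexp (std Z n) (\<lambda>_. lam / lam') (qf \<gamma> g Sa Sb) \<le> 1" using le[of n] qf01[OF Z \<gamma>] by (meson order_trans)
  qed
  have "theta \<gamma> g Sa Sb Z lam = theta \<gamma> g Sa Sb Z (lam / lam' * lam')" using lam by simp
  also have "\<dots> = measure_pmf.expectation (Pi_pmf Z 0 (\<lambda>_. poisson_pmf lam')) (\<lambda>n. bexp (std Z n) (\<lambda>_. lam / lam') (qf \<gamma> g Sa Sb))"
    using theta_thinning[OF Z p(3,1,2) \<gamma>] by simp
  also have "\<dots> \<le> theta \<gamma> g Sa Sb Z lam'" unfolding theta_def
    using le qf01[OF Z \<gamma>] b01 by (intro integral_mono pmf_integrable_01) auto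
  finally show ?thesis .
qed

text \<open>Conditioning on the set of present vertices separates the vertex coins from everything
  else, and exchangeability leaves only the counts.\<close>

lemma binomial_model_eq:
  assumes Z: "finite Z" and s: "0 \<le> s" "s \<le> 1" and \<gamma>: "0 \<le> \<gamma>" "\<gamma> \<le> 1"
  shows "(\<integral>X. bexp (cidx (std Z n)) (rt s \<gamma> g X) (\<lambda>S. of_bool (con (cub Sa) (cub Sb) S)) \<partial>PX)
    = measure_pmf.expectation (Pi_pmf Z 0 (\<lambda>z. binomial_pmf (n z) s)) (\<lambda>k. qf \<gamma> g Sa Sb (std Z k))"
proof -
  let ?W = "std Z n" and ?con = "\<lambda>S. of_bool (con (cub Sa) (cub Sb) S) :: real"
  have finW: "finite ?W" using Z by simp
  have "bexp (cidx ?W) (rt s \<gamma> g X) ?con = bexp ?W (\<lambda>_. s) (\<lambda>A. bexp (eidx A) (rr \<gamma> g X) (\<lambda>F. ?con (conf A F)))" for X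
  proof -
    have "bexp (cidx ?W) (rt s \<gamma> g X) ?con = bexp (Inl ` ?W) (rt s \<gamma> g X) (\<lambda>S. bexp (Inr ` eidx ?W) (rt s \<gamma> g X) (\<lambda>T. ?con (S \<union> T)))"
      unfolding cidx_eq using finW by (intro bexp_Un) auto
    also have "\<dots> = bexp ?W (\<lambda>_. s) (\<lambda>A. bexp (eidx ?W) (rr \<gamma> g X) (\<lambda>F. ?con (conf A F)))"
      using finW by (simp add: bexp_reindex conf_def rt_def rr_def[abs_def])
    also have "\<dots> = bexp ?W (\<lambda>_. s) (\<lambda>A. bexp (eidx A) (rr \<gamma> g X) (\<lambda>F. ?con (conf A F)))"
      using finW by (intro bexp_cong refl bexp_subset eidx_mono) (auto simp: con_conf_Int)
    finally show ?thesis .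
  qed
  then have "(\<integral>X. bexp (cidx ?W) (rt s \<gamma> g X) ?con \<partial>PX) = bexp ?W (\<lambda>_. s) (qf \<gamma> g Sa Sb)"
    unfolding qf_def[abs_def] using finW \<gamma>
    by (simp, intro bexp_integral(1) bexp_rr_integrable[where A = "std Z n"]) (auto dest: eidx_mono subsetD)
  then show ?thesis using bexp_qf[OF Z s \<gamma>] by simp
qed

lemma binomial_model_tendsto:
  assumes Z: "finite Z" and lam: "0 < lam" and \<gamma>: "0 \<le> \<gamma>" "\<gamma> \<le> 1"
  shows "(\<lambda>M. \<integral>X. bexp (cidx (lbls Z M)) (rt (lam / real M) \<gamma> g X) (\<lambda>S. of_bool (con (cub Sa) (cub Sb) S)) \<partial>PX)
     \<longlonglongrightarrow> theta \<gamma> g Sa Sb Z lam"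
proof -
  have "(\<lambda>M. measure_pmf.expectation (Pi_pmf Z 0 (\<lambda>z. binomial_pmf M (lam / real M))) (\<lambda>k. qf \<gamma> g Sa Sb (std Z k)))
     \<longlonglongrightarrow> theta \<gamma> g Sa Sb Z lam"
    unfolding theta_def
  proof (rule pmf_tendsto_expectation)
    fix k :: "int \<times> int \<Rightarrow> nat"
    show "(\<lambda>M. pmf (Pi_pmf Z 0 (\<lambda>z. binomial_pmf M (lam / real M))) k) \<longlonglongrightarrow> pmf (Pi_pmf Z 0 (\<lambda>_. poisson_pmf lam)) k"
    proof (cases "\<forall>x. x \<notin> Z \<longrightarrow> k x = 0")
      case True
      show ?thesis unfolding pmf_Pi[OF Z] if_P[OF True] by (intro tendsto_prod binomial_poisson_limit lam)
    next
      case False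
      show ?thesis unfolding pmf_Pi[OF Z] if_not_P[OF False] by simp
    qed
  qed (use qf01[OF Z \<gamma>] in auto)
  moreover have "eventually (\<lambda>M. (\<integral>X. bexp (cidx (lbls Z M)) (rt (lam / real M) \<gamma> g X) (\<lambda>S. of_bool (con (cub Sa) (cub Sb) S)) \<partial>PX)
      = measure_pmf.expectation (Pi_pmf Z 0 (\<lambda>z. binomial_pmf M (lam / real M))) (\<lambda>k. qf \<gamma> g Sa Sb (std Z k))) sequentially"
    using eventually_ge_at_top[of "nat \<lceil>lam\<rceil> + 1"]
  proof eventually_elim
    case (elim M)
    have "lam \<le> real (nat \<lceil>lam\<rceil>)" by (rule real_nat_ceiling_ge)
    then have "lam < real M" using elim by linarith
    then have "0 \<le> lam / real M" "lam / real M \<le> 1" using lam by auto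
    moreover have "lbls Z M = std Z (\<lambda>_. M)" by (auto simp: lbls_def std_def)
    ultimately show ?case using binomial_model_eq[OF Z _ _ \<gamma>] by simp
  qed
  ultimately show ?thesis by (simp add: tendsto_cong)
qed

end

lemma conn_meas_scale: "conn_meas g \<Longrightarrow> 0 \<le> p \<Longrightarrow> p \<le> 1 \<Longrightarrow> conn_meas (\<lambda>r. p * g r)"
  unfolding conn_meas_def by (auto simp: mult_left_mono intro: mult_le_one)

lemma (in conn_fun) conn_meas_f: "conn_meas f"
  unfolding conn_meas_def using f01 f_anti by auto

lemma qf_mono_g:
  assumes g: "conn_meas g" and g': "conn_meas g'" and le: "\<And>r. 0 \<le> r \<Longrightarrow> g r \<le> g' r"
    and fin: "finite A" and \<gamma>: "0 \<le> \<gamma>" "\<gamma> \<le> \<gamma>'" "\<gamma>' \<le> 1"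
  shows "qf \<gamma> g Sa Sb A \<le> qf \<gamma>' g' Sa Sb A"
  unfolding qf_def
proof (intro integral_mono conn_meas.bexp_rr_integrable[OF g fin] conn_meas.bexp_rr_integrable[OF g' fin])
  fix X
  have "bexp (eidx A) (rr \<gamma> g X) (\<lambda>F. of_bool (con (cub Sa) (cub Sb) (conf A F)))
     \<le> bexp (eidx A) (rr \<gamma>' g' X) (\<lambda>F. of_bool (con (cub Sa) (cub Sb) (conf A F)))"
  proof (intro bexp_mono_rate)
    show "0 \<le> rr \<gamma> g X e \<and> rr \<gamma> g X e \<le> rr \<gamma>' g' X e \<and> rr \<gamma>' g' X e \<le> 1" if e: "e \<in> eidx A" for e
    proof -
      have "finite e" "e \<noteq> {}" using e by (auto simp: eidx_def intro: card_ge_0_finite)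
      then have "g (pdist X e) \<le> g' (pdist X e)" using le pdist_nonneg by blast
      then have "rr \<gamma> g X e \<le> rr \<gamma>' g' X e" using \<gamma> by (auto simp: rr_def)
      then show ?thesis using conn_meas.rr01[OF g _ _ e, of \<gamma> X] conn_meas.rr01[OF g' _ _ e, of \<gamma>' X] \<gamma> by auto
    qed
    show "of_bool (con (cub Sa) (cub Sb) (conf A S)) \<le> (of_bool (con (cub Sa) (cub Sb) (conf A T)) :: real)" if "S \<subseteq> T" for S T
      using con_mono[of "cub Sa" "cub Sb" "conf A S" "conf A T"] that by (auto simp: conf_def)
  qed (use fin in auto)
  then show "bexp (eidx A) (rr \<gamma> g X) (\<lambda>F. of_bool (con (cub Sa) (cub Sb) (conf A F)))
     \<le> bexp (eidx A) (rr \<gamma>' g' X) (\<lambda>F. of_bool (con (cub Sa) (cub Sb) (conf A F)))" .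
qed (use \<gamma> in auto)

lemma theta_mono_g:
  assumes g: "conn_meas g" and g': "conn_meas g'" and le: "\<And>r. 0 \<le> r \<Longrightarrow> g r \<le> g' r"
    and fin: "finite Z" and \<gamma>: "0 \<le> \<gamma>" "\<gamma> \<le> \<gamma>'" "\<gamma>' \<le> 1"
  shows "theta \<gamma> g Sa Sb Z lam \<le> theta \<gamma>' g' Sa Sb Z lam"
  unfolding theta_def using qf_mono_g[OF g g' le] fin \<gamma> conn_meas.qf01[OF g] conn_meas.qf01[OF g']
  by (intro integral_mono pmf_integrable_01) auto

text \<open>Given the open edges and a connection, fix one pair of end points; both are marked with
  probability 1 / 4. Disjointness of Sa and Sb ensures that these are two different marks.\<close>

lemma qf_marks:
  assumes g: "conn_meas g" and fin: "finite A" and disj: "Sa \<inter> Sb = {}"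
  shows "qf 1 g Sa Sb A / 4 \<le> qf (1/2) g Sa Sb A"
proof -
  let ?con = "\<lambda>F. of_bool (con (cub Sa) (cub Sb) (conf A F)) :: real"
  define J where "J = {e. e \<subseteq> A \<and> card e = 1}"
  have E: "eidx A = pairs A \<union> J" "pairs A \<inter> J = {}" by (auto simp: eidx_def pairs_def J_def)
  have finJ: "finite J" "finite (pairs A)" using fin by (auto simp: J_def)
  have split: "bexp (eidx A) (rr \<gamma> g X) ?con = bexp (pairs A) (rr 1 g X) (\<lambda>F. bexp J (\<lambda>_. \<gamma>) (\<lambda>T. ?con (F \<union> T)))" for \<gamma> X
  proof -
    have "bexp (eidx A) (rr \<gamma> g X) ?con = bexp (pairs A) (rr \<gamma> g X) (\<lambda>F. bexp J (rr \<gamma> g X) (\<lambda>T. ?con (F \<union> T)))"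
      unfolding E(1) using finJ E(2) by (intro bexp_Un)
    also have "\<dots> = bexp (pairs A) (rr 1 g X) (\<lambda>F. bexp J (\<lambda>_. \<gamma>) (\<lambda>T. ?con (F \<union> T)))"
      by (intro bexp_cong) (auto simp: rr_def pairs_def J_def)
    finally show ?thesis .
  qed
  have le: "bexp (eidx A) (rr 1 g X) ?con / 4 \<le> bexp (eidx A) (rr (1/2) g X) ?con" for X
  proof -
    have "(1/4) * bexp (eidx A) (rr 1 g X) ?con = bexp (pairs A) (rr 1 g X) (\<lambda>F. (1/4) * ?con (F \<union> J))"
      unfolding split bexp_cmult using finJ by (simp add: bexp_one)
    also have "\<dots> \<le> bexp (pairs A) (rr 1 g X) (\<lambda>F. bexp J (\<lambda>_. 1/2) (\<lambda>T. ?con (F \<union> T)))"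
    proof (intro bexp_mono)
      show "0 \<le> rr 1 g X e \<and> rr 1 g X e \<le> 1" if "e \<in> pairs A" for e
        using conn_meas.rr01[OF g, of 1 e A X] that by (auto simp: pairs_def eidx_def)
      fix F assume F: "F \<subseteq> pairs A"
      show "(1/4) * ?con (F \<union> J) \<le> bexp J (\<lambda>_. 1/2) (\<lambda>T. ?con (F \<union> T))"
      proof (cases "con (cub Sa) (cub Sb) (conf A (F \<union> J))")
        case True
        then obtain x y where xy: "x \<in> cub Sa" "y \<in> cub Sb" "x \<in> A" "y \<in> A" "(cadj (conf A (F \<union> J)))\<^sup>*\<^sup>* x y"
          unfolding con_conf by blast
        have ne: "{x} \<noteq> {y}" using xy disj by (auto simp: cub_def)
        have cy: "{{x}, {y}} \<subseteq> J" using xy by (auto simp: J_def)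
        have "bexp J (\<lambda>_. 1/2) (\<lambda>T. of_bool ({{x}, {y}} \<subseteq> T \<and> T \<inter> {} = {})) = (1/4 :: real)"
          using bexp_cylinder[OF finJ(1) cy, of "{}" "\<lambda>_. 1/2"] ne by simp
        moreover have "bexp J (\<lambda>_. 1/2) (\<lambda>T. of_bool ({{x}, {y}} \<subseteq> T \<and> T \<inter> {} = {})) \<le> bexp J (\<lambda>_. 1/2) (\<lambda>T. ?con (F \<union> T))"
        proof (intro bexp_mono finJ)
          fix T assume T: "T \<subseteq> J"
          have "con (cub Sa) (cub Sb) (conf A (F \<union> T))" if xyT: "{x} \<in> T" "{y} \<in> T"
          proof -
            have "cadj (conf A (F \<union> T)) u v" if uv: "cadj (conf A (F \<union> J)) u v" for u v
            proof -
              have "u \<noteq> v" "{u, v} \<in> F \<union> J" using uv by (auto simp: cadj_conf)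
              moreover have "{u, v} \<notin> J" using \<open>u \<noteq> v\<close> by (simp add: J_def)
              ultimately show ?thesis using uv unfolding cadj_conf by blast
            qed
            then have "cadj (conf A (F \<union> J)) \<le> cadj (conf A (F \<union> T))" by (intro predicate2I)
            then have "(cadj (conf A (F \<union> T)))\<^sup>*\<^sup>* x y" using xy(5) rtranclp_mono predicate2D by metis
            then show ?thesis using xy xyT unfolding con_conf by blast
          qed
          then show "of_bool ({{x}, {y}} \<subseteq> T \<and> T \<inter> {} = {}) \<le> ?con (F \<union> T)" by auto
        qed auto
        ultimately show ?thesis using True by simp
      next
        case False
        then show ?thesis using finJ by (auto intro!: bexp_nonneg)
      qed
    qed (use finJ in auto)
    also have "\<dots> = bexp (eidx A) (rr (1/2) g X) ?con" by (simp only: split)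
    finally show ?thesis by simp
  qed
  have int: "integrable PX (\<lambda>X. bexp (eidx A) (rr \<gamma> g X) ?con)" if "0 \<le> \<gamma>" "\<gamma> \<le> 1" for \<gamma>
    using that by (intro conn_meas.bexp_rr_integrable[OF g fin]) auto
  have "(\<integral>X. bexp (eidx A) (rr 1 g X) ?con / 4 \<partial>PX) \<le> qf (1/2) g Sa Sb A"
    unfolding qf_def using int[of 1] int[of "1/2"] le by (intro integral_mono) auto
  then show ?thesis unfolding qf_def by simp
qed

lemma theta_marks:
  assumes g: "conn_meas g" and fin: "finite Z" and disj: "Sa \<inter> Sb = {}"
  shows "theta 1 g Sa Sb Z lam / 4 \<le> theta (1/2) g Sa Sb Z lam"
proof -
  have b: "0 \<le> qf \<gamma> g Sa Sb (std Z k) \<and> qf \<gamma> g Sa Sb (std Z k) \<le> 1" if "0 \<le> \<gamma>" "\<gamma> \<le> 1" for \<gamma> k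
    using conn_meas.qf01[OF g fin that] by simp
  have "measure_pmf.expectation (Pi_pmf Z 0 (\<lambda>_. poisson_pmf lam)) (\<lambda>k. qf 1 g Sa Sb (std Z k) / 4) \<le> theta (1/2) g Sa Sb Z lam"
    unfolding theta_def
  proof (intro integral_mono)
    show "integrable (measure_pmf (Pi_pmf Z 0 (\<lambda>_. poisson_pmf lam))) (\<lambda>k. qf 1 g Sa Sb (std Z k) / 4)"
      using b[of 1] by (intro pmf_integrable_01) (auto simp: field_simps intro: order_trans[of _ 1])
    show "integrable (measure_pmf (Pi_pmf Z 0 (\<lambda>_. poisson_pmf lam))) (\<lambda>k. qf (1/2) g Sa Sb (std Z k))"
      using b[of "1/2"] by (intro pmf_integrable_01) auto
  qed (use qf_marks[OF g] fin disj in auto)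
  then show ?thesis by (simp add: theta_def)
qed

section \<open>Comparison of parameters for Poisson points\<close>

context conn_fun
begin

text \<open>The limit of \<open>flow_le\<close> for M tending to infinity. The pivot inequality is
  asked for at all times at once from some M on, so only the two ends of the curve have to
  converge.\<close>

lemma theta_flow:
  assumes lam: "0 < lam" and c: "0 \<le> c" "c \<le> 1" and p: "0 < p1" "p1 \<le> p0" "p0 \<le> 1"
    and ineq: "eventually (\<lambda>M. \<forall>t. 0 \<le> t \<and> t \<le> ln (p0 / p1) \<longrightarrow>
      (\<integral>X. bexp (cidx (lbls (zbox z0 N) M)) (rX M (lam * exp ((1 - c) * t)) (p0 * exp (- t)) X) (\<lambda>S. real (card (pivE (cub Sa) (cub Sb) S))) \<partial>PX)
      \<le> (1 - c) * (\<integral>X. bexp (cidx (lbls (zbox z0 N) M)) (rX M (lam * exp ((1 - c) * t)) (p0 * exp (- t)) X) (\<lambda>S. real (card (pivV (cub Sa) (cub Sb) S))) \<partial>PX)) sequentially"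
  shows "theta (1/2) (\<lambda>r. p0 * f r) Sa Sb (zbox z0 N) lam \<le> theta (1/2) (\<lambda>r. p1 * f r) Sa Sb (zbox z0 N) (lam * exp ((1 - c) * ln (p0 / p1)))"
proof -
  define \<tau> where "\<tau> = ln (p0 / p1)"
  have \<tau>: "0 \<le> \<tau>" using p by (simp add: \<tau>_def)
  have p1: "p0 * exp (- \<tau>) = p1" using p by (simp add: \<tau>_def exp_minus)
  have cm0: "conn_meas (\<lambda>r. p0 * f r)" and cm1: "conn_meas (\<lambda>r. p1 * f r)"
    using p by (auto intro!: conn_meas_scale conn_meas_f)
  let ?con = "\<lambda>S. of_bool (con (cub Sa) (cub Sb) S) :: real"
  have l0: "(\<lambda>M. \<integral>X. bexp (cidx (lbls (zbox z0 N) M)) (rX M lam p0 X) ?con \<partial>PX) \<longlonglongrightarrow> theta (1/2) (\<lambda>r. p0 * f r) Sa Sb (zbox z0 N) lam"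
    using lam by (intro conn_meas.binomial_model_tendsto[OF cm0]) auto
  have l1: "(\<lambda>M. \<integral>X. bexp (cidx (lbls (zbox z0 N) M)) (rX M (lam * exp ((1 - c) * \<tau>)) p1 X) ?con \<partial>PX)
      \<longlonglongrightarrow> theta (1/2) (\<lambda>r. p1 * f r) Sa Sb (zbox z0 N) (lam * exp ((1 - c) * \<tau>))"
    using lam by (intro conn_meas.binomial_model_tendsto[OF cm1]) auto
  have "eventually (\<lambda>M. (\<integral>X. bexp (cidx (lbls (zbox z0 N) M)) (rX M lam p0 X) ?con \<partial>PX)
     \<le> (\<integral>X. bexp (cidx (lbls (zbox z0 N) M)) (rX M (lam * exp ((1 - c) * \<tau>)) p1 X) ?con \<partial>PX)) sequentially"
    using ineq eventually_ge_at_top[of "nat \<lceil>2 * lam * exp ((1 - c) * \<tau>)\<rceil> + 1"]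
  proof eventually_elim
    case (elim M)
    have "2 * lam * exp ((1 - c) * \<tau>) \<le> real (nat \<lceil>2 * lam * exp ((1 - c) * \<tau>)\<rceil>)" by (rule real_nat_ceiling_ge)
    then have "2 * lam * exp ((1 - c) * \<tau>) \<le> real M" using elim(2) by linarith
    then have "(\<integral>X. bexp (cidx (lbls (zbox z0 N) M)) (rX M (lam * exp ((1 - c) * 0)) (p0 * exp (- 0)) X) ?con \<partial>PX)
       \<le> (\<integral>X. bexp (cidx (lbls (zbox z0 N) M)) (rX M (lam * exp ((1 - c) * \<tau>)) (p0 * exp (- \<tau>)) X) ?con \<partial>PX)"
      using elim lam c p \<tau> by (intro flow_le) (auto simp: \<tau>_def)
    then show ?case unfolding p1 by simp
  qed
  then show ?thesis unfolding \<tau>_def[symmetric] using LIMSEQ_le[OF l0 l1] by (auto simp: eventually_sequentially)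
qed

text \<open>The case c = 0, in which the curve keeps the product of intensity and edge probability
  constant. It may start at p0 = 1.\<close>

lemma theta_flow_weak:
  assumes lam: "0 < lam" and p: "0 < p1" "p1 \<le> p0" "p0 \<le> 1"
  shows "theta (1/2) (\<lambda>r. p0 * f r) Sa Sb (zbox z0 N) lam \<le> theta (1/2) (\<lambda>r. p1 * f r) Sa Sb (zbox z0 N) (lam * (p0 / p1))"
proof -
  have "theta (1/2) (\<lambda>r. p0 * f r) Sa Sb (zbox z0 N) lam \<le> theta (1/2) (\<lambda>r. p1 * f r) Sa Sb (zbox z0 N) (lam * exp ((1 - 0) * ln (p0 / p1)))"
  proof (rule theta_flow[OF lam _ _ p])
    show "eventually (\<lambda>M. \<forall>t. 0 \<le> t \<and> t \<le> ln (p0 / p1) \<longrightarrow>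
      (\<integral>X. bexp (cidx (lbls (zbox z0 N) M)) (rX M (lam * exp ((1 - 0) * t)) (p0 * exp (- t)) X) (\<lambda>S. real (card (pivE (cub Sa) (cub Sb) S))) \<partial>PX)
      \<le> (1 - 0) * (\<integral>X. bexp (cidx (lbls (zbox z0 N) M)) (rX M (lam * exp ((1 - 0) * t)) (p0 * exp (- t)) X) (\<lambda>S. real (card (pivV (cub Sa) (cub Sb) S))) \<partial>PX)) sequentially"
      using eventually_ge_at_top[of "nat \<lceil>2 * lam * (p0 / p1)\<rceil> + 1"]
    proof eventually_elim
      case (elim M)
      show ?case
      proof (intro allI impI)
        fix t assume t: "0 \<le> t \<and> t \<le> ln (p0 / p1)"
        have "exp t \<le> exp (ln (p0 / p1))" using t by simp
        then have "exp t \<le> p0 / p1" using p by simp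
        then have "2 * lam * exp t \<le> 2 * lam * (p0 / p1)" using lam by (intro mult_left_mono) auto
        moreover have "2 * lam * (p0 / p1) \<le> real (nat \<lceil>2 * lam * (p0 / p1)\<rceil>)" by (rule real_nat_ceiling_ge)
        ultimately have a: "2 * (lam * exp t) \<le> real M" using elim by linarith
        have b: "p0 * exp (- t) \<le> 1 * 1" using p t by (intro mult_mono) auto
        show "(\<integral>X. bexp (cidx (lbls (zbox z0 N) M)) (rX M (lam * exp ((1 - 0) * t)) (p0 * exp (- t)) X) (\<lambda>S. real (card (pivE (cub Sa) (cub Sb) S))) \<partial>PX)
      \<le> (1 - 0) * (\<integral>X. bexp (cidx (lbls (zbox z0 N) M)) (rX M (lam * exp ((1 - 0) * t)) (p0 * exp (- t)) X) (\<lambda>S. real (card (pivV (cub Sa) (cub Sb) S))) \<partial>PX)"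
          using pivot_inequality_weak[of M "lam * exp t" "p0 * exp (- t)" z0 N "cub Sa" "cub Sb"] a b elim lam p by simp
      qed
    qed
  qed auto
  then show ?thesis using p by simp
qed

text \<open>The bounds confine the whole curve to a compact region of parameters with edge
  probabilities at most q, so that one constant serves all of it.\<close>

lemma theta_flow_strict:
  assumes pmin: "0 < pmin" "pmin \<le> q" "q < 1" and l0: "0 < l0" "l0 \<le> l1"
  shows "\<exists>c>0. c \<le> 1 \<and> (\<forall>p0 p1 lam z0 N Sa Sb. pmin \<le> p1 \<and> p1 \<le> p0 \<and> p0 \<le> q \<and> l0 \<le> lam \<and> lam * (p0 / p1) \<le> l1 \<longrightarrow>
     theta (1/2) (\<lambda>r. p0 * f r) Sa Sb (zbox z0 N) lam \<le> theta (1/2) (\<lambda>r. p1 * f r) Sa Sb (zbox z0 N) (lam * exp ((1 - c) * ln (p0 / p1))))"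
proof -
  obtain c' M0 where c': "0 < c'" and pi0: "\<forall>M\<ge>M0. \<forall>lam p z0 N A B. l0 \<le> lam \<and> lam \<le> l1 \<and> pmin \<le> p \<and> p \<le> q \<longrightarrow>
     2 * lam \<le> real M \<and>
     (1 + c') * (\<integral>X. bexp (cidx (lbls (zbox z0 N) M)) (rX M lam p X) (\<lambda>S. real (card (pivE A B S))) \<partial>PX)
      \<le> (\<integral>X. bexp (cidx (lbls (zbox z0 N) M)) (rX M lam p X) (\<lambda>S. real (card (pivV A B S))) \<partial>PX)"
    using pivot_inequality[OF pmin l0] by (elim exE conjE) (rule that, assumption+)
  have pi: "(1 + c') * (\<integral>X. bexp (cidx (lbls (zbox z0 N) M)) (rX M lam p X) (\<lambda>S. real (card (pivE A B S))) \<partial>PX)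
      \<le> (\<integral>X. bexp (cidx (lbls (zbox z0 N) M)) (rX M lam p X) (\<lambda>S. real (card (pivV A B S))) \<partial>PX)"
    if "M0 \<le> M" "l0 \<le> lam" "lam \<le> l1" "pmin \<le> p" "p \<le> q" for M lam p z0 N A B
    by (rule pi0[rule_format, OF that(1), THEN conjunct2]) (use that in blast)
  \<comment> \<open>Chosen so that 1 - c is the inverse of 1 + c'.\<close>
  define c where "c = c' / (1 + c')"
  have c: "0 < c" "c \<le> 1" "1 - c = 1 / (1 + c')" using c' by (auto simp: c_def field_simps)
  show ?thesis
  proof (intro exI[of _ c] conjI c allI impI)
    fix p0 p1 lam z0 N Sa Sb
    assume a: "pmin \<le> p1 \<and> p1 \<le> p0 \<and> p0 \<le> q \<and> l0 \<le> lam \<and> lam * (p0 / p1) \<le> l1"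
    have p: "0 < p1" "p1 \<le> p0" "p0 \<le> 1" and lam: "0 < lam" using a pmin l0 by auto
    show "theta (1/2) (\<lambda>r. p0 * f r) Sa Sb (zbox z0 N) lam \<le> theta (1/2) (\<lambda>r. p1 * f r) Sa Sb (zbox z0 N) (lam * exp ((1 - c) * ln (p0 / p1)))"
    proof (rule theta_flow[OF lam _ c(2) p])
      show "0 \<le> c" using c by simp
      show "eventually (\<lambda>M. \<forall>t. 0 \<le> t \<and> t \<le> ln (p0 / p1) \<longrightarrow>
      (\<integral>X. bexp (cidx (lbls (zbox z0 N) M)) (rX M (lam * exp ((1 - c) * t)) (p0 * exp (- t)) X) (\<lambda>S. real (card (pivE (cub Sa) (cub Sb) S))) \<partial>PX)
      \<le> (1 - c) * (\<integral>X. bexp (cidx (lbls (zbox z0 N) M)) (rX M (lam * exp ((1 - c) * t)) (p0 * exp (- t)) X) (\<lambda>S. real (card (pivV (cub Sa) (cub Sb) S))) \<partial>PX)) sequentially"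
        using eventually_ge_at_top[of M0]
      proof eventually_elim
        case (elim M)
        show ?case
        proof (intro allI impI)
          fix t assume t: "0 \<le> t \<and> t \<le> ln (p0 / p1)"
          have "exp t \<le> exp (ln (p0 / p1))" using t by simp
          then have et: "exp t \<le> p0 / p1" using p by simp
          have "(1 - c) * t \<le> t" using mult_right_mono[of "1 - c" 1 t] c(1) t by simp
          then have "exp ((1 - c) * t) \<le> p0 / p1" using et by (meson exp_le_cancel_iff order_trans)
          then have "lam * exp ((1 - c) * t) \<le> lam * (p0 / p1)" using lam by (intro mult_left_mono) auto
          then have 1: "lam * exp ((1 - c) * t) \<le> l1" using a by linarith
          have "lam * 1 \<le> lam * exp ((1 - c) * t)" using lam c(2) t by (intro mult_left_mono) auto
          then have 2: "l0 \<le> lam * exp ((1 - c) * t)" using a by linarith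
          have "p0 * exp (- t) \<le> p0 * 1" using p t by (intro mult_left_mono) auto
          then have 3: "p0 * exp (- t) \<le> q" using a by linarith
          have "p1 * exp t \<le> p0" using et p by (simp add: field_simps)
          then have "p1 \<le> p0 * exp (- t)" by (simp add: exp_minus field_simps)
          then have 4: "pmin \<le> p0 * exp (- t)" using a by linarith
          show "(\<integral>X. bexp (cidx (lbls (zbox z0 N) M)) (rX M (lam * exp ((1 - c) * t)) (p0 * exp (- t)) X) (\<lambda>S. real (card (pivE (cub Sa) (cub Sb) S))) \<partial>PX)
      \<le> (1 - c) * (\<integral>X. bexp (cidx (lbls (zbox z0 N) M)) (rX M (lam * exp ((1 - c) * t)) (p0 * exp (- t)) X) (\<lambda>S. real (card (pivV (cub Sa) (cub Sb) S))) \<partial>PX)"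
            using pi[OF elim 2 1 4 3, of z0 N "cub Sa" "cub Sb"] c' unfolding c(3) by (simp add: field_simps)
        qed
      qed
    qed
  qed
qed

end

section \<open>Infinite clusters and finite-volume connections\<close>

declare split_paired_All [simp del] split_paired_Ex [simp del]

definition gadj :: "lbl set \<Rightarrow> (lbl set \<Rightarrow> bool) \<Rightarrow> lbl \<Rightarrow> lbl \<Rightarrow> bool" where
  "gadj A B v w \<longleftrightarrow> v \<in> A \<and> w \<in> A \<and> v \<noteq> w \<and> B {v, w}"

definition far :: "int \<times> int \<Rightarrow> nat \<Rightarrow> (int \<times> int) set" where
  "far z0 n = {z. int n < zd z0 z}"

text \<open>All vertices count as marked here. The walk is confined to a box that exceeds the radius
  n by the range D: the event depends on finitely many squares, and edges of range D cannot jump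
  over the additional shell.\<close>

definition reach :: "nat \<Rightarrow> int \<times> int \<Rightarrow> nat \<Rightarrow> lbl set \<Rightarrow> (lbl set \<Rightarrow> bool) \<Rightarrow> bool" where
  "reach D z0 n A B \<longleftrightarrow> con (cub {z0}) (cub (far z0 n)) (conf (A \<inter> cub (zbox z0 (n + D))) {e. card e = 1 \<or> B e})"

definition loc_fin :: "lbl set \<Rightarrow> bool" where
  "loc_fin A \<longleftrightarrow> (\<forall>z. finite {v \<in> A. fst v = z})"

definition ranged :: "nat \<Rightarrow> lbl set \<Rightarrow> (lbl set \<Rightarrow> bool) \<Rightarrow> bool" where
  "ranged D A B \<longleftrightarrow> (\<forall>v w. gadj A B v w \<longrightarrow> zd (fst v) (fst w) \<le> int D)"

lemma loc_fin_box: 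
  assumes "loc_fin A" "finite Z" shows "finite {v \<in> A. fst v \<in> Z}"
proof -
  have "{v \<in> A. fst v \<in> Z} = (\<Union>z\<in>Z. {v \<in> A. fst v = z})" by auto
  then show ?thesis using assms by (simp add: loc_fin_def)
qed

text \<open>Before its first vertex beyond distance n the walk stays within distance n, and that
  vertex is at most D further out.\<close>

lemma first_exit:
  assumes rg: "ranged D A B" and v: "v \<in> A" "fst v = z0" and path: "(gadj A B)\<^sup>*\<^sup>* v w" and w: "int n < zd z0 (fst w)"
  shows "reach D z0 n A B"
proof -
  let ?S = "conf (A \<inter> cub (zbox z0 (n + D))) {e. card e = 1 \<or> B e}"
  have inbox: "x \<in> cub (zbox z0 (n + D))" if "zd z0 (fst x) \<le> int n + int D" for x using that by (auto simp: cub_def zbox_def)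
  have "(zd z0 (fst w) \<le> int n \<and> w \<in> A \<and> (cadj ?S)\<^sup>*\<^sup>* v w) \<or> reach D z0 n A B"
    using path
  proof (induction rule: rtranclp_induct)
    case base
    then show ?case using v by simp
  next
    case (step y z)
    show ?case
    proof (cases "reach D z0 n A B")
      case False
      then have y: "zd z0 (fst y) \<le> int n" "y \<in> A" "(cadj ?S)\<^sup>*\<^sup>* v y" using step.IH by auto
      have yz: "z \<in> A" "y \<noteq> z" "B {y, z}" "zd (fst y) (fst z) \<le> int D" using step.hyps(2) rg by (auto simp: gadj_def ranged_def)
      have zb: "zd z0 (fst z) \<le> int n + int D" using zd_triangle[of z0 "fst z" "fst y"] y yz by linarith
      have "cadj ?S y z" using y yz zb inbox[of y] inbox[of z] by (auto simp: cadj_conf)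
      then have vz: "(cadj ?S)\<^sup>*\<^sup>* v z" using y by auto
      show ?thesis
      proof (cases "zd z0 (fst z) \<le> int n")
        case True
        then show ?thesis using yz vz by simp
      next
        case far: False
        have "v \<in> cub {z0}" "z \<in> cub (far z0 n)" using v far by (auto simp: cub_def far_def)
        moreover have "v \<in> A \<inter> cub (zbox z0 (n + D))" "z \<in> A \<inter> cub (zbox z0 (n + D))"
          using v yz inbox[of v] inbox[of z] zb by auto
        ultimately have "reach D z0 n A B" unfolding reach_def con_conf using vz by auto
        then show ?thesis ..
      qed
    qed simp
  qed
  then show ?thesis using w by auto
qed

lemma reach_path:
  assumes "reach D z0 n A B"
  shows "\<exists>v w. v \<in> A \<and> fst v = z0 \<and> (gadj A B)\<^sup>*\<^sup>* v w \<and> int n < zd z0 (fst w)"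
proof -
  let ?S = "conf (A \<inter> cub (zbox z0 (n + D))) {e. card e = 1 \<or> B e}"
  obtain x y where xy: "x \<in> cub {z0}" "y \<in> cub (far z0 n)" "x \<in> A" "(cadj ?S)\<^sup>*\<^sup>* x y"
    using assms unfolding reach_def con_conf by blast
  have "gadj A B u v" if "cadj ?S u v" for u v
  proof -
    have "u \<noteq> v" "u \<in> A" "v \<in> A" "card {u, v} = 1 \<or> B {u, v}" using that unfolding cadj_conf by blast+
    then show ?thesis by (simp add: gadj_def)
  qed
  then have "cadj ?S \<le> gadj A B" by (intro predicate2I)
  then have "(gadj A B)\<^sup>*\<^sup>* x y" using xy(4) by (rule rtranclp_mono[THEN predicate2D])
  then show ?thesis using xy by (auto simp: cub_def far_def)
qed

lemma reach_antimono:
  assumes "ranged D A B" "reach D z0 m A B" "n \<le> m"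
  shows "reach D z0 n A B"
proof -
  obtain v w where vw: "v \<in> A" "fst v = z0" "(gadj A B)\<^sup>*\<^sup>* v w" "int m < zd z0 (fst w)"
    using reach_path[OF assms(2)] by blast
  have "int n < zd z0 (fst w)" using vw(4) assms(3) by linarith
  then show ?thesis using first_exit[OF assms(1) vw(1-3)] by blast
qed

lemma rtranclp_gadj_subset: "{w. (gadj A B)\<^sup>*\<^sup>* v w} \<subseteq> insert v A"
proof
  fix w assume "w \<in> {w. (gadj A B)\<^sup>*\<^sup>* v w}"
  then have "(gadj A B)\<^sup>*\<^sup>* v w" by simp
  then show "w \<in> insert v A" by (cases rule: rtranclp.cases) (auto simp: gadj_def)
qed

lemma inf_cluster_in: "infinite {w. (gadj A B)\<^sup>*\<^sup>* v w} \<Longrightarrow> v \<in> A"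
proof (rule ccontr)
  assume inf: "infinite {w. (gadj A B)\<^sup>*\<^sup>* v w}" and v: "v \<notin> A"
  have "w = v" if "(gadj A B)\<^sup>*\<^sup>* v w" for w
    using that v by (cases rule: converse_rtranclpE) (auto simp: gadj_def)
  then have "{w. (gadj A B)\<^sup>*\<^sup>* v w} \<subseteq> {v}" by auto
  then show False using inf finite_subset by blast
qed

text \<open>A square holds finitely many vertices. If all their clusters were finite, these would
  lie within a bounded distance, and the square could not reach beyond it.\<close>

lemma has_inf_cluster_iff_reach:
  assumes lf: "loc_fin A" and rg: "ranged D A B"
  shows "has_inf_cluster (gadj A B) \<longleftrightarrow> (\<exists>z0. \<forall>n. reach D z0 n A B)"
proof
  assume "has_inf_cluster (gadj A B)"
  then obtain v where v: "infinite {w. (gadj A B)\<^sup>*\<^sup>* v w}" by (auto simp: has_inf_cluster_def)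
  have vA: "v \<in> A" using inf_cluster_in[OF v] .
  have "reach D (fst v) n A B" for n
  proof -
    have "\<not> {w. (gadj A B)\<^sup>*\<^sup>* v w} \<subseteq> {w \<in> A. fst w \<in> zbox (fst v) n}"
      using v loc_fin_box[OF lf finite_zbox] finite_subset by blast
    then obtain w where w: "(gadj A B)\<^sup>*\<^sup>* v w" "w \<notin> {w \<in> A. fst w \<in> zbox (fst v) n}" by blast
    then have "w \<in> A" using rtranclp_gadj_subset[of A B v] vA by auto
    then have "int n < zd (fst v) (fst w)" using w(2) by (auto simp: zbox_def)
    then show ?thesis using first_exit[OF rg vA refl w(1)] by blast
  qed
  then show "\<exists>z0. \<forall>n. reach D z0 n A B" by blast
next
  assume "\<exists>z0. \<forall>n. reach D z0 n A B"
  then obtain z0 where z0: "\<And>n. reach D z0 n A B" by blast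
  show "has_inf_cluster (gadj A B)"
  proof (rule ccontr)
    assume "\<not> has_inf_cluster (gadj A B)"
    then have fin: "finite {w. (gadj A B)\<^sup>*\<^sup>* v w}" for v by (auto simp: has_inf_cluster_def)
    define C where "C = (\<Union>v\<in>{v \<in> A. fst v = z0}. {w. (gadj A B)\<^sup>*\<^sup>* v w})"
    have finC: "finite C" unfolding C_def using lf fin by (auto simp: loc_fin_def)
    define K where "K = nat (Max (insert 0 ((\<lambda>w. zd z0 (fst w)) ` C)))"
    obtain v w where vw: "v \<in> A" "fst v = z0" "(gadj A B)\<^sup>*\<^sup>* v w" "int K < zd z0 (fst w)"
      using reach_path[OF z0[of K]] by blast
    have "w \<in> C" using vw by (auto simp: C_def)
    then have "zd z0 (fst w) \<le> Max (insert 0 ((\<lambda>w. zd z0 (fst w)) ` C))" using finC by (intro Max_ge) auto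
    then show False using vw(4) unfolding K_def by linarith
  qed
qed

text \<open>Degrees are finite, so the cluster of v is covered by P and the remaining clusters of
  finitely many vertices, namely v and the neighbours of P. One of these clusters is
  infinite.\<close>

lemma has_inf_cluster_remove_finite:
  assumes lf: "loc_fin A" and rg: "ranged D A B" and fin: "finite P" and inf: "has_inf_cluster (gadj A B)"
  shows "has_inf_cluster (gadj (A - P) B)"
proof (rule ccontr)
  assume no: "\<not> has_inf_cluster (gadj (A - P) B)"
  then have finc: "finite {w. (gadj (A - P) B)\<^sup>*\<^sup>* v w}" for v by (auto simp: has_inf_cluster_def)
  obtain v where v: "infinite {w. (gadj A B)\<^sup>*\<^sup>* v w}" using inf by (auto simp: has_inf_cluster_def)
  define NP where "NP = P \<union> {w. \<exists>x\<in>P. gadj A B x w}"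
  have "{w. gadj A B x w} \<subseteq> {w \<in> A. fst w \<in> zbox (fst x) D}" for x
    using rg by (auto simp: ranged_def gadj_def zbox_def)
  then have "finite {w. gadj A B x w}" for x using loc_fin_box[OF lf finite_zbox] finite_subset by blast
  moreover have "NP = P \<union> (\<Union>x\<in>P. {w. gadj A B x w})" by (auto simp: NP_def)
  ultimately have finNP: "finite NP" using fin by auto
  define C where "C = P \<union> (\<Union>u\<in>insert v NP. {w. (gadj (A - P) B)\<^sup>*\<^sup>* u w})"
  have "w \<in> C" if "(gadj A B)\<^sup>*\<^sup>* v w" for w
    using that
  proof (induction rule: rtranclp_induct)
    case base
    then show ?case by (auto simp: C_def)
  next
    case (step y z)
    show ?case
    proof (cases "z \<in> P")
      case zP: False
      show ?thesis
      proof (cases "y \<in> P")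
        case True
        then have "z \<in> NP" using step by (auto simp: NP_def)
        then show ?thesis by (auto simp: C_def)
      next
        case False
        then obtain u where u: "u \<in> insert v NP" "(gadj (A - P) B)\<^sup>*\<^sup>* u y" using step.IH unfolding C_def by blast
        have "gadj (A - P) B y z" using step.hyps(2) False zP by (auto simp: gadj_def)
        then have "(gadj (A - P) B)\<^sup>*\<^sup>* u z" using u(2) by auto
        then show ?thesis using u(1) unfolding C_def by blast
      qed
    qed (simp add: C_def)
  qed
  then have "{w. (gadj A B)\<^sup>*\<^sup>* v w} \<subseteq> C" by auto
  moreover have "finite C" unfolding C_def using fin finNP finc by auto
  ultimately show False using v finite_subset by blast
qed

lemma has_inf_cluster_mono:
  assumes "has_inf_cluster adj" "\<And>v w. adj v w \<Longrightarrow> adj' v w"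
  shows "has_inf_cluster adj'"
proof -
  obtain v where v: "infinite {w. adj\<^sup>*\<^sup>* v w}" using assms(1) by (auto simp: has_inf_cluster_def)
  have "adj \<le> adj'" using assms(2) by (intro predicate2I)
  then have "{w. adj\<^sup>*\<^sup>* v w} \<subseteq> {w. adj'\<^sup>*\<^sup>* v w}" using rtranclp_mono[of adj adj'] by auto
  then show ?thesis using v finite_subset unfolding has_inf_cluster_def by blast
qed

lemma pred_rtranclp [measurable (raw)]:
  fixes adj :: "'w \<Rightarrow> 'a::countable \<Rightarrow> 'a \<Rightarrow> bool"
  assumes [measurable]: "\<And>x y. Measurable.pred M (\<lambda>\<omega>. adj \<omega> x y)"
  shows "Measurable.pred M (\<lambda>\<omega>. (adj \<omega>)\<^sup>*\<^sup>* x y)"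
proof -
  have [measurable]: "Measurable.pred M (\<lambda>\<omega>. (adj \<omega> ^^ n) x y)" for n x y
  proof (induction n arbitrary: y)
    case (Suc n)
    have [measurable]: "Measurable.pred M (\<lambda>\<omega>. (adj \<omega> ^^ n) x z)" for z by (rule Suc)
    have "(adj \<omega> ^^ Suc n) x y \<longleftrightarrow> (\<exists>z. (adj \<omega> ^^ n) x z \<and> adj \<omega> z y)" for \<omega>
      by (auto simp: OO_def)
    then show ?case by simp
  qed simp
  show ?thesis unfolding rtranclp_power by measurable
qed

text \<open>With countably many vertices, a cluster is infinite iff it contains vertices of
  arbitrarily large index, which is a countable combination of path events.\<close>

lemma pred_has_inf_cluster [measurable (raw)]:
  fixes adj :: "'w \<Rightarrow> 'a::countable \<Rightarrow> 'a \<Rightarrow> bool"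
  assumes [measurable]: "\<And>x y. Measurable.pred M (\<lambda>\<omega>. adj \<omega> x y)"
  shows "Measurable.pred M (\<lambda>\<omega>. has_inf_cluster (adj \<omega>))"
proof -
  have inf: "infinite S \<longleftrightarrow> (\<forall>n. \<exists>w. n < to_nat w \<and> w \<in> S)" for S :: "'a set"
  proof -
    have "infinite S \<longleftrightarrow> infinite (to_nat ` S)" by (simp add: finite_image_iff)
    also have "\<dots> \<longleftrightarrow> (\<forall>n. \<exists>w. n < to_nat w \<and> w \<in> S)" unfolding infinite_nat_iff_unbounded by blast
    finally show ?thesis .
  qed
  show ?thesis unfolding has_inf_cluster_def inf mem_Collect_eq by measurable
qed

text \<open>Finitely many counts have countably many joint values, so their law is identified by its
  atoms.\<close>

lemma PiM_poisson_marginal: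
  fixes h :: "('i \<Rightarrow> nat) \<Rightarrow> real"
  assumes Z: "finite Z" and dep: "\<And>k. h k = h (\<lambda>z. if z \<in> Z then k z else 0)"
  shows "(\<integral>N. h N \<partial>PiM UNIV (\<lambda>_. measure_pmf q)) = measure_pmf.expectation (Pi_pmf Z 0 (\<lambda>_. q)) h"
    and "h \<in> borel_measurable (PiM UNIV (\<lambda>_. measure_pmf q))"
proof -
  let ?P = "PiM UNIV (\<lambda>_::'i. measure_pmf q)"
  define \<rho> where "\<rho> N = (\<lambda>z. if z \<in> Z then N z else (0::nat))" for N :: "'i \<Rightarrow> nat"
  define \<Omega> where "\<Omega> = PiE_dflt Z (0::nat) (\<lambda>_. UNIV)"
  have spP: "space ?P = UNIV" by (simp add: space_PiM)
  have cnt: "countable \<Omega>"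
  proof -
    have "\<Omega> \<subseteq> (\<lambda>g z. if z \<in> Z then g z else 0) ` (PiE Z (\<lambda>_. UNIV))"
    proof
      fix k assume "k \<in> \<Omega>"
      then have "k = (\<lambda>z. if z \<in> Z then restrict k Z z else 0)" by (auto simp: \<Omega>_def PiE_dflt_def)
      then show "k \<in> (\<lambda>g z. if z \<in> Z then g z else 0) ` (PiE Z (\<lambda>_. UNIV))" by (intro image_eqI[of _ _ "restrict k Z"]) auto
    qed
    moreover have "countable (PiE Z (\<lambda>_. UNIV :: nat set))" using Z by (intro countable_PiE) auto
    ultimately show ?thesis by (meson countable_image countable_subset)
  qed
  have \<rho>\<Omega>: "\<rho> N \<in> \<Omega>" for N by (auto simp: \<rho>_def \<Omega>_def PiE_dflt_def)
  have pre: "\<rho> -` {k} \<inter> space ?P = prod_emb UNIV (\<lambda>_. measure_pmf q) Z (PiE Z (\<lambda>z. {k z}))" if "k \<in> \<Omega>" for k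
    using that by (auto simp: spP \<rho>_def \<Omega>_def PiE_dflt_def prod_emb_def fun_eq_iff PiE_iff extensional_def)
  have pres: "\<rho> -` {k} \<inter> space ?P \<in> sets ?P" if "k \<in> \<Omega>" for k
    unfolding pre[OF that] using Z by (intro sets_PiM_I) auto
  have meas: "\<rho> \<in> ?P \<rightarrow>\<^sub>M count_space UNIV"
  proof (rule measurableI)
    fix S :: "('i \<Rightarrow> nat) set"
    have "\<rho> -` S \<inter> space ?P = (\<Union>k\<in>S \<inter> \<Omega>. \<rho> -` {k} \<inter> space ?P)" using \<rho>\<Omega> by auto
    also have "\<dots> \<in> sets ?P" using cnt pres by (intro sets.countable_UN') auto
    finally show "\<rho> -` S \<inter> space ?P \<in> sets ?P" .
  qed auto
  have eq: "distr ?P (count_space UNIV) \<rho> = measure_pmf (Pi_pmf Z 0 (\<lambda>_. q))"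
  proof (rule measure_eqI_countable_AE[OF _ _ _ _ cnt])
    show "AE x in distr ?P (count_space UNIV) \<rho>. x \<in> \<Omega>" using meas \<rho>\<Omega> by (subst AE_distr_iff) auto
    show "AE x in measure_pmf (Pi_pmf Z 0 (\<lambda>_. q)). x \<in> \<Omega>"
      using set_Pi_pmf_subset'[OF Z, of 0 "\<lambda>_. q"] by (auto simp: AE_measure_pmf_iff \<Omega>_def PiE_dflt_def)
    fix k assume k: "k \<in> \<Omega>"
    have "emeasure (distr ?P (count_space UNIV) \<rho>) {k} = emeasure ?P (prod_emb UNIV (\<lambda>_. measure_pmf q) Z (PiE Z (\<lambda>z. {k z})))"
      using meas pre[OF k] by (simp add: emeasure_distr)
    also have "\<dots> = (\<Prod>z\<in>Z. emeasure (measure_pmf q) {k z})"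
      using Z by (intro emeasure_PiM_emb) (auto intro: measure_pmf.prob_space_axioms)
    also have "\<dots> = ennreal (\<Prod>z\<in>Z. pmf q (k z))" by (simp add: emeasure_pmf_single prod_ennreal)
    also have "\<dots> = emeasure (measure_pmf (Pi_pmf Z 0 (\<lambda>_. q))) {k}"
      using k by (simp add: emeasure_pmf_single pmf_Pi[OF Z] \<Omega>_def PiE_dflt_def)
    finally show "emeasure (distr ?P (count_space UNIV) \<rho>) {k} = emeasure (measure_pmf (Pi_pmf Z 0 (\<lambda>_. q))) {k}" .
  qed auto
  have h\<rho>: "h N = h (\<rho> N)" for N using dep[of N] by (simp add: \<rho>_def)
  have "(\<lambda>N. h (\<rho> N)) \<in> borel_measurable ?P" using meas by (rule measurable_compose) simp
  then show "h \<in> borel_measurable ?P" using h\<rho> by (metis measurable_cong)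
  have "(\<integral>N. h N \<partial>?P) = (\<integral>N. h (\<rho> N) \<partial>?P)" using h\<rho> by simp
  also have "\<dots> = (\<integral>k. h k \<partial>distr ?P (count_space UNIV) \<rho>)" using meas by (subst integral_distr) auto
  finally show "(\<integral>N. h N \<partial>?P) = measure_pmf.expectation (Pi_pmf Z 0 (\<lambda>_. q)) h" unfolding eq .
qed

section \<open>Finite-volume connections in the random connection model\<close>

definition PN :: "real \<Rightarrow> (int \<times> int \<Rightarrow> nat) measure" where
  "PN lam = PiM UNIV (\<lambda>z. measure_pmf (poisson_pmf lam))"

definition PU :: "(lbl set \<Rightarrow> real) measure" where
  "PU = PiM UNIV (\<lambda>e::lbl set. uniform_measure lborel {0..1::real})"

definition PB :: "real \<Rightarrow> ('i \<Rightarrow> bool) measure" where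
  "PB p = PiM UNIV (\<lambda>_. measure_pmf (bernoulli_pmf p))"

definition vset :: "(int \<times> int \<Rightarrow> nat) \<Rightarrow> lbl set" where
  "vset N = {v. snd v < N (fst v)}"

lemma RCM_space_eq: "RCM_space lam = (PN lam \<Otimes>\<^sub>M PX) \<Otimes>\<^sub>M PU"
  by (simp add: RCM_space_def PN_def PX_def PU_def)

lemma prob_space_U01: "prob_space (uniform_measure lborel {0..1::real})"
  by (intro prob_space_uniform_measure) auto

lemma prob_space_PN: "prob_space (PN lam)"
  unfolding PN_def by (intro prob_space_PiM measure_pmf.prob_space_axioms)

lemma prob_space_PU: "prob_space PU"
  unfolding PU_def by (intro prob_space_PiM prob_space_U01)

lemma prob_space_PB: "prob_space (PB p)"
  unfolding PB_def by (intro prob_space_PiM measure_pmf.prob_space_axioms)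

lemma prob_space_NX: "prob_space (PN lam \<Otimes>\<^sub>M PX)"
  by (intro prob_space_pair prob_space_PN prob_space_PX)

lemma prob_space_RCM: "prob_space (RCM_space lam)"
  unfolding RCM_space_eq by (intro prob_space_pair prob_space_NX prob_space_PU)

lemma space_all [simp]: "space (PN lam) = UNIV" "space PX = UNIV" "space PU = UNIV" "space (PB p) = UNIV" "space (RCM_space lam) = UNIV"
  by (simp_all add: PN_def PX_def PU_def PB_def RCM_space_eq space_pair_measure space_PiM)

lemma PN_component [measurable]: "(\<lambda>N. N z) \<in> PN lam \<rightarrow>\<^sub>M count_space UNIV"
proof -
  have "(\<lambda>N. N z) \<in> PN lam \<rightarrow>\<^sub>M measure_pmf (poisson_pmf lam)" unfolding PN_def by (rule measurable_component_singleton) simp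
  then show ?thesis by (simp cong: measurable_cong_sets)
qed

lemma PB_component [measurable]: "(\<lambda>N. N z) \<in> PB p \<rightarrow>\<^sub>M count_space UNIV"
proof -
  have "(\<lambda>N. N z) \<in> PB p \<rightarrow>\<^sub>M measure_pmf (bernoulli_pmf p)" unfolding PB_def by (rule measurable_component_singleton) simp
  then show ?thesis by (simp cong: measurable_cong_sets)
qed

lemma PU_component [measurable]: "(\<lambda>U. U e) \<in> borel_measurable PU"
proof -
  have "(\<lambda>U. U e) \<in> PU \<rightarrow>\<^sub>M uniform_measure lborel {0..1::real}" unfolding PU_def by (rule measurable_component_singleton) simp
  then show ?thesis by (simp cong: measurable_cong_sets)
qed

lemma measure_U01: "0 \<le> t \<Longrightarrow> t \<le> 1 \<Longrightarrow> measure (uniform_measure lborel {0..1::real}) {y. y < t} = t"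
proof -
  assume t: "0 \<le> t" "t \<le> 1"
  have "emeasure (uniform_measure lborel {0..1::real}) {y. y < t} = emeasure lborel ({0..1} \<inter> {y. y < t}) / emeasure lborel {0..1::real}"
    by (intro emeasure_uniform_measure) auto
  also have "{0..1} \<inter> {y. y < t} = {0..<t}" using t by auto
  finally have "emeasure (uniform_measure lborel {0..1::real}) {y. y < t} = ennreal t / 1" using t by simp
  then show ?thesis using t divide_ennreal[of t 1] by (simp add: measure_def)
qed

lemma pair_integral_01:
  fixes h :: "'a \<times> 'b \<Rightarrow> real"
  assumes "prob_space M1" "prob_space M2" and h[measurable]: "h \<in> borel_measurable (M1 \<Otimes>\<^sub>M M2)"
    and bd: "\<And>x. 0 \<le> h x \<and> h x \<le> 1"
  shows "(\<integral>z. h z \<partial>(M1 \<Otimes>\<^sub>M M2)) = (\<integral>x. (\<integral>y. h (x, y) \<partial>M2) \<partial>M1)"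
    and "(\<lambda>x. \<integral>y. h (x, y) \<partial>M2) \<in> borel_measurable M1"
    and "0 \<le> (\<integral>y. h (x, y) \<partial>M2) \<and> (\<integral>y. h (x, y) \<partial>M2) \<le> 1"
proof -
  interpret M1: prob_space M1 by fact
  interpret M2: prob_space M2 by fact
  interpret P: pair_prob_space M1 M2 ..
  have "integrable (M1 \<Otimes>\<^sub>M M2) h" using bd by (intro P.integrable_const_bound[where B = 1]) auto
  then show "(\<integral>z. h z \<partial>(M1 \<Otimes>\<^sub>M M2)) = (\<integral>x. (\<integral>y. h (x, y) \<partial>M2) \<partial>M1)" using P.integral_fst'[of h] by simp
  show "(\<lambda>x. \<integral>y. h (x, y) \<partial>M2) \<in> borel_measurable M1" by measurable
  show "0 \<le> (\<integral>y. h (x, y) \<partial>M2) \<and> (\<integral>y. h (x, y) \<partial>M2) \<le> 1"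
  proof (cases "integrable M2 (\<lambda>y. h (x, y))")
    case True
    then have "(\<integral>y. h (x, y) \<partial>M2) \<le> (\<integral>y. 1 \<partial>M2)" using bd by (intro integral_mono) auto
    then show ?thesis using bd by (auto simp: M2.prob_space intro!: integral_nonneg_AE)
  qed (simp add: not_integrable_integral_eq)
qed

lemma RCM_integral:
  fixes h :: "rcm_sample \<Rightarrow> real"
  assumes h: "h \<in> borel_measurable (RCM_space lam)" and bd: "\<And>x. 0 \<le> h x \<and> h x \<le> 1"
  shows "(\<integral>\<omega>. h \<omega> \<partial>RCM_space lam) = (\<integral>N. (\<integral>X. (\<integral>U. h ((N, X), U) \<partial>PU) \<partial>PX) \<partial>PN lam)"
proof -
  note i1 = pair_integral_01[OF prob_space_NX prob_space_PU h[unfolded RCM_space_eq] bd]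
  note i2 = pair_integral_01[OF prob_space_PN prob_space_PX i1(2) i1(3)]
  show ?thesis using i1(1) i2(1) unfolding RCM_space_eq by simp
qed

lemma pred_reach:
  assumes A: "\<And>v. Measurable.pred M (\<lambda>\<omega>. v \<in> A \<omega>)"
    and B: "\<And>u v. u \<noteq> v \<Longrightarrow> Measurable.pred M (\<lambda>\<omega>. B \<omega> {u, v})"
  shows "Measurable.pred M (\<lambda>\<omega>. reach D z0 n (A \<omega>) (B \<omega>))"
proof -
  let ?S = "\<lambda>\<omega>. conf (A \<omega> \<inter> cub (zbox z0 (n + D))) {e. card e = 1 \<or> B \<omega> e}"
  have c: "Measurable.pred M (\<lambda>\<omega>. cadj (?S \<omega>) x y)" for x y
  proof (cases "x = y")
    case True
    then show ?thesis by (simp add: cadj_conf)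
  next
    case False
    have eq: "cadj (?S \<omega>) x y \<longleftrightarrow> (x \<in> cub (zbox z0 (n + D)) \<and> y \<in> cub (zbox z0 (n + D))) \<and> x \<in> A \<omega> \<and> y \<in> A \<omega> \<and> B \<omega> {x, y}" for \<omega>
      using False by (auto simp: cadj_conf)
    show ?thesis unfolding eq by (intro pred_intros_logic A B False) simp_all
  qed
  have eq: "reach D z0 n (A \<omega>) (B \<omega>) \<longleftrightarrow> (\<exists>x. \<exists>y. (x \<in> cub {z0} \<and> y \<in> cub (far z0 n) \<and> x \<in> cub (zbox z0 (n + D)) \<and> y \<in> cub (zbox z0 (n + D)))
      \<and> x \<in> A \<omega> \<and> y \<in> A \<omega> \<and> (cadj (?S \<omega>))\<^sup>*\<^sup>* x y)" for \<omega>
    unfolding reach_def con_conf by (simp add: Bex_def) blast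
  show ?thesis unfolding eq by (intro pred_intros_countable pred_intros_logic pred_rtranclp A c) simp_all
qed

lemma pred_gadj:
  assumes [measurable]: "\<And>v. Measurable.pred M (\<lambda>\<omega>. v \<in> A \<omega>)"
    and B: "\<And>u v. u \<noteq> v \<Longrightarrow> Measurable.pred M (\<lambda>\<omega>. B \<omega> {u, v})"
  shows "Measurable.pred M (\<lambda>\<omega>. gadj (A \<omega>) (B \<omega>) u v)"
proof (cases "u = v")
  case True
  then show ?thesis by (simp add: gadj_def)
next
  case False
  have [measurable]: "Measurable.pred M (\<lambda>\<omega>. B \<omega> {u, v})" by (rule B[OF False])
  show ?thesis unfolding gadj_def by measurable
qed

lemma loc_fin_vset: "A \<subseteq> vset N \<Longrightarrow> loc_fin A"
  unfolding loc_fin_def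
proof
  fix z assume A: "A \<subseteq> vset N"
  have "{v \<in> A. fst v = z} \<subseteq> {z} \<times> {..<N z}" using A by (auto simp: vset_def)
  then show "finite {v \<in> A. fst v = z}" using finite_subset by blast
qed

lemma vset_cub: "vset N \<inter> cub Z = std Z N"
  by (auto simp: vset_def cub_def std_def)

definition ebond :: "(real \<Rightarrow> real) \<Rightarrow> (lbl \<Rightarrow> real \<times> real) \<Rightarrow> (lbl set \<Rightarrow> real) \<Rightarrow> lbl set \<Rightarrow> bool" where
  "ebond f X U e \<longleftrightarrow> U e < f (pdist X e)"

lemma rcm_adj_gadj: "rcm_adj f ((N, X), U) = gadj (vset N) (ebond f X U)"
  by (intro ext) (simp add: rcm_adj_def gadj_def vset_def rcm_vertices_def rcm_pos_def ebond_def pdist_pair)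

lemma meas_X [measurable]: "(\<lambda>\<omega>. snd (fst \<omega>)) \<in> RCM_space lam \<rightarrow>\<^sub>M PX" "(\<lambda>\<omega>. snd \<omega>) \<in> RCM_space lam \<rightarrow>\<^sub>M PU"
   "(\<lambda>\<omega>. fst (fst \<omega>)) \<in> RCM_space lam \<rightarrow>\<^sub>M PN lam"
  unfolding RCM_space_eq by measurable

lemma pred_vset [measurable (raw)]:
  assumes [measurable]: "a \<in> M \<rightarrow>\<^sub>M PN lam"
  shows "Measurable.pred M (\<lambda>\<omega>. v \<in> vset (a \<omega>))"
  unfolding vset_def mem_Collect_eq by measurable

context conn_meas
begin

lemma pred_ebond:
  assumes [measurable]: "a \<in> M \<rightarrow>\<^sub>M PX" "b \<in> M \<rightarrow>\<^sub>M PU" and uv: "u \<noteq> v"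
  shows "Measurable.pred M (\<lambda>\<omega>. ebond g (a \<omega>) (b \<omega>) {u, v})"
proof -
  have c: "card {u, v} = 2" using uv by simp
  have [measurable]: "(\<lambda>X. g (pdist X {u, v})) \<in> borel_measurable PX" by (rule g_pdist_measurable[OF c])
  show ?thesis unfolding ebond_def by measurable
qed

text \<open>For fixed positions the uniform variables act as independent coins. Singletons, which
  are the marks, are always counted as present, whence the rate 1.\<close>

lemma coin_PU:
  assumes A: "finite A"
  shows "(\<integral>U. h {e \<in> eidx A. card e = 1 \<or> ebond g X U e} \<partial>PU) = bexp (eidx A) (rr 1 g X) h"
proof -
  let ?Q = "\<lambda>e y. card e = 1 \<or> y < g (pdist X e)"
  have "(\<integral>U. h {e \<in> eidx A. ?Q e (U e)} \<partial>PU)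
     = bexp (eidx A) (\<lambda>e. measure (uniform_measure lborel {0..1::real}) {y \<in> space (uniform_measure lborel {0..1::real}). ?Q e y}) h"
    unfolding PU_def using A by (intro PiM_coin_integral prob_space_U01) auto
  also have "\<dots> = bexp (eidx A) (rr 1 g X) h"
  proof (intro bexp_cong refl)
    fix e assume e: "e \<in> eidx A"
    interpret U: prob_space "uniform_measure lborel {0..1::real}" by (rule prob_space_U01)
    show "measure (uniform_measure lborel {0..1::real}) {y \<in> space (uniform_measure lborel {0..1::real}). ?Q e y} = rr 1 g X e"
    proof (cases "card e = 1")
      case True
      then show ?thesis using U.prob_space by (simp add: rr_def)
    next
      case False
      have "finite e" "e \<noteq> {}" using e by (auto simp: eidx_def intro: card_ge_0_finite)
      then have b: "0 \<le> g (pdist X e)" "g (pdist X e) \<le> 1" using g01[OF pdist_nonneg] by blast+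
      have "{y \<in> space (uniform_measure lborel {0..1::real}). ?Q e y} = {y. y < g (pdist X e)}" using False by auto
      then show ?thesis using False measure_U01[OF b] by (simp only: rr_def if_False)
    qed
  qed
  finally show ?thesis by (simp add: ebond_def)
qed

lemma con_coin:
  "con P Q (conf A {e. card e = 1 \<or> E e}) = con P Q (conf A {e \<in> eidx A. card e = 1 \<or> E e})"
proof -
  have "{e. card e = 1 \<or> E e} \<inter> eidx A = {e \<in> eidx A. card e = 1 \<or> E e}" by auto
  then show ?thesis using con_conf_Int[of P Q A "{e. card e = 1 \<or> E e}"] by simp
qed

lemma expectation_qf_marginal:
  fixes H :: "(int \<times> int \<Rightarrow> nat) \<Rightarrow> real"
  assumes "finite Z" "\<And>N. H N = H' (std Z N)"
  shows "(\<integral>N. H N \<partial>PN lam) = measure_pmf.expectation (Pi_pmf Z 0 (\<lambda>_. poisson_pmf lam)) H"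
  unfolding PN_def
proof (rule PiM_poisson_marginal(1)[OF assms(1)])
  fix k :: "int \<times> int \<Rightarrow> nat"
  have "std Z k = std Z (\<lambda>z. if z \<in> Z then k z else 0)" by (auto simp: std_def)
  then show "H k = H (\<lambda>z. if z \<in> Z then k z else 0)" using assms(2)[of k] assms(2)[of "\<lambda>z. if z \<in> Z then k z else 0"] by simp
qed

lemma prob_reach_rcm:
  "measure (RCM_space lam) {\<omega>. reach D z0 n (vset (fst (fst \<omega>))) (ebond g (snd (fst \<omega>)) (snd \<omega>))}
     = theta 1 g {z0} (far z0 n) (zbox z0 (n + D)) lam"
    (is "measure _ {\<omega>. ?R \<omega>} = _")
  and sets_reach_rcm: "Measurable.pred (RCM_space lam) (\<lambda>\<omega>. reach D z0 n (vset (fst (fst \<omega>))) (ebond g (snd (fst \<omega>)) (snd \<omega>)))"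
proof -
  let ?Z = "zbox z0 (n + D)"
  show pr: "Measurable.pred (RCM_space lam) ?R" by (intro pred_reach pred_ebond pred_vset[of _ _ lam]) measurable
  then have m: "{\<omega>. ?R \<omega>} \<in> sets (RCM_space lam)" by (simp add: pred_def)
  have "measure (RCM_space lam) {\<omega>. ?R \<omega>} = (\<integral>\<omega>. of_bool (?R \<omega>) \<partial>RCM_space lam)"
  proof -
    have "(\<integral>\<omega>. of_bool (?R \<omega>) \<partial>RCM_space lam) = (\<integral>\<omega>. indicator {\<omega>. ?R \<omega>} \<omega> \<partial>RCM_space lam :: real)"
      by (intro Bochner_Integration.integral_cong) (auto simp: indicator_def)
    then show ?thesis using m by simp
  qed
  also have "\<dots> = (\<integral>N. (\<integral>X. (\<integral>U. of_bool (reach D z0 n (vset N) (ebond g X U)) \<partial>PU) \<partial>PX) \<partial>PN lam)"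
    using pr by (subst RCM_integral) auto
  also have "\<dots> = (\<integral>N. qf 1 g {z0} (far z0 n) (std ?Z N) \<partial>PN lam)"
    unfolding qf_def reach_def vset_cub con_coin
    using coin_PU[of "std ?Z _" "\<lambda>F. of_bool (con (cub {z0}) (cub (far z0 n)) (conf (std ?Z _) F))"] by simp
  also have "\<dots> = theta 1 g {z0} (far z0 n) ?Z lam"
    unfolding theta_def by (intro expectation_qf_marginal) auto
  finally show "measure (RCM_space lam) {\<omega>. ?R \<omega>} = theta 1 g {z0} (far z0 n) ?Z lam" .
qed

text \<open>The percolation coins are integrated first, for fixed graph; they thin the vertex set,
  and \<open>theta_thinning\<close> turns this into a lower intensity.\<close>

lemma prob_reach_site:
  assumes p: "0 < p" "p \<le> 1" and lam: "0 < lam"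
  shows "measure (RCM_space lam \<Otimes>\<^sub>M PB p) {z. reach D z0 n (vset (fst (fst (fst z))) \<inter> {v. snd z v}) (ebond g (snd (fst (fst z))) (snd (fst z)))}
     = theta 1 g {z0} (far z0 n) (zbox z0 (n + D)) (p * lam)"
    (is "measure ?J {z. ?R z} = _")
  and "Measurable.pred (RCM_space lam \<Otimes>\<^sub>M PB p)
     (\<lambda>z. reach D z0 n (vset (fst (fst (fst z))) \<inter> {v. snd z v}) (ebond g (snd (fst (fst z))) (snd (fst z))))"
proof -
  let ?Z = "zbox z0 (n + D)" and ?con = "\<lambda>S. of_bool (con (cub {z0}) (cub (far z0 n)) S) :: real"
  show pr: "Measurable.pred ?J ?R"
    by (intro pred_reach pred_ebond, unfold Int_iff mem_Collect_eq) measurable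
  then have m: "{z. ?R z} \<in> sets ?J" by (simp add: pred_def space_pair_measure)
  note alt = measure_pair_measure_alt[OF prob_space_RCM prob_space_PB m]
  have inner: "measure (PB p) (Pair \<omega> -` {z. ?R z}) = bexp (std ?Z (fst (fst \<omega>))) (\<lambda>_. p)
      (\<lambda>A. ?con (conf A {e. card e = 1 \<or> ebond g (snd (fst \<omega>)) (snd \<omega>) e}))" for \<omega>
  proof -
    interpret B: prob_space "PB p :: (lbl \<Rightarrow> bool) measure" by (rule prob_space_PB)
    let ?F = "{e. card e = 1 \<or> ebond g (snd (fst \<omega>)) (snd \<omega>) e}"
    have s: "Pair \<omega> -` {z. ?R z} \<in> sets (PB p)" using sets_Pair1[OF m, of \<omega>] by simp
    have "vset (fst (fst \<omega>)) \<inter> {v. \<eta> v} \<inter> cub ?Z = {v \<in> std ?Z (fst (fst \<omega>)). \<eta> v}" for \<eta>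
      using vset_cub[of "fst (fst \<omega>)" ?Z] by auto
    then have "indicator (Pair \<omega> -` {z. ?R z}) \<eta> = ?con (conf {v \<in> std ?Z (fst (fst \<omega>)). \<eta> v} ?F)" for \<eta>
      by (simp add: indicator_def reach_def of_bool_def)
    then have "measure (PB p) (Pair \<omega> -` {z. ?R z}) = (\<integral>\<eta>. ?con (conf {v \<in> std ?Z (fst (fst \<omega>)). \<eta> v} ?F) \<partial>PB p)"
      using s by (subst (asm) eq_commute) simp
    also have "\<dots> = bexp (std ?Z (fst (fst \<omega>))) (\<lambda>e. measure (measure_pmf (bernoulli_pmf p)) {y \<in> space (measure_pmf (bernoulli_pmf p)). y}) (\<lambda>A. ?con (conf A ?F))"
      unfolding PB_def by (intro PiM_coin_integral[of "\<lambda>_. measure_pmf (bernoulli_pmf p)" _ "\<lambda>_ y. y" "\<lambda>A. ?con (conf A ?F)"] measure_pmf.prob_space_axioms) auto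
    also have "measure (measure_pmf (bernoulli_pmf p)) {y \<in> space (measure_pmf (bernoulli_pmf p)). y} = p"
    proof -
      have "{y \<in> space (measure_pmf (bernoulli_pmf p)). y} = {True}" by auto
      then show ?thesis using p by (simp add: measure_pmf_single)
    qed
    finally show ?thesis .
  qed
  have "measure ?J {z. ?R z} = (\<integral>\<omega>. bexp (std ?Z (fst (fst \<omega>))) (\<lambda>_. p)
      (\<lambda>A. ?con (conf A {e. card e = 1 \<or> ebond g (snd (fst \<omega>)) (snd \<omega>) e})) \<partial>RCM_space lam)"
    using alt(1) unfolding inner by simp
  also have "\<dots> = (\<integral>N. (\<integral>X. (\<integral>U. bexp (std ?Z N) (\<lambda>_. p) (\<lambda>A. ?con (conf A {e. card e = 1 \<or> ebond g X U e})) \<partial>PU) \<partial>PX) \<partial>PN lam)"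
  proof (subst RCM_integral)
    show "(\<lambda>\<omega>. bexp (std ?Z (fst (fst \<omega>))) (\<lambda>_. p) (\<lambda>A. ?con (conf A {e. card e = 1 \<or> ebond g (snd (fst \<omega>)) (snd \<omega>) e}))) \<in> borel_measurable (RCM_space lam)"
      using alt(2) unfolding inner .
    fix \<omega>
    show "0 \<le> bexp (std ?Z (fst (fst \<omega>))) (\<lambda>_. p) (\<lambda>A. ?con (conf A {e. card e = 1 \<or> ebond g (snd (fst \<omega>)) (snd \<omega>) e})) \<and>
      bexp (std ?Z (fst (fst \<omega>))) (\<lambda>_. p) (\<lambda>A. ?con (conf A {e. card e = 1 \<or> ebond g (snd (fst \<omega>)) (snd \<omega>) e})) \<le> 1"
      unfolding inner[symmetric] using prob_space.prob_le_1[OF prob_space_PB] by auto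
  qed simp
  also have "\<dots> = (\<integral>N. bexp (std ?Z N) (\<lambda>_. p) (qf 1 g {z0} (far z0 n)) \<partial>PN lam)"
  proof (intro Bochner_Integration.integral_cong refl)
    fix N :: "int \<times> int \<Rightarrow> nat"
    let ?W = "std ?Z N"
    have fin: "finite A" if "A \<subseteq> ?W" for A using finite_subset[OF that] by simp
    have "(\<integral>U. bexp ?W (\<lambda>_. p) (\<lambda>A. ?con (conf A {e. card e = 1 \<or> ebond g X U e})) \<partial>PU)
        = bexp ?W (\<lambda>_. p) (\<lambda>A. bexp (eidx A) (rr 1 g X) (\<lambda>F. ?con (conf A F)))" for X
    proof -
      interpret PU: prob_space PU by (rule prob_space_PU)
      have "(\<integral>U. bexp ?W (\<lambda>_. p) (\<lambda>A. ?con (conf A {e. card e = 1 \<or> ebond g X U e})) \<partial>PU)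
          = bexp ?W (\<lambda>_. p) (\<lambda>A. \<integral>U. ?con (conf A {e. card e = 1 \<or> ebond g X U e}) \<partial>PU)"
      proof (rule bexp_integral(1))
        fix A assume A: "A \<subseteq> ?W"
        show "integrable PU (\<lambda>U. ?con (conf A {e. card e = 1 \<or> ebond g X U e}))"
        proof (rule PU.integrable_const_bound[where B = 1])
          show "(\<lambda>U. ?con (conf A {e. card e = 1 \<or> ebond g X U e})) \<in> borel_measurable PU"
            unfolding con_coin using fin[OF A]
            by (intro PiM_coin_measurable[where J = "eidx A" and N = PU and Q = "\<lambda>e U. card e = 1 \<or> ebond g X U e" and h = "\<lambda>F. ?con (conf A F)"]) (auto simp: ebond_def)
        qed auto
      qed simp
      also have "\<dots> = bexp ?W (\<lambda>_. p) (\<lambda>A. bexp (eidx A) (rr 1 g X) (\<lambda>F. ?con (conf A F)))"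
      proof (intro bexp_cong refl)
        fix A assume A: "A \<subseteq> ?W"
        show "(\<integral>U. ?con (conf A {e. card e = 1 \<or> ebond g X U e}) \<partial>PU) = bexp (eidx A) (rr 1 g X) (\<lambda>F. ?con (conf A F))"
          unfolding con_coin by (rule coin_PU[OF fin[OF A]])
      qed
      finally show ?thesis .
    qed
    then have "(\<integral>X. (\<integral>U. bexp ?W (\<lambda>_. p) (\<lambda>A. ?con (conf A {e. card e = 1 \<or> ebond g X U e})) \<partial>PU) \<partial>PX)
       = (\<integral>X. bexp ?W (\<lambda>_. p) (\<lambda>A. bexp (eidx A) (rr 1 g X) (\<lambda>F. ?con (conf A F))) \<partial>PX)" by simp
    also have "\<dots> = bexp ?W (\<lambda>_. p) (qf 1 g {z0} (far z0 n))"
      unfolding qf_def[abs_def]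
    proof (rule bexp_integral(1))
      show "integrable PX (\<lambda>X. bexp (eidx A) (rr 1 g X) (\<lambda>F. ?con (conf A F)))" if "A \<subseteq> ?W" for A
        by (rule bexp_rr_integrable[OF fin[OF that]]) auto
    qed simp
    finally show "(\<integral>X. (\<integral>U. bexp ?W (\<lambda>_. p) (\<lambda>A. ?con (conf A {e. card e = 1 \<or> ebond g X U e})) \<partial>PU) \<partial>PX)
       = bexp ?W (\<lambda>_. p) (qf 1 g {z0} (far z0 n))" .
  qed
  also have "\<dots> = measure_pmf.expectation (Pi_pmf ?Z 0 (\<lambda>_. poisson_pmf lam)) (\<lambda>N. bexp (std ?Z N) (\<lambda>_. p) (qf 1 g {z0} (far z0 n)))"
    by (rule expectation_qf_marginal[where H' = "\<lambda>W. bexp W (\<lambda>_. p) (qf 1 g {z0} (far z0 n))"]) simp_all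
  also have "\<dots> = theta 1 g {z0} (far z0 n) ?Z (p * lam)"
    using p lam by (intro theta_thinning) auto
  finally show "measure ?J {z. ?R z} = theta 1 g {z0} (far z0 n) ?Z (p * lam)" .
qed

text \<open>\<open>bexp_Int\<close> merges edge variables and percolation coins into edges of
  probability p * g. Marks have rate 1 in both factors.\<close>

lemma prob_reach_bond:
  assumes p: "0 < p" "p \<le> 1"
  shows "measure (RCM_space lam \<Otimes>\<^sub>M PB p) {z. reach D z0 n (vset (fst (fst (fst z)))) (\<lambda>e. ebond g (snd (fst (fst z))) (snd (fst z)) e \<and> snd z e)}
     = theta 1 (\<lambda>r. p * g r) {z0} (far z0 n) (zbox z0 (n + D)) lam"
    (is "measure ?J {z. ?R z} = _")
  and "Measurable.pred (RCM_space lam \<Otimes>\<^sub>M PB p)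
     (\<lambda>z. reach D z0 n (vset (fst (fst (fst z)))) (\<lambda>e. ebond g (snd (fst (fst z))) (snd (fst z)) e \<and> snd z e))"
proof -
  let ?Z = "zbox z0 (n + D)" and ?con = "\<lambda>S. of_bool (con (cub {z0}) (cub (far z0 n)) S) :: real"
  let ?q = "\<lambda>e::lbl set. if card e = 1 then 1 else p"
  show pr: "Measurable.pred ?J ?R"
    by (intro pred_reach pred_intros_logic pred_ebond) measurable
  then have m: "{z. ?R z} \<in> sets ?J" by (simp add: pred_def space_pair_measure)
  note alt = measure_pair_measure_alt[OF prob_space_RCM prob_space_PB m]
  have inner: "measure (PB p) (Pair \<omega> -` {z. ?R z}) = (let A = std ?Z (fst (fst \<omega>)) in
      bexp (eidx A) ?q (\<lambda>G. ?con (conf A ({e \<in> eidx A. card e = 1 \<or> ebond g (snd (fst \<omega>)) (snd \<omega>) e} \<inter> G))))" for \<omega>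
  proof -
    interpret B: prob_space "PB p :: (lbl set \<Rightarrow> bool) measure" by (rule prob_space_PB)
    let ?A = "std ?Z (fst (fst \<omega>))"
    let ?F = "{e \<in> eidx ?A. card e = 1 \<or> ebond g (snd (fst \<omega>)) (snd \<omega>) e}"
    have s: "Pair \<omega> -` {z. ?R z} \<in> sets (PB p)" using sets_Pair1[OF m, of \<omega>] by simp
    have "{e \<in> eidx ?A. card e = 1 \<or> ebond g (snd (fst \<omega>)) (snd \<omega>) e \<and> \<eta> e} = ?F \<inter> {e \<in> eidx ?A. card e = 1 \<or> \<eta> e}" for \<eta> by auto
    then have "?R (\<omega>, \<eta>) \<longleftrightarrow> con (cub {z0}) (cub (far z0 n)) (conf ?A (?F \<inter> {e \<in> eidx ?A. card e = 1 \<or> \<eta> e}))" for \<eta>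
      unfolding reach_def fst_conv snd_conv vset_cub con_coin by simp
    then have "indicator (Pair \<omega> -` {z. ?R z}) \<eta> = ?con (conf ?A (?F \<inter> {e \<in> eidx ?A. card e = 1 \<or> \<eta> e}))" for \<eta>
      by (simp only: indicator_def vimage_def mem_Collect_eq)
    then have "measure (PB p) (Pair \<omega> -` {z. ?R z}) = (\<integral>\<eta>. ?con (conf ?A (?F \<inter> {e \<in> eidx ?A. card e = 1 \<or> \<eta> e})) \<partial>PB p)"
      using s by (subst (asm) eq_commute) simp
    also have "\<dots> = bexp (eidx ?A) (\<lambda>e. measure (measure_pmf (bernoulli_pmf p)) {y \<in> space (measure_pmf (bernoulli_pmf p)). card e = 1 \<or> y}) (\<lambda>G. ?con (conf ?A (?F \<inter> G)))"
      unfolding PB_def by (intro PiM_coin_integral[of "\<lambda>_. measure_pmf (bernoulli_pmf p)" _ "\<lambda>e y. card e = 1 \<or> y" "\<lambda>G. ?con (conf ?A (?F \<inter> G))"] measure_pmf.prob_space_axioms) auto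
    also have "\<dots> = bexp (eidx ?A) ?q (\<lambda>G. ?con (conf ?A (?F \<inter> G)))"
    proof (intro bexp_cong refl)
      fix e :: "lbl set"
      show "measure (measure_pmf (bernoulli_pmf p)) {y \<in> space (measure_pmf (bernoulli_pmf p)). card e = 1 \<or> y} = ?q e"
      proof (cases "card e = 1")
        case True
        then have "{y \<in> space (measure_pmf (bernoulli_pmf p)). card e = 1 \<or> y} = space (measure_pmf (bernoulli_pmf p))" by auto
        then show ?thesis using True measure_pmf.prob_space[of "bernoulli_pmf p"] by simp
      next
        case False
        then have "{y \<in> space (measure_pmf (bernoulli_pmf p)). card e = 1 \<or> y} = {True}" by auto
        then show ?thesis using False p by (simp add: measure_pmf_single)
      qed
    qed
    finally show ?thesis by (simp add: Let_def)
  qed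
  have "measure ?J {z. ?R z} = (\<integral>\<omega>. (let A = std ?Z (fst (fst \<omega>)) in
      bexp (eidx A) ?q (\<lambda>G. ?con (conf A ({e \<in> eidx A. card e = 1 \<or> ebond g (snd (fst \<omega>)) (snd \<omega>) e} \<inter> G)))) \<partial>RCM_space lam)"
    using alt(1) unfolding inner by simp
  also have "\<dots> = (\<integral>N. (\<integral>X. (\<integral>U. (let A = std ?Z N in
      bexp (eidx A) ?q (\<lambda>G. ?con (conf A ({e \<in> eidx A. card e = 1 \<or> ebond g X U e} \<inter> G)))) \<partial>PU) \<partial>PX) \<partial>PN lam)"
  proof (subst RCM_integral)
    show "(\<lambda>\<omega>. let A = std ?Z (fst (fst \<omega>)) in bexp (eidx A) ?q (\<lambda>G. ?con (conf A ({e \<in> eidx A. card e = 1 \<or> ebond g (snd (fst \<omega>)) (snd \<omega>) e} \<inter> G))))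
       \<in> borel_measurable (RCM_space lam)"
      using alt(2) unfolding inner .
    fix \<omega>
    show "0 \<le> (let A = std ?Z (fst (fst \<omega>)) in bexp (eidx A) ?q (\<lambda>G. ?con (conf A ({e \<in> eidx A. card e = 1 \<or> ebond g (snd (fst \<omega>)) (snd \<omega>) e} \<inter> G)))) \<and>
      (let A = std ?Z (fst (fst \<omega>)) in bexp (eidx A) ?q (\<lambda>G. ?con (conf A ({e \<in> eidx A. card e = 1 \<or> ebond g (snd (fst \<omega>)) (snd \<omega>) e} \<inter> G)))) \<le> 1"
      unfolding inner[symmetric] using prob_space.prob_le_1[OF prob_space_PB] by auto
  qed simp
  also have "\<dots> = (\<integral>N. qf 1 (\<lambda>r. p * g r) {z0} (far z0 n) (std ?Z N) \<partial>PN lam)"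
  proof (intro Bochner_Integration.integral_cong refl)
    fix N :: "int \<times> int \<Rightarrow> nat"
    let ?A = "std ?Z N"
    have "(\<integral>U. (let A = ?A in bexp (eidx A) ?q (\<lambda>G. ?con (conf A ({e \<in> eidx A. card e = 1 \<or> ebond g X U e} \<inter> G)))) \<partial>PU)
        = bexp (eidx ?A) (rr 1 (\<lambda>r. p * g r) X) (\<lambda>F. ?con (conf ?A F))" for X
    proof -
      have "(\<integral>U. (let A = ?A in bexp (eidx A) ?q (\<lambda>G. ?con (conf A ({e \<in> eidx A. card e = 1 \<or> ebond g X U e} \<inter> G)))) \<partial>PU)
         = bexp (eidx ?A) (rr 1 g X) (\<lambda>F. bexp (eidx ?A) ?q (\<lambda>G. ?con (conf ?A (F \<inter> G))))"
        unfolding Let_def by (rule coin_PU) simp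
      also have "\<dots> = bexp (eidx ?A) (\<lambda>e. rr 1 g X e * ?q e) (\<lambda>F. ?con (conf ?A F))"
        by (intro bexp_Int) simp
      also have "\<dots> = bexp (eidx ?A) (rr 1 (\<lambda>r. p * g r) X) (\<lambda>F. ?con (conf ?A F))"
        by (intro bexp_cong) (auto simp: rr_def)
      finally show ?thesis .
    qed
    then show "(\<integral>X. (\<integral>U. (let A = ?A in bexp (eidx A) ?q (\<lambda>G. ?con (conf A ({e \<in> eidx A. card e = 1 \<or> ebond g X U e} \<inter> G)))) \<partial>PU) \<partial>PX)
       = qf 1 (\<lambda>r. p * g r) {z0} (far z0 n) ?A" by (simp add: qf_def)
  qed
  also have "\<dots> = theta 1 (\<lambda>r. p * g r) {z0} (far z0 n) ?Z lam"
    unfolding theta_def by (intro expectation_qf_marginal) auto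
  finally show "measure ?J {z. ?R z} = theta 1 (\<lambda>r. p * g r) {z0} (far z0 n) ?Z lam" .
qed

end

section \<open>From finite boxes to almost sure percolation\<close>

lemma prob_all_reach:
  fixes R :: "nat \<Rightarrow> 'a \<Rightarrow> bool"
  assumes "prob_space M" and R: "\<And>n. Measurable.pred M (R n)" and G: "AE \<omega> in M. \<forall>m n. n \<le> m \<longrightarrow> R m \<omega> \<longrightarrow> R n \<omega>"
    and ge: "\<And>n. \<epsilon> \<le> measure M {\<omega> \<in> space M. R n \<omega>}"
  shows "\<epsilon> \<le> measure M {\<omega> \<in> space M. \<forall>n. R n \<omega>}"
proof -
  interpret prob_space M by fact
  \<comment> \<open>The events decrease only almost surely; their finite intersections decrease
    everywhere and have the same probabilities.\<close>
  define T where "T n = {\<omega> \<in> space M. \<forall>k\<in>{..n}. R k \<omega>}" for n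
  have R': "{\<omega> \<in> space M. R n \<omega>} \<in> sets M" for n using R[of n] by (simp only: pred_def)
  have T: "T n \<in> sets M" for n
    unfolding T_def by (rule sets.sets_Collect_finite_All[OF R']) simp
  have "AE \<omega> in M. \<omega> \<in> T n \<longleftrightarrow> \<omega> \<in> {\<omega> \<in> space M. R n \<omega>}" for n
    using G
  proof eventually_elim
    case (elim \<omega>)
    have "(\<forall>k\<in>{..n}. R k \<omega>) \<longleftrightarrow> R n \<omega>"
    proof
      assume "R n \<omega>"
      then show "\<forall>k\<in>{..n}. R k \<omega>" using elim by (simp only: atMost_iff Ball_def) blast
    qed (simp only: Ball_def atMost_iff order_refl)
    then show ?case by (simp only: T_def mem_Collect_eq)
  qed
  then have "measure M (T n) = measure M {\<omega> \<in> space M. R n \<omega>}" for n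
    by (rule finite_measure_eq_AE[OF _ T R'])
  then have ge': "\<epsilon> \<le> measure M (T n)" for n using ge by simp
  have d: "decseq T" unfolding decseq_def T_def by (auto dest: order_trans)
  have "(\<lambda>n. measure M (T n)) \<longlonglongrightarrow> measure M (\<Inter>n. T n)"
    by (rule finite_Lim_measure_decseq[OF _ d]) (use T in blast)
  then have "\<epsilon> \<le> measure M (\<Inter>n. T n)" by (rule LIMSEQ_le_const) (use ge' in blast)
  also have "(\<Inter>n. T n) = {\<omega> \<in> space M. \<forall>n. R n \<omega>}"
    unfolding T_def by (intro equalityI subsetI) (simp_all only: INT_iff mem_Collect_eq UNIV_I Ball_def atMost_iff, blast+)
  finally show ?thesis .
qed

text \<open>Each fibre has measure 0 or 1, so S may be replaced by the base points whose fibre is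
  full. This strips one layer off the sample space; a finite number of uses leaves a single product
  measure.\<close>

lemma zero_one_layer:
  fixes K :: "'i \<Rightarrow> 'b measure"
  assumes M1: "prob_space M1" and K: "\<And>i. prob_space (K i)" and S: "S \<in> sets (M1 \<Otimes>\<^sub>M PiM UNIV K)"
    and inv: "\<And>x y i t. (x, y(i := t)) \<in> S \<longleftrightarrow> (x, y) \<in> S"
  shows "measure (M1 \<Otimes>\<^sub>M PiM UNIV K) S = measure M1 {x \<in> space M1. measure (PiM UNIV K) (Pair x -` S) = 1}"
    and "{x \<in> space M1. measure (PiM UNIV K) (Pair x -` S) = 1} \<in> sets M1"
proof -
  interpret M1: prob_space M1 by fact
  have P2: "prob_space (PiM UNIV K)" using K by (intro prob_space_PiM)
  note alt = measure_pair_measure_alt[OF M1 P2 S]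
  let ?m = "\<lambda>x. measure (PiM UNIV K) (Pair x -` S)"
  have z1: "?m x = 0 \<or> ?m x = 1" for x
    using sets_Pair1[OF S] inv by (intro PiM_zero_one K) auto
  show s: "{x \<in> space M1. ?m x = 1} \<in> sets M1" using alt(2) by measurable
  have "(\<integral>x. ?m x \<partial>M1) = (\<integral>x. indicator {x \<in> space M1. ?m x = 1} x \<partial>M1)"
    using z1 by (intro Bochner_Integration.integral_cong refl) (auto simp: indicator_def)
  then show "measure (M1 \<Otimes>\<^sub>M PiM UNIV K) S = measure M1 {x \<in> space M1. ?m x = 1}" using alt(1) s by simp
qed

text \<open>The two graphs agree outside the finite set P, and an infinite cluster survives the
  removal of P.\<close>

lemma has_inf_cluster_local_change:
  assumes "loc_fin A" "ranged D A B" "finite P" "A - P = A' - P"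
    and "\<And>v w. v \<in> A - P \<Longrightarrow> w \<in> A - P \<Longrightarrow> v \<noteq> w \<Longrightarrow> B {v, w} = B' {v, w}" and "has_inf_cluster (gadj A B)"
  shows "has_inf_cluster (gadj A' B')"
proof -
  have "has_inf_cluster (gadj (A - P) B)" using has_inf_cluster_remove_finite[OF assms(1,2,3,6)] .
  then show ?thesis
  proof (rule has_inf_cluster_mono)
    fix v w assume "gadj (A - P) B v w"
    then have vw: "v \<in> A - P" "w \<in> A - P" "v \<noteq> w" "B {v, w}" by (auto simp: gadj_def)
    then have "B' {v, w}" using assms(5) by blast
    moreover have "v \<in> A'" "w \<in> A'" using vw(1,2) assms(4) by auto
    ultimately show "gadj A' B' v w" using vw(3) by (simp add: gadj_def)
  qed
qed

text \<open>\<open>ranged\<close> holds only almost surely, whereas the zero-one law needs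
  invariance at every sample point. Discarding long edges makes the bound on the range certain and
  changes the graph on a null set only.\<close>

definition nearE :: "nat \<Rightarrow> lbl set \<Rightarrow> bool" where
  "nearE D e \<longleftrightarrow> (\<forall>v\<in>e. \<forall>w\<in>e. zd (fst v) (fst w) \<le> int D)"

lemma ranged_nearE: "ranged D A (\<lambda>e. B e \<and> nearE D e)"
  by (auto simp: ranged_def gadj_def nearE_def)

definition bperc :: "nat \<Rightarrow> (real \<Rightarrow> real) \<Rightarrow> ((rcm_sample \<times> (lbl set \<Rightarrow> bool)) \<Rightarrow> bool)" where
  "bperc D f z \<longleftrightarrow> has_inf_cluster (gadj (vset (fst (fst (fst z))))
     (\<lambda>e. (ebond f (snd (fst (fst z))) (snd (fst z)) e \<and> snd z e) \<and> nearE D e))"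

lemma bperc_local:
  assumes P: "finite P" and A: "vset N - P = vset N' - P"
    and B: "\<And>v w. v \<notin> P \<Longrightarrow> w \<notin> P \<Longrightarrow> v \<noteq> w \<Longrightarrow> (ebond f X U {v, w} \<and> u {v, w}) = (ebond f X' U' {v, w} \<and> u' {v, w})"
  shows "bperc D f (((N, X), U), u) \<longleftrightarrow> bperc D f (((N', X'), U'), u')"
proof -
  have 1: "bperc D f (((N', X'), U'), u')" if a: "bperc D f (((N, X), U), u)" 
    and A: "vset N - P = vset N' - P" 
    and B: "\<And>v w. v \<notin> P \<Longrightarrow> w \<notin> P \<Longrightarrow> v \<noteq> w \<Longrightarrow> (ebond f X U {v, w} \<and> u {v, w}) = (ebond f X' U' {v, w} \<and> u' {v, w})"
    for N X U u N' X' U' u'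
    unfolding bperc_def fst_conv snd_conv
  proof (rule has_inf_cluster_local_change[OF loc_fin_vset[OF order_refl] ranged_nearE P A])
    show "has_inf_cluster (gadj (vset N) (\<lambda>e. (ebond f X U e \<and> u e) \<and> nearE D e))"
      using a by (simp add: bperc_def)
    show "((ebond f X U {v, w} \<and> u {v, w}) \<and> nearE D {v, w}) = ((ebond f X' U' {v, w} \<and> u' {v, w}) \<and> nearE D {v, w})"
      if "v \<in> vset N - P" "w \<in> vset N - P" "v \<noteq> w" for v w using that B[of v w] by blast
  qed
  show ?thesis using 1[of N X U u N' X' U' u'] 1[of N' X' U' u' N X U u] A B by blast
qed

text \<open>The uniform variables and bond coins are indexed by all sets of labels. A change at e
  affects at most one pair, which the removal of a finite set eliminates; an infinite e is no pair
  at all.\<close>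

lemma fun_upd_other_pair: "\<exists>P. finite P \<and> (\<forall>v w. v \<notin> P \<longrightarrow> w \<notin> P \<longrightarrow> {v, w} \<noteq> e)"
proof (cases "finite e")
  case True
  then show ?thesis by (intro exI[of _ e]) auto
next
  case False
  then show ?thesis by (intro exI[of _ "{}"]) auto
qed

context conn_fun
begin

text \<open>An edge longer than R would need a uniform variable below 0, and points lie in their
  squares almost surely.\<close>

lemma AE_RCM_ranged: "AE \<omega> in RCM_space lam. ranged (rng R) (vset (fst (fst \<omega>))) (ebond f (snd (fst \<omega>)) (snd \<omega>))"
proof -
  interpret N: prob_space "PN lam" by (rule prob_space_PN)
  interpret X: prob_space PX by (rule prob_space_PX)
  interpret U: prob_space PU by (rule prob_space_PU)
  interpret NX: prob_space "PN lam \<Otimes>\<^sub>M PX" by (rule prob_space_NX)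
  interpret P1: pair_sigma_finite "PN lam" PX ..
  interpret P2: pair_sigma_finite "PN lam \<Otimes>\<^sub>M PX" PU ..
  have cm: "Measurable.pred PX (\<lambda>X. X v \<in> cube (fst v))" for v by measurable
  have pm: "Measurable.pred (PN lam \<Otimes>\<^sub>M PX) (\<lambda>z. \<forall>v. snd z v \<in> cube (fst v))"
    by (intro pred_intros_countable measurable_compose[OF measurable_snd cm])
  have 1: "AE z in PN lam \<Otimes>\<^sub>M PX. \<forall>v. snd z v \<in> cube (fst v)"
    using pm AE_PX_cube by (intro P1.AE_pair_measure) (auto simp: pred_def)
  have "AE y in uniform_measure lborel {0..1::real}. 0 \<le> y" by (intro AE_uniform_measureI) auto
  then have "AE U in PU. 0 \<le> U e" for e
    unfolding PU_def by (intro AE_PiM_component[where M = "\<lambda>_. uniform_measure lborel {0..1::real}"] prob_space_U01) auto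
  then have Uae: "AE U in PU. \<forall>v w. 0 \<le> U {v, w}" unfolding AE_all_countable by blast
  have "AE z in PN lam \<Otimes>\<^sub>M PX. AE U in PU. (\<forall>v. snd (fst (z, U)) v \<in> cube (fst v)) \<and> (\<forall>v w. 0 \<le> snd (z, U) {v, w})"
    using 1
  proof eventually_elim
    case (elim z)
    show ?case using Uae by eventually_elim (use elim in simp)
  qed
  moreover have "Measurable.pred ((PN lam \<Otimes>\<^sub>M PX) \<Otimes>\<^sub>M PU) (\<lambda>\<omega>. (\<forall>v. snd (fst \<omega>) v \<in> cube (fst v)) \<and> (\<forall>v w. 0 \<le> snd \<omega> {v, w}))"
  proof (intro pred_intros_logic pred_intros_countable)
    show "Measurable.pred ((PN lam \<Otimes>\<^sub>M PX) \<Otimes>\<^sub>M PU) (\<lambda>\<omega>. snd (fst \<omega>) v \<in> cube (fst v))" for v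
      by (rule measurable_compose[OF _ cm]) measurable
    show "Measurable.pred ((PN lam \<Otimes>\<^sub>M PX) \<Otimes>\<^sub>M PU) (\<lambda>\<omega>. 0 \<le> snd \<omega> {v, w})" for v w by measurable
  qed
  ultimately have "AE \<omega> in RCM_space lam. (\<forall>v. snd (fst \<omega>) v \<in> cube (fst v)) \<and> (\<forall>v w. 0 \<le> snd \<omega> {v, w})"
    unfolding RCM_space_eq by (intro P2.AE_pair_measure) (simp_all add: pred_def)
  then show ?thesis
  proof eventually_elim
    case (elim \<omega>)
    show ?case unfolding ranged_def
    proof (intro allI impI)
      fix v w assume "gadj (vset (fst (fst \<omega>))) (ebond f (snd (fst \<omega>)) (snd \<omega>)) v w"
      then have "snd \<omega> {v, w} < f (dist (snd (fst \<omega>) v) (snd (fst \<omega>) w))" by (simp add: gadj_def ebond_def pdist_pair)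
      then have "f (dist (snd (fst \<omega>) v) (snd (fst \<omega>) w)) \<noteq> 0" using elim by (metis not_le)
      then have "dist (snd (fst \<omega>) v) (snd (fst \<omega>) w) \<le> R" by (metis f_zero not_le)
      then show "zd (fst v) (fst w) \<le> int (rng R)" using elim zd_le_rng by blast
    qed
  qed
qed

abbreviation "Rr z0 n \<omega> \<equiv> reach (rng R) z0 n (vset (fst (fst \<omega>))) (ebond f (snd (fst \<omega>)) (snd \<omega>))"
abbreviation "th g z0 n lam \<equiv> theta 1 g {z0} (far z0 n) (zbox z0 (n + rng R)) lam"

lemma prob_Rr: "measure (RCM_space lam) {\<omega> \<in> space (RCM_space lam). Rr z0 n \<omega>} = th f z0 n lam"
  using conn_meas.prob_reach_rcm[OF conn_meas_f, of lam "rng R" z0 n] by simp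

lemma pred_Rr: "Measurable.pred (RCM_space lam) (Rr z0 n)"
  by (rule conn_meas.sets_reach_rcm[OF conn_meas_f])

lemma AE_rcm_perc_iff: "AE \<omega> in RCM_space lam. has_inf_cluster (rcm_adj f \<omega>) \<longleftrightarrow> (\<exists>z0. \<forall>n. Rr z0 n \<omega>)"
  using AE_RCM_ranged
proof eventually_elim
  case (elim \<omega>)
  have "rcm_adj f \<omega> = gadj (vset (fst (fst \<omega>))) (ebond f (snd (fst \<omega>)) (snd \<omega>))"
    using rcm_adj_gadj[of f "fst (fst \<omega>)" "snd (fst \<omega>)" "snd \<omega>"] by simp
  then show ?case using has_inf_cluster_iff_reach[OF loc_fin_vset[OF order_refl] elim] by simp
qed

text \<open>Percolation means that some square reaches arbitrarily far. There are countably many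
  squares, so one of them does so with positive probability.\<close>

lemma perc_imp_theta:
  assumes "\<not> (AE \<omega> in RCM_space lam. \<not> has_inf_cluster (rcm_adj f \<omega>))"
  shows "\<exists>z0. \<exists>\<epsilon>>0. \<forall>n. \<epsilon> \<le> th f z0 n lam"
proof (rule ccontr)
  interpret M: prob_space "RCM_space lam" by (rule prob_space_RCM)
  assume no: "\<not> ?thesis"
  have "AE \<omega> in RCM_space lam. \<not> (\<forall>n. Rr z0 n \<omega>)" for z0
  proof -
    note pred_Rr[measurable]
    have s: "{\<omega> \<in> space (RCM_space lam). \<forall>n. Rr z0 n \<omega>} \<in> sets (RCM_space lam)" by measurable
    have "measure (RCM_space lam) {\<omega> \<in> space (RCM_space lam). \<forall>n. Rr z0 n \<omega>} \<le> th f z0 n lam" for n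
    proof -
      have s': "{\<omega> \<in> space (RCM_space lam). Rr z0 n \<omega>} \<in> sets (RCM_space lam)" using pred_Rr by (simp only: pred_def)
      show ?thesis unfolding prob_Rr[symmetric] by (intro M.finite_measure_mono s') auto
    qed
    note le = this
    have "measure (RCM_space lam) {\<omega> \<in> space (RCM_space lam). \<forall>n. Rr z0 n \<omega>} = 0" (is "?m = 0")
    proof (rule ccontr)
      assume "?m \<noteq> 0"
      then have "0 < ?m" using measure_nonneg[of "RCM_space lam"] by (simp add: order_less_le)
      then have "\<exists>n. \<not> ?m \<le> th f z0 n lam" using no by blast
      then show False using le by blast
    qed
    then show ?thesis using s by (intro AE_I[OF _ _ s]) (auto simp: M.emeasure_eq_measure)
  qed
  then have "AE \<omega> in RCM_space lam. \<forall>z0. \<not> (\<forall>n. Rr z0 n \<omega>)" unfolding AE_all_countable by blast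
  then have "AE \<omega> in RCM_space lam. \<not> has_inf_cluster (rcm_adj f \<omega>)"
    using AE_rcm_perc_iff by eventually_elim blast
  then show False using assms by simp
qed

text \<open>By continuity from above, connection probabilities bounded below would produce an
  infinite cluster with positive probability.\<close>

lemma no_perc_imp_theta:
  assumes "AE \<omega> in RCM_space lam. \<not> has_inf_cluster (rcm_adj f \<omega>)" "0 < \<epsilon>"
  shows "\<exists>n. th f z0 n lam < \<epsilon>"
proof (rule ccontr)
  assume "\<not> ?thesis"
  then have ge: "\<epsilon> \<le> measure (RCM_space lam) {\<omega> \<in> space (RCM_space lam). Rr z0 n \<omega>}" for n
    unfolding prob_Rr by (meson not_le)
  interpret M: prob_space "RCM_space lam" by (rule prob_space_RCM)
  have anti: "AE \<omega> in RCM_space lam. \<forall>m n. n \<le> m \<longrightarrow> Rr z0 m \<omega> \<longrightarrow> Rr z0 n \<omega>"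
    using AE_RCM_ranged by eventually_elim (use reach_antimono in blast)
  have 1: "\<epsilon> \<le> measure (RCM_space lam) {\<omega> \<in> space (RCM_space lam). \<forall>n. Rr z0 n \<omega>}"
    by (rule prob_all_reach[OF prob_space_RCM pred_Rr anti ge])
  have "AE \<omega> in RCM_space lam. \<not> (\<forall>n. Rr z0 n \<omega>)"
    using assms(1) AE_rcm_perc_iff by eventually_elim blast
  then have "measure (RCM_space lam) {\<omega> \<in> space (RCM_space lam). \<forall>n. Rr z0 n \<omega>} = 0"
    by (rule M.prob_eq_0_AE)
  then show False using 1 assms(2) by simp
qed

lemma theta_imp_perc:
  assumes "0 < \<epsilon>" "\<And>n. \<epsilon> \<le> th f z0 n lam"
  shows "\<not> (AE \<omega> in RCM_space lam. \<not> has_inf_cluster (rcm_adj f \<omega>))"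
  using no_perc_imp_theta[of lam \<epsilon> z0] assms by (meson not_le)

text \<open>The open part has the connection probabilities of intensity p * lam. These are at most
  those of lam', which tend to 0.\<close>

lemma site_no_perc:
  assumes p: "0 < p" "p \<le> 1" and lam: "0 < lam" "p * lam \<le> lam'"
    and no: "AE \<omega> in RCM_space lam'. \<not> has_inf_cluster (rcm_adj f \<omega>)"
  shows "AE z in RCM_space lam \<Otimes>\<^sub>M PB p. 
    \<not> has_inf_cluster (gadj (vset (fst (fst (fst z))) \<inter> {v. snd z v}) (ebond f (snd (fst (fst z))) (snd (fst z))))"
proof -
  let ?J = "RCM_space lam \<Otimes>\<^sub>M (PB p :: (lbl \<Rightarrow> bool) measure)"
  interpret M: prob_space "RCM_space lam" by (rule prob_space_RCM)
  interpret B: prob_space "PB p :: (lbl \<Rightarrow> bool) measure" by (rule prob_space_PB)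
  interpret J: prob_space ?J by (intro prob_space_pair) unfold_locales
  let ?A = "\<lambda>z. vset (fst (fst (fst z))) \<inter> {v. snd z v}" and ?B = "\<lambda>z. ebond f (snd (fst (fst z))) (snd (fst z))"
  note pr = conn_meas.prob_reach_site[OF conn_meas_f p lam(1)]
  have "AE z in ?J. \<not> (\<forall>n. reach (rng R) z0 n (?A z) (?B z))" for z0
  proof -
    have [measurable]: "Measurable.pred ?J (\<lambda>z. reach (rng R) z0 n (?A z) (?B z))" for n by (rule pr(2))
    have s: "{z \<in> space ?J. \<forall>n. reach (rng R) z0 n (?A z) (?B z)} \<in> sets ?J" by measurable
    have sp: "space ?J = UNIV" by (simp add: space_pair_measure)
    have "measure ?J {z \<in> space ?J. \<forall>n. reach (rng R) z0 n (?A z) (?B z)} < \<epsilon>" if e: "0 < \<epsilon>" for \<epsilon>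
    proof -
      obtain n where n: "th f z0 n lam' < \<epsilon>" using no_perc_imp_theta[OF no e] by blast
      have s': "{z \<in> space ?J. reach (rng R) z0 n (?A z) (?B z)} \<in> sets ?J" by measurable
      have "measure ?J {z \<in> space ?J. \<forall>n. reach (rng R) z0 n (?A z) (?B z)} \<le> measure ?J {z \<in> space ?J. reach (rng R) z0 n (?A z) (?B z)}"
        by (intro J.finite_measure_mono s') auto
      also have "\<dots> = th f z0 n (p * lam)" using pr(1)[of "rng R" z0 n] sp by simp
      also have "\<dots> \<le> th f z0 n lam'"
        using p lam by (intro conn_meas.theta_mono_lam[OF conn_meas_f]) auto
      finally show ?thesis using n by linarith
    qed
    then have "\<not> 0 < measure ?J {z \<in> space ?J. \<forall>n. reach (rng R) z0 n (?A z) (?B z)}" by blast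
    then have "measure ?J {z \<in> space ?J. \<forall>n. reach (rng R) z0 n (?A z) (?B z)} = 0"
      using measure_nonneg[of ?J "{z \<in> space ?J. \<forall>n. reach (rng R) z0 n (?A z) (?B z)}"] by linarith
    then show ?thesis using s by (intro AE_I[OF _ _ s]) (auto simp: J.emeasure_eq_measure)
  qed
  then have 1: "AE z in ?J. \<forall>z0. \<not> (\<forall>n. reach (rng R) z0 n (?A z) (?B z))" unfolding AE_all_countable by blast
  have 2: "AE z in ?J. ranged (rng R) (vset (fst (fst (fst z)))) (?B z)"
  proof (rule AE_distrD[where f = fst and M' = "RCM_space lam"])
    show "AE \<omega> in distr ?J (RCM_space lam) fst. ranged (rng R) (vset (fst (fst \<omega>))) (ebond f (snd (fst \<omega>)) (snd \<omega>))"
      using AE_RCM_ranged[of lam] unfolding B.distr_pair_fst .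
  qed simp
  from 1 2 show ?thesis
  proof eventually_elim
    case (elim z)
    have "ranged (rng R) (?A z) (?B z)" using elim(2) by (auto simp: ranged_def gadj_def)
    moreover have "loc_fin (?A z)" by (rule loc_fin_vset[of _ "fst (fst (fst z))"]) auto
    ultimately show ?case using has_inf_cluster_iff_reach elim(1) by blast
  qed
qed

lemma bperc_zero_one:
  "measure (RCM_space lam \<Otimes>\<^sub>M PB p) {z. bperc (rng R) f z} = 0 \<or> measure (RCM_space lam \<Otimes>\<^sub>M PB p) {z. bperc (rng R) f z} = 1"
  and pred_bperc: "Measurable.pred (RCM_space lam \<Otimes>\<^sub>M PB p) (bperc (rng R) f)"
proof -
  let ?D = "rng R"
  let ?J = "RCM_space lam \<Otimes>\<^sub>M (PB p :: (lbl set \<Rightarrow> bool) measure)"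
  have sp: "space ?J = UNIV" by (simp add: space_pair_measure)
  show pr: "Measurable.pred ?J (bperc ?D f)"
    unfolding bperc_def[abs_def]
    by (intro pred_has_inf_cluster pred_gadj pred_intros_logic conn_meas.pred_ebond[OF conn_meas_f] pred_vset[where lam = lam]) measurable
  define S where "S = {z. bperc ?D f z}"
  have S: "S \<in> sets ?J" using pr by (simp add: S_def pred_def sp)
  have invu: "bperc ?D f (\<omega>, u(e := t)) \<longleftrightarrow> bperc ?D f (\<omega>, u)" for \<omega> u e t
  proof -
    obtain P where P: "finite P" "\<And>v w. v \<notin> P \<Longrightarrow> w \<notin> P \<Longrightarrow> {v, w} \<noteq> e" using fun_upd_other_pair[of e] by blast
    show ?thesis
      using bperc_local[of P "fst (fst \<omega>)" "fst (fst \<omega>)" f "snd (fst \<omega>)" "snd \<omega>" "u(e := t)" "snd (fst \<omega>)" "snd \<omega>" u] P by simp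
  qed
  have invU: "bperc ?D f ((nx, U(e := t)), u) \<longleftrightarrow> bperc ?D f ((nx, U), u)" for nx U u e t
  proof -
    obtain P where P: "finite P" "\<And>v w. v \<notin> P \<Longrightarrow> w \<notin> P \<Longrightarrow> {v, w} \<noteq> e" using fun_upd_other_pair[of e] by blast
    show ?thesis
      using bperc_local[of P "fst nx" "fst nx" f "snd nx" "U(e := t)" u "snd nx" U u] P by (simp add: ebond_def)
  qed
  have invX: "bperc ?D f (((N, X(v := t)), U), u) \<longleftrightarrow> bperc ?D f (((N, X), U), u)" for N X U u v t
    by (rule bperc_local[of "{v}"]) (auto simp: ebond_def pdist_pair)
  \<comment> \<open>A change of one count adds or removes finitely many labels, all in one
    square.\<close>
  have invN: "bperc ?D f (((N(z := t), X), U), u) \<longleftrightarrow> bperc ?D f (((N, X), U), u)" for N X U u z t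
  proof (rule bperc_local[of "{z} \<times> {..<max t (N z)}"])
    show "vset (N(z := t)) - {z} \<times> {..<max t (N z)} = vset N - {z} \<times> {..<max t (N z)}"
      by (auto simp: vset_def split: if_splits)
  qed auto
  have PBp: "(PB p :: (lbl set \<Rightarrow> bool) measure) = PiM UNIV (\<lambda>_. measure_pmf (bernoulli_pmf p))" by (simp add: PB_def)
  \<comment> \<open>Integrating out the coins, the edge variables and the positions in turn leaves
    an event in the counts.\<close>
  define S1 where "S1 = {\<omega>. measure (PB p) (Pair \<omega> -` S) = 1}"
  define S2 where "S2 = {nx. measure PU (Pair nx -` S1) = 1}"
  define S3 where "S3 = {N. measure PX (Pair N -` S2) = 1}"
  have 1: "measure ?J S = measure (RCM_space lam) S1" "S1 \<in> sets (RCM_space lam)"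
    using zero_one_layer[OF prob_space_RCM, of "\<lambda>_. measure_pmf (bernoulli_pmf p)" S lam] S invu
    unfolding PBp[symmetric] S1_def by (auto simp: S_def measure_pmf.prob_space_axioms)
  have i1: "((nx, U(e := t)) \<in> S1) = ((nx, U) \<in> S1)" for nx U e t
  proof -
    have "Pair (nx, U(e := t)) -` S = Pair (nx, U) -` S" using invU by (auto simp: S_def)
    then show ?thesis by (simp add: S1_def)
  qed
  have 2: "measure (RCM_space lam) S1 = measure (PN lam \<Otimes>\<^sub>M PX) S2" "S2 \<in> sets (PN lam \<Otimes>\<^sub>M PX)"
    using zero_one_layer[OF prob_space_NX, of "\<lambda>_. uniform_measure lborel {0..1::real}" S1 lam] 1(2) i1 prob_space_U01
    unfolding PU_def[symmetric] S2_def RCM_space_eq by (auto simp: space_pair_measure)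
  have i2: "((N, X(v := t)) \<in> S2) = ((N, X) \<in> S2)" for N X v t
  proof -
    have "Pair ((N, X(v := t)), U) -` S = Pair ((N, X), U) -` S" for U using invX by (auto simp: S_def)
    then have "Pair (N, X(v := t)) -` S1 = Pair (N, X) -` S1" by (auto simp: S1_def)
    then show ?thesis by (simp add: S2_def)
  qed
  have 3: "measure (PN lam \<Otimes>\<^sub>M PX) S2 = measure (PN lam) S3" "S3 \<in> sets (PN lam)"
    using zero_one_layer[OF prob_space_PN, of "\<lambda>v::lbl. uniform_measure lborel (cube (fst v))" S2 lam] 2(2) i2 prob_space_unif
    unfolding PX_def[symmetric] S3_def by auto
  have i3: "(N(z := t) \<in> S3) = (N \<in> S3)" for N z t
  proof -
    have "Pair ((N(z := t), X), U) -` S = Pair ((N, X), U) -` S" for X U using invN by (auto simp: S_def)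
    then have "Pair (N(z := t), X) -` S1 = Pair (N, X) -` S1" for X by (auto simp: S1_def)
    then have "Pair (N(z := t)) -` S2 = Pair N -` S2" by (auto simp: S2_def)
    then show ?thesis by (simp add: S3_def)
  qed
  have "measure (PN lam) S3 = 0 \<or> measure (PN lam) S3 = 1"
    using 3(2) i3 unfolding PN_def by (intro PiM_zero_one) (auto simp: measure_pmf.prob_space_axioms)
  then show "measure ?J {z. bperc ?D f z} = 0 \<or> measure ?J {z. bperc ?D f z} = 1" using 1(1) 2(1) 3(1) by (simp add: S_def)
qed

text \<open>Connection probabilities bounded below give percolation with positive probability, and
  the zero-one law for \<open>bperc\<close> raises it to 1.\<close>

lemma bond_perc:
  assumes p: "0 < p" "p \<le> 1" and e: "0 < \<epsilon>" "\<And>n. \<epsilon> \<le> th (\<lambda>r. p * f r) z0 n lam"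
  shows "AE z in RCM_space lam \<Otimes>\<^sub>M PB p. 
    has_inf_cluster (gadj (vset (fst (fst (fst z)))) (\<lambda>e. ebond f (snd (fst (fst z))) (snd (fst z)) e \<and> snd z e))"
proof -
  let ?J = "RCM_space lam \<Otimes>\<^sub>M (PB p :: (lbl set \<Rightarrow> bool) measure)"
  interpret M: prob_space "RCM_space lam" by (rule prob_space_RCM)
  interpret B: prob_space "PB p :: (lbl set \<Rightarrow> bool) measure" by (rule prob_space_PB)
  interpret J: prob_space ?J by (intro prob_space_pair) unfold_locales
  have sp: "space ?J = UNIV" by (simp add: space_pair_measure)
  let ?A = "\<lambda>z. vset (fst (fst (fst z)))" and ?B = "\<lambda>z e. ebond f (snd (fst (fst z))) (snd (fst z)) e \<and> snd z e"
  note pr = conn_meas.prob_reach_bond[OF conn_meas_f p]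
  have 2: "AE z in ?J. ranged (rng R) (?A z) (?B z)"
  proof -
    have "AE z in ?J. ranged (rng R) (?A z) (ebond f (snd (fst (fst z))) (snd (fst z)))"
    proof (rule AE_distrD[where f = fst and M' = "RCM_space lam"])
      show "AE \<omega> in distr ?J (RCM_space lam) fst. ranged (rng R) (vset (fst (fst \<omega>))) (ebond f (snd (fst \<omega>)) (snd \<omega>))"
        using AE_RCM_ranged[of lam] unfolding B.distr_pair_fst .
    qed simp
    then show ?thesis by eventually_elim (auto simp: ranged_def gadj_def)
  qed
  have ge: "\<epsilon> \<le> measure ?J {z \<in> space ?J. reach (rng R) z0 n (?A z) (?B z)}" for n
    using e(2)[of n] pr(1)[of lam "rng R" z0 n] sp by simp
  have anti: "AE z in ?J. \<forall>m n. n \<le> m \<longrightarrow> reach (rng R) z0 m (?A z) (?B z) \<longrightarrow> reach (rng R) z0 n (?A z) (?B z)"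
    using 2 by eventually_elim (use reach_antimono in blast)
  have all: "\<epsilon> \<le> measure ?J {z \<in> space ?J. \<forall>n. reach (rng R) z0 n (?A z) (?B z)}"
    by (rule prob_all_reach[OF J.prob_space_axioms pr(2) anti ge])
  have perc_eq: "AE z in ?J. (has_inf_cluster (gadj (?A z) (?B z)) \<longleftrightarrow> bperc (rng R) f z) \<and> ((\<forall>n. reach (rng R) z0 n (?A z) (?B z)) \<longrightarrow> bperc (rng R) f z)"
    using 2
  proof eventually_elim
    case (elim z)
    have "gadj (?A z) (?B z) = gadj (?A z) (\<lambda>e. ?B z e \<and> nearE (rng R) e)"
    proof (intro ext)
      fix v w
      have "nearE (rng R) {v, w}" if "gadj (?A z) (?B z) v w"
      proof -
        have a: "zd (fst v) (fst w) \<le> int (rng R)" using elim that unfolding ranged_def by blast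
        then have b: "zd (fst w) (fst v) \<le> int (rng R)" by (subst zd_commute)
        have c: "zd x x \<le> int (rng R)" for x by (simp add: zd_def)
        show ?thesis unfolding nearE_def using a b c by blast
      qed
      then show "gadj (?A z) (?B z) v w = gadj (?A z) (\<lambda>e. ?B z e \<and> nearE (rng R) e) v w" by (auto simp: gadj_def)
    qed
    then have "has_inf_cluster (gadj (?A z) (?B z)) \<longleftrightarrow> bperc (rng R) f z" unfolding bperc_def by simp
    then show ?case using has_inf_cluster_iff_reach[OF loc_fin_vset[OF order_refl] elim] by blast
  qed
  have bp: "{z. bperc (rng R) f z} \<in> sets ?J" using pred_bperc[of lam p] by (simp add: pred_def sp)
  have "measure ?J {z \<in> space ?J. \<forall>n. reach (rng R) z0 n (?A z) (?B z)} \<le> measure ?J {z. bperc (rng R) f z}"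
    using perc_eq bp by (intro J.finite_measure_mono_AE) auto
  then have "measure ?J {z. bperc (rng R) f z} = 1" using bperc_zero_one[of lam p] all e(1) by linarith
  then have "AE z in ?J. bperc (rng R) f z" using J.AE_prob_1 by (auto dest!: J.AE_prob_1)
  then show ?thesis using perc_eq by eventually_elim blast
qed

end

section \<open>A hierarchical renormalisation of the square lattice\<close>

text \<open>A block of level k + 1 consists of 3 x 3 blocks of level k and is bad if two of them are bad. Removing one square
  from a 3 x 3 grid leaves it connected, and two adjacent grids with one square removed from each still touch.\<close>

definition sadj :: "(int \<times> int \<Rightarrow> bool) \<Rightarrow> int \<times> int \<Rightarrow> int \<times> int \<Rightarrow> bool" where
  "sadj G z w \<longleftrightarrow> G z \<and> G w \<and> \<bar>fst z - fst w\<bar> + \<bar>snd z - snd w\<bar> = 1"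

definition par :: "int \<times> int \<Rightarrow> int \<times> int" where
  "par c = (fst c div 3, snd c div 3)"

primrec bad :: "(int \<times> int \<Rightarrow> bool) \<Rightarrow> nat \<Rightarrow> int \<times> int \<Rightarrow> bool" where
  "bad G 0 u \<longleftrightarrow> \<not> G u"
| "bad G (Suc k) u \<longleftrightarrow> (\<exists>c c'. c \<noteq> c' \<and> par c = u \<and> par c' = u \<and> bad G k c \<and> bad G k c')"

text \<open>The squares of the block for which all blocks of level below k around them are good. For
  a good block they form a nonempty connected set.\<close>

primrec core :: "(int \<times> int \<Rightarrow> bool) \<Rightarrow> nat \<Rightarrow> int \<times> int \<Rightarrow> (int \<times> int) set" where
  "core G 0 u = {u}"
| "core G (Suc k) u = (\<Union>c\<in>{c. par c = u \<and> \<not> bad G k c}. core G k c)"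

lemma par_child: "i \<in> {0, 1, 2} \<Longrightarrow> j \<in> {0, 1, 2} \<Longrightarrow> par (3 * a + i, 3 * b + j) = (a, b)"
  by (auto simp: par_def)

lemma par_cases:
  assumes "par c = (a, b)" obtains i j where "i \<in> {0, 1, 2}" "j \<in> {0, 1, 2}" "c = (3 * a + i, 3 * b + j)"
proof
  show "fst c mod 3 \<in> {0, 1, 2}" "snd c mod 3 \<in> {0, 1, 2}" by auto
  show "c = (3 * a + fst c mod 3, 3 * b + snd c mod 3)" using assms by (auto simp: par_def prod_eq_iff)
qed

text \<open>K i j stands for the component of cell (i, j), and b for the removed cells, of which
  there is at most one. If the centre is present, side cells touch it and every corner reaches it
  through one of two side cells. If the centre is removed, the other eight cells form a
  ring.\<close>

lemma grid9:
  fixes b :: "int \<Rightarrow> int \<Rightarrow> bool" and K :: "int \<Rightarrow> int \<Rightarrow> 'a"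
  assumes hor: "\<And>i j. i \<in> {0, 1} \<Longrightarrow> j \<in> {0, 1, 2} \<Longrightarrow> \<not> b i j \<Longrightarrow> \<not> b (i + 1) j \<Longrightarrow> K i j = K (i + 1) j"
    and ver: "\<And>i j. i \<in> {0, 1, 2} \<Longrightarrow> j \<in> {0, 1} \<Longrightarrow> \<not> b i j \<Longrightarrow> \<not> b i (j + 1) \<Longrightarrow> K i j = K i (j + 1)"
    and uni: "\<And>i j i' j'. i \<in> {0, 1, 2} \<Longrightarrow> j \<in> {0, 1, 2} \<Longrightarrow> i' \<in> {0, 1, 2} \<Longrightarrow> j' \<in> {0, 1, 2} \<Longrightarrow> b i j \<Longrightarrow> b i' j' \<Longrightarrow> i = i' \<and> j = j'"
    and ij: "i \<in> {0, 1, 2}" "j \<in> {0, 1, 2}" "i' \<in> {0, 1, 2}" "j' \<in> {0, 1, 2}" "\<not> b i j" "\<not> b i' j'"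
  shows "K i j = K i' j'"
proof -
  have h: "\<not> b 0 j \<Longrightarrow> \<not> b 1 j \<Longrightarrow> K 0 j = K 1 j" "\<not> b 1 j \<Longrightarrow> \<not> b 2 j \<Longrightarrow> K 1 j = K 2 j" if "j \<in> {0, 1, 2}" for j
    using hor[of 0 j] hor[of 1 j] that by auto
  have v: "\<not> b i 0 \<Longrightarrow> \<not> b i 1 \<Longrightarrow> K i 0 = K i 1" "\<not> b i 1 \<Longrightarrow> \<not> b i 2 \<Longrightarrow> K i 1 = K i 2" if "i \<in> {0, 1, 2}" for i
    using ver[of i 0] ver[of i 1] that by auto
  have H: "\<not> b 0 0 \<Longrightarrow> \<not> b 1 0 \<Longrightarrow> K 0 0 = K 1 0" "\<not> b 1 0 \<Longrightarrow> \<not> b 2 0 \<Longrightarrow> K 1 0 = K 2 0"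
    "\<not> b 0 1 \<Longrightarrow> \<not> b 1 1 \<Longrightarrow> K 0 1 = K 1 1" "\<not> b 1 1 \<Longrightarrow> \<not> b 2 1 \<Longrightarrow> K 1 1 = K 2 1"
    "\<not> b 0 2 \<Longrightarrow> \<not> b 1 2 \<Longrightarrow> K 0 2 = K 1 2" "\<not> b 1 2 \<Longrightarrow> \<not> b 2 2 \<Longrightarrow> K 1 2 = K 2 2"
    "\<not> b 0 0 \<Longrightarrow> \<not> b 0 1 \<Longrightarrow> K 0 0 = K 0 1" "\<not> b 0 1 \<Longrightarrow> \<not> b 0 2 \<Longrightarrow> K 0 1 = K 0 2"
    "\<not> b 1 0 \<Longrightarrow> \<not> b 1 1 \<Longrightarrow> K 1 0 = K 1 1" "\<not> b 1 1 \<Longrightarrow> \<not> b 1 2 \<Longrightarrow> K 1 1 = K 1 2"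
    "\<not> b 2 0 \<Longrightarrow> \<not> b 2 1 \<Longrightarrow> K 2 0 = K 2 1" "\<not> b 2 1 \<Longrightarrow> \<not> b 2 2 \<Longrightarrow> K 2 1 = K 2 2"
    using h[of 0] h[of 1] h[of 2] v[of 0] v[of 1] v[of 2] by auto
  have hub: "K i j = (if b 1 1 then K 0 0 else K 1 1)" if c: "i \<in> {0, 1, 2}" "j \<in> {0, 1, 2}" "\<not> b i j" for i j
  proof (cases "b 1 1")
    case True
    then have n: "\<not> b x y" if "x \<in> {0, 1, 2}" "y \<in> {0, 1, 2}" "x \<noteq> 1 \<or> y \<noteq> 1" for x y
      using uni[of x y 1 1] that by blast
    have "\<not> b 0 0" "\<not> b 0 1" "\<not> b 0 2" "\<not> b 1 0" "\<not> b 1 2" "\<not> b 2 0" "\<not> b 2 1" "\<not> b 2 2" by (simp_all add: n)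
    note E = H(1)[OF this(1,4)] H(2)[OF this(4,6)] H(5)[OF this(3,5)] H(6)[OF this(5,8)] H(7)[OF this(1,2)] H(8)[OF this(2,3)] H(11)[OF this(6,7)] H(12)[OF this(7,8)]
    have ij: "i = 0 \<or> i = 1 \<or> i = 2" "j = 0 \<or> j = 1 \<or> j = 2" "i \<noteq> 1 \<or> j \<noteq> 1" using c True by auto
    have "K i j = K 0 0" using ij by (elim disjE) (simp_all add: E)
    then show ?thesis using True by simp
  next
    case False
    have ij: "i = 0 \<or> i = 1 \<or> i = 2" "j = 0 \<or> j = 1 \<or> j = 2" using c by auto
    have U: "\<not> b 0 1 \<or> \<not> b 1 0" "\<not> b 0 1 \<or> \<not> b 1 2" "\<not> b 2 1 \<or> \<not> b 1 0" "\<not> b 2 1 \<or> \<not> b 1 2"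
      using uni[of 0 1 1 0] uni[of 0 1 1 2] uni[of 2 1 1 0] uni[of 2 1 1 2] by auto
    have k: "\<not> b 0 1 \<Longrightarrow> K 0 1 = K 1 1" "\<not> b 2 1 \<Longrightarrow> K 2 1 = K 1 1" "\<not> b 1 0 \<Longrightarrow> K 1 0 = K 1 1" "\<not> b 1 2 \<Longrightarrow> K 1 2 = K 1 1"
      using H(3,4,9,10) False by simp_all
    have "\<not> b 0 0 \<Longrightarrow> K 0 0 = K 1 1" using U(1) H(1,7) k by metis
    moreover have "\<not> b 0 2 \<Longrightarrow> K 0 2 = K 1 1" using U(2) H(5,8) k by metis
    moreover have "\<not> b 2 0 \<Longrightarrow> K 2 0 = K 1 1" using U(3) H(2,11) k by metis
    moreover have "\<not> b 2 2 \<Longrightarrow> K 2 2 = K 1 1" using U(4) H(6,12) k by metis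
    ultimately have "K i j = K 1 1" using ij c(3) k by (elim disjE) (hypsubst, simp)+
    then show ?thesis using False by simp
  qed
  show ?thesis using hub[OF ij(1,2,5)] hub[OF ij(3,4,6)] by simp
qed

lemma sadj_sym: "(sadj G)\<^sup>*\<^sup>* x y \<Longrightarrow> (sadj G)\<^sup>*\<^sup>* y x"
  by (rule sympD[OF symp_rtranclp]) (auto simp: symp_def sadj_def)

lemma core_div: "x \<in> core G k u \<Longrightarrow> fst x div 3 ^ k = fst u \<and> snd x div 3 ^ k = snd u"
proof (induction k arbitrary: u)
  case (Suc k)
  then obtain c where c: "par c = u" "x \<in> core G k c" by auto
  have e: "a div 3 ^ Suc k = a div 3 ^ k div 3" for a :: int
    unfolding power_Suc2 by (rule zdiv_zmult2_eq) simp
  show ?case using Suc.IH[OF c(2)] c(1) unfolding e by (auto simp: par_def)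
qed auto

text \<open>The three claims need a common induction: contact between neighbouring good blocks of
  level k is what makes the grid inside a block of level k + 1 connected.\<close>

lemma core_connected:
  shows core_nonempty: "\<not> bad G k u \<Longrightarrow> core G k u \<noteq> {}"
    and "\<not> bad G k u \<Longrightarrow> x \<in> core G k u \<Longrightarrow> y \<in> core G k u \<Longrightarrow> (sadj G)\<^sup>*\<^sup>* x y"
    and "\<not> bad G k u \<Longrightarrow> \<not> bad G k u' \<Longrightarrow> u' = (fst u + 1, snd u) \<or> u' = (fst u, snd u + 1)
      \<Longrightarrow> x \<in> core G k u \<Longrightarrow> y \<in> core G k u' \<Longrightarrow> (sadj G)\<^sup>*\<^sup>* x y"
proof (induction k arbitrary: u u' x y)
  case 0
  {
    case 1 then show ?case by simp
  next
    case 2 then show ?case by simp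
  next
    case 3
    then have "sadj G x y" by (auto simp: sadj_def)
    then show ?case by blast
  }
next
  case (Suc k)
  note IH = Suc.IH
  have one: "c = c'" if "\<not> bad G (Suc k) u" "par c = u" "par c' = u" "bad G k c" "bad G k c'" for c c' u
    using that by auto
  \<comment> \<open>Two touching sides have three facing pairs of blocks, and each side contains at
    most one bad block, so one facing pair is good.\<close>
  have pick: "\<exists>j\<in>{0, 1, 2}. \<not> bad G k (s j) \<and> \<not> bad G k (t j)"
    if n: "\<not> bad G (Suc k) u" "\<not> bad G (Suc k) u'" and s: "\<And>j. j \<in> {0, 1, 2} \<Longrightarrow> par (s j) = u" "\<And>j. j \<in> {0, 1, 2} \<Longrightarrow> par (t j) = u'"
      and inj: "inj_on s {0, 1, 2}" "inj_on t {0, 1, 2}" for u u' s and t :: "int \<Rightarrow> int \<times> int"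
  proof (rule ccontr)
    assume "\<not> ?thesis"
    then have B: "bad G k (s j) \<or> bad G k (t j)" if "j \<in> {0, 1, 2}" for j using that by blast
    have us: "i = j" if "i \<in> {0, 1, 2}" "j \<in> {0, 1, 2}" "bad G k (s i)" "bad G k (s j)" for i j
      using one[OF n(1) s(1) s(1) that(3,4)] that(1,2) inj(1) by (meson inj_onD)
    have ut: "i = j" if "i \<in> {0, 1, 2}" "j \<in> {0, 1, 2}" "bad G k (t i)" "bad G k (t j)" for i j
      using one[OF n(2) s(2) s(2) that(3,4)] that(1,2) inj(2) by (meson inj_onD)
    show False using B[of 0] B[of 1] B[of 2] us[of 0 1] us[of 0 2] us[of 1 2] ut[of 0 1] ut[of 0 2] ut[of 1 2] by auto
  qed
  have conn: "(sadj G)\<^sup>*\<^sup>* x y" if nb: "\<not> bad G (Suc k) u" and xy: "x \<in> core G (Suc k) u" "y \<in> core G (Suc k) u" for u x y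
  proof -
    obtain a b where u: "u = (a, b)" by (cases u)
    define B where "B i j = bad G k (3 * a + i, 3 * b + j)" for i j
    \<comment> \<open>The component is encoded as the set of squares reachable from the core, so
      that being connected becomes an equality as in \<open>grid9\<close>.\<close>
    define K where "K i j = {z. \<exists>x\<in>core G k (3 * a + i, 3 * b + j). (sadj G)\<^sup>*\<^sup>* x z}" for i j
    have Keq: "K i j = K i' j'" if nb2: "\<not> B i j" "\<not> B i' j'" and
      l: "\<And>x y. x \<in> core G k (3 * a + i, 3 * b + j) \<Longrightarrow> y \<in> core G k (3 * a + i', 3 * b + j') \<Longrightarrow> (sadj G)\<^sup>*\<^sup>* x y" for i j i' j'
    proof -
      obtain x0 y0 where x0: "x0 \<in> core G k (3 * a + i, 3 * b + j)" and y0: "y0 \<in> core G k (3 * a + i', 3 * b + j')"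
        using IH(1) nb2 unfolding B_def by blast
      show ?thesis unfolding K_def using l x0 y0 sadj_sym[of G] rtranclp_trans[of "sadj G"] by blast
    qed
    obtain c c' where c: "par c = u" "\<not> bad G k c" "x \<in> core G k c" and c': "par c' = u" "\<not> bad G k c'" "y \<in> core G k c'"
      using xy by auto
    obtain i j where ij: "i \<in> {0, 1, 2}" "j \<in> {0, 1, 2}" "c = (3 * a + i, 3 * b + j)" using par_cases c(1) u by metis
    obtain i' j' where ij': "i' \<in> {0, 1, 2}" "j' \<in> {0, 1, 2}" "c' = (3 * a + i', 3 * b + j')" using par_cases c'(1) u by metis
    have "K i j = K i' j'"
    proof (rule grid9[of B])
      show "K i j = K (i + 1) j" if "\<not> B i j" "\<not> B (i + 1) j" for i j
        by (rule Keq[OF that]) (rule IH(3)[of "(3 * a + i, 3 * b + j)" "(3 * a + (i + 1), 3 * b + j)"], use that in \<open>auto simp: B_def\<close>)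
      show "K i j = K i (j + 1)" if "\<not> B i j" "\<not> B i (j + 1)" for i j
        by (rule Keq[OF that]) (rule IH(3)[of "(3 * a + i, 3 * b + j)" "(3 * a + i, 3 * b + (j + 1))"], use that in \<open>auto simp: B_def\<close>)
      show "i = i' \<and> j = j'" if "i \<in> {0, 1, 2}" "j \<in> {0, 1, 2}" "i' \<in> {0, 1, 2}" "j' \<in> {0, 1, 2}" "B i j" "B i' j'" for i j i' j'
        using one[OF nb, of "(3 * a + i, 3 * b + j)" "(3 * a + i', 3 * b + j')"] that par_child[of i j a b] par_child[of i' j' a b] u
        unfolding B_def by simp
      show "\<not> B i j" "\<not> B i' j'" using c(2) c'(2) ij(3) ij'(3) by (simp_all add: B_def)
    qed (use ij ij' in auto)
    moreover have "y \<in> K i' j'" using c'(3) ij'(3) by (auto simp: K_def)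
    ultimately obtain x1 where x1: "x1 \<in> core G k c" "(sadj G)\<^sup>*\<^sup>* x1 y" using ij(3) unfolding K_def by blast
    have "(sadj G)\<^sup>*\<^sup>* x x1" by (rule IH(2)[OF c(2,3) x1(1)])
    then show ?thesis using x1(2) by (rule rtranclp_trans)
  qed
  {
    case (1 u)
    obtain a b where u: "u = (a, b)" by (cases u)
    have p: "par (3 * a + j, 3 * b + 0) = u" if "j \<in> {0, 1, 2}" for j using par_child[OF that, of 0 a b] u by simp
    obtain j where j: "j \<in> {0, 1, 2}" "\<not> bad G k (3 * a + j, 3 * b + 0)"
      using pick[OF 1 1, of "\<lambda>j. (3 * a + j, 3 * b + 0)" "\<lambda>j. (3 * a + j, 3 * b + 0)", OF p p inj_onI inj_onI] by (simp only: prod.inject add_left_cancel) blast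
    then show ?case unfolding core.simps using IH(1)[OF j(2)] p[OF j(1)] by blast
  next
    case (2 u x y)
    then show ?case by (rule conn)
  next
    case (3 u u' x y)
    obtain a b where u: "u = (a, b)" by (cases u)
    have "\<exists>c c'. par c = u \<and> par c' = u' \<and> \<not> bad G k c \<and> \<not> bad G k c' \<and> (c' = (fst c + 1, snd c) \<or> c' = (fst c, snd c + 1))"
      using 3(3)
    proof
      assume u': "u' = (fst u + 1, snd u)"
      have p: "par (3 * a + 2, 3 * b + j) = u" "par (3 * a + 3, 3 * b + j) = u'" if "j \<in> {0, 1, 2}" for j
        using that u u' by (auto simp: par_def)
      obtain j where j: "j \<in> {0, 1, 2}" "\<not> bad G k (3 * a + 2, 3 * b + j)" "\<not> bad G k (3 * a + 3, 3 * b + j)"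
        using pick[OF 3(1,2), of "\<lambda>j. (3 * a + 2, 3 * b + j)" "\<lambda>j. (3 * a + 3, 3 * b + j)", OF p inj_onI inj_onI] by (simp only: prod.inject add_left_cancel) blast
      show ?thesis by (rule exI[of _ "(3 * a + 2, 3 * b + j)"], rule exI[of _ "(3 * a + 3, 3 * b + j)"]) (use p j in auto)
    next
      assume u': "u' = (fst u, snd u + 1)"
      have p: "par (3 * a + j, 3 * b + 2) = u" "par (3 * a + j, 3 * b + 3) = u'" if "j \<in> {0, 1, 2}" for j
        using that u u' by (auto simp: par_def)
      obtain j where j: "j \<in> {0, 1, 2}" "\<not> bad G k (3 * a + j, 3 * b + 2)" "\<not> bad G k (3 * a + j, 3 * b + 3)"
        using pick[OF 3(1,2), of "\<lambda>j. (3 * a + j, 3 * b + 2)" "\<lambda>j. (3 * a + j, 3 * b + 3)", OF p inj_onI inj_onI] by (simp only: prod.inject add_left_cancel) blast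
      show ?thesis by (rule exI[of _ "(3 * a + j, 3 * b + 2)"], rule exI[of _ "(3 * a + j, 3 * b + 3)"]) (use p j in auto)
    qed
    then obtain c c' where cc: "par c = u" "par c' = u'" "\<not> bad G k c" "\<not> bad G k c'" "c' = (fst c + 1, snd c) \<or> c' = (fst c, snd c + 1)" by blast
    obtain x0 y0 where x0: "x0 \<in> core G k c" and y0: "y0 \<in> core G k c'" using IH(1) cc(3,4) by blast
    have "x0 \<in> core G (Suc k) u" "y0 \<in> core G (Suc k) u'" using x0 y0 cc by auto
    then have "(sadj G)\<^sup>*\<^sup>* x x0" "(sadj G)\<^sup>*\<^sup>* y0 y" using conn 3 by blast+
    moreover have "(sadj G)\<^sup>*\<^sup>* x0 y0" by (rule IH(3)[OF cc(3,4,5) x0 y0])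
    ultimately show ?case by (meson rtranclp_trans)
  }
qed

text \<open>The block (0, 0) of level k + 1 contains that of level k at its corner, so the cores
  increase. The increase is strict because two further children of the block cannot both be
  bad.\<close>

lemma has_inf_cluster_sadj:
  assumes nb: "\<And>k. \<not> bad G k (0, 0)"
  shows "has_inf_cluster (sadj G)"
  unfolding has_inf_cluster_def
proof (rule exI, rule notI)
  assume fin: "finite {w. (sadj G)\<^sup>*\<^sup>* (0, 0) w}"
  have sub: "core G k (0, 0) \<subset> core G (Suc k) (0, 0)" for k
  proof
    have "(0, 0) \<in> {c. par c = (0, 0) \<and> \<not> bad G k c}" using nb[of k] by (simp add: par_def)
    then show "core G k (0, 0) \<subseteq> core G (Suc k) (0, 0)" unfolding core.simps by blast
    have "\<not> bad G k (0, 1) \<or> \<not> bad G k (1, 0)" 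
    proof (rule ccontr)
      assume "\<not> ?thesis"
      moreover have "par (0, 1) = (0, 0)" "par (1, 0) = (0, 0)" "(0, 1) \<noteq> (1, 0::int)" by (simp_all add: par_def)
      ultimately have "bad G (Suc k) (0, 0)" unfolding bad.simps by blast
      then show False using nb by blast
    qed
    then obtain c where c: "\<not> bad G k c" "par c = (0, 0)" "c \<noteq> (0, 0)" by (force simp: par_def)
    obtain x where x: "x \<in> core G k c" using core_nonempty[OF c(1)] by blast
    have "x \<notin> core G k (0, 0)" using core_div[OF x] core_div[of x G k "(0, 0)"] c(3) by (auto simp: prod_eq_iff)
    moreover have "x \<in> core G (Suc k) (0, 0)" using x c by auto
    ultimately show "core G k (0, 0) \<noteq> core G (Suc k) (0, 0)" by blast
  qed
  have z: "(0, 0) \<in> core G k (0, 0)" for k by (induction k) (use sub in auto)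
  have in_fin: "core G k (0, 0) \<subseteq> {w. (sadj G)\<^sup>*\<^sup>* (0, 0) w}" for k using core_connected(2)[OF nb z] by blast
  have card: "k \<le> card (core G k (0, 0))" for k
  proof (induction k)
    case (Suc k)
    have "card (core G k (0, 0)) < card (core G (Suc k) (0, 0))"
      by (rule psubset_card_mono[OF finite_subset[OF in_fin fin] sub])
    then show ?case using Suc by linarith
  qed simp
  show False using card[of "Suc (card {w. (sadj G)\<^sup>*\<^sup>* (0, 0) w})"] card_mono[OF fin in_fin] by (meson Suc_n_not_le_n order_trans)
qed

definition ch :: "int \<times> int \<Rightarrow> (int \<times> int) set" where
  "ch u = {c. par c = u}"

lemma card_ch: "card (ch u) = 9" "finite (ch u)"
proof -
  have "ch u = {3 * fst u..3 * fst u + 2} \<times> {3 * snd u..3 * snd u + 2}"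
    by (cases u) (auto simp: ch_def par_def)
  then show "card (ch u) = 9" "finite (ch u)" by (simp_all add: card_cartesian_product)
qed

text \<open>A bad block of level k contains \<open>2 ^ k\<close> bad squares; \<open>bfam\<close> lists their possible positions.\<close>

primrec bfam :: "nat \<Rightarrow> int \<times> int \<Rightarrow> (int \<times> int) set set" where
  "bfam 0 u = {{u}}"
| "bfam (Suc k) u = (\<Union>c\<in>ch u. \<Union>c'\<in>ch u - {c}. (\<lambda>(Q, Q'). Q \<union> Q') ` (bfam k c \<times> bfam k c'))"

lemma bad_bfam: "bad G k u \<Longrightarrow> \<exists>Q\<in>bfam k u. \<forall>z\<in>Q. \<not> G z"
proof (induction k arbitrary: u)
  case (Suc k)
  then obtain c c' where c: "c \<noteq> c'" "c \<in> ch u" "c' \<in> ch u" "bad G k c" "bad G k c'" by (auto simp: ch_def)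
  obtain Q Q' where "Q \<in> bfam k c" "\<forall>z\<in>Q. \<not> G z" "Q' \<in> bfam k c'" "\<forall>z\<in>Q'. \<not> G z" using Suc.IH[OF c(4)] Suc.IH[OF c(5)] by blast
  note Q = this
  have "Q \<union> Q' \<in> (\<lambda>(Q, Q'). Q \<union> Q') ` (bfam k c \<times> bfam k c')" by (rule image_eqI[of _ _ "(Q, Q')"]) (use Q in simp_all)
  then have "Q \<union> Q' \<in> bfam (Suc k) u" unfolding bfam.simps using c(1-3)
    by (intro UN_I[of c "ch u"] UN_I[of c' "ch u - {c}"]) simp_all
  then show ?case using Q by blast
qed auto

lemma bfam_div: "Q \<in> bfam k u \<Longrightarrow> finite Q \<and> card Q = 2 ^ k \<and> (\<forall>x\<in>Q. fst x div 3 ^ k = fst u \<and> snd x div 3 ^ k = snd u)"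
proof (induction k arbitrary: u Q)
  case (Suc k)
  then obtain c c' Q1 Q2 where c: "c \<in> ch u" "c' \<in> ch u" "c \<noteq> c'" and Q: "Q1 \<in> bfam k c" "Q2 \<in> bfam k c'" "Q = Q1 \<union> Q2"
    unfolding bfam.simps by blast
  note I1 = Suc.IH[OF Q(1)] and I2 = Suc.IH[OF Q(2)]
  have "Q1 \<inter> Q2 = {}" using I1 I2 c(3) by (fastforce simp: prod_eq_iff)
  then have "card Q = 2 ^ Suc k" using I1 I2 Q(3) by (simp add: card_Un_disjoint)
  moreover have e: "a div 3 ^ Suc k = a div 3 ^ k div 3" for a :: int
    unfolding power_Suc2 by (rule zdiv_zmult2_eq) simp
  have "fst x div 3 ^ Suc k = fst u \<and> snd x div 3 ^ Suc k = snd u" if "x \<in> Q" for x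
  proof -
    have "(fst x div 3 ^ k = fst c \<and> snd x div 3 ^ k = snd c) \<or> (fst x div 3 ^ k = fst c' \<and> snd x div 3 ^ k = snd c')"
      using that Q(3) I1 I2 by blast
    then show ?thesis unfolding e using c by (auto simp: ch_def par_def)
  qed
  ultimately show ?case using I1 I2 Q(3) by blast
qed auto

text \<open>With 9 children the cardinalities satisfy a(k + 1) \<le> 81 * a(k)^2; the factor 81 in
  the claim turns this into pure squaring.\<close>

lemma card_bfam: "finite (bfam k u) \<and> 81 * card (bfam k u) \<le> 81 ^ 2 ^ k"
proof (induction k arbitrary: u)
  case (Suc k)
  define m :: nat where "m = 81 ^ 2 ^ k div 81"
  have c: "card (bfam k c) \<le> m" for c using Suc[of c] unfolding m_def by linarith
  have fin: "finite (bfam k c)" for c using Suc by blast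
  have i: "card ((\<lambda>(Q, Q'). Q \<union> Q') ` (bfam k c \<times> bfam k c')) \<le> m * m" for c c'
  proof -
    have "card ((\<lambda>(Q, Q'). Q \<union> Q') ` (bfam k c \<times> bfam k c')) \<le> card (bfam k c \<times> bfam k c')"
      using fin by (intro card_image_le) auto
    also have "\<dots> \<le> m * m" unfolding card_cartesian_product by (intro mult_mono c) auto
    finally show ?thesis .
  qed
  have j: "card (\<Union>c'\<in>ch u - {c}. (\<lambda>(Q, Q'). Q \<union> Q') ` (bfam k c \<times> bfam k c')) \<le> 9 * (m * m)" for c
  proof -
    have "card (\<Union>c'\<in>ch u - {c}. (\<lambda>(Q, Q'). Q \<union> Q') ` (bfam k c \<times> bfam k c'))
        \<le> (\<Sum>c'\<in>ch u - {c}. card ((\<lambda>(Q, Q'). Q \<union> Q') ` (bfam k c \<times> bfam k c')))"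
      using card_ch(2) by (intro card_UN_le) auto
    also have "\<dots> \<le> (\<Sum>c'\<in>ch u - {c}. m * m)" by (intro sum_mono i)
    also have "\<dots> \<le> 9 * (m * m)" using card_ch[of u] card_mono[of "ch u" "ch u - {c}"] by (simp add: Diff_subset)
    finally show ?thesis .
  qed
  have "card (bfam (Suc k) u) \<le> (\<Sum>c\<in>ch u. card (\<Union>c'\<in>ch u - {c}. (\<lambda>(Q, Q'). Q \<union> Q') ` (bfam k c \<times> bfam k c')))"
    unfolding bfam.simps using card_ch(2) by (intro card_UN_le) auto
  also have "\<dots> \<le> (\<Sum>c\<in>ch u. 9 * (m * m))" by (intro sum_mono j)
  also have "\<dots> = 81 * (m * m)" by (simp add: card_ch)
  finally have "81 * card (bfam (Suc k) u) \<le> (81 * m) * (81 * m)" by simp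
  also have "\<dots> \<le> 81 ^ 2 ^ k * 81 ^ 2 ^ k" unfolding m_def by (intro mult_mono) auto
  also have "\<dots> = 81 ^ 2 ^ Suc k" by (simp add: power_add[symmetric] mult_2)
  finally show ?case using fin card_ch(2) by auto
qed auto

text \<open>A union bound over the positions of bad squares: the block (0, 0) of level k is bad with
  probability at most (81 * \<epsilon>)^(2^k), and these bounds sum to at most 1 / 3. So with
  positive probability it is good at every level.\<close>

lemma sadj_percolates:
  assumes M: "prob_space M" and G: "\<And>z. Measurable.pred M (\<lambda>\<omega>. G \<omega> z)"
    and le: "\<And>Q. finite Q \<Longrightarrow> measure M {\<omega> \<in> space M. \<forall>z\<in>Q. \<not> G \<omega> z} \<le> \<epsilon> ^ card Q" and e: "0 \<le> \<epsilon>" "81 * \<epsilon> \<le> 1 / 4"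
  shows "\<not> (AE \<omega> in M. \<not> has_inf_cluster (sadj (G \<omega>)))"
proof
  interpret prob_space M by fact
  assume no: "AE \<omega> in M. \<not> has_inf_cluster (sadj (G \<omega>))"
  define E where "E k = (\<Union>Q\<in>bfam k (0, 0). {\<omega> \<in> space M. \<forall>z\<in>Q. \<not> G \<omega> z})" for k
  have s: "{\<omega> \<in> space M. \<forall>z\<in>Q. \<not> G \<omega> z} \<in> sets M" if "Q \<in> bfam k (0, 0)" for Q k
  proof -
    have "{\<omega> \<in> space M. \<not> G \<omega> z} \<in> sets M" for z
    proof -
      have "Measurable.pred M (\<lambda>\<omega>. \<not> G \<omega> z)" using G[of z] by (rule pred_intros_logic)
      then show ?thesis by (simp only: pred_def)
    qed
    then show ?thesis using bfam_div[OF that] by (intro sets.sets_Collect_finite_All) auto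
  qed
  have Es: "E k \<in> sets M" for k unfolding E_def using card_bfam s by (intro sets.finite_UN) auto
  have Ele: "measure M (E k) \<le> (1 / 4) ^ Suc k" for k
  proof -
    have "measure M (E k) \<le> (\<Sum>Q\<in>bfam k (0, 0). measure M {\<omega> \<in> space M. \<forall>z\<in>Q. \<not> G \<omega> z})"
      unfolding E_def using card_bfam s by (intro finite_measure_subadditive_finite) auto
    also have "\<dots> \<le> (\<Sum>Q\<in>bfam k (0, 0). \<epsilon> ^ 2 ^ k)"
      using bfam_div le by (intro sum_mono) (metis (no_types))
    also have "\<dots> = real (card (bfam k (0, 0))) * \<epsilon> ^ 2 ^ k" by simp
    also have "\<dots> \<le> 81 ^ 2 ^ k * \<epsilon> ^ 2 ^ k"
    proof (intro mult_right_mono)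
      have "card (bfam k (0, 0)) \<le> 81 ^ 2 ^ k" using card_bfam[of k "(0, 0)"] by linarith
      then have "real (card (bfam k (0, 0))) \<le> real (81 ^ 2 ^ k)" by (rule of_nat_mono)
      then show "real (card (bfam k (0, 0))) \<le> 81 ^ 2 ^ k" by simp
    qed (use e in simp)
    also have "\<dots> = (81 * \<epsilon>) ^ 2 ^ k" by (simp add: power_mult_distrib)
    also have "\<dots> \<le> (1 / 4) ^ 2 ^ k" using e by (intro power_mono) auto
    also have "\<dots> \<le> (1 / 4) ^ Suc k" by (intro power_decreasing) (auto simp: Suc_leI)
    finally show ?thesis .
  qed
  have geo: "(\<lambda>k. (1 / 4) ^ Suc k :: real) sums (1 / 3)"
    using sums_mult[OF geometric_sums[of "1 / 4 :: real"], of "1 / 4"] by simp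
  have sm: "summable (\<lambda>k. measure M (E k))" 
    by (rule summable_comparison_test'[OF sums_summable[OF geo]]) (use Ele in simp)
  have "measure M (\<Union>k. E k) \<le> (\<Sum>k. measure M (E k))"
    using Es sm by (intro finite_measure_subadditive_countably) auto
  also have "\<dots> \<le> (\<Sum>k. (1 / 4) ^ Suc k)" by (rule suminf_le[OF Ele sm sums_summable[OF geo]])
  also have "\<dots> = 1 / 3" using geo by (simp add: sums_iff)
  finally have "measure M (\<Union>k. E k) \<le> 1 / 3" .
  moreover have "AE \<omega> in M. \<omega> \<in> (\<Union>k. E k)"
    using no AE_space
  proof eventually_elim
    case (elim \<omega>)
    obtain k where "bad (G \<omega>) k (0, 0)" using has_inf_cluster_sadj[of "G \<omega>"] elim(1) by blast
    from bad_bfam[OF this] obtain Q where "Q \<in> bfam k (0, 0)" "\<forall>z\<in>Q. \<not> G \<omega> z" by blast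
    then have "\<omega> \<in> E k" unfolding E_def using elim(2) by blast
    then show ?case by blast
  qed
  then have "measure M (\<Union>k. E k) = 1" using Es by (intro prob_eq_1[THEN iffD2]) auto
  ultimately show False by simp
qed

section \<open>Positivity and finiteness of the critical intensity\<close>

lemma measure_PiM_cylinder:
  assumes M: "\<And>i. prob_space (M i)" and fin: "finite I" and A: "\<And>i. i \<in> I \<Longrightarrow> A i \<in> sets (M i)"
  shows "measure (PiM UNIV M) {x \<in> space (PiM UNIV M). \<forall>i\<in>I. x i \<in> A i} = (\<Prod>i\<in>I. measure (M i) (A i))"
    and "{x \<in> space (PiM UNIV M). \<forall>i\<in>I. x i \<in> A i} \<in> sets (PiM UNIV M)"
proof -
  interpret P: product_prob_space M UNIV using M by (rule product_prob_spaceI)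
  have "emeasure (PiM UNIV M) {x \<in> space (PiM UNIV M). \<forall>i\<in>I. x i \<in> A i} = (\<Prod>i\<in>I. emeasure (M i) (A i))"
    using fin A by (intro P.emeasure_PiM_Collect) auto
  also have "\<dots> = ennreal (\<Prod>i\<in>I. measure (M i) (A i))"
    using M by (simp add: finite_measure.emeasure_eq_measure prob_space.finite_measure prod_ennreal)
  finally show "measure (PiM UNIV M) {x \<in> space (PiM UNIV M). \<forall>i\<in>I. x i \<in> A i} = (\<Prod>i\<in>I. measure (M i) (A i))"
    by (simp add: measure_def prod_nonneg)
  show "{x \<in> space (PiM UNIV M). \<forall>i\<in>I. x i \<in> A i} \<in> sets (PiM UNIV M)"
    using fin A by (intro sets.sets_Collect_finite_All) (auto intro!: sets_Collect_single')
qed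

lemma measure_RCM_rect:
  assumes A: "A \<in> sets (PN lam)" and B: "B \<in> sets PX"
  shows "measure (RCM_space lam) {\<omega>. fst (fst \<omega>) \<in> A \<and> snd (fst \<omega>) \<in> B} = measure (PN lam) A * measure PX B"
proof -
  interpret N: prob_space "PN lam" by (rule prob_space_PN)
  interpret X: prob_space PX by (rule prob_space_PX)
  interpret U: prob_space PU by (rule prob_space_PU)
  have "{\<omega>. fst (fst \<omega>) \<in> A \<and> snd (fst \<omega>) \<in> B} = (A \<times> B) \<times> space PU" by auto
  then have "emeasure (RCM_space lam) {\<omega>. fst (fst \<omega>) \<in> A \<and> snd (fst \<omega>) \<in> B} = emeasure (PN lam \<Otimes>\<^sub>M PX) (A \<times> B) * emeasure PU (space PU)"
    unfolding RCM_space_eq using A B by (simp add: U.emeasure_pair_measure_Times del: space_all)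
  also have "\<dots> = emeasure (PN lam) A * emeasure PX B" using A B by (simp add: X.emeasure_pair_measure_Times U.emeasure_space_1 del: space_all)
  finally show ?thesis by (simp add: measure_def enn2real_mult)
qed

section \<open>Low intensity: paths of occupied squares\<close>

primrec zpaths :: "nat \<Rightarrow> int \<times> int \<Rightarrow> nat \<Rightarrow> (int \<times> int) list set" where
  "zpaths D z0 0 = {[z0]}"
| "zpaths D z0 (Suc m) = (\<Union>xs\<in>zpaths D z0 m. (\<lambda>y. y # xs) ` zbox (hd xs) D)"

lemma zpaths_bounds: "finite (zpaths D z0 m) \<and> card (zpaths D z0 m) \<le> ((2 * D + 1)\<^sup>2) ^ m \<and> (\<forall>xs\<in>zpaths D z0 m. length xs = Suc m)"
proof (induction m)
  case (Suc m)
  have "card (zpaths D z0 (Suc m)) \<le> (\<Sum>xs\<in>zpaths D z0 m. card ((\<lambda>y. y # xs) ` zbox (hd xs) D))"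
    unfolding zpaths.simps using Suc by (intro card_UN_le) auto
  also have "\<dots> \<le> (\<Sum>xs\<in>zpaths D z0 m. (2 * D + 1)\<^sup>2)"
    by (intro sum_mono) (metis card_zbox card_image_le finite_zbox)
  also have "\<dots> \<le> ((2 * D + 1)\<^sup>2) ^ Suc m" using Suc by simp
  finally show ?case using Suc by auto
qed simp

text \<open>In a walk of minimal length two equal vertices would allow the part between them to be
  cut out.\<close>

lemma geodesic:
  assumes "r\<^sup>*\<^sup>* x y"
  shows "\<exists>n g. g 0 = x \<and> g n = y \<and> (\<forall>i<n. r (g i) (g (Suc i))) \<and> inj_on g {..n}"
proof -
  define n where "n = (LEAST n. (r ^^ n) x y)"
  have ex: "\<exists>n. (r ^^ n) x y" using assms by (simp add: rtranclp_power)
  have n: "(r ^^ n) x y" unfolding n_def using ex by (rule LeastI_ex)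
  have least: "n \<le> k" if "(r ^^ k) x y" for k unfolding n_def using that by (rule Least_le)
  obtain g where g: "g 0 = x" "g n = y" "\<forall>i<n. r (g i) (g (Suc i))" using n unfolding relpowp_fun_conv by blast
  have "i = j" if ij: "i < j" "j \<le> n" "g i = g j" for i j
  proof -
    define h where "h k = (if k \<le> i then g k else g (k + (j - i)))" for k
    have "(r ^^ (n - (j - i))) x y"
      unfolding relpowp_fun_conv
    proof (intro exI[of _ h] conjI allI impI)
      show "h 0 = x" using g by (simp add: h_def)
      show "h (n - (j - i)) = y"
      proof (cases "n - (j - i) \<le> i")
        case True
        then have "n - (j - i) = i" "n = j" using ij by auto
        then show ?thesis using g ij by (simp add: h_def)
      next
        case False
        then show ?thesis using g ij by (simp add: h_def)
      qed
      fix k assume k: "k < n - (j - i)"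
      consider "k < i" | "k = i" | "i < k" by linarith
      then show "r (h k) (h (Suc k))"
      proof cases
        case 1
        then show ?thesis using g(3) ij by (simp add: h_def)
      next
        case 2
        then show ?thesis using g(3) ij k by (simp add: h_def)
      next
        case 3
        then show ?thesis using g(3) ij k by (simp add: h_def)
      qed
    qed
    then show ?thesis using least[of "n - (j - i)"] ij by linarith
  qed
  then have "inj_on g {..n}" by (intro inj_onI) (metis atMost_iff linorder_neqE_nat)
  then show ?thesis using g by blast
qed

text \<open>The squares along a connecting walk are occupied. Passing to a geodesic makes them
  distinct, so that their counts are independent; getting further than m * D takes more than m
  steps.\<close>

lemma reach_zpaths:
  assumes rg: "ranged D (vset N) B" and re: "reach D z0 (m * D) (vset N) B"
  shows "\<exists>xs\<in>zpaths D z0 m. distinct xs \<and> (\<forall>z\<in>set xs. 0 < N z)"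
proof -
  define r where "r a b \<longleftrightarrow> zd a b \<le> int D \<and> 0 < N a \<and> 0 < N b" for a b
  obtain v w where vw: "v \<in> vset N" "fst v = z0" "(gadj (vset N) B)\<^sup>*\<^sup>* v w" "int (m * D) < zd z0 (fst w)"
    using reach_path[OF re] by blast
  have "r\<^sup>*\<^sup>* (fst v) (fst w)" using vw(3)
  proof (induction rule: rtranclp_induct)
    case (step y z)
    have "r (fst y) (fst z)" using step(2) rg by (auto simp: r_def ranged_def gadj_def vset_def)
    then show ?case using step.IH by (rule rtranclp.rtrancl_into_rtrancl[rotated])
  qed simp
  then obtain n g where g: "g 0 = fst v" "g n = fst w" "\<And>i. i < n \<Longrightarrow> r (g i) (g (Suc i))" "inj_on g {..n}"
    using geodesic[of r "fst v" "fst w"] by blast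
  have d: "zd z0 (g i) \<le> int (i * D)" if "i \<le> n" for i
    using that
  proof (induction i)
    case (Suc i)
    then have "zd (g i) (g (Suc i)) \<le> int D" using g(3)[of i] by (simp add: r_def)
    then show ?case using Suc zd_triangle[of z0 "g (Suc i)" "g i"] by (simp add: algebra_simps)
  qed (use g vw in simp)
  have mn: "m < n"
  proof (rule ccontr)
    assume "\<not> m < n"
    then have "n * D \<le> m * D" by simp
    then have "int (n * D) \<le> int (m * D)" by (rule of_nat_mono)
    then show False using d[of n] vw(4) g(2) by simp
  qed
  have p: "map g (rev [0..<Suc i]) \<in> zpaths D z0 i" if "i \<le> m" for i
    using that
  proof (induction i)
    case (Suc i)
    have "zd (g i) (g (Suc i)) \<le> int D" using g(3)[of i] Suc mn by (simp add: r_def)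
    then have "g (Suc i) \<in> zbox (hd (map g (rev [0..<Suc i]))) D" by (simp add: zbox_def)
    moreover have "map g (rev [0..<Suc (Suc i)]) = g (Suc i) # map g (rev [0..<Suc i])" by simp
    ultimately show ?case using Suc unfolding zpaths.simps by (metis (no_types, lifting) UN_I Suc_leD image_eqI)
  qed (use g vw in simp)
  show ?thesis
  proof (intro bexI[OF _ p[OF order_refl]] conjI ballI)
    have "inj_on g (set (rev [0..<Suc m]))" by (rule inj_on_subset[OF g(4)]) (use mn in auto)
    then show "distinct (map g (rev [0..<Suc m]))" by (simp only: distinct_map distinct_rev distinct_upt simp_thms)
    fix z assume "z \<in> set (map g (rev [0..<Suc m]))"
    then obtain i where "i < Suc m" "z = g i" unfolding set_map set_rev set_upt by (meson atLeastLessThan_iff imageE)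
    then show "0 < N z" using g(3)[of i] mn by (simp add: r_def)
  qed
qed

lemma prob_occupied:
  assumes lam: "0 < lam" and Q: "finite Q"
  shows "measure (RCM_space lam) {\<omega>. \<forall>z\<in>Q. 0 < fst (fst \<omega>) z} \<le> lam ^ card Q" "{\<omega>. \<forall>z\<in>Q. 0 < fst (fst \<omega>) z} \<in> sets (RCM_space lam)"
proof -
  have sp: "space (PiM UNIV (\<lambda>z. measure_pmf (poisson_pmf lam))) = UNIV" by (simp add: space_PiM)
  note c = measure_PiM_cylinder[of "\<lambda>_::int \<times> int. measure_pmf (poisson_pmf lam)" Q "\<lambda>_. {0<..}", OF measure_pmf.prob_space_axioms Q, unfolded sp]
  have "{\<omega>. \<forall>z\<in>Q. 0 < fst (fst \<omega>) z} = {\<omega>. fst (fst \<omega>) \<in> {N \<in> UNIV. \<forall>z\<in>Q. N z \<in> {0<..}} \<and> snd (fst \<omega>) \<in> UNIV}" by simp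
  moreover have "measure (RCM_space lam) {\<omega>. fst (fst \<omega>) \<in> {N \<in> UNIV. \<forall>z\<in>Q. N z \<in> {0<..}} \<and> snd (fst \<omega>) \<in> UNIV}
      = measure (PN lam) {N \<in> UNIV. \<forall>z\<in>Q. N z \<in> {0<..}} * measure PX UNIV"
    using c(2) sets.top[of PX] by (intro measure_RCM_rect) (simp_all add: PN_def)
  ultimately have "measure (RCM_space lam) {\<omega>. \<forall>z\<in>Q. 0 < fst (fst \<omega>) z} = measure (PN lam) {N \<in> UNIV. \<forall>z\<in>Q. N z \<in> {0<..}}"
    using prob_space.prob_space[OF prob_space_PX] by simp
  also have "\<dots> = measure (measure_pmf (poisson_pmf lam)) {0<..} ^ card Q" unfolding PN_def using c(1) by simp
  also have "\<dots> \<le> lam ^ card Q"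
  proof (intro power_mono)
    have "measure (measure_pmf (poisson_pmf lam)) {0<..} = 1 - measure (measure_pmf (poisson_pmf lam)) {0}"
    proof -
      have "{0<..} = UNIV - {0::nat}" by auto
      then show ?thesis using measure_pmf.prob_compl[of "{0}" "poisson_pmf lam"] by simp
    qed
    also have "\<dots> = 1 - exp (- lam)" using lam by (simp add: measure_pmf_single)
    also have "\<dots> \<le> lam" using exp_ge_add_one_self[of "- lam"] by linarith
    finally show "measure (measure_pmf (poisson_pmf lam)) {0<..} \<le> lam" .
  qed simp
  finally show "measure (RCM_space lam) {\<omega>. \<forall>z\<in>Q. 0 < fst (fst \<omega>) z} \<le> lam ^ card Q" .
  have "Measurable.pred (RCM_space lam) (\<lambda>\<omega>. \<forall>z\<in>Q. 0 < fst (fst \<omega>) z)"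
    using Q by (intro pred_intros_finite measurable_compose[OF meas_X(3), of "\<lambda>N. 0 < N z" for z]) measurable
  then show "{\<omega>. \<forall>z\<in>Q. 0 < fst (fst \<omega>) z} \<in> sets (RCM_space lam)" by (simp add: pred_def)
qed

context conn_fun
begin

lemma no_perc_small: "\<exists>lam>0. AE \<omega> in RCM_space lam. \<not> has_inf_cluster (rcm_adj f \<omega>)"
proof -
  define D where "D = rng R"
  define k where "k = real ((2 * D + 1)\<^sup>2)"
  \<comment> \<open>k is the number of squares available in one step, so the expected number of
    occupied paths with m steps is at most (k * lam)^m = (1 / 2)^m.\<close>
  define lam where "lam = 1 / (2 * k)"
  have k: "1 \<le> k" unfolding k_def by simp
  have lam: "0 < lam" "lam \<le> 1" "k * lam = 1 / 2" using k by (auto simp: lam_def field_simps)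
  interpret M: prob_space "RCM_space lam" by (rule prob_space_RCM)
  have le: "th f z0 (m * D) lam \<le> (1 / 2) ^ m" for z0 m
  proof -
    let ?L = "{xs \<in> zpaths D z0 m. distinct xs}"
    have s: "{\<omega> \<in> space (RCM_space lam). Rr z0 (m * D) \<omega>} \<in> sets (RCM_space lam)" using pred_Rr by (simp add: pred_def)
    have fin: "finite ?L" "card ?L \<le> ((2 * D + 1)\<^sup>2) ^ m"
      using zpaths_bounds[of D z0 m] card_mono[of "zpaths D z0 m" ?L] by auto
    have st: "(\<Union>xs\<in>?L. {\<omega>. \<forall>z\<in>set xs. 0 < fst (fst \<omega>) z}) \<in> sets (RCM_space lam)"
      using fin prob_occupied(2)[OF lam(1)] by (intro sets.finite_UN) auto
    have "th f z0 (m * D) lam = measure (RCM_space lam) {\<omega> \<in> space (RCM_space lam). Rr z0 (m * D) \<omega>}"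
      using prob_Rr[of lam z0 "m * D"] by simp
    also have "\<dots> \<le> measure (RCM_space lam) (\<Union>xs\<in>?L. {\<omega>. \<forall>z\<in>set xs. 0 < fst (fst \<omega>) z})"
    proof (rule M.finite_measure_mono_AE[OF _ st])
      show "AE \<omega> in RCM_space lam. \<omega> \<in> {\<omega> \<in> space (RCM_space lam). Rr z0 (m * D) \<omega>} \<longrightarrow> \<omega> \<in> (\<Union>xs\<in>?L. {\<omega>. \<forall>z\<in>set xs. 0 < fst (fst \<omega>) z})"
        using AE_RCM_ranged
      proof eventually_elim
        case (elim \<omega>)
        show ?case using reach_zpaths[OF elim, of z0 m] unfolding D_def by blast
      qed
    qed
    also have "\<dots> \<le> (\<Sum>xs\<in>?L. measure (RCM_space lam) {\<omega>. \<forall>z\<in>set xs. 0 < fst (fst \<omega>) z})"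
      using fin prob_occupied(2)[OF lam(1)] by (intro M.finite_measure_subadditive_finite) auto
    also have "\<dots> \<le> (\<Sum>xs\<in>?L. lam ^ m)"
    proof (intro sum_mono)
      fix xs assume xs: "xs \<in> ?L"
      then have "card (set xs) = Suc m" using zpaths_bounds[of D z0 m] by (simp add: distinct_card)
      then have "measure (RCM_space lam) {\<omega>. \<forall>z\<in>set xs. 0 < fst (fst \<omega>) z} \<le> lam ^ Suc m"
        using prob_occupied(1)[OF lam(1), of "set xs"] by simp
      also have "\<dots> \<le> lam ^ m" using lam by (intro power_decreasing) auto
      finally show "measure (RCM_space lam) {\<omega>. \<forall>z\<in>set xs. 0 < fst (fst \<omega>) z} \<le> lam ^ m" .
    qed
    also have "\<dots> = real (card ?L) * lam ^ m" by simp
    also have "\<dots> \<le> k ^ m * lam ^ m"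
    proof (intro mult_right_mono)
      have "real (card ?L) \<le> real (((2 * D + 1)\<^sup>2) ^ m)" using fin(2) by (rule of_nat_mono)
      then show "real (card ?L) \<le> k ^ m" unfolding k_def by simp
    qed (use lam in simp)
    also have "\<dots> = (1 / 2) ^ m" unfolding power_mult_distrib[symmetric] lam(3) ..
    finally show ?thesis .
  qed
  have "AE \<omega> in RCM_space lam. \<not> has_inf_cluster (rcm_adj f \<omega>)"
  proof (rule ccontr)
    assume "\<not> ?thesis"
    then obtain z0 \<epsilon> where e: "0 < \<epsilon>" "\<And>n. \<epsilon> \<le> th f z0 n lam" using perc_imp_theta by blast
    obtain m where "(1 / 2 :: real) ^ m < \<epsilon>" using real_arch_pow_inv[OF e(1), of "1 / 2"] by auto
    then show False using e(2)[of "m * D"] le[of z0 m] by linarith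
  qed
  then show ?thesis using lam by blast
qed

end

section \<open>High intensity: squares with points everywhere\<close>

definition cel :: "nat \<Rightarrow> int \<times> int \<Rightarrow> nat \<times> nat \<Rightarrow> (real \<times> real) set" where
  "cel m z c = {real_of_int (fst z) + real (fst c) / real m..<real_of_int (fst z) + real (fst c) / real m + 1 / real m}
     \<times> {real_of_int (snd z) + real (snd c) / real m..<real_of_int (snd z) + real (snd c) / real m + 1 / real m}"

lemma cel_sets [measurable]: "cel m z c \<in> sets borel"
  unfolding cel_def by (intro borel_Times) auto

lemma cel_subset:
  assumes "c \<in> {..<m} \<times> {..<m}" shows "cel m z c \<subseteq> cube z"
proof
  fix x assume x: "x \<in> cel m z c"
  have m: "0 < real m" using assms by auto
  have "real (fst c) + 1 \<le> real m" "real (snd c) + 1 \<le> real m" using assms by auto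
  then have "(real (fst c) + 1) / real m \<le> 1" "(real (snd c) + 1) / real m \<le> 1" using m by simp_all
  then have "real (fst c) / real m + 1 / real m \<le> 1" "real (snd c) / real m + 1 / real m \<le> 1" by (simp_all add: add_divide_distrib)
  moreover have "0 \<le> real (fst c) / real m" "0 \<le> real (snd c) / real m" by simp_all
  moreover have "real_of_int (fst z) + real (fst c) / real m \<le> fst x" "fst x < real_of_int (fst z) + real (fst c) / real m + 1 / real m"
    "real_of_int (snd z) + real (snd c) / real m \<le> snd x" "snd x < real_of_int (snd z) + real (snd c) / real m + 1 / real m"
    using x by (auto simp: cel_def)
  ultimately show "x \<in> cube z" unfolding mem_cube by linarith
qed

lemma measure_unif_cel:
  assumes c: "c \<in> {..<m} \<times> {..<m}"
  shows "measure (uniform_measure lborel (cube z)) (- cel m z c) = 1 - 1 / (real m)\<^sup>2"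
proof -
  interpret U: prob_space "uniform_measure lborel (cube z)" by (rule prob_space_unif)
  have "emeasure (uniform_measure lborel (cube z)) (cel m z c) = emeasure lborel (cube z \<inter> cel m z c) / emeasure lborel (cube z)"
    by (intro emeasure_uniform_measure) auto
  also have "cube z \<inter> cel m z c = cel m z c" using cel_subset[OF c, of z] by auto
  also have "emeasure lborel (cel m z c) = ennreal (1 / real m * (1 / real m))" unfolding cel_def by (intro emeasure_lborel_rect) auto
  finally have "measure (uniform_measure lborel (cube z)) (cel m z c) = 1 / (real m)\<^sup>2"
    using divide_ennreal[of "1 / real m * (1 / real m)" 1] by (simp add: measure_def emeasure_cube power2_eq_square)
  then show ?thesis using U.prob_compl[of "cel m z c"] by (simp add: Compl_eq_Diff_UNIV)
qed

definition gd :: "nat \<Rightarrow> rcm_sample \<Rightarrow> int \<times> int \<Rightarrow> bool" where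
  "gd m \<omega> z \<longleftrightarrow> (\<forall>c\<in>{..<m} \<times> {..<m}. \<exists>i<fst (fst \<omega>) z. snd (fst \<omega>) (z, i) \<in> cel m z c)"

lemma pred_gd: "Measurable.pred (RCM_space lam) (\<lambda>\<omega>. gd m \<omega> z)"
proof -
  have N: "Measurable.pred (RCM_space lam) (\<lambda>\<omega>. i < fst (fst \<omega>) z)" for i
    by (rule measurable_compose[OF meas_X(3)]) measurable
  have X: "Measurable.pred (RCM_space lam) (\<lambda>\<omega>. snd (fst \<omega>) (z, i) \<in> cel m z c)" for i c
    by (rule measurable_compose[OF meas_X(1)]) measurable
  have eq: "gd m \<omega> z \<longleftrightarrow> (\<forall>c\<in>{..<m} \<times> {..<m}. \<exists>i. i < fst (fst \<omega>) z \<and> snd (fst \<omega>) (z, i) \<in> cel m z c)" for \<omega> by (simp add: gd_def)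
  show ?thesis unfolding eq by (intro pred_intros_finite pred_intros_countable pred_intros_logic N X) simp
qed

text \<open>A square has m * m + 1 possible reasons to fail: it has fewer than K points, or one of
  its subsquares is missed by the first K labels. Once a reason is fixed for each square of Q, the
  events concern different counts and positions, and their probabilities multiply.\<close>

lemma prob_not_gd:
  assumes m: "0 < m" and K: "(1 - 1 / (real m)\<^sup>2) ^ K \<le> \<delta>" and lam: "measure (measure_pmf (poisson_pmf lam)) {..<K} \<le> \<delta>"
    and Q: "finite Q"
  shows "measure (RCM_space lam) {\<omega> \<in> space (RCM_space lam). \<forall>z\<in>Q. \<not> gd m \<omega> z} \<le> (real (m * m + 1) * \<delta>) ^ card Q"
proof -
  interpret M: prob_space "RCM_space lam" by (rule prob_space_RCM)
  let ?J = "{..<m} \<times> {..<m}"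
  \<comment> \<open>\<open>None\<close> stands for too few points, \<open>Some c\<close> for the
    missed subsquare c.\<close>
  define \<Phi> where "\<Phi> = PiE Q (\<lambda>_. insert None (Some ` ?J))"
  define A where "A \<phi> = {N :: int \<times> int \<Rightarrow> nat. \<forall>z\<in>{z \<in> Q. \<phi> z = None}. N z \<in> {..<K}}" for \<phi> :: "int \<times> int \<Rightarrow> (nat \<times> nat) option"
  define B where "B \<phi> = {X :: lbl \<Rightarrow> real \<times> real. \<forall>v\<in>{z \<in> Q. \<phi> z \<noteq> None} \<times> {..<K}. X v \<in> - cel m (fst v) (the (\<phi> (fst v)))}"
    for \<phi> :: "int \<times> int \<Rightarrow> (nat \<times> nat) option"
  have d: "0 \<le> \<delta>" using lam measure_nonneg order_trans by blast
  have b01: "0 \<le> 1 - 1 / (real m)\<^sup>2" using m by simp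
  have fin\<Phi>: "finite \<Phi>" and card\<Phi>: "card \<Phi> = (m * m + 1) ^ card Q"
    using Q by (simp_all add: \<Phi>_def finite_PiE card_PiE card_image card_cartesian_product)
  have sA: "A \<phi> \<in> sets (PN lam)" and mA: "measure (PN lam) (A \<phi>) = measure (measure_pmf (poisson_pmf lam)) {..<K} ^ card {z \<in> Q. \<phi> z = None}" for \<phi>
  proof -
    note c = measure_PiM_cylinder[of "\<lambda>_::int \<times> int. measure_pmf (poisson_pmf lam)" "{z \<in> Q. \<phi> z = None}" "\<lambda>_. {..<K}", OF measure_pmf.prob_space_axioms, folded PN_def]
    have e: "A \<phi> = {x \<in> space (PN lam). \<forall>i\<in>{z \<in> Q. \<phi> z = None}. x i \<in> {..<K}}" by (simp add: A_def)
    show "A \<phi> \<in> sets (PN lam)" unfolding e by (rule c(2)) (use Q in auto)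
    show "measure (PN lam) (A \<phi>) = measure (measure_pmf (poisson_pmf lam)) {..<K} ^ card {z \<in> Q. \<phi> z = None}"
      unfolding e using Q by (subst c(1)) auto
  qed
  have sB: "B \<phi> \<in> sets PX" and mB: "\<phi> \<in> \<Phi> \<Longrightarrow> measure PX (B \<phi>) = (1 - 1 / (real m)\<^sup>2) ^ (card {z \<in> Q. \<phi> z \<noteq> None} * K)" for \<phi>
  proof -
    note c = measure_PiM_cylinder[of "\<lambda>v::lbl. uniform_measure lborel (cube (fst v))" "{z \<in> Q. \<phi> z \<noteq> None} \<times> {..<K}"
      "\<lambda>v. - cel m (fst v) (the (\<phi> (fst v)))", OF prob_space_unif, folded PX_def]
    have e: "B \<phi> = {x \<in> space PX. \<forall>v\<in>{z \<in> Q. \<phi> z \<noteq> None} \<times> {..<K}. x v \<in> - cel m (fst v) (the (\<phi> (fst v)))}" by (simp add: B_def)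
    show "B \<phi> \<in> sets PX" unfolding e by (rule c(2)) (use Q in auto)
    have "measure PX (B \<phi>) = (\<Prod>v\<in>{z \<in> Q. \<phi> z \<noteq> None} \<times> {..<K}. measure (uniform_measure lborel (cube (fst v))) (- cel m (fst v) (the (\<phi> (fst v)))))"
      unfolding e by (rule c(1)) (use Q in auto)
    also have "\<dots> = (\<Prod>v\<in>{z \<in> Q. \<phi> z \<noteq> None} \<times> {..<K}. 1 - 1 / (real m)\<^sup>2)" if "\<phi> \<in> \<Phi>"
    proof (intro prod.cong refl measure_unif_cel)
      fix v assume "v \<in> {z \<in> Q. \<phi> z \<noteq> None} \<times> {..<K}"
      then have "\<phi> (fst v) \<in> insert None (Some ` ?J)" "\<phi> (fst v) \<noteq> None" using that by (auto simp: \<Phi>_def PiE_iff)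
      then show "the (\<phi> (fst v)) \<in> ?J" by auto
    qed
    finally show "measure PX (B \<phi>) = (1 - 1 / (real m)\<^sup>2) ^ (card {z \<in> Q. \<phi> z \<noteq> None} * K)" if "\<phi> \<in> \<Phi>"
      using that by (simp add: card_cartesian_product)
  qed
  define E where "E \<phi> = {\<omega> :: rcm_sample. fst (fst \<omega>) \<in> A \<phi> \<and> snd (fst \<omega>) \<in> B \<phi>}" for \<phi>
  have sE: "E \<phi> \<in> sets (RCM_space lam)" for \<phi>
  proof -
    have "E \<phi> = (\<lambda>\<omega>. fst (fst \<omega>)) -` A \<phi> \<inter> space (RCM_space lam) \<inter> ((\<lambda>\<omega>. snd (fst \<omega>)) -` B \<phi> \<inter> space (RCM_space lam))" by (auto simp: E_def)
    then show ?thesis using measurable_sets[OF meas_X(3) sA] measurable_sets[OF meas_X(1) sB] by (metis sets.Int)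
  qed
  have mE: "measure (RCM_space lam) (E \<phi>) \<le> \<delta> ^ card Q" if "\<phi> \<in> \<Phi>" for \<phi>
  proof -
    let ?a = "card {z \<in> Q. \<phi> z = None}" and ?b = "card {z \<in> Q. \<phi> z \<noteq> None}"
    have "card Q = card ({z \<in> Q. \<phi> z = None} \<union> {z \<in> Q. \<phi> z \<noteq> None})" by (rule arg_cong[of _ _ card]) auto
    also have "\<dots> = ?a + ?b" using Q by (intro card_Un_disjoint) auto
    finally have ab: "card Q = ?a + ?b" .
    have "measure (RCM_space lam) (E \<phi>) = measure (measure_pmf (poisson_pmf lam)) {..<K} ^ ?a * ((1 - 1 / (real m)\<^sup>2) ^ K) ^ ?b"
      unfolding E_def using measure_RCM_rect[OF sA sB] mA mB[OF that] by (simp add: power_mult[symmetric] mult.commute)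
    also have "\<dots> \<le> \<delta> ^ ?a * \<delta> ^ ?b"
      using K lam d b01 by (intro mult_mono power_mono) auto
    finally show ?thesis by (simp add: ab power_add)
  qed
  have sub: "{\<omega> \<in> space (RCM_space lam). \<forall>z\<in>Q. \<not> gd m \<omega> z} \<subseteq> (\<Union>\<phi>\<in>\<Phi>. E \<phi>)"
  proof
    fix \<omega> assume "\<omega> \<in> {\<omega> \<in> space (RCM_space lam). \<forall>z\<in>Q. \<not> gd m \<omega> z}"
    then have ng: "\<not> gd m \<omega> z" if "z \<in> Q" for z using that by blast
    have "\<exists>c\<in>?J. \<forall>i<fst (fst \<omega>) z. snd (fst \<omega>) (z, i) \<notin> cel m z c" if "z \<in> Q" for z
      using ng[OF that] unfolding gd_def by blast
    then obtain c where c: "\<And>z. z \<in> Q \<Longrightarrow> c z \<in> ?J" "\<And>z i. z \<in> Q \<Longrightarrow> i < fst (fst \<omega>) z \<Longrightarrow> snd (fst \<omega>) (z, i) \<notin> cel m z (c z)" by metis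
    define \<phi> where "\<phi> = restrict (\<lambda>z. if fst (fst \<omega>) z < K then None else Some (c z)) Q"
    have "\<phi> \<in> \<Phi>" using c(1) by (auto simp: \<phi>_def \<Phi>_def)
    moreover have "fst (fst \<omega>) \<in> A \<phi>" by (auto simp: A_def \<phi>_def split: if_splits)
    moreover have "snd (fst \<omega>) \<in> B \<phi>"
      unfolding B_def mem_Collect_eq
    proof
      fix v assume "v \<in> {z \<in> Q. \<phi> z \<noteq> None} \<times> {..<K}"
      then have v: "fst v \<in> Q" "\<not> fst (fst \<omega>) (fst v) < K" "snd v < K" by (auto simp: \<phi>_def split: if_splits)
      then have "snd (fst \<omega>) (fst v, snd v) \<notin> cel m (fst v) (c (fst v))" by (intro c(2)) auto
      then show "snd (fst \<omega>) v \<in> - cel m (fst v) (the (\<phi> (fst v)))" using v by (simp add: \<phi>_def)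
    qed
    ultimately show "\<omega> \<in> (\<Union>\<phi>\<in>\<Phi>. E \<phi>)" unfolding E_def by blast
  qed
  have "measure (RCM_space lam) {\<omega> \<in> space (RCM_space lam). \<forall>z\<in>Q. \<not> gd m \<omega> z} \<le> measure (RCM_space lam) (\<Union>\<phi>\<in>\<Phi>. E \<phi>)"
    using fin\<Phi> sE by (intro M.finite_measure_mono sub sets.finite_UN) auto
  also have "\<dots> \<le> (\<Sum>\<phi>\<in>\<Phi>. measure (RCM_space lam) (E \<phi>))"
    using fin\<Phi> sE by (intro M.finite_measure_subadditive_finite) auto
  also have "\<dots> \<le> (\<Sum>\<phi>\<in>\<Phi>. \<delta> ^ card Q)" by (intro sum_mono mE)
  also have "\<dots> = (real (m * m + 1) * \<delta>) ^ card Q" by (simp add: card\<Phi> power_mult_distrib)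
  finally show ?thesis .
qed

lemma poisson_lessThan_tendsto_0: "((\<lambda>lam. measure (measure_pmf (poisson_pmf lam)) {..<K}) \<longlongrightarrow> 0) at_top"
proof -
  have "((\<lambda>lam::real. \<Sum>i<K. lam ^ i / exp lam / fact i) \<longlongrightarrow> (\<Sum>i<K. 0 / fact i)) at_top"
    by (intro tendsto_sum tendsto_divide tendsto_power_div_exp_0 tendsto_const) auto
  then have "((\<lambda>lam::real. \<Sum>i<K. lam ^ i / exp lam / fact i) \<longlongrightarrow> 0) at_top" by simp
  moreover have "eventually (\<lambda>lam::real. (\<Sum>i<K. lam ^ i / exp lam / fact i) = measure (measure_pmf (poisson_pmf lam)) {..<K}) at_top"
    using eventually_gt_at_top[of 0]
  proof eventually_elim
    case (elim lam)
    then show ?case by (subst measure_measure_pmf_finite) (auto simp: exp_minus field_simps)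
  qed
  ultimately show ?thesis by (rule Lim_transform_eventually)
qed

lemma rtranclp_gadj_sym: "(gadj A B)\<^sup>*\<^sup>* x y \<Longrightarrow> (gadj A B)\<^sup>*\<^sup>* y x"
  by (rule sympD[OF symp_rtranclp]) (auto simp: symp_def gadj_def insert_commute)

text \<open>Points in neighbouring subsquares are at distance at most 3 / m \<le> r0, where edges
  are certain. The bottom row or the left column of subsquares leads from one good square to the
  next.\<close>

lemma gd_inf_cluster:
  assumes m: "0 < m" "3 / real m \<le> r0" and g1: "\<And>r. r \<le> r0 \<Longrightarrow> g r = 1"
    and U: "\<And>v w. U {v, w} < 1" and inf: "has_inf_cluster (sadj (gd m ((N, X), U)))"
  shows "has_inf_cluster (gadj (vset N) (ebond g X U))"
proof -
  let ?G = "gd m ((N, X), U)" and ?T = "(gadj (vset N) (ebond g X U))\<^sup>*\<^sup>*"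
  let ?h = "1 / real m"
  have h: "0 < ?h" "3 * ?h \<le> r0" using m by simp_all
  define V where "V z c = (z, SOME i. i < N z \<and> X (z, i) \<in> cel m z c)" for z c
  have V: "V z c \<in> vset N" "X (V z c) \<in> cel m z c" if "?G z" "c \<in> {..<m} \<times> {..<m}" for z c
  proof -
    have "\<exists>i. i < N z \<and> X (z, i) \<in> cel m z c" using that by (auto simp: gd_def)
    then have "(SOME i. i < N z \<and> X (z, i) \<in> cel m z c) < N z \<and> X (V z c) \<in> cel m z c" unfolding V_def by (rule someI_ex)
    then show "V z c \<in> vset N" "X (V z c) \<in> cel m z c" by (simp_all add: V_def vset_def)
  qed
  have near: "?T v w" if "v \<in> vset N" "w \<in> vset N" "X v \<in> {a..<a + ?h} \<times> {b..<b + ?h}" "X w \<in> {a'..<a' + ?h} \<times> {b'..<b' + ?h}"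
      "\<bar>a - a'\<bar> + \<bar>b - b'\<bar> \<le> ?h" for v w a b a' b'
  proof (cases "v = w")
    case False
    have "a \<le> fst (X v)" "fst (X v) < a + ?h" "b \<le> snd (X v)" "snd (X v) < b + ?h" 
      "a' \<le> fst (X w)" "fst (X w) < a' + ?h" "b' \<le> snd (X w)" "snd (X w) < b' + ?h" using that(3,4) by (auto simp: mem_Times_iff)
    then have "dist (X v) (X w) \<le> 3 * ?h" using that(5) dist_pair_le[of "X v" "X w"] by linarith
    then have "gadj (vset N) (ebond g X U) v w" using that(1,2) False h g1 U[of v w] by (simp add: gadj_def ebond_def pdist_pair)
    then show ?thesis by blast
  qed simp
  have m1: "real (m - 1) / real m + ?h = 1" using m(1) by (simp add: add_divide_distrib[symmetric] of_nat_diff)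
  have row: "?T (V z (0, 0)) (V z (k, 0))" if "?G z" "k < m" for z k
    using that(2)
  proof (induction k)
    case (Suc k)
    have "?T (V z (k, 0)) (V z (Suc k, 0))"
    proof (rule near)
      show "X (V z (k, 0)) \<in> {real_of_int (fst z) + real k / real m..<real_of_int (fst z) + real k / real m + ?h} \<times> {real_of_int (snd z)..<real_of_int (snd z) + ?h}"
        using V(2)[OF that(1), of "(k, 0)"] Suc.prems by (simp add: cel_def)
      show "X (V z (Suc k, 0)) \<in> {real_of_int (fst z) + real (Suc k) / real m..<real_of_int (fst z) + real (Suc k) / real m + ?h} \<times> {real_of_int (snd z)..<real_of_int (snd z) + ?h}"
        using V(2)[OF that(1), of "(Suc k, 0)"] Suc.prems by (simp add: cel_def)
    qed (use V(1)[OF that(1)] Suc.prems h in \<open>auto simp: add_divide_distrib\<close>)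
    then show ?case using Suc by (meson Suc_lessD rtranclp_trans)
  qed simp
  have col: "?T (V z (0, 0)) (V z (0, k))" if "?G z" "k < m" for z k
    using that(2)
  proof (induction k)
    case (Suc k)
    have "?T (V z (0, k)) (V z (0, Suc k))"
    proof (rule near)
      show "X (V z (0, k)) \<in> {real_of_int (fst z)..<real_of_int (fst z) + ?h} \<times> {real_of_int (snd z) + real k / real m..<real_of_int (snd z) + real k / real m + ?h}"
        using V(2)[OF that(1), of "(0, k)"] Suc.prems by (simp add: cel_def)
      show "X (V z (0, Suc k)) \<in> {real_of_int (fst z)..<real_of_int (fst z) + ?h} \<times> {real_of_int (snd z) + real (Suc k) / real m..<real_of_int (snd z) + real (Suc k) / real m + ?h}"
        using V(2)[OF that(1), of "(0, Suc k)"] Suc.prems by (simp add: cel_def)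
    qed (use V(1)[OF that(1)] Suc.prems h in \<open>auto simp: add_divide_distrib\<close>)
    then show ?case using Suc by (meson Suc_lessD rtranclp_trans)
  qed simp
  have right: "?T (V z (0, 0)) (V w (0, 0))" if G: "?G z" "?G w" and w: "w = (fst z + 1, snd z)" for z w
  proof -
    have "?T (V z (m - 1, 0)) (V w (0, 0))"
    proof (rule near)
      show "X (V z (m - 1, 0)) \<in> {real_of_int (fst z) + real (m - 1) / real m..<real_of_int (fst z) + real (m - 1) / real m + ?h} \<times> {real_of_int (snd z)..<real_of_int (snd z) + ?h}"
        using V(2)[OF G(1), of "(m - 1, 0)"] m by (simp add: cel_def)
      show "X (V w (0, 0)) \<in> {real_of_int (fst z) + 1..<real_of_int (fst z) + 1 + ?h} \<times> {real_of_int (snd z)..<real_of_int (snd z) + ?h}"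
        using V(2)[OF G(2), of "(0, 0)"] m w by (simp add: cel_def)
      show "\<bar>real_of_int (fst z) + real (m - 1) / real m - (real_of_int (fst z) + 1)\<bar> + \<bar>real_of_int (snd z) - real_of_int (snd z)\<bar> \<le> ?h"
        using m1 h(1) by linarith
    qed (use V(1) G m in auto)
    then show ?thesis using row[OF G(1), of "m - 1"] m by (meson diff_less rtranclp_trans zero_less_one)
  qed
  have up: "?T (V z (0, 0)) (V w (0, 0))" if G: "?G z" "?G w" and w: "w = (fst z, snd z + 1)" for z w
  proof -
    have "?T (V z (0, m - 1)) (V w (0, 0))"
    proof (rule near)
      show "X (V z (0, m - 1)) \<in> {real_of_int (fst z)..<real_of_int (fst z) + ?h} \<times> {real_of_int (snd z) + real (m - 1) / real m..<real_of_int (snd z) + real (m - 1) / real m + ?h}"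
        using V(2)[OF G(1), of "(0, m - 1)"] m by (simp add: cel_def)
      show "X (V w (0, 0)) \<in> {real_of_int (fst z)..<real_of_int (fst z) + ?h} \<times> {real_of_int (snd z) + 1..<real_of_int (snd z) + 1 + ?h}"
        using V(2)[OF G(2), of "(0, 0)"] m w by (simp add: cel_def)
      show "\<bar>real_of_int (fst z) - real_of_int (fst z)\<bar> + \<bar>real_of_int (snd z) + real (m - 1) / real m - (real_of_int (snd z) + 1)\<bar> \<le> ?h"
        using m1 h(1) by linarith
    qed (use V(1) G m in auto)
    then show ?thesis using col[OF G(1), of "m - 1"] m by (meson diff_less rtranclp_trans zero_less_one)
  qed
  have step: "?T (V z (0, 0)) (V w (0, 0))" if "sadj ?G z w" for z w
  proof -
    have G: "?G z" "?G w" and d: "\<bar>fst z - fst w\<bar> + \<bar>snd z - snd w\<bar> = 1" using that by (auto simp: sadj_def)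
    have "(fst w = fst z + 1 \<and> snd w = snd z) \<or> (fst w = fst z \<and> snd w = snd z + 1) \<or> (fst z = fst w + 1 \<and> snd z = snd w) \<or> (fst z = fst w \<and> snd z = snd w + 1)"
      using d by linarith
    then consider "w = (fst z + 1, snd z)" | "w = (fst z, snd z + 1)" | "z = (fst w + 1, snd w)" | "z = (fst w, snd w + 1)"
      by (metis prod.collapse)
    then show ?thesis
      by cases (use right[OF G] up[OF G] right[OF G(2,1)] up[OF G(2,1)] rtranclp_gadj_sym in blast)+
  qed
  obtain z0 where z0: "infinite {w. (sadj ?G)\<^sup>*\<^sup>* z0 w}" using inf by (auto simp: has_inf_cluster_def)
  have "?T (V z0 (0, 0)) (V w (0, 0))" if "(sadj ?G)\<^sup>*\<^sup>* z0 w" for w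
    using that
  proof (induction rule: rtranclp_induct)
    case (step y z)
    then show ?case using \<open>\<And>z w. sadj ?G z w \<Longrightarrow> ?T (V z (0, 0)) (V w (0, 0))\<close> by (meson rtranclp_trans)
  qed simp
  then have "(\<lambda>w. V w (0, 0)) ` {w. (sadj ?G)\<^sup>*\<^sup>* z0 w} \<subseteq> {v. ?T (V z0 (0, 0)) v}" by blast
  moreover have "inj_on (\<lambda>w. V w (0, 0)) {w. (sadj ?G)\<^sup>*\<^sup>* z0 w}" by (auto simp: inj_on_def V_def)
  ultimately have "infinite {v. ?T (V z0 (0, 0)) v}" using z0 finite_subset finite_image_iff by metis
  then show ?thesis unfolding has_inf_cluster_def by blast
qed

text \<open>Where g equals 1 an edge is open iff its uniform variable is below 1, so the value 1 has
  to be excluded.\<close>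

lemma AE_U_less_1: "AE \<omega> in RCM_space lam. \<forall>v w. snd \<omega> {v, w} < 1"
proof -
  interpret NX: prob_space "PN lam \<Otimes>\<^sub>M PX" by (rule prob_space_NX)
  interpret U: prob_space PU by (rule prob_space_PU)
  interpret P2: pair_sigma_finite "PN lam \<Otimes>\<^sub>M PX" PU ..
  have "AE y in uniform_measure lborel {0..1::real}. y < 1"
  proof (rule AE_uniform_measureI)
    have "AE y in lborel. y \<noteq> (1::real)" by (rule AE_lborel_singleton)
    then show "AE y in lborel. y \<in> {0..1::real} \<longrightarrow> y < 1" by eventually_elim auto
  qed simp
  then have "AE U in PU. U e < 1" for e
    unfolding PU_def by (intro AE_PiM_component[where M = "\<lambda>_. uniform_measure lborel {0..1::real}"] prob_space_U01) auto
  then have Uae: "AE U in PU. \<forall>v w. U {v, w} < 1" unfolding AE_all_countable by blast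
  have m: "Measurable.pred ((PN lam \<Otimes>\<^sub>M PX) \<Otimes>\<^sub>M PU) (\<lambda>\<omega>. \<forall>v w. snd \<omega> {v, w} < 1)"
    by (intro pred_intros_countable) measurable
  have "AE z in PN lam \<Otimes>\<^sub>M PX. AE U in PU. (\<forall>v w. snd (z, U) {v, w} < 1)" using Uae by simp
  then show ?thesis unfolding RCM_space_eq by (intro P2.AE_pair_measure) (use m in \<open>simp_all add: pred_def\<close>)
qed

lemma perc_large_full:
  assumes r0: "0 < r0" and g1: "\<And>r. r \<le> r0 \<Longrightarrow> g r = 1"
  shows "\<exists>lam>0. \<not> (AE \<omega> in RCM_space lam. \<not> has_inf_cluster (rcm_adj g \<omega>))"
proof -
  obtain m0 where m0: "inverse (real (Suc m0)) < r0 / 3" using reals_Archimedean[of "r0 / 3"] r0 by auto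
  define m where "m = Suc m0"
  have m: "0 < m" "3 / real m \<le> r0" using m0 by (simp_all add: m_def field_simps)
  \<comment> \<open>The number of reasons and the factor 81 of \<open>sadj_percolates\<close> then
    multiply to exactly 1 / 4.\<close>
  define \<delta> where "\<delta> = 1 / (324 * real (m * m + 1))"
  have mm: "0 < real (m * m + 1)" by (simp only: of_nat_0_less_iff)
  have d: "0 < \<delta>" "81 * (real (m * m + 1) * \<delta>) \<le> 1 / 4" using mm by (simp_all only: \<delta>_def) (simp_all add: field_simps)
  have "\<bar>1 - 1 / (real m)\<^sup>2\<bar> < 1" using m by simp
  \<comment> \<open>K depends on m alone; afterwards lam is taken so large that fewer than K points
    are unlikely.\<close>
  then obtain K where K: "(1 - 1 / (real m)\<^sup>2) ^ K < \<delta>" using real_arch_pow_inv[OF d(1), of "1 - 1 / (real m)\<^sup>2"] m(1) by auto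
  have "eventually (\<lambda>lam. measure (measure_pmf (poisson_pmf lam)) {..<K} < \<delta>) at_top"
    by (rule order_tendstoD(2)[OF poisson_lessThan_tendsto_0 d(1)])
  then have "eventually (\<lambda>lam. measure (measure_pmf (poisson_pmf lam)) {..<K} < \<delta> \<and> 0 < lam) at_top"
    using eventually_gt_at_top by (rule eventually_conj)
  then obtain lam where lam: "measure (measure_pmf (poisson_pmf lam)) {..<K} < \<delta>" "0 < lam" using eventually_happens by force
  have p: "\<not> (AE \<omega> in RCM_space lam. \<not> has_inf_cluster (sadj (gd m \<omega>)))"
    using prob_not_gd[OF m(1) less_imp_le[OF K] less_imp_le[OF lam(1)]] d
    by (intro sadj_percolates[OF prob_space_RCM pred_gd, where \<epsilon> = "real (m * m + 1) * \<delta>"]) auto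
  have "\<not> (AE \<omega> in RCM_space lam. \<not> has_inf_cluster (rcm_adj g \<omega>))"
  proof
    assume "AE \<omega> in RCM_space lam. \<not> has_inf_cluster (rcm_adj g \<omega>)"
    then have "AE \<omega> in RCM_space lam. \<not> has_inf_cluster (sadj (gd m \<omega>))"
      using AE_U_less_1
    proof eventually_elim
      case (elim \<omega>)
      obtain N X U where w: "\<omega> = ((N, X), U)" by (cases \<omega>) auto
      have "U {u, v} < 1" for u v using elim(2) by (simp add: w)
      then show ?case using gd_inf_cluster[OF m, of g U N X] g1 elim(1) unfolding w rcm_adj_gadj by blast
    qed
    then show False using p by blast
  qed
  then show ?thesis using lam by blast
qed

context conn_fun
begin

text \<open>Once edges of length at most R / 2 are made certain, dense points percolate;
  the weak comparison of parameters then trades intensity for the missing edge probability.\<close>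

lemma perc_large: "\<exists>lam0>0. \<forall>lam\<ge>lam0. \<not> (AE \<omega> in RCM_space lam. \<not> has_inf_cluster (rcm_adj f \<omega>))"
proof -
  \<comment> \<open>A radius below R, so that c = f r0 is positive and c * f1 \<le> f.\<close>
  define r0 where "r0 = R / 2"
  define f1 where "f1 r = (if r \<le> r0 then 1 else f r)" for r
  define c where "c = f r0"
  have r0: "0 < r0" "r0 < R" using R_pos by (auto simp: r0_def)
  have c: "0 < c" "c \<le> 1" using f_pos[of r0] f01[of r0] r0 by (auto simp: c_def)
  interpret F: conn_fun f1 R
  proof
    show "0 \<le> f1 r \<and> f1 r \<le> 1" if "0 \<le> r" for r using f01 that by (simp add: f1_def)
    show "f1 t \<le> f1 r" if "0 \<le> r" "r \<le> t" for r t using f01[of t] f_anti[of r t] that by (auto simp: f1_def)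
    show "0 < R" by (rule R_pos)
    show "0 < f1 r" if "0 \<le> r" "r < R" for r using f_pos that by (simp add: f1_def)
    show "f1 r = 0" if "R < r" for r using f_zero that r0 by (simp add: f1_def)
  qed
  obtain lam where lam: "0 < lam" "\<not> (AE \<omega> in RCM_space lam. \<not> has_inf_cluster (rcm_adj f1 \<omega>))"
    using perc_large_full[OF r0(1), of f1] by (auto simp: f1_def)
  obtain z0 \<epsilon> where e: "0 < \<epsilon>" "\<And>n. \<epsilon> \<le> theta 1 f1 {z0} (far z0 n) (zbox z0 (n + rng R)) lam" using F.perc_imp_theta[OF lam(2)] by blast
  have cm: "conn_meas (\<lambda>r. c * f1 r)" using c by (intro conn_meas_scale F.conn_meas_f) auto
  have le: "c * f1 r \<le> f r" if "0 \<le> r" for r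
    using that c f_anti[of r r0] f01[of r] mult_right_mono[of c 1 "f r"] by (auto simp: f1_def c_def)
  have "\<epsilon> / 4 \<le> th f z0 n lam'" if lam': "lam * (1 / c) \<le> lam'" for n lam'
  proof -
    let ?Z = "zbox z0 (n + rng R)"
    have "\<epsilon> / 4 \<le> theta 1 f1 {z0} (far z0 n) ?Z lam / 4" using e(2)[of n] by simp
    also have "\<dots> \<le> theta (1/2) f1 {z0} (far z0 n) ?Z lam"
      by (intro theta_marks F.conn_meas_f) (auto simp: far_def)
    also have "\<dots> \<le> theta (1/2) (\<lambda>r. c * f1 r) {z0} (far z0 n) ?Z (lam * (1 / c))"
      using F.theta_flow_weak[OF lam(1) c(1,2) order_refl, of "{z0}" "far z0 n" z0 "n + rng R"] by simp
    also have "\<dots> \<le> theta 1 f {z0} (far z0 n) ?Z (lam * (1 / c))"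
      by (intro theta_mono_g cm conn_meas_f le) auto
    also have "\<dots> \<le> theta 1 f {z0} (far z0 n) ?Z lam'"
      using lam(1) c lam' by (intro conn_meas.theta_mono_lam[OF conn_meas_f]) auto
    finally show ?thesis .
  qed
  then have "\<not> (AE \<omega> in RCM_space lam'. \<not> has_inf_cluster (rcm_adj f \<omega>))" if "lam * (1 / c) \<le> lam'" for lam'
    using that e(1) by (intro theta_imp_perc[of "\<epsilon> / 4" z0]) auto
  then show ?thesis using lam(1) c by (intro exI[of _ "lam * (1 / c)"]) auto
qed

text \<open>\<open>Sup\<close> of a set of reals is informative only if the set is nonempty and
  bounded above, which \<open>no_perc_small\<close> and \<open>perc_large\<close> ensure.\<close>

lemma lambda_crit_facts:
  shows lambda_crit_pos: "0 < lambda_crit f"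
    and above_lambda_crit: "lambda_crit f < lam \<Longrightarrow> \<not> (AE \<omega> in RCM_space lam. \<not> has_inf_cluster (rcm_adj f \<omega>))"
    and below_lambda_crit: "lam < lambda_crit f \<Longrightarrow> \<exists>lam'>lam. AE \<omega> in RCM_space lam'. \<not> has_inf_cluster (rcm_adj f \<omega>)"
proof -
  let ?S = "{lam. 0 < lam \<and> (AE \<omega> in RCM_space lam. \<not> has_inf_cluster (rcm_adj f \<omega>))}"
  obtain l0 where l0: "l0 \<in> ?S" using no_perc_small by blast
  obtain l1 where l1: "\<And>lam. l1 \<le> lam \<Longrightarrow> lam \<notin> ?S" using perc_large by blast
  have bdd: "bdd_above ?S" unfolding bdd_above_def using l1 by (meson linear)
  have "l0 \<le> lambda_crit f" unfolding lambda_crit_def using l0 bdd by (rule cSup_upper)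
  then show pos: "0 < lambda_crit f" using l0 by simp
  show "\<not> (AE \<omega> in RCM_space lam. \<not> has_inf_cluster (rcm_adj f \<omega>))" if "lambda_crit f < lam"
  proof
    assume "AE \<omega> in RCM_space lam. \<not> has_inf_cluster (rcm_adj f \<omega>)"
    then have "lam \<in> ?S" using that pos by simp
    then have "lam \<le> lambda_crit f" unfolding lambda_crit_def using bdd by (rule cSup_upper)
    then show False using that by simp
  qed
  show "\<exists>lam'>lam. AE \<omega> in RCM_space lam'. \<not> has_inf_cluster (rcm_adj f \<omega>)" if "lam < lambda_crit f"
    using that l0 bdd unfolding lambda_crit_def by (subst (asm) less_cSup_iff) auto
qed

end

section \<open>Critical probabilities of the infinite component\<close>

text \<open>A coupling device: coins on the vertices or edges of one graph are obtained from a field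
  on all labels or label sets, by restriction and a coordinatewise map.\<close>

lemma distr_PiM_map_restrict:
  fixes P :: "'b pmf" and h :: "'b \<Rightarrow> 'c" and E :: "'i set"
  shows "distr (PiM UNIV (\<lambda>_. measure_pmf P)) (PiM E (\<lambda>_. measure_pmf (map_pmf h P))) (\<lambda>x. \<lambda>e\<in>E. h (x e)) = PiM E (\<lambda>_. measure_pmf (map_pmf h P))"
    and "(\<lambda>x. \<lambda>e\<in>E. h (x e)) \<in> PiM UNIV (\<lambda>_. measure_pmf P) \<rightarrow>\<^sub>M PiM E (\<lambda>_. measure_pmf (map_pmf h P))"
proof -
  let ?K = "PiM UNIV (\<lambda>_::'i. measure_pmf P)" and ?I = "PiM E (\<lambda>_. measure_pmf (map_pmf h P))" and ?t = "\<lambda>x. \<lambda>e\<in>E. h (x e)"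
  have hm: "h \<in> measure_pmf P \<rightarrow>\<^sub>M measure_pmf (map_pmf h P)" by (simp cong: measurable_cong_sets)
  have "(\<lambda>x. h (x e)) \<in> ?K \<rightarrow>\<^sub>M measure_pmf (map_pmf h P)" for e
    using measurable_compose[of "\<lambda>x. x e" ?K "measure_pmf P" h] hm measurable_component_singleton[of e UNIV "\<lambda>_. measure_pmf P"] by simp
  then show t: "?t \<in> ?K \<rightarrow>\<^sub>M ?I" by (intro measurable_restrict)
  show "distr ?K ?I ?t = ?I"
  proof (rule measure_eqI_PiM_infinite[symmetric, OF refl])
    show "finite_measure ?I"
      by (intro prob_space.finite_measure prob_space_PiM measure_pmf.prob_space_axioms)
    fix A and J :: "'i set" assume J: "finite J" "J \<subseteq> E"
    have "?I (prod_emb E (\<lambda>_. measure_pmf (map_pmf h P)) J (Pi\<^sub>E J A)) = (\<Prod>j\<in>J. emeasure (measure_pmf (map_pmf h P)) (A j))"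
      using J by (intro emeasure_PiM_emb measure_pmf.prob_space_axioms) auto
    also have "\<dots> = (\<Prod>j\<in>J. emeasure (measure_pmf P) (h -` A j))" by (simp add: emeasure_map_pmf)
    also have "\<dots> = ?K (prod_emb UNIV (\<lambda>_. measure_pmf P) J (\<Pi>\<^sub>E j\<in>J. h -` A j))"
      using J by (intro emeasure_PiM_emb[symmetric] measure_pmf.prob_space_axioms) auto
    also have "prod_emb UNIV (\<lambda>_. measure_pmf P) J (\<Pi>\<^sub>E j\<in>J. h -` A j) = ?t -` prod_emb E (\<lambda>_. measure_pmf (map_pmf h P)) J (Pi\<^sub>E J A) \<inter> space ?K"
      using J by (auto simp: prod_emb_def space_PiM PiE_iff subset_iff)
    also have "?K \<dots> = distr ?K ?I ?t (prod_emb E (\<lambda>_. measure_pmf (map_pmf h P)) J (Pi\<^sub>E J A))"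
      using J by (intro emeasure_distr[symmetric] sets_PiM_I t) auto
    finally show "?I (prod_emb E (\<lambda>_. measure_pmf (map_pmf h P)) J (Pi\<^sub>E J A)) = distr ?K ?I ?t (prod_emb E (\<lambda>_. measure_pmf (map_pmf h P)) J (Pi\<^sub>E J A))" .
  qed simp
qed

lemma AE_PiM_map_restrict:
  fixes P :: "'b pmf" and h :: "'b \<Rightarrow> 'c" and E :: "'i set"
  assumes Q: "Measurable.pred (PiM E (\<lambda>_. measure_pmf (map_pmf h P))) Q"
  shows "(AE \<eta> in PiM E (\<lambda>_. measure_pmf (map_pmf h P)). Q \<eta>) \<longleftrightarrow> (AE x in PiM UNIV (\<lambda>_. measure_pmf P). Q (\<lambda>e\<in>E. h (x e)))"
  using Q by (subst distr_PiM_map_restrict(1)[symmetric], subst AE_distr_iff[OF distr_PiM_map_restrict(2)]) (auto simp: pred_def)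

lemma PiM_pmf_component: "e \<in> E \<Longrightarrow> Measurable.pred (PiM E (\<lambda>_. measure_pmf (q :: bool pmf))) (\<lambda>\<eta>. \<eta> e)"
proof -
  assume "e \<in> E"
  then have "(\<lambda>\<eta>. \<eta> e) \<in> PiM E (\<lambda>_. measure_pmf q) \<rightarrow>\<^sub>M measure_pmf q" by (rule measurable_component_singleton)
  then show ?thesis by (simp cong: measurable_cong_sets)
qed

lemma pred_site_open:
  fixes S :: "'a::countable set"
  shows "Measurable.pred (PiM S (\<lambda>_. measure_pmf (q :: bool pmf))) (\<lambda>\<eta>. has_inf_cluster (site_open_adj S adj \<eta>))"
proof (rule pred_has_inf_cluster)
  fix x y
  show "Measurable.pred (PiM S (\<lambda>_. measure_pmf q)) (\<lambda>\<eta>. site_open_adj S adj \<eta> x y)"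
  proof (cases "x \<in> S \<and> y \<in> S \<and> adj x y")
    case True
    then have "site_open_adj S adj \<eta> x y \<longleftrightarrow> \<eta> x \<and> \<eta> y" for \<eta> by (simp add: site_open_adj_def)
    then show ?thesis using True by (simp add: pred_intros_logic PiM_pmf_component)
  next
    case False
    then have "\<not> site_open_adj S adj \<eta> x y" for \<eta> by (auto simp: site_open_adj_def)
    then show ?thesis by simp
  qed
qed

lemma pred_bond_open:
  fixes S :: "'a::countable set"
  shows "Measurable.pred (PiM (edges_of S adj) (\<lambda>_. measure_pmf (q :: bool pmf))) (\<lambda>\<eta>. has_inf_cluster (bond_open_adj S adj \<eta>))"
proof (rule pred_has_inf_cluster)
  fix x y
  show "Measurable.pred (PiM (edges_of S adj) (\<lambda>_. measure_pmf q)) (\<lambda>\<eta>. bond_open_adj S adj \<eta> x y)"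
  proof (cases "x \<in> S \<and> y \<in> S \<and> adj x y")
    case True
    then have "bond_open_adj S adj \<eta> x y \<longleftrightarrow> \<eta> {x, y}" for \<eta> by (simp add: bond_open_adj_def)
    moreover have "{x, y} \<in> edges_of S adj" using True by (auto simp: edges_of_def)
    ultimately show ?thesis by (simp add: PiM_pmf_component)
  next
    case False
    then have "\<not> bond_open_adj S adj \<eta> x y" for \<eta> by (auto simp: bond_open_adj_def)
    then show ?thesis by simp
  qed
qed

text \<open>The open part of the infinite component is a subgraph of the open part of the whole
  graph, so it cannot percolate if the latter does not.\<close>

lemma pc_site_ge:
  fixes N X U
  defines "\<omega> \<equiv> ((N, X), U)"
  assumes p: "0 \<le> p" "p \<le> 1"
    and no: "AE \<eta> in PB p. \<not> has_inf_cluster (gadj (vset N \<inter> {v. \<eta> v}) (ebond f X U))"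
  shows "p \<le> pc_site (inf_comp f \<omega>) (inf_comp_adj f \<omega>)"
  unfolding pc_site_def
proof (rule cSup_upper)
  let ?S = "inf_comp f \<omega>" and ?adj = "inf_comp_adj f \<omega>"
  have "AE x in PB p. \<not> has_inf_cluster (site_open_adj ?S ?adj (\<lambda>e\<in>?S. x e))"
    using no
  proof eventually_elim
    case (elim \<eta>)
    show ?case
    proof
      assume "has_inf_cluster (site_open_adj ?S ?adj (\<lambda>e\<in>?S. \<eta> e))"
      then have "has_inf_cluster (gadj (vset N \<inter> {v. \<eta> v}) (ebond f X U))"
      proof (rule has_inf_cluster_mono)
        fix v w assume a: "site_open_adj ?S ?adj (\<lambda>e\<in>?S. \<eta> e) v w"
        then have "rcm_adj f ((N, X), U) v w" "\<eta> v" "\<eta> w" by (auto simp: site_open_adj_def inf_comp_adj_def \<omega>_def)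
        then show "gadj (vset N \<inter> {v. \<eta> v}) (ebond f X U) v w" unfolding rcm_adj_gadj by (simp add: gadj_def)
      qed
      then show False using elim by blast
    qed
  qed
  then have "AE \<eta> in site_meas ?S p. \<not> has_inf_cluster (site_open_adj ?S ?adj \<eta>)"
    using AE_PiM_map_restrict[where E = "?S" and h = "\<lambda>b. b" and P = "bernoulli_pmf p" and Q = "\<lambda>\<eta>. \<not> has_inf_cluster (site_open_adj ?S ?adj \<eta>)"]
      pred_intros_logic(2)[OF pred_site_open[where S = "?S" and q = "bernoulli_pmf p" and adj = "?adj"]]
    unfolding site_meas_def PB_def map_pmf_ident by blast
  then show "p \<in> {p \<in> {0..1}. AE \<eta> in site_meas ?S p. \<not> has_inf_cluster (site_open_adj ?S ?adj \<eta>)}" using p by simp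
  show "bdd_above {p \<in> {0..1}. AE \<eta> in site_meas ?S p. \<not> has_inf_cluster (site_open_adj ?S ?adj \<eta>)}" by (rule bdd_aboveI[of _ 1]) auto
qed

text \<open>The vertices of an infinite open cluster lie in an infinite component of the graph
  itself, so restriction to \<open>inf_comp\<close> loses nothing. The second field \<eta>' serves
  the coupling of two edge probabilities.\<close>

lemma bond_cluster_in_inf_comp:
  fixes N X U
  defines "\<omega> \<equiv> ((N, X), U)"
  assumes inf: "has_inf_cluster (gadj (vset N) (\<lambda>e. ebond f X U e \<and> \<eta> e))" and le: "\<And>e. \<eta> e \<Longrightarrow> \<eta>' e"
  shows "has_inf_cluster (bond_open_adj (inf_comp f \<omega>) (inf_comp_adj f \<omega>) (\<lambda>e\<in>edges_of (inf_comp f \<omega>) (inf_comp_adj f \<omega>). \<eta>' e))"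
proof -
  let ?S = "inf_comp f \<omega>" and ?adj = "inf_comp_adj f \<omega>" and ?g = "gadj (vset N) (\<lambda>e. ebond f X U e \<and> \<eta> e)"
  have sub: "?g y z \<Longrightarrow> gadj (vset N) (ebond f X U) y z" for y z by (auto simp: gadj_def)
  have sub': "(gadj (vset N) (ebond f X U))\<^sup>*\<^sup>* y z" if "?g\<^sup>*\<^sup>* y z" for y z
    using that by (rule rtranclp_mono[THEN predicate2D, rotated]) (use sub in blast)
  obtain v where v: "infinite {w. ?g\<^sup>*\<^sup>* v w}" using inf by (auto simp: has_inf_cluster_def)
  have S: "y \<in> ?S" if "?g\<^sup>*\<^sup>* v y" for y
  proof -
    have "{w. ?g\<^sup>*\<^sup>* v w} \<subseteq> {w. (gadj (vset N) (ebond f X U))\<^sup>*\<^sup>* y w}"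
      using sub'[OF that] sub' rtranclp_gadj_sym by (meson Collect_mono rtranclp_trans)
    then have "infinite {w. (gadj (vset N) (ebond f X U))\<^sup>*\<^sup>* y w}" using v finite_subset by blast
    then show ?thesis by (simp add: inf_comp_def \<omega>_def rcm_adj_gadj)
  qed
  have "(bond_open_adj ?S ?adj (\<lambda>e\<in>edges_of ?S ?adj. \<eta>' e))\<^sup>*\<^sup>* v w" if "?g\<^sup>*\<^sup>* v w" for w
    using that
  proof (induction rule: rtranclp_induct)
    case (step y z)
    have yz: "y \<in> ?S" "z \<in> ?S" using S[OF step(1)] S[OF rtranclp.rtrancl_into_rtrancl[OF step(1,2)]] by auto
    have adj: "?adj y z" unfolding inf_comp_adj_def using yz sub[OF step(2)] by (simp add: \<omega>_def rcm_adj_gadj)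
    have "{y, z} \<in> edges_of ?S ?adj" using yz adj by (auto simp: edges_of_def)
    then have "bond_open_adj ?S ?adj (\<lambda>e\<in>edges_of ?S ?adj. \<eta>' e) y z"
      using yz adj step(2) le by (simp add: bond_open_adj_def gadj_def)
    then show ?case using step.IH by (rule rtranclp.rtrancl_into_rtrancl[rotated])
  qed simp
  then have "{w. ?g\<^sup>*\<^sup>* v w} \<subseteq> {w. (bond_open_adj ?S ?adj (\<lambda>e\<in>edges_of ?S ?adj. \<eta>' e))\<^sup>*\<^sup>* v w}" by blast
  then show ?thesis using v finite_subset unfolding has_inf_cluster_def by blast
qed

text \<open>Provides an element of the set whose \<open>Sup\<close> is
  \<open>pc_bond\<close>.\<close>

lemma no_bond_perc_0:
  fixes S :: "'a::countable set"
  shows "AE \<eta> in bond_meas S adj 0. \<not> has_inf_cluster (bond_open_adj S adj \<eta>)"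
proof -
  have "AE \<eta> in bond_meas S adj 0. {v, w} \<in> edges_of S adj \<longrightarrow> \<not> \<eta> {v, w}" for v w
  proof (cases "{v, w} \<in> edges_of S adj")
    case True
    have "AE y in measure_pmf (bernoulli_pmf 0). \<not> y" 
    proof -
      have "True \<notin> set_pmf (bernoulli_pmf 0)" by (simp add: set_pmf_iff)
      then show ?thesis unfolding AE_measure_pmf_iff by (metis (full_types))
    qed
    then show ?thesis unfolding bond_meas_def
      using AE_PiM_component[of "edges_of S adj" "\<lambda>_. measure_pmf (bernoulli_pmf 0)" "{v, w}" "\<lambda>y. \<not> y"] True by (simp add: measure_pmf.prob_space_axioms)
  qed simp
  then have "AE \<eta> in bond_meas S adj 0. \<forall>v w. {v, w} \<in> edges_of S adj \<longrightarrow> \<not> \<eta> {v, w}" unfolding AE_all_countable by blast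
  then show ?thesis
  proof eventually_elim
    case (elim \<eta>)
    have "\<not> bond_open_adj S adj \<eta> v w" for v w
    proof
      assume b: "bond_open_adj S adj \<eta> v w"
      then have "{v, w} \<in> edges_of S adj" by (auto simp: bond_open_adj_def edges_of_def)
      then show False using elim b by (auto simp: bond_open_adj_def)
    qed
    then have "{w. (bond_open_adj S adj \<eta>)\<^sup>*\<^sup>* v w} \<subseteq> {v}" for v by (auto elim: converse_rtranclpE)
    then show ?case unfolding has_inf_cluster_def using finite_subset by blast
  qed
qed

text \<open>If percolation failed at some p > q, thinning the coins of parameter p by independent
  coins of parameter q / p would give those of parameter q; an infinite cluster of the latter is
  contained in one of the former.\<close>

lemma pc_bond_le:
  fixes N X U
  defines "\<omega> \<equiv> ((N, X), U)"
  assumes q: "0 < q" "q \<le> 1"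
    and perc: "AE \<eta> in PB q. has_inf_cluster (gadj (vset N) (\<lambda>e. ebond f X U e \<and> \<eta> e))"
  shows "pc_bond (inf_comp f \<omega>) (inf_comp_adj f \<omega>) \<le> q"
  unfolding pc_bond_def
proof (rule cSup_least)
  let ?S = "inf_comp f \<omega>" and ?adj = "inf_comp_adj f \<omega>"
  let ?E = "edges_of ?S ?adj"
  have "0 \<in> {p \<in> {0..1}. AE \<eta> in bond_meas ?S ?adj p. \<not> has_inf_cluster (bond_open_adj ?S ?adj \<eta>)}"
    using no_bond_perc_0[of ?S ?adj] by simp
  then show "{p \<in> {0..1}. AE \<eta> in bond_meas ?S ?adj p. \<not> has_inf_cluster (bond_open_adj ?S ?adj \<eta>)} \<noteq> {}" by blast
  fix p assume "p \<in> {p \<in> {0..1}. AE \<eta> in bond_meas ?S ?adj p. \<not> has_inf_cluster (bond_open_adj ?S ?adj \<eta>)}"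
  then have p: "0 \<le> p" "p \<le> 1" and no: "AE \<eta> in bond_meas ?S ?adj p. \<not> has_inf_cluster (bond_open_adj ?S ?adj \<eta>)" by auto
  show "p \<le> q"
  proof (rule ccontr)
    assume "\<not> p \<le> q"
    then have qp: "q < p" by simp
    define P where "P = pair_pmf (bernoulli_pmf p) (bernoulli_pmf (q / p))"
    let ?M = "PiM UNIV (\<lambda>_::lbl set. measure_pmf P)"
    interpret M: prob_space ?M by (intro prob_space_PiM measure_pmf.prob_space_axioms)
    have Pp: "map_pmf fst P = bernoulli_pmf p" by (simp add: P_def map_fst_pair_pmf)
    have Pq: "map_pmf (\<lambda>x. fst x \<and> snd x) P = bernoulli_pmf q"
    proof (rule pmf_eqI)
      have T: "pmf (map_pmf (\<lambda>x. fst x \<and> snd x) P) True = q"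
      proof -
        have "(\<lambda>x. fst x \<and> snd x) -` {True} = {(True, True)}" by (simp only: set_eq_iff split_paired_All) simp
        then have "pmf (map_pmf (\<lambda>x. fst x \<and> snd x) P) True = pmf P (True, True)" by (simp only: pmf_map measure_pmf_single)
        also have "\<dots> = p * (q / p)" using p q qp by (simp add: P_def pmf_pair)
        finally show ?thesis using qp q by simp
      qed
      have F: "pmf r False = 1 - pmf r True" for r :: "bool pmf"
        using sum_pmf_eq_1[of "UNIV :: bool set" r, OF _ subset_UNIV] by (simp add: UNIV_bool)
      fix b show "pmf (map_pmf (\<lambda>x. fst x \<and> snd x) P) b = pmf (bernoulli_pmf q) b"
        using T F[of "map_pmf (\<lambda>x. fst x \<and> snd x) P"] q by (cases b) auto
    qed
    have 1: "AE x in ?M. \<not> has_inf_cluster (bond_open_adj ?S ?adj (\<lambda>e\<in>?E. fst (x e)))"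
      using no AE_PiM_map_restrict[where E = "?E" and h = fst and P = P and Q = "\<lambda>\<eta>. \<not> has_inf_cluster (bond_open_adj ?S ?adj \<eta>)"]
        pred_intros_logic(2)[OF pred_bond_open[where S = "?S" and adj = "?adj" and q = "bernoulli_pmf p"]] unfolding bond_meas_def Pp by blast
    have 2: "AE x in ?M. has_inf_cluster (gadj (vset N) (\<lambda>e. ebond f X U e \<and> (fst (x e) \<and> snd (x e))))"
    proof -
      have m: "(\<lambda>x. \<lambda>e\<in>UNIV. fst (x e) \<and> snd (x e)) \<in> ?M \<rightarrow>\<^sub>M (PB q :: (lbl set \<Rightarrow> bool) measure)"
        using distr_PiM_map_restrict(2)[where E = "UNIV :: lbl set set" and h = "\<lambda>x. fst x \<and> snd x" and P = P] unfolding Pq PB_def by simp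
      have d: "distr ?M (PB q) (\<lambda>x. \<lambda>e\<in>UNIV. fst (x e) \<and> snd (x e)) = (PB q :: (lbl set \<Rightarrow> bool) measure)"
        using distr_PiM_map_restrict(1)[where E = "UNIV :: lbl set set" and h = "\<lambda>x. fst x \<and> snd x" and P = P] unfolding Pq PB_def by simp
      have "AE x in ?M. has_inf_cluster (gadj (vset N) (\<lambda>e. ebond f X U e \<and> (\<lambda>e\<in>UNIV. fst (x e) \<and> snd (x e)) e))"
        using perc AE_distrD[OF m] unfolding d by blast
      then show ?thesis by simp
    qed
    from 1 2 have "AE x in ?M. False"
    proof eventually_elim
      case (elim x)
      show ?case using elim(1) bond_cluster_in_inf_comp[OF elim(2), of "\<lambda>e. fst (x e)"] unfolding \<omega>_def by blast
    qed
    then show False by simp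
  qed
qed

section \<open>The strict inequality\<close>

context conn_fun
begin

lemma AE_site_ge:
  assumes p: "0 < p" "p \<le> 1" and lam: "0 < lam" "p * lam < lambda_crit f"
  shows "AE \<omega> in RCM_space lam. p \<le> pc_site (inf_comp f \<omega>) (inf_comp_adj f \<omega>)"
proof -
  interpret M: prob_space "RCM_space lam" by (rule prob_space_RCM)
  interpret B: prob_space "PB p :: (lbl \<Rightarrow> bool) measure" by (rule prob_space_PB)
  interpret P: pair_sigma_finite "RCM_space lam" "PB p :: (lbl \<Rightarrow> bool) measure" ..
  obtain lam' where lam': "p * lam < lam'" "AE \<omega> in RCM_space lam'. \<not> has_inf_cluster (rcm_adj f \<omega>)"
    using below_lambda_crit[OF lam(2)] by blast
  from P.AE_pair[OF site_no_perc[OF p lam(1) less_imp_le[OF lam'(1)] lam'(2)]]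
  show ?thesis
  proof eventually_elim
    case (elim \<omega>)
    obtain N X U where w: "\<omega> = ((N, X), U)" by (cases \<omega>) auto
    show ?case using pc_site_ge[OF less_imp_le[OF p(1)] p(2), of N f X U] elim unfolding w by simp
  qed
qed

lemma AE_bond_le:
  assumes q: "0 < q" "q \<le> 1" and e: "0 < \<epsilon>" "\<And>n. \<epsilon> \<le> th (\<lambda>r. q * f r) z0 n lam"
  shows "AE \<omega> in RCM_space lam. pc_bond (inf_comp f \<omega>) (inf_comp_adj f \<omega>) \<le> q"
proof -
  interpret M: prob_space "RCM_space lam" by (rule prob_space_RCM)
  interpret B: prob_space "PB q :: (lbl set \<Rightarrow> bool) measure" by (rule prob_space_PB)
  interpret P: pair_sigma_finite "RCM_space lam" "PB q :: (lbl set \<Rightarrow> bool) measure" ..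
  from P.AE_pair[OF bond_perc[OF q e]]
  show ?thesis
  proof eventually_elim
    case (elim \<omega>)
    obtain N X U where w: "\<omega> = ((N, X), U)" by (cases \<omega>) auto
    show ?case using pc_bond_le[OF q, of N f X U] elim unfolding w by simp
  qed
qed

text \<open>The order of choice matters. The constant c depends on the region of parameters, so q',
  the lower bound \<open>pmin\<close> for edge probabilities and the upper bound lam * exp L for
  intensities come first; s, which decides q and the starting intensity, comes after c.\<close>

lemma bond_strictly_better:
  assumes lam: "lambda_crit f < lam"
  shows "\<exists>q z0. \<exists>\<epsilon>>0. 0 < q \<and> q < lambda_crit f / lam \<and> (\<forall>n. \<epsilon> \<le> th (\<lambda>r. q * f r) z0 n lam)"
proof -
  define \<mu> where "\<mu> = lambda_crit f"
  have \<mu>: "0 < \<mu>" "\<mu> < lam" using lambda_crit_pos lam by (auto simp: \<mu>_def)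
  define ps where "ps = \<mu> / lam"
  have ps: "0 < ps" "ps < 1" "lam = \<mu> / ps" using \<mu> by (auto simp: ps_def)
  \<comment> \<open>A value strictly between ps and 1.\<close>
  define q' where "q' = (ps + 1) / 2"
  have q': "ps < q'" "q' < 1" "0 < q'" using ps by (auto simp: q'_def)
  \<comment> \<open>The time that the curve takes from edge probability q' down to ps.\<close>
  define L where "L = ln (q' / ps)"
  have L: "0 < L" "exp L = q' / ps" using ps q' by (auto simp: L_def)
  \<comment> \<open>The value of q = ps * exp (- s) for the largest s that can occur, s = L /
    2.\<close>
  define pmin where "pmin = ps * exp (- (L / 2))"
  have pmin: "0 < pmin" "pmin \<le> q'"
  proof -
    show "0 < pmin" using ps by (simp add: pmin_def)
    have "pmin \<le> ps * 1" unfolding pmin_def using ps L by (intro mult_left_mono) auto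
    then show "pmin \<le> q'" using q' by simp
  qed
  have "lam * 1 \<le> lam * exp L" using \<mu> L(1) by (intro mult_left_mono) auto
  then have l1: "\<mu> \<le> lam * exp L" using \<mu> by linarith
  obtain c where c: "0 < c" "c \<le> 1" and flow: "\<And>p0 p1 lam0 z0 N Sa Sb. pmin \<le> p1 \<Longrightarrow> p1 \<le> p0 \<Longrightarrow> p0 \<le> q' \<Longrightarrow> \<mu> \<le> lam0 \<Longrightarrow> lam0 * (p0 / p1) \<le> lam * exp L \<Longrightarrow>
     theta (1/2) (\<lambda>r. p0 * f r) Sa Sb (zbox z0 N) lam0 \<le> theta (1/2) (\<lambda>r. p1 * f r) Sa Sb (zbox z0 N) (lam0 * exp ((1 - c) * ln (p0 / p1)))"
    using theta_flow_strict[OF pmin q'(2) \<mu>(1) l1] by blast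
  \<comment> \<open>s solves \<open>s + (1 - c) * (L + s) \<le> L\<close>, which says that the flow from (lam1 / q', q') to q ends below lam\<close>
  define s where "s = c * L / 2"
  have s: "0 < s" "s \<le> L / 2" using c L by (auto simp: s_def)
  \<comment> \<open>Above the critical intensity, so that connection probabilities are bounded below
    there.\<close>
  define lam1 where "lam1 = \<mu> * exp s"
  define q where "q = ps * exp (- s)"
  define lam0 where "lam0 = lam1 * (1 / q')"
  have q: "0 < q" "q < ps" "pmin \<le> q" using ps s by (auto simp: q_def pmin_def)
  have lam1: "\<mu> < lam1" "0 < lam1" using \<mu> s by (auto simp: lam1_def)
  have lam0: "\<mu> \<le> lam0" "0 < lam0"
  proof -
    have "lam1 * 1 \<le> lam0" unfolding lam0_def using lam1 q' by (intro mult_left_mono) auto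
    then show "\<mu> \<le> lam0" "0 < lam0" using lam1 by auto
  qed
  have lnq: "ln (q' / q) = L + s"
  proof -
    have "q' / q = exp (L + s)" using ps by (simp add: q_def exp_add L(2) exp_minus field_simps)
    then show ?thesis by simp
  qed
  \<comment> \<open>The left side equals lam * exp (2 * s), and 2 * s \<le> L keeps the curve inside
    the region for which c was obtained.\<close>
  have ub: "lam0 * (q' / q) \<le> lam * exp L"
  proof -
    have "q' / q = q' * exp s / ps" by (simp add: q_def exp_minus divide_inverse mult.commute mult.left_commute)
    then have "lam0 * (q' / q) = (\<mu> * exp s) * (1 / q') * (q' * exp s / ps)" by (simp only: lam0_def lam1_def)
    also have "\<dots> = \<mu> / ps * (exp s * exp s)" using q'(3) by simp
    also have "\<dots> = lam * exp (2 * s)" by (simp only: ps(3) mult_2 exp_add)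
    also have "\<dots> \<le> lam * exp L" using s \<mu> by (intro mult_left_mono) auto
    finally show ?thesis .
  qed
  have lam2: "lam0 * exp ((1 - c) * ln (q' / q)) \<le> lam"
  proof -
    have "s + (1 - c) * (L + s) \<le> L"
    proof -
      have "s + (1 - c) * (L + s) = L + (2 * s - c * L) - c * s" by (simp add: algebra_simps)
      also have "2 * s - c * L = 0" by (simp add: s_def)
      finally show ?thesis using c s by simp
    qed
    then have "exp (s + (1 - c) * (L + s)) \<le> q' / ps" unfolding L(2)[symmetric] by simp
    then have "\<mu> / q' * exp (s + (1 - c) * (L + s)) \<le> \<mu> / q' * (q' / ps)" using \<mu> q' by (intro mult_left_mono) auto
    also have "\<dots> = lam" using q' ps(3) by simp
    finally show ?thesis unfolding lnq by (simp add: lam0_def lam1_def exp_add mult.assoc)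
  qed
  have "\<not> (AE \<omega> in RCM_space lam1. \<not> has_inf_cluster (rcm_adj f \<omega>))"
    using above_lambda_crit lam1 unfolding \<mu>_def by blast
  then obtain z0 \<epsilon> where e: "0 < \<epsilon>" "\<And>n. \<epsilon> \<le> th f z0 n lam1" using perc_imp_theta by blast
  have cm: "conn_meas (\<lambda>r. q * f r)" using q ps by (intro conn_meas_scale conn_meas_f) auto
  have "\<epsilon> / 4 \<le> th (\<lambda>r. q * f r) z0 n lam" for n
  proof -
    let ?T = "\<lambda>\<gamma> g lam. theta \<gamma> g {z0} (far z0 n) (zbox z0 (n + rng R)) lam"
    have "\<epsilon> / 4 \<le> ?T 1 f lam1 / 4" using e(2)[of n] by simp
    also have "\<dots> \<le> ?T (1/2) f lam1" by (intro theta_marks conn_meas_f) (auto simp: far_def)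
    also have "\<dots> \<le> ?T (1/2) (\<lambda>r. q' * f r) lam0"
      using theta_flow_weak[OF lam1(2) q'(3) less_imp_le[OF q'(2)] order_refl, of "{z0}" "far z0 n" z0 "n + rng R"] by (simp add: lam0_def)
    also have "\<dots> \<le> ?T (1/2) (\<lambda>r. q * f r) (lam0 * exp ((1 - c) * ln (q' / q)))"
      using q q' lam0 ub by (intro flow) auto
    also have "\<dots> \<le> ?T (1/2) (\<lambda>r. q * f r) lam"
      using lam0 lam2 by (intro conn_meas.theta_mono_lam[OF cm]) auto
    also have "\<dots> \<le> ?T 1 (\<lambda>r. q * f r) lam" by (intro theta_mono_g cm) auto
    finally show ?thesis .
  qed
  then show ?thesis using e(1) q unfolding ps_def \<mu>_def by (intro exI[of _ q] exI[of _ z0] exI[of _ "\<epsilon> / 4"]) auto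
qed

text \<open>Both thresholds are bounded weakly, so a further p between q and
  \<open>lambda_crit f / lam\<close> is inserted to make the inequality strict.\<close>

lemma AE_pc_bond_less_pc_site:
  assumes lam: "lambda_crit f < lam"
  shows "AE \<omega> in RCM_space lam. pc_bond (inf_comp f \<omega>) (inf_comp_adj f \<omega>) < pc_site (inf_comp f \<omega>) (inf_comp_adj f \<omega>)"
proof -
  have lam0: "0 < lam" using lam lambda_crit_pos by linarith
  obtain q z0 \<epsilon> where q: "0 < q" "q < lambda_crit f / lam" and e: "0 < \<epsilon>" "\<And>n. \<epsilon> \<le> th (\<lambda>r. q * f r) z0 n lam"
    using bond_strictly_better[OF lam] by blast
  obtain p where p: "q < p" "p < lambda_crit f / lam" using dense[OF q(2)] by blast
  have "lambda_crit f / lam < 1" using lam lam0 by simp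
  then have "p \<le> 1" using p by linarith
  then have p1: "0 < p" "p \<le> 1" "p * lam < lambda_crit f" using p q lam0 pos_less_divide_eq[of lam p "lambda_crit f"] by auto
  have "AE \<omega> in RCM_space lam. pc_bond (inf_comp f \<omega>) (inf_comp_adj f \<omega>) \<le> q"
    using q p p1 by (intro AE_bond_le[OF _ _ e]) auto
  then show ?thesis using AE_site_ge[OF p1(1,2) lam0 p1(3)] by eventually_elim (use p in linarith)
qed

end

theorem theorem2:
  fixes f :: "real \<Rightarrow> real" and lam :: real
  assumes f_range: "\<And>r. 0 \<le> r \<Longrightarrow> 0 \<le> f r \<and> f r \<le> 1"
    and f_noninc: "\<And>r s. 0 \<le> r \<Longrightarrow> r \<le> s \<Longrightarrow> f s \<le> f r"
    and supp_nonempty: "{a. 0 \<le> a \<and> f a > 0} \<noteq> {}"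
    and supp_bdd: "bdd_above {a. 0 \<le> a \<and> f a > 0}"
    and supp_pos: "0 < Sup {a. 0 \<le> a \<and> f a > 0}"
    and lam_pos: "0 < lam"
    and lam_super: "lam > lambda_crit f"
  shows "AE \<omega> in RCM_space lam.
           pc_bond (inf_comp f \<omega>) (inf_comp_adj f \<omega>) < pc_site (inf_comp f \<omega>) (inf_comp_adj f \<omega>)"
proof -
  define R where "R = Sup {a. 0 \<le> a \<and> f a > 0}"
  interpret conn_fun f R
  proof
    show "0 \<le> f r \<and> f r \<le> 1" if "0 \<le> r" for r using f_range that .
    show "f t \<le> f r" if "0 \<le> r" "r \<le> t" for r t using f_noninc that .
    show "0 < R" using supp_pos by (simp add: R_def)
    \<comment> \<open>As R is a supremum, some point of positive value lies beyond r, and f does not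
      increase.\<close>
    show "0 < f r" if r: "0 \<le> r" "r < R" for r
    proof -
      obtain a where "0 \<le> a" "f a > 0" "r < a"
        using less_cSupD[OF supp_nonempty, of r] r(2) unfolding R_def by blast
      then show ?thesis using f_noninc[of r a] r(1) by linarith
    qed
    show "f r = 0" if "R < r" for r
    proof (rule ccontr)
      assume "f r \<noteq> 0"
      moreover have "0 \<le> r" using that supp_pos by (simp add: R_def)
      ultimately have "r \<in> {a. 0 \<le> a \<and> f a > 0}" using f_range[of r] by auto
      then have "r \<le> R" unfolding R_def by (rule cSup_upper[OF _ supp_bdd])
      then show False using that by simp
    qed
  qed
  show ?thesis by (rule AE_pc_bond_less_pc_site[OF lam_super])
qed

end
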